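(* Let $\phi_\ast:C_\ast(\mathcal{F}at)\to\mathcal{G}_\ast^{\mathbb{Z}}$ be any augmented chain map carried by the forest carrier $F_\ast$. Then $\phi_\ast$ is a rational homotopy equivalence, i.e. $\phi_\ast\otimes\mathbb{Q}:C_\ast(\mathcal{F}at;\mathbb{Q})\to\mathcal{G}_\ast^{\mathbb{Z}}\otimes\mathbb{Q}=\mathcal{G}_\ast\otimes\mathbb{Q}$ is a chain homotopy equivalence.
   Context: **Ribbon graphs.** Fix an infinite set $\Omega$ disjoint from its power set. A graph is a finite subset of $\Omega$ (the half-edges) with a partition into pairs (edges) and a partition into subsets of cardinality $\ge 3$ (vertices); the cardinality of a vertex is its valence and its elements are the half-edges incident to it. An edge is a loop if both its halves lie in the same vertex. A ribbon graph is a connected graph with a cyclic ordering of the half-edges at each vertex. The codimension of a vertex is its valence minus $3$; the codimension of a graph is the sum of the codimensions of its vertices. If $e=\{e^-,e^+\}$ is not a loop, with endpoints $v_1=(e^-,h_1,\dots,h_p)$ and $v_2=(e^+,k_1,\dots,k_q)$, then $\Gamma/e$ is obtained by deleting $e^\pm$ and merging $v_1,v_2$ into one vertex $(h_1,\dots,h_p,k_1,\dots,k_q)$. For a spanning forest $F$ of $\Gamma$, $\Gamma/F$ is obtained by collapsing all edges of $F$. A morphism $\Gamma_0\to\Gamma_1$ is an isomorphism of ribbon graphs $\Gamma_0/F\cong\Gamma_1$ for some spanning forest $F$ of $\Gamma_0$. This gives the category $\mathcal{F}at$; $\mathrm{Aut}(\Gamma)$ is the group of ribbon graph automorphisms. $C_n(\mathcal{F}at)$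 is the free abelian group on the $n$-simplices $\Gamma_\ast=(\Gamma_0\to\cdots\to\Gamma_n)$ of the nerve, with the usual alternating-sum boundary and augmentation sending each $0$-simplex to $1$. **Orientations.** An orientation of a graph is an orientation of the real vector space spanned by its vertices and half-edges (equivalently given by ordering the vertices and orienting the edges). If the orientation of $\Gamma$ is $v_1v_2\,e^-e^+\cdots$ where $e=\{e^-,e^+\}$ goes from $v_1$ to $v_2$, the induced orientation of $\Gamma/e$ is $v_\ast\cdots$ with $v_\ast$ the merged vertex and the rest unchanged. A morphism induces an orientation by collapsing edges successively. A ribbon graph with all valences odd has a natural orientation: $v_1$, then its half-edges in cyclic order, then $v_2$, then its half-edges in cyclic order, etc. For oriented such $\Gamma$, $o(\Gamma)=\pm1$ according to whether the orientation is the natural one. **Graph cohomology.** $\mathcal{G}^n$ is the abelian group generated by isomorphism classes $[\Gamma]$ of oriented ribbon graphs of codimension $n$ modulo $[-\Gamma]=-[\Gamma]$, with $\partial[\Gamma]=\sum_e[\Gamma/e]$ over non-loop edges. $\mathcal{G}_n$ is the group of finitely supported homomorphisms $\mathcal{G}^n\to\mathbb{Z}$, generated by the duals $[\Gamma]^\ast$ ($[\Gamma]^*=0$ if $\Gamma$ has an orientation-reversing automorphism), with $d:\mathcal{G}_n\to\mathcal{G}_{n-1}$ dual to $\partial$. $\mathcal{G}_\ast^{\mathbb{Z}}\subset\mathcal{G}_\ast$ is the subcomplex generated by the elements $\langle\Gamma\rangle=|\mathrm{Aut}(\Gamma)|[\Gamma]^\ast$, augmented by $\varepsilon\langle\Gamma\rangle=o(\Gamma)$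 for $\Gamma$ trivalent. **Forest carrier.** For a ribbon graph $\Gamma_0$, $F_k(\Gamma_0)$ is the free abelian group generated by isomorphism classes (over $\Gamma_0$, orientation preserving) of morphisms $f:\Gamma\to\Gamma_0$ in $\mathcal{F}at$ with $\Gamma$ oriented of codimension $k$, modulo reversal of orientation $=$ change of sign. The boundary is $d[f:\Gamma\to\Gamma_0]=\sum[f\circ g_i:\Gamma_i\to\Gamma_0]$ over all right equivalence classes (isomorphism classes over $\Gamma$) of morphisms $g_i:\Gamma_i\to\Gamma$ collapsing exactly one edge, $\Gamma_i$ having the orientation inducing that of $\Gamma$; the augmentation is $\varepsilon[\Gamma\to\Gamma_0]=o(\Gamma)$ on $F_0$. $F_\ast$ is a covariant functor on $\mathcal{F}at$ by composition, and $p:F_\ast(\Gamma_0)\to\mathcal{G}_\ast^{\mathbb{Z}}$, $p[f:\Gamma\to\Gamma_0]=\langle\Gamma\rangle$, is a natural augmented chain map. Each augmented complex $F_\ast(\Gamma_0)$ is acyclic. An augmented chain map $\phi:C_\ast(\mathcal{F}at)\to\mathcal{G}_\ast^{\mathbb{Z}}$ is carried by $F_\ast$ if there are augmented chain maps $\Phi_\Gamma:C_\ast(\mathcal{F}at/\Gamma)\to F_\ast(\Gamma)$, natural in $\Gamma\in\mathcal{F}at$, such that $p\circ\Phi_\Gamma$ equals the composition of the forgetful map $C_\ast(\mathcal{F}at/\Gamma)\to C_\ast(\mathcal{F}at)$ with $\phi$. Such a $\phi$ exists and is unique up to chain homotopy. *)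

theory Defs
  imports
    "HOL-Algebra.Free_Abelian_Groups"
    "HOL-Library.Disjoint_Sets"
    "HOL-Library.Infinite_Typeclass"
    "HOL-Combinatorics.Orbits"
    "Jordan_Normal_Form.Determinant"
begin

section \<open>Ribbon graphs\<close>

text \<open>
  The ambient set of half-edges is an arbitrary infinite type \<open>'h\<close>; its disjointness from its
  power set is automatic by typing. A cyclic ordering of the half-edges at each vertex is given by
  the successor permutation \<open>nxt\<close>, which is required to be the identity outside the graph so that
  equality of records is equality of ribbon graphs.
\<close>

record 'h ribbon =
  halves :: "'h set"
  edges :: "'h set set"
  verts :: "'h set set"
  nxt :: "'h \<Rightarrow> 'h"

definition joins :: "'h set \<Rightarrow> 'h set \<Rightarrow> 'h set \<Rightarrow> bool" where
  "joins e u v \<longleftrightarrow> (\<exists>a b. e = {a, b} \<and> a \<in> u \<and> b \<in> v)"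

definition connected_graph :: "'h ribbon \<Rightarrow> bool" where
  "connected_graph \<Gamma> \<longleftrightarrow> verts \<Gamma> \<noteq> {} \<and>
     (\<forall>u\<in>verts \<Gamma>. \<forall>v\<in>verts \<Gamma>.
        (u, v) \<in> {(u', v'). u' \<in> verts \<Gamma> \<and> v' \<in> verts \<Gamma> \<and> (\<exists>e\<in>edges \<Gamma>. joins e u' v')}\<^sup>*)"

definition ribbon_graph :: "'h ribbon \<Rightarrow> bool" where
  "ribbon_graph \<Gamma> \<longleftrightarrow>
     finite (halves \<Gamma>) \<and>
     partition_on (halves \<Gamma>) (edges \<Gamma>) \<and> (\<forall>e\<in>edges \<Gamma>. card e = 2) \<and>
     partition_on (halves \<Gamma>) (verts \<Gamma>) \<and> (\<forall>v\<in>verts \<Gamma>. card v \<ge> 3) \<and>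
     nxt \<Gamma> permutes halves \<Gamma> \<and> (\<forall>v\<in>verts \<Gamma>. cyclic_on (nxt \<Gamma>) v) \<and>
     connected_graph \<Gamma>"

definition codim :: "'h ribbon \<Rightarrow> nat" where
  "codim \<Gamma> = (\<Sum>v\<in>verts \<Gamma>. card v - 3)"

definition is_loop :: "'h ribbon \<Rightarrow> 'h set \<Rightarrow> bool" where
  "is_loop \<Gamma> e \<longleftrightarrow> (\<exists>v\<in>verts \<Gamma>. e \<subseteq> v)"

definition nonloops :: "'h ribbon \<Rightarrow> 'h set set" where
  "nonloops \<Gamma> = {e \<in> edges \<Gamma>. \<not> is_loop \<Gamma> e}"

text \<open>
  \<open>collapse \<Gamma> e\<close> is \<open>\<Gamma>/e\<close>: merging \<open>(e\<^sup>-, h\<^sub>1, \<dots>, h\<^sub>p)\<close> and \<open>(e\<^sup>+, k\<^sub>1, \<dots>, k\<^sub>q)\<close> into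
  \<open>(h\<^sub>1, \<dots>, h\<^sub>p, k\<^sub>1, \<dots>, k\<^sub>q)\<close> means that a half-edge whose successor is one half of \<open>e\<close> gets
  the successor of the other half.
\<close>

definition other_half :: "'h set \<Rightarrow> 'h \<Rightarrow> 'h" where
  "other_half e a = (THE b. b \<in> e \<and> b \<noteq> a)"

definition merged_vertex :: "'h ribbon \<Rightarrow> 'h set \<Rightarrow> 'h set" where
  "merged_vertex \<Gamma> e = \<Union>{v \<in> verts \<Gamma>. v \<inter> e \<noteq> {}} - e"

definition collapse :: "'h ribbon \<Rightarrow> 'h set \<Rightarrow> 'h ribbon" where
  "collapse \<Gamma> e = \<lparr>
     halves = halves \<Gamma> - e,
     edges = edges \<Gamma> - {e},
     verts = insert (merged_vertex \<Gamma> e) {v \<in> verts \<Gamma>. v \<inter> e = {}},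
     nxt = (\<lambda>h. if h \<in> halves \<Gamma> - e
                then (if nxt \<Gamma> h \<in> e then nxt \<Gamma> (other_half e (nxt \<Gamma> h)) else nxt \<Gamma> h)
                else h)\<rparr>"

text \<open>
  A spanning forest contains all vertices, so it is given by its set of edges; it has no cycle,
  where loops and pairs of parallel edges count as cycles of length 1 and 2.
\<close>

definition is_cycle :: "'h ribbon \<Rightarrow> 'h set list \<Rightarrow> 'h set list \<Rightarrow> bool" where
  "is_cycle \<Gamma> vs es \<longleftrightarrow>
     es \<noteq> [] \<and> length vs = length es \<and> distinct vs \<and> distinct es \<and>
     set vs \<subseteq> verts \<Gamma> \<and> set es \<subseteq> edges \<Gamma> \<and>
     (\<forall>i<length es. joins (es ! i) (vs ! i) (vs ! (Suc i mod length es)))"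

definition spanning_forest :: "'h ribbon \<Rightarrow> 'h set set \<Rightarrow> bool" where
  "spanning_forest \<Gamma> F \<longleftrightarrow> F \<subseteq> edges \<Gamma> \<and> \<not> (\<exists>vs es. is_cycle \<Gamma> vs es \<and> set es \<subseteq> F)"

text \<open>
  \<open>collapses \<Gamma> F \<Delta>\<close>: collapsing the edges of \<open>F\<close> in some order results in \<open>\<Delta>\<close>, i.e.
  \<open>\<Delta> = \<Gamma>/F\<close> (the order does not matter).
\<close>

inductive collapses :: "'h ribbon \<Rightarrow> 'h set set \<Rightarrow> 'h ribbon \<Rightarrow> bool" where
  collapses_empty: "collapses \<Gamma> {} \<Gamma>"
| collapses_insert: "e \<in> nonloops \<Gamma> \<Longrightarrow> collapses (collapse \<Gamma> e) F \<Delta> \<Longrightarrow> collapses \<Gamma> (insert e F) \<Delta>"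

text \<open>
  Morphisms are partial maps on half-edges, so that composition is \<^term>\<open>(\<circ>\<^sub>m)\<close>: an isomorphism
  \<open>\<Gamma>\<^sub>0/F \<cong> \<Gamma>\<^sub>1\<close> is undefined exactly on the halves of edges in \<open>F\<close> (and outside \<open>\<Gamma>\<^sub>0\<close>), hence
  determines \<open>F\<close>.
\<close>

type_synonym 'h mor = "'h \<rightharpoonup> 'h"

definition img :: "'h mor \<Rightarrow> 'h set \<Rightarrow> 'h set" where
  "img f A = {k. \<exists>h\<in>A. f h = Some k}"

definition ribbon_iso :: "'h ribbon \<Rightarrow> 'h mor \<Rightarrow> 'h ribbon \<Rightarrow> bool" where
  "ribbon_iso \<Gamma> f \<Gamma>' \<longleftrightarrow>
     dom f = halves \<Gamma> \<and> ran f = halves \<Gamma>' \<and> inj_on f (dom f) \<and>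
     img f ` edges \<Gamma> = edges \<Gamma>' \<and> img f ` verts \<Gamma> = verts \<Gamma>' \<and>
     (\<forall>h\<in>halves \<Gamma>. f (nxt \<Gamma> h) = map_option (nxt \<Gamma>') (f h))"

definition Aut :: "'h ribbon \<Rightarrow> 'h mor set" where
  "Aut \<Gamma> = {f. ribbon_iso \<Gamma> f \<Gamma>}"

definition Mor :: "'h ribbon \<Rightarrow> 'h ribbon \<Rightarrow> 'h mor set" where
  "Mor \<Gamma>0 \<Gamma>1 = {f. \<exists>F \<Delta>. spanning_forest \<Gamma>0 F \<and> collapses \<Gamma>0 F \<Delta> \<and> ribbon_iso \<Delta> f \<Gamma>1}"


section \<open>Orientations\<close>

text \<open>
  The real vector space spanned by a set of symbols consists of the finitely supported functions
  on them, with the symbols as unit vectors.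
\<close>

instantiation poly_mapping :: (type, real_vector) real_vector
begin

lift_definition scaleR_poly_mapping :: "real \<Rightarrow> ('a \<Rightarrow>\<^sub>0 'b) \<Rightarrow> ('a \<Rightarrow>\<^sub>0 'b)"
  is "\<lambda>r f x. r *\<^sub>R f x"
  by (erule rev_finite_subset) auto

instance
  by standard (transfer; simp add: fun_eq_iff algebra_simps)+

end

definition unit_vec :: "'b \<Rightarrow> ('b \<Rightarrow>\<^sub>0 real)" where
  "unit_vec x = Poly_Mapping.single x 1"

definition ordered_bases :: "'b set \<Rightarrow> ('b \<Rightarrow>\<^sub>0 real) list set" where
  "ordered_bases B =
     {bs. distinct bs \<and> independent (set bs) \<and> span (set bs) = span (unit_vec ` B)}"

definition same_orientation :: "('b \<Rightarrow>\<^sub>0 real) list \<Rightarrow> ('b \<Rightarrow>\<^sub>0 real) list \<Rightarrow> bool" where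
  "same_orientation bs cs \<longleftrightarrow> length cs = length bs \<and>
     (\<exists>A \<in> carrier_mat (length bs) (length bs). Determinant.det A > 0 \<and>
        (\<forall>j<length bs. cs ! j = (\<Sum>i<length bs. A $$ (i, j) *\<^sub>R bs ! i)))"

definition orientation_class :: "'b set \<Rightarrow> ('b \<Rightarrow>\<^sub>0 real) list \<Rightarrow> ('b \<Rightarrow>\<^sub>0 real) list set" where
  "orientation_class B bs = {cs \<in> ordered_bases B. same_orientation bs cs}"

definition orientations :: "'b set \<Rightarrow> ('b \<Rightarrow>\<^sub>0 real) list set set" where
  "orientations B = orientation_class B ` ordered_bases B"

type_synonym 'h cell = "'h set + 'h"
type_synonym 'h orient = "('h cell \<Rightarrow>\<^sub>0 real) list set"
type_synonym 'h ograph = "'h ribbon \<times> 'h orient"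

definition cells :: "'h ribbon \<Rightarrow> 'h cell set" where
  "cells \<Gamma> = Inl ` verts \<Gamma> \<union> Inr ` halves \<Gamma>"

text \<open>A word listing the vertices and half-edges once each denotes an orientation.\<close>

definition is_word :: "'h ribbon \<Rightarrow> 'h cell list \<Rightarrow> bool" where
  "is_word \<Gamma> w \<longleftrightarrow> distinct w \<and> set w = cells \<Gamma>"

definition word_orient :: "'h ribbon \<Rightarrow> 'h cell list \<Rightarrow> 'h orient" where
  "word_orient \<Gamma> w = orientation_class (cells \<Gamma>) (map unit_vec w)"

definition ographs :: "nat \<Rightarrow> 'h ograph set" where
  "ographs n = {(\<Gamma>, \<omega>). ribbon_graph \<Gamma> \<and> codim \<Gamma> = n \<and> \<omega> \<in> orientations (cells \<Gamma>)}"

text \<open>Reversal: the other class of ordered bases.\<close>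

definition orev :: "'h ograph \<Rightarrow> 'h ograph" where
  "orev x = (fst x, ordered_bases (cells (fst x)) - snd x)"

definition cell_map :: "'h mor \<Rightarrow> 'h cell \<Rightarrow> 'h cell" where
  "cell_map f = map_sum (img f) (the \<circ> f)"

definition oriented_iso :: "'h ograph \<Rightarrow> 'h mor \<Rightarrow> 'h ograph \<Rightarrow> bool" where
  "oriented_iso x f y \<longleftrightarrow> ribbon_iso (fst x) f (fst y) \<and>
     (\<exists>w. is_word (fst x) w \<and> snd x = word_orient (fst x) w \<and>
          snd y = word_orient (fst y) (map (cell_map f) w))"

definition collapse_orient :: "'h ribbon \<Rightarrow> 'h set \<Rightarrow> 'h orient \<Rightarrow> 'h orient \<Rightarrow> bool" where
  "collapse_orient \<Gamma> e \<omega> \<omega>' \<longleftrightarrow>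
     (\<exists>a b v1 v2 w. e = {a, b} \<and> v1 \<in> verts \<Gamma> \<and> v2 \<in> verts \<Gamma> \<and> a \<in> v1 \<and> b \<in> v2 \<and>
        is_word \<Gamma> (Inl v1 # Inl v2 # Inr a # Inr b # w) \<and>
        \<omega> = word_orient \<Gamma> (Inl v1 # Inl v2 # Inr a # Inr b # w) \<and>
        \<omega>' = word_orient (collapse \<Gamma> e) (Inl (merged_vertex \<Gamma> e) # w))"

definition ocollapse :: "'h ograph \<Rightarrow> 'h set \<Rightarrow> 'h ograph" where
  "ocollapse x e = (collapse (fst x) e, THE \<omega>'. collapse_orient (fst x) e (snd x) \<omega>')"

text \<open>
  The natural orientation, for a chosen order \<open>vs\<close> of the vertices and a chosen first half-edge
  \<open>b v\<close> at each vertex \<open>v\<close>; if all valences are odd, the choices do not matter.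
\<close>

definition is_natural :: "'h ograph \<Rightarrow> bool" where
  "is_natural x \<longleftrightarrow>
     (\<exists>vs b. distinct vs \<and> set vs = verts (fst x) \<and> (\<forall>v\<in>verts (fst x). b v \<in> v) \<and>
        snd x = word_orient (fst x)
          (concat (map (\<lambda>v. Inl v # map (\<lambda>i. Inr ((nxt (fst x) ^^ i) (b v))) [0..<card v]) vs)))"

definition orient_sign :: "'h ograph \<Rightarrow> int" where
  "orient_sign x = (if is_natural x then 1 else - 1)"


section \<open>Chain complexes and tensor products of abelian groups\<close>

text \<open>
  \<open>hom_on A B S g v\<close> is the homomorphism \<open>A \<rightarrow> B\<close> with value \<open>v x\<close> on the generator \<open>g x\<close>, \<open>x \<in> S\<close>.
\<close>

definition hom_on ::
  "('a, 'm) monoid_scheme \<Rightarrow> ('b, 'n) monoid_scheme \<Rightarrow> 'x set \<Rightarrow> ('x \<Rightarrow> 'a) \<Rightarrow> ('x \<Rightarrow> 'b) \<Rightarrow> 'a \<Rightarrow> 'b"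
where
  "hom_on A B S g v =
     (THE h. h \<in> hom A B \<inter> extensional (carrier A) \<and> (\<forall>x\<in>S. h (g x) = v x))"

text \<open>\<open>Dif C n\<close> is the boundary from degree \<open>Suc n\<close> to degree \<open>n\<close>.\<close>

record 'a chain_complex =
  Grp :: "nat \<Rightarrow> 'a monoid"
  Dif :: "nat \<Rightarrow> 'a \<Rightarrow> 'a"

record 'a aug_complex = "'a chain_complex" +
  Aug :: "'a \<Rightarrow> int"

definition chain_map ::
  "('a, 'm) chain_complex_scheme \<Rightarrow> ('b, 'n) chain_complex_scheme \<Rightarrow> (nat \<Rightarrow> 'a \<Rightarrow> 'b) \<Rightarrow> bool" where
  "chain_map C D f \<longleftrightarrow>
     (\<forall>n. f n \<in> hom (Grp C n) (Grp D n)) \<and>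
     (\<forall>n. \<forall>x\<in>carrier (Grp C (Suc n)). f n (Dif C n x) = Dif D n (f (Suc n) x))"

definition aug_chain_map ::
  "('a, 'm) aug_complex_scheme \<Rightarrow> ('b, 'n) aug_complex_scheme \<Rightarrow> (nat \<Rightarrow> 'a \<Rightarrow> 'b) \<Rightarrow> bool" where
  "aug_chain_map C D f \<longleftrightarrow>
     chain_map C D f \<and> (\<forall>x\<in>carrier (Grp C 0). Aug D (f 0 x) = Aug C x)"

definition chain_homotopic ::
  "('a, 'm) chain_complex_scheme \<Rightarrow> ('b, 'n) chain_complex_scheme \<Rightarrow>
   (nat \<Rightarrow> 'a \<Rightarrow> 'b) \<Rightarrow> (nat \<Rightarrow> 'a \<Rightarrow> 'b) \<Rightarrow> bool" where
  "chain_homotopic C D f g \<longleftrightarrow>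
     (\<exists>s. (\<forall>n. s n \<in> hom (Grp C n) (Grp D (Suc n))) \<and>
        (\<forall>x\<in>carrier (Grp C 0).
           f 0 x \<otimes>\<^bsub>Grp D 0\<^esub> inv\<^bsub>Grp D 0\<^esub> (g 0 x) = Dif D 0 (s 0 x)) \<and>
        (\<forall>n. \<forall>x\<in>carrier (Grp C (Suc n)).
           f (Suc n) x \<otimes>\<^bsub>Grp D (Suc n)\<^esub> inv\<^bsub>Grp D (Suc n)\<^esub> (g (Suc n) x) =
           Dif D (Suc n) (s (Suc n) x) \<otimes>\<^bsub>Grp D (Suc n)\<^esub> s n (Dif C n x)))"

definition chain_homotopy_equivalence ::
  "('a, 'm) chain_complex_scheme \<Rightarrow> ('b, 'n) chain_complex_scheme \<Rightarrow> (nat \<Rightarrow> 'a \<Rightarrow> 'b) \<Rightarrow> bool" where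
  "chain_homotopy_equivalence C D f \<longleftrightarrow>
     chain_map C D f \<and>
     (\<exists>g. chain_map D C g \<and>
        chain_homotopic C C (\<lambda>n. g n \<circ> f n) (\<lambda>n. id) \<and>
        chain_homotopic D D (\<lambda>n. f n \<circ> g n) (\<lambda>n. id))"

definition chain_iso ::
  "('a, 'm) chain_complex_scheme \<Rightarrow> ('b, 'n) chain_complex_scheme \<Rightarrow> (nat \<Rightarrow> 'a \<Rightarrow> 'b) \<Rightarrow> bool" where
  "chain_iso C D f \<longleftrightarrow> chain_map C D f \<and> (\<forall>n. f n \<in> iso (Grp C n) (Grp D n))"

definition tensor_rels ::
  "('a, 'm) monoid_scheme \<Rightarrow> ('b, 'n) monoid_scheme \<Rightarrow> ('a \<times> 'b \<Rightarrow>\<^sub>0 int) set" where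
  "tensor_rels A B = generate (free_Abelian_group (carrier A \<times> carrier B))
     ({frag_of (a \<otimes>\<^bsub>A\<^esub> a', b) - frag_of (a, b) - frag_of (a', b) | a a' b.
         a \<in> carrier A \<and> a' \<in> carrier A \<and> b \<in> carrier B} \<union>
      {frag_of (a, b \<otimes>\<^bsub>B\<^esub> b') - frag_of (a, b) - frag_of (a, b') | a b b'.
         a \<in> carrier A \<and> b \<in> carrier B \<and> b' \<in> carrier B})"

definition tensor ::
  "('a, 'm) monoid_scheme \<Rightarrow> ('b, 'n) monoid_scheme \<Rightarrow> ('a \<times> 'b \<Rightarrow>\<^sub>0 int) set monoid" where
  "tensor A B = free_Abelian_group (carrier A \<times> carrier B) Mod tensor_rels A B"

definition pure_tensor ::
  "('a, 'm) monoid_scheme \<Rightarrow> ('b, 'n) monoid_scheme \<Rightarrow> 'a \<Rightarrow> 'b \<Rightarrow> ('a \<times> 'b \<Rightarrow>\<^sub>0 int) set" where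
  "pure_tensor A B a b =
     tensor_rels A B #>\<^bsub>free_Abelian_group (carrier A \<times> carrier B)\<^esub> frag_of (a, b)"

definition rat_group :: "rat monoid" where
  "rat_group = \<lparr>carrier = UNIV, monoid.mult = (+), one = 0\<rparr>"

text \<open>
  \<open>rat_map A B f\<close> is \<open>f \<otimes> \<rat> : A \<otimes> \<rat> \<rightarrow> B \<otimes> \<rat>\<close>. Additive maps between rational vector spaces are
  rational-linear, so chain maps and homotopies between rationalised complexes are just additive.
\<close>

definition rat_map ::
  "('a, 'm) monoid_scheme \<Rightarrow> ('b, 'n) monoid_scheme \<Rightarrow> ('a \<Rightarrow> 'b) \<Rightarrow>
   ('a \<times> rat \<Rightarrow>\<^sub>0 int) set \<Rightarrow> ('b \<times> rat \<Rightarrow>\<^sub>0 int) set" where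
  "rat_map A B f =
     hom_on (tensor A rat_group) (tensor B rat_group) (carrier A \<times> UNIV)
       (\<lambda>(a, q). pure_tensor A rat_group a q) (\<lambda>(a, q). pure_tensor B rat_group (f a) q)"

definition rat_complex ::
  "('a, 'm) chain_complex_scheme \<Rightarrow> ('a \<times> rat \<Rightarrow>\<^sub>0 int) set chain_complex" where
  "rat_complex C = \<lparr>
     Grp = (\<lambda>n. tensor (Grp C n) rat_group),
     Dif = (\<lambda>n. rat_map (Grp C (Suc n)) (Grp C n) (Dif C n))\<rparr>"

definition rat_chain_map ::
  "('a, 'm) chain_complex_scheme \<Rightarrow> ('b, 'n) chain_complex_scheme \<Rightarrow> (nat \<Rightarrow> 'a \<Rightarrow> 'b) \<Rightarrow>
   nat \<Rightarrow> ('a \<times> rat \<Rightarrow>\<^sub>0 int) set \<Rightarrow> ('b \<times> rat \<Rightarrow>\<^sub>0 int) set" where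
  "rat_chain_map C D f n = rat_map (Grp C n) (Grp D n) (f n)"


section \<open>Chains on the nerve of a category\<close>

text \<open>
  The unnormalised chains on the nerve do not involve the identities, which are therefore not
  recorded. \<open>Comp C g f\<close> is \<open>g\<close> after \<open>f\<close>.
\<close>

record ('o, 'm) cat =
  Obj :: "'o set"
  Arr :: "'o \<Rightarrow> 'o \<Rightarrow> 'm set"
  Comp :: "'m \<Rightarrow> 'm \<Rightarrow> 'm"

type_synonym ('o, 'm) simplex = "'o list \<times> 'm list"

definition nerve :: "('o, 'm) cat \<Rightarrow> nat \<Rightarrow> ('o, 'm) simplex set" where
  "nerve C n = {(xs, fs). length xs = Suc n \<and> length fs = n \<and> set xs \<subseteq> Obj C \<and>
     (\<forall>i<n. fs ! i \<in> Arr C (xs ! i) (xs ! Suc i))}"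

definition face :: "('o, 'm) cat \<Rightarrow> nat \<Rightarrow> ('o, 'm) simplex \<Rightarrow> ('o, 'm) simplex" where
  "face C i = (\<lambda>(xs, fs).
     (take i xs @ drop (Suc i) xs,
      if i = 0 then tl fs
      else if i = length fs then butlast fs
      else take (i - 1) fs @ [Comp C (fs ! i) (fs ! (i - 1))] @ drop (Suc i) fs))"

definition nerve_chains :: "('o, 'm) cat \<Rightarrow> (('o, 'm) simplex \<Rightarrow>\<^sub>0 int) aug_complex" where
  "nerve_chains C = \<lparr>
     Grp = (\<lambda>n. free_Abelian_group (nerve C n)),
     Dif = (\<lambda>n. frag_extend (\<lambda>\<sigma>. \<Sum>i\<le>Suc n. frag_cmul ((- 1) ^ i) (frag_of (face C i \<sigma>)))),
     Aug = (\<lambda>c. \<Sum>\<sigma>\<in>Poly_Mapping.keys c. Poly_Mapping.lookup c \<sigma>)\<rparr>"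

definition slice :: "('o, 'm) cat \<Rightarrow> 'o \<Rightarrow> ('o \<times> 'm, 'm) cat" where
  "slice C c = \<lparr>
     Obj = {(x, f). x \<in> Obj C \<and> f \<in> Arr C x c},
     Arr = (\<lambda>(x, f) (y, g). {h \<in> Arr C x y. Comp C g h = f}),
     Comp = Comp C\<rparr>"

text \<open>The maps induced on chains by the functors \<open>C/c \<rightarrow> C\<close> and \<open>C/c \<rightarrow> C/c'\<close> (for \<open>h : c \<rightarrow> c'\<close>).\<close>

definition slice_forget :: "(('o \<times> 'm, 'm) simplex \<Rightarrow>\<^sub>0 int) \<Rightarrow> (('o, 'm) simplex \<Rightarrow>\<^sub>0 int)" where
  "slice_forget = frag_extend (\<lambda>(xs, fs). frag_of (map fst xs, fs))"

definition slice_push ::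
  "('o, 'm) cat \<Rightarrow> 'm \<Rightarrow> (('o \<times> 'm, 'm) simplex \<Rightarrow>\<^sub>0 int) \<Rightarrow> (('o \<times> 'm, 'm) simplex \<Rightarrow>\<^sub>0 int)" where
  "slice_push C h = frag_extend (\<lambda>(xs, fs). frag_of (map (\<lambda>(x, f). (x, Comp C h f)) xs, fs))"

definition fat :: "('h ribbon, 'h mor) cat" where
  "fat = \<lparr>Obj = {\<Gamma>. ribbon_graph \<Gamma>}, Arr = Mor, Comp = (\<circ>\<^sub>m)\<rparr>"


section \<open>Graph cohomology\<close>

text \<open>
  \<open>antisym_group X r rv\<close> is the abelian group generated by the \<open>r\<close>-classes \<open>[x]\<close> of elements of
  \<open>X\<close> modulo \<open>[rv x] = - [x]\<close>, and \<open>antisym_gen X r rv x\<close> is its generator \<open>[x]\<close>.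
\<close>

definition antisym_rels :: "'x set \<Rightarrow> 'x rel \<Rightarrow> ('x \<Rightarrow> 'x) \<Rightarrow> ('x set \<Rightarrow>\<^sub>0 int) set" where
  "antisym_rels X r rv = generate (free_Abelian_group (X // r))
     {frag_of (r `` {rv x}) + frag_of (r `` {x}) | x. x \<in> X}"

definition antisym_group :: "'x set \<Rightarrow> 'x rel \<Rightarrow> ('x \<Rightarrow> 'x) \<Rightarrow> ('x set \<Rightarrow>\<^sub>0 int) set monoid" where
  "antisym_group X r rv = free_Abelian_group (X // r) Mod antisym_rels X r rv"

definition antisym_gen :: "'x set \<Rightarrow> 'x rel \<Rightarrow> ('x \<Rightarrow> 'x) \<Rightarrow> 'x \<Rightarrow> ('x set \<Rightarrow>\<^sub>0 int) set" where
  "antisym_gen X r rv x = antisym_rels X r rv #>\<^bsub>free_Abelian_group (X // r)\<^esub> frag_of (r `` {x})"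

definition oiso_rel :: "nat \<Rightarrow> 'h ograph rel" where
  "oiso_rel n = {(x, y). x \<in> ographs n \<and> y \<in> ographs n \<and> (\<exists>f. oriented_iso x f y)}"

type_synonym 'h gelem = "('h ograph set \<Rightarrow>\<^sub>0 int) set"
type_synonym 'h gdual = "'h gelem \<Rightarrow> int"

text \<open>\<open>G_up n\<close> is \<open>\<G>\<^sup>n\<close> with boundary \<open>G_bd n\<close> to \<open>\<G>\<^sup>n\<^sup>+\<^sup>1\<close>, and \<open>G_dn n\<close> is \<open>\<G>\<^sub>n\<close>.\<close>

definition G_up :: "nat \<Rightarrow> 'h gelem monoid" where
  "G_up n = antisym_group (ographs n) (oiso_rel n) orev"

definition G_gen :: "nat \<Rightarrow> 'h ograph \<Rightarrow> 'h gelem" where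
  "G_gen n = antisym_gen (ographs n) (oiso_rel n) orev"

definition G_bd :: "nat \<Rightarrow> 'h gelem \<Rightarrow> 'h gelem" where
  "G_bd n = hom_on (G_up n) (G_up (Suc n)) (ographs n) (G_gen n)
     (\<lambda>x. finprod (G_up (Suc n)) (\<lambda>e. G_gen (Suc n) (ocollapse x e)) (nonloops (fst x)))"

definition G_dn :: "nat \<Rightarrow> 'h gdual monoid" where
  "G_dn n = \<lparr>
     carrier = {h \<in> hom (G_up n) integer_group \<inter> extensional (carrier (G_up n)).
                  finite {c \<in> G_gen n ` ographs n. h c \<noteq> 0}},
     monoid.mult = (\<lambda>h k. \<lambda>c\<in>carrier (G_up n). h c + k c),
     one = (\<lambda>c\<in>carrier (G_up n). 0)\<rparr>"

definition G_complex :: "'h gdual chain_complex" where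
  "G_complex = \<lparr>
     Grp = G_dn,
     Dif = (\<lambda>n h. \<lambda>c\<in>carrier (G_up n). h (G_bd n c))\<rparr>"

definition G_dual :: "'h ograph \<Rightarrow> 'h gdual" where
  "G_dual x = (let n = codim (fst x) in
     THE h. h \<in> carrier (G_dn n) \<and>
       (\<forall>y\<in>ographs n. h (G_gen n y) =
          (if (x, orev x) \<in> oiso_rel n then 0
           else if (x, y) \<in> oiso_rel n then 1
           else if (orev x, y) \<in> oiso_rel n then - 1
           else 0)))"

text \<open>\<open>\<langle>\<Gamma>\<rangle> = |Aut(\<Gamma>)| [\<Gamma>]\<^sup>*\<close>, where the group is written multiplicatively.\<close>

definition bracket :: "'h ograph \<Rightarrow> 'h gdual" where
  "bracket x = G_dual x [^]\<^bsub>G_dn (codim (fst x))\<^esub> card (Aut (fst x))"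

definition GZ :: "nat \<Rightarrow> 'h gdual monoid" where
  "GZ n = (G_dn n)\<lparr>carrier := generate (G_dn n) (bracket ` ographs n)\<rparr>"

definition GZ_complex :: "'h gdual aug_complex" where
  "GZ_complex = \<lparr>
     Grp = GZ,
     Dif = Dif G_complex,
     Aug = hom_on (GZ 0) integer_group (ographs 0) bracket orient_sign\<rparr>"


section \<open>The forest carrier\<close>

type_synonym 'h overgraph = "'h ograph \<times> 'h mor"
type_synonym 'h felem = "('h overgraph set \<Rightarrow>\<^sub>0 int) set"

definition overgraphs :: "'h ribbon \<Rightarrow> nat \<Rightarrow> 'h overgraph set" where
  "overgraphs \<Gamma>0 k = {(x, f). x \<in> ographs k \<and> f \<in> Mor (fst x) \<Gamma>0}"

definition over_rel :: "'h ribbon \<Rightarrow> nat \<Rightarrow> 'h overgraph rel" where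
  "over_rel \<Gamma>0 k = {((x, f), (y, g)). (x, f) \<in> overgraphs \<Gamma>0 k \<and> (y, g) \<in> overgraphs \<Gamma>0 k \<and>
     (\<exists>\<alpha>. oriented_iso x \<alpha> y \<and> g \<circ>\<^sub>m \<alpha> = f)}"

definition over_rev :: "'h overgraph \<Rightarrow> 'h overgraph" where
  "over_rev = (\<lambda>(x, f). (orev x, f))"

definition F_grp :: "'h ribbon \<Rightarrow> nat \<Rightarrow> 'h felem monoid" where
  "F_grp \<Gamma>0 k = antisym_group (overgraphs \<Gamma>0 k) (over_rel \<Gamma>0 k) over_rev"

definition F_gen :: "'h ribbon \<Rightarrow> nat \<Rightarrow> 'h overgraph \<Rightarrow> 'h felem" where
  "F_gen \<Gamma>0 k = antisym_gen (overgraphs \<Gamma>0 k) (over_rel \<Gamma>0 k) over_rev"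

text \<open>
  \<open>expands (y, g) x\<close>: \<open>g\<close> is a morphism from \<open>y\<close> to \<open>x\<close> that collapses exactly one edge, and the
  orientation of \<open>y\<close> induces that of \<open>x\<close>. Since \<open>g\<close> and the orientation of \<open>x\<close> determine the
  orientation of \<open>y\<close>, the right equivalence classes of such \<open>g\<close> may be taken with orientations.
\<close>

definition expands :: "'h overgraph \<Rightarrow> 'h ograph \<Rightarrow> bool" where
  "expands = (\<lambda>(y, g) x. \<exists>e \<omega>. e \<in> nonloops (fst y) \<and>
     collapse_orient (fst y) e (snd y) \<omega> \<and> oriented_iso (collapse (fst y) e, \<omega>) g x)"

definition expansions :: "nat \<Rightarrow> 'h ograph \<Rightarrow> 'h overgraph set set" where
  "expansions k x = {z \<in> overgraphs (fst x) k. expands z x} // over_rel (fst x) k"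

definition F_complex :: "'h ribbon \<Rightarrow> 'h felem aug_complex" where
  "F_complex \<Gamma>0 = \<lparr>
     Grp = F_grp \<Gamma>0,
     Dif = (\<lambda>k. hom_on (F_grp \<Gamma>0 (Suc k)) (F_grp \<Gamma>0 k) (overgraphs \<Gamma>0 (Suc k)) (F_gen \<Gamma>0 (Suc k))
       (\<lambda>(x, f). finprod (F_grp \<Gamma>0 k)
          (\<lambda>c. let (y, g) = (SOME z. z \<in> c) in F_gen \<Gamma>0 k (y, f \<circ>\<^sub>m g)) (expansions k x))),
     Aug = hom_on (F_grp \<Gamma>0 0) integer_group (overgraphs \<Gamma>0 0) (F_gen \<Gamma>0 0)
       (\<lambda>(x, f). orient_sign x)\<rparr>"

definition F_push :: "'h ribbon \<Rightarrow> 'h ribbon \<Rightarrow> 'h mor \<Rightarrow> nat \<Rightarrow> 'h felem \<Rightarrow> 'h felem" where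
  "F_push \<Gamma>0 \<Gamma>1 h k = hom_on (F_grp \<Gamma>0 k) (F_grp \<Gamma>1 k) (overgraphs \<Gamma>0 k) (F_gen \<Gamma>0 k)
     (\<lambda>(x, f). F_gen \<Gamma>1 k (x, h \<circ>\<^sub>m f))"

definition F_proj :: "'h ribbon \<Rightarrow> nat \<Rightarrow> 'h felem \<Rightarrow> 'h gdual" where
  "F_proj \<Gamma>0 k = hom_on (F_grp \<Gamma>0 k) (GZ k) (overgraphs \<Gamma>0 k) (F_gen \<Gamma>0 k) (\<lambda>(x, f). bracket x)"

type_synonym 'h fat_chain = "('h ribbon, 'h mor) simplex \<Rightarrow>\<^sub>0 int"
type_synonym 'h fat_slice_chain = "('h ribbon \<times> 'h mor, 'h mor) simplex \<Rightarrow>\<^sub>0 int"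

definition carried_by_forests :: "(nat \<Rightarrow> 'h fat_chain \<Rightarrow> 'h gdual) \<Rightarrow> bool" where
  "carried_by_forests \<phi> \<longleftrightarrow>
     (\<exists>\<Phi> :: 'h ribbon \<Rightarrow> nat \<Rightarrow> 'h fat_slice_chain \<Rightarrow> 'h felem.
        (\<forall>\<Gamma>\<in>Obj fat. aug_chain_map (nerve_chains (slice fat \<Gamma>)) (F_complex \<Gamma>) (\<Phi> \<Gamma>)) \<and>
        (\<forall>\<Gamma>\<in>Obj fat. \<forall>\<Gamma>'\<in>Obj fat. \<forall>h\<in>Arr fat \<Gamma> \<Gamma>'. \<forall>n.
           \<forall>c\<in>carrier (Grp (nerve_chains (slice fat \<Gamma>)) n).
             \<Phi> \<Gamma>' n (slice_push fat h c) = F_push \<Gamma> \<Gamma>' h n (\<Phi> \<Gamma> n c)) \<and>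
        (\<forall>\<Gamma>\<in>Obj fat. \<forall>n. \<forall>c\<in>carrier (Grp (nerve_chains (slice fat \<Gamma>)) n).
           F_proj \<Gamma> n (\<Phi> \<Gamma> n c) = \<phi> n (slice_forget c)))"

end

theory Submission
 imports Defs
begin

text \<open>
 Every oriented graph \<open>x\<close> of codimension \<open>k\<close> carries a rational \<open>k\<close>-chain \<open>cyc k x\<close> on the nerve of
 the slice over it: a trivalent graph gets a point, with the sign of its orientation, and a graph of
 positive codimension gets the cone on the sum of the chains of its one-edge expansions. The cone goes to
 the terminal object of the slice and is averaged over all isomorphisms from a representative of the
 isomorphism class, so that it commutes with isomorphisms; the average needs rational coefficients. The
 boundary of \<open>cyc\<close> is the sum over the expansions (\<open>qbd_cyc\<close>) because that sum is a cycle: the two orders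
 of expanding a pair of edges cancel (\<open>ocollapse_commute\<close>, \<open>expansions_twice\<close>), and the expansions of a
 graph of codimension 1 have cancelling signs (\<open>aug_zet\<close>).
 
 Pushing \<open>cyc\<close> forward along the morphisms to \<open>G\<close> gives a chain map \<open>Psi\<close> from the forest carrier of \<open>G\<close> to
 the rational chains on the slice over \<open>G\<close>, natural in \<open>G\<close>. Let \<open>\<Phi>\<close> be the natural map that carries \<open>\<phi>\<close>.
 The composite of \<open>\<Phi>\<close> and \<open>Psi\<close> is naturally homotopic to the identity, since the slices are contractible
 and their simplices are the push-forwards of the canonical lifts \<open>hat\<close> of simplices of the nerve: the
 homotopy is built on these lifts degree by degree (\<open>hmt_bd\<close>).
 
 Forgetting the structure maps turns \<open>cyc\<close> into a map \<open>psi\<close> from graph homology to the rational chains on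
 the nerve, and the homotopy into one between \<open>psi\<close> after \<open>\<phi>\<close> and the identity (\<open>homotopy\<close>). In the other order
 the composite is equal to the identity. In degree \<open>k\<close> the carrier of a graph of codimension \<open>k\<close> is infinite
 cyclic, generated by the identity of the graph (\<open>top_degree\<close>). So \<open>\<Phi>\<close> sends \<open>cyc k x\<close> to a multiple of this
 generator, and comparison of boundaries shows that the multiple is 1 (\<open>pairing_cyc\<close>). Applying the
 projection of the carrier, \<open>\<phi>\<close> sends the forgetful image of \<open>cyc k x\<close> to the class of \<open>x\<close> (\<open>pe_fcyc\<close>).
 
 For the second assertion, the inclusion of the subcomplex stays injective after tensoring with \<open>\<rat>\<close>, and it
 becomes surjective because every element of the dual complex has a multiple in the subcomplex
 (\<open>multiple_in_GZ\<close>).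
\<close>

abbreviation "keys \<equiv> Poly_Mapping.keys"
abbreviation "lookup \<equiv> Poly_Mapping.lookup"
notation map_comp (infixl "o'_m" 55)

section \<open>Abelian groups given by generators and relations\<close>

declare mult_FactGroup [simp del] one_FactGroup [simp del]

lemma hom_eq_on_generate:
 assumes "group A" "group B" "h : hom A B" "k : hom A B" "X <= carrier A"
  and "!!x. x : X ==> h x = k x" and "y : generate A X"
 shows "h y = k y"
proof -
 interpret A: group A by fact
 interpret h: group_hom A B h using assms by (simp add: group_hom_def group_hom_axioms_def)
 interpret k: group_hom A B k using assms by (simp add: group_hom_def group_hom_axioms_def)
 show ?thesis using assms(7)
 proof (induction rule: generate.induct)
  case one show ?case by simp
 next
  case (incl x) thus ?case using assms by auto
 next
  case (inv x) thus ?case using assms by (auto simp: subset_iff)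
 next
  case (eng x y)
  thus ?case using A.generate_in_carrier[OF assms(5)] by simp
 qed
qed

lemma hom_on_spec:
 assumes "group A" "group B" and gen: "carrier A = generate A (g ` S)" and "g ` S <= carrier A"
  and h: "h : hom A B" "!!x. x : S ==> h (g x) = v x"
 shows "hom_on A B S g v : hom A B" "hom_on A B S g v : extensional (carrier A)"
  "!!x. x : S ==> hom_on A B S g v (g x) = v x"
proof -
 interpret A: group A by fact
 let ?k = "restrict h (carrier A)"
 have k: "?k : hom A B \<inter> extensional (carrier A) & (ALL x:S. ?k (g x) = v x)"
  using h assms(4) by (auto simp: hom_def Pi_def)
 have u: "k' = ?k" if k': "k' : hom A B \<inter> extensional (carrier A) & (ALL x:S. k' (g x) = v x)" for k'
 proof (rule extensionalityI)
  show "k' x = ?k x" if "x : carrier A" for x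
  proof (rule hom_eq_on_generate[where h = k' and k = ?k, OF assms(1,2) _ _ assms(4)])
   show "k' : hom A B" "?k : hom A B" using k k' by blast+
   show "x : generate A (g ` S)" using that gen by simp
   show "k' y = ?k y" if "y : g ` S" for y using that k k' by auto
  qed
 qed (use k k' in auto)
 have "hom_on A B S g v = ?k" unfolding hom_on_def
 proof (rule the_equality)
  show "?k : hom A B \<inter> extensional (carrier A) & (ALL x:S. ?k (g x) = v x)" by (rule k)
 qed (rule u)
 thus "hom_on A B S g v : hom A B" "hom_on A B S g v : extensional (carrier A)"
  "!!x. x : S ==> hom_on A B S g v (g x) = v x" using k by auto
qed

lemma hom_finprod:
 assumes "comm_group A" "comm_group B" "h : hom A B" "f : X \<rightarrow> carrier A"
 shows "h (finprod A f X) = finprod B (%x. h (f x)) X"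
proof -
 interpret A: comm_group A by fact
 interpret B: comm_group B by fact
 interpret h: group_hom A B h using assms by (simp add: group_hom_def group_hom_axioms_def A.is_group B.is_group)
 show ?thesis using assms(4)
 proof (induction X rule: infinite_finite_induct)
  case (insert x F)
  hence "f : F \<rightarrow> carrier A" "f x : carrier A" by auto
  thus ?case using insert by (simp add: Pi_def)
 qed (auto simp: h.hom_one)
qed

text \<open>The additive group of a type, to speak of homomorphisms into vector spaces of chains.\<close>

definition add_group :: "'a::ab_group_add monoid" where
 "add_group = \<lparr>carrier = UNIV, monoid.mult = (+), one = 0\<rparr>"

lemma add_group_simps [simp]:
 "carrier add_group = UNIV" "x \<otimes>\<^bsub>add_group\<^esub> y = x + y" "\<one>\<^bsub>add_group\<^esub> = 0"
 by (auto simp: add_group_def)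

lemma comm_group_add_group: "comm_group add_group"
 by (rule comm_groupI) (auto simp: add_group_def ac_simps intro!: exI[of _ "- _"])

lemma inv_add_group [simp]: "inv\<^bsub>add_group\<^esub> x = - x"
 by (rule group.inv_equality[OF comm_group.axioms(2)[OF comm_group_add_group]]) auto

lemma finprod_add_group: "finprod add_group f X = sum f X"
proof -
 interpret comm_group add_group by (rule comm_group_add_group)
 show ?thesis by (induction X rule: infinite_finite_induct) (auto simp: Pi_def)
qed

lemma rat_group_simps [simp]:
 "carrier rat_group = UNIV" "x \<otimes>\<^bsub>rat_group\<^esub> y = x + y" "\<one>\<^bsub>rat_group\<^esub> = 0"
 by (auto simp: rat_group_def)

lemma integer_group_eq: "integer_group = add_group" by (simp add: integer_group_def add_group_def)

abbreviation presented :: "'s set => ('s \<Rightarrow>\<^sub>0 int) set => ('s \<Rightarrow>\<^sub>0 int) set monoid" where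
 "presented S R \<equiv> free_Abelian_group S Mod generate (free_Abelian_group S) R"

abbreviation pgen :: "'s set => ('s \<Rightarrow>\<^sub>0 int) set => ('s \<Rightarrow>\<^sub>0 int) => ('s \<Rightarrow>\<^sub>0 int) set" where
 "pgen S R u \<equiv> generate (free_Abelian_group S) R #>\<^bsub>free_Abelian_group S\<^esub> u"

context
 fixes S :: "'s set" and R :: "('s \<Rightarrow>\<^sub>0 int) set"
 assumes R: "R <= carrier (free_Abelian_group S)"
begin

interpretation Fr: comm_group "free_Abelian_group S" by (rule abelian_free_Abelian_group)

lemma subgroup_rels: "subgroup (generate (free_Abelian_group S) R) (free_Abelian_group S)"
 using R by (rule Fr.generate_is_subgroup)

lemma normal_rels: "generate (free_Abelian_group S) R \<lhd> free_Abelian_group S"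
 using subgroup_rels by (simp add: Fr.normal_iff_subgroup)

lemma comm_group_presented: "comm_group (presented S R)"
 by (rule Fr.abelian_FactGroup[OF subgroup_rels])

lemma pgen_hom: "pgen S R : hom (free_Abelian_group S) (presented S R)"
 by (rule normal.r_coset_hom_Mod[OF normal_rels])

lemma pgen_rel: assumes "r : R" shows "pgen S R r = \<one>\<^bsub>presented S R\<^esub>"
 using Fr.coset_join2[OF subsetD[OF R assms] subgroup_rels generate.incl[OF assms]] by (simp add: one_FactGroup)

lemma carrier_presented:
 "carrier (presented S R) = generate (presented S R) ((%s. pgen S R (frag_of s)) ` S)" (is "_ = generate _ ?G")
proof -
 interpret P: comm_group "presented S R" by (rule comm_group_presented)
 interpret h: group_hom "free_Abelian_group S" "presented S R" "pgen S R"
  using pgen_hom by (simp add: group_hom_def group_hom_axioms_def P.is_group)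
 have G: "?G <= carrier (presented S R)" using h.hom_closed by auto
 have sub: "subgroup (generate (presented S R) ?G) (presented S R)" using P.generate_is_subgroup[OF G] .
 have "pgen S R u : generate (presented S R) ?G" if "keys u <= S" for u
 proof (rule free_Abelian_group_induct[OF that])
  show "pgen S R 0 : generate (presented S R) ?G" using subgroup.one_closed[OF sub] h.hom_one by simp
 next
  fix x y assume 2: "keys x <= S" "keys y <= S"
   "pgen S R x : generate (presented S R) ?G" "pgen S R y : generate (presented S R) ?G"
  have "pgen S R (x - y) = pgen S R x \<otimes>\<^bsub>presented S R\<^esub> inv\<^bsub>presented S R\<^esub> pgen S R y"
   using 2 h.hom_mult[of x "- y"] h.hom_inv[of y] by simp
  thus "pgen S R (x - y) : generate (presented S R) ?G"
   using 2 sub by (simp add: subgroup.m_closed subgroup.m_inv_closed)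
 next
  fix a assume "a : S"
  thus "pgen S R (frag_of a) : generate (presented S R) ?G" by (auto intro: generate.incl)
 qed
 hence "carrier (presented S R) <= generate (presented S R) ?G"
  by (auto simp: carrier_FactGroup)
 thus ?thesis using P.generate_in_carrier[OF G] by blast
qed

lemma presented_hom_exists:
 assumes B: "comm_group B" and v: "v : S \<rightarrow> carrier B"
  and rel: "ALL h:hom (free_Abelian_group S) B. (ALL s:S. h (frag_of s) = v s) \<longrightarrow> (ALL r:R. h r = \<one>\<^bsub>B\<^esub>)"
 shows "EX h:hom (presented S R) B. ALL s:S. h (pgen S R (frag_of s)) = v s"
proof -
 interpret B: comm_group B by (rule B)
 have "v ` S <= carrier B" using v by auto
 then obtain h where h: "h : hom (free_Abelian_group S) B" "!!s. s : S ==> h (frag_of s) = v s"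
  using B.free_Abelian_group_universal by metis
 interpret h: group_hom "free_Abelian_group S" B h
  using h(1) by (simp add: group_hom_def group_hom_axioms_def B.is_group)
 have one: "h r = \<one>\<^bsub>B\<^esub>" if "r : generate (free_Abelian_group S) R" for r
  using hom_eq_on_generate[OF Fr.is_group B.is_group h(1) _ R _ that, of "%_. \<one>\<^bsub>B\<^esub>"] rel h
  by (simp add: hom_def)
 have "h x = h y" if x: "x : carrier (free_Abelian_group S)" and y: "y : carrier (free_Abelian_group S)"
  and xy: "pgen S R x = pgen S R y" for x y
 proof -
  have "x : pgen S R y"
   using Fr.rcos_self[OF x subgroup_rels] xy by simp
  then obtain r where "r : generate (free_Abelian_group S) R" "x = r \<otimes>\<^bsub>free_Abelian_group S\<^esub> y"
   by (auto simp: r_coset_def)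
  thus ?thesis using one y h.hom_mult[of r y] Fr.generate_in_carrier[OF R]
   by (metis B.l_one h.hom_closed)
 qed
 then obtain g where "g : hom (presented S R) B"
  "!!x. x : carrier (free_Abelian_group S) ==> g (pgen S R x) = h x"
  using FactGroup_universal[OF h(1) normal_rels] by metis
 thus ?thesis using h(2) by (intro bexI[of _ g]) auto
qed

end

section \<open>Tensor products with the rational numbers\<close>

definition trels :: "('a, 'm) monoid_scheme => ('a \<times> rat \<Rightarrow>\<^sub>0 int) set" where
 "trels A = {frag_of (a \<otimes>\<^bsub>A\<^esub> a', b) - frag_of (a, b) - frag_of (a', b) | a a' b.
    a : carrier A & a' : carrier A & b : carrier rat_group} \<union>
   {frag_of (a, b \<otimes>\<^bsub>rat_group\<^esub> b') - frag_of (a, b) - frag_of (a, b') | a b b'.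
    a : carrier A & b : carrier rat_group & b' : carrier rat_group}"

abbreviation rt :: "('a, 'm) monoid_scheme => ('a \<times> rat \<Rightarrow>\<^sub>0 int) set monoid" where
 "rt A \<equiv> tensor A rat_group"

abbreviation pt :: "('a, 'm) monoid_scheme => 'a => rat => ('a \<times> rat \<Rightarrow>\<^sub>0 int) set" where
 "pt A \<equiv> pure_tensor A rat_group"

context
 fixes A :: "('a, 'm) monoid_scheme"
 assumes A: "comm_group A"
begin

interpretation A: comm_group A by (rule A)

lemma trels_carrier: "trels A <= carrier (free_Abelian_group (carrier A \<times> carrier rat_group))"
proof -
 have *: "frag_of x - frag_of y - frag_of z : carrier (free_Abelian_group (carrier A \<times> carrier rat_group))"
  if "x : carrier A \<times> carrier rat_group" "y : carrier A \<times> carrier rat_group" "z : carrier A \<times> carrier rat_group" for x y z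
  using that keys_diff[of "frag_of x - frag_of y" "frag_of z"] keys_diff[of "frag_of x" "frag_of y"]
  by auto
 show ?thesis unfolding trels_def by (auto simp del: carrier_free_Abelian_group_iff intro!: *[unfolded rat_group_simps])
qed

lemma rt_eq: "rt A = presented (carrier A \<times> carrier rat_group) (trels A)"
 unfolding tensor_def tensor_rels_def trels_def by simp

lemma pt_eq: "pt A a q = pgen (carrier A \<times> carrier rat_group) (trels A) (frag_of (a, q))"
 unfolding pure_tensor_def tensor_rels_def trels_def by simp

lemma comm_group_rt: "comm_group (rt A)"
 unfolding rt_eq by (rule comm_group_presented[OF trels_carrier])

interpretation T: comm_group "rt A" by (rule comm_group_rt)

lemma carrier_rt: "carrier (rt A) = generate (rt A) ((%(a, q). pt A a q) ` (carrier A \<times> UNIV))"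
 using carrier_presented[OF trels_carrier] unfolding rt_eq pt_eq
 by (auto simp: case_prod_beta)

lemma pt_closed: "a : carrier A ==> pt A a q : carrier (rt A)"
 unfolding carrier_rt by (rule generate.incl) auto

lemma pgen_hom_rt: "pgen (carrier A \<times> carrier rat_group) (trels A) : hom (free_Abelian_group (carrier A \<times> carrier rat_group)) (rt A)"
 unfolding rt_eq by (rule pgen_hom[OF trels_carrier])

lemma pt_add_aux:
 assumes "frag_of x - frag_of y - frag_of z : trels A"
  "x : carrier A \<times> UNIV" "y : carrier A \<times> UNIV" "z : carrier A \<times> UNIV"
 shows "pt A (fst x) (snd x) = pt A (fst y) (snd y) \<otimes>\<^bsub>rt A\<^esub> pt A (fst z) (snd z)"
proof -
 let ?S = "carrier A \<times> carrier rat_group"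
 interpret h: group_hom "free_Abelian_group ?S" "rt A" "pgen ?S (trels A)"
  using pgen_hom_rt by (simp add: group_hom_def group_hom_axioms_def T.is_group)
 let ?r = "frag_of x - frag_of y - frag_of z"
 have k: "keys ?r <= ?S" using subsetD[OF trels_carrier assms(1)] by simp
 have yz: "keys (frag_of y + frag_of z) <= ?S"
  using assms by (intro order_trans[OF keys_add]) auto
 have "pgen ?S (trels A) (?r + (frag_of y + frag_of z)) = pgen ?S (trels A) ?r \<otimes>\<^bsub>rt A\<^esub> pgen ?S (trels A) (frag_of y + frag_of z)"
  using h.hom_mult[of ?r "frag_of y + frag_of z"] k yz by simp
 also have "pgen ?S (trels A) ?r = \<one>\<^bsub>rt A\<^esub>"
  using pgen_rel[OF trels_carrier assms(1)] by (simp add: rt_eq)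
 also have "pgen ?S (trels A) (frag_of y + frag_of z) = pgen ?S (trels A) (frag_of y) \<otimes>\<^bsub>rt A\<^esub> pgen ?S (trels A) (frag_of z)"
  using h.hom_mult[of "frag_of y" "frag_of z"] assms by (simp add: case_prod_unfold)
 finally have "pgen ?S (trels A) (frag_of x) = pgen ?S (trels A) (frag_of y) \<otimes>\<^bsub>rt A\<^esub> pgen ?S (trels A) (frag_of z)"
  using assms h.hom_closed[of "frag_of y"] h.hom_closed[of "frag_of z"] T.l_one by (simp add: case_prod_unfold)
 thus ?thesis by (simp add: pt_eq)
qed

lemma pt_add_left: "a : carrier A ==> b : carrier A ==> pt A (a \<otimes>\<^bsub>A\<^esub> b) q = pt A a q \<otimes>\<^bsub>rt A\<^esub> pt A b q"
 by (rule pt_add_aux[of "(a \<otimes>\<^bsub>A\<^esub> b, q)" "(a, q)" "(b, q)", unfolded fst_conv snd_conv]) ((force simp: trels_def) | simp)+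

lemma pt_add_right: "a : carrier A ==> pt A a (q + r) = pt A a q \<otimes>\<^bsub>rt A\<^esub> pt A a r"
 by (rule pt_add_aux[of "(a, q + r)" "(a, q)" "(a, r)", unfolded fst_conv snd_conv]) ((force simp: trels_def) | simp)+

lemma pt_hom_right: "a : carrier A ==> pt A a : hom add_group (rt A)"
 by (auto simp: hom_def pt_closed pt_add_right)

lemma pt_hom_left: "(%a. pt A a q) : hom A (rt A)"
 by (auto simp: hom_def pt_closed pt_add_left)

lemma pt_zero: "a : carrier A ==> pt A a 0 = \<one>\<^bsub>rt A\<^esub>"
 using pt_hom_right T.is_group hom_one[of "pt A a" add_group "rt A"]
  comm_group.axioms(2)[OF comm_group_add_group] by auto

lemma pt_uminus: assumes "a : carrier A" shows "pt A a (- q) = inv\<^bsub>rt A\<^esub> pt A a q"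
 using T.inv_equality[of "pt A a (- q)" "pt A a q"] assms pt_add_right[OF assms, of "- q" q]
 by (simp add: pt_closed pt_zero)

lemma pt_inv: assumes "a : carrier A" shows "pt A (inv\<^bsub>A\<^esub> a) q = inv\<^bsub>rt A\<^esub> pt A a q"
 using hom_one[OF pt_hom_left[of q]] T.inv_equality[of "pt A (inv\<^bsub>A\<^esub> a) q" "pt A a q"] assms
  pt_add_left[of "inv\<^bsub>A\<^esub> a" a q] A.is_group T.is_group
 by (simp add: pt_closed)

lemma pt_one_left: "pt A \<one>\<^bsub>A\<^esub> q = \<one>\<^bsub>rt A\<^esub>"
 using hom_one[OF pt_hom_left[of q]] A.is_group T.is_group by simp

lemma pt_nat_pow: "a : carrier A ==> pt A (a [^]\<^bsub>A\<^esub> (n::nat)) q = pt A a (of_nat n * q)"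
proof (induction n)
 case (Suc n)
 thus ?case by (simp add: pt_add_left pt_add_right[symmetric] algebra_simps)
qed (simp add: pt_one_left pt_zero)

text \<open>Common denominators turn every tensor into a pure one.\<close>

lemma rt_pure:
 assumes "x : carrier (rt A)"
 shows "EX a:carrier A. EX n::nat. n > 0 & x = pt A a (1 / of_nat n)"
proof -
 have g: "x : generate (rt A) ((%(a, q). pt A a q) ` (carrier A \<times> UNIV))" using assms carrier_rt by simp
 have pq: "EX b:carrier A. EX n::nat. n > 0 & pt A a q = pt A b (1 / of_nat n)" if a: "a : carrier A" for a q
 proof -
  obtain m n where mn: "quotient_of q = (m, n)" by (cases "quotient_of q")
  hence n: "n > 0" and q: "q = of_int m / of_int n"
   using quotient_of_denom_pos quotient_of_div by auto
  have "n = int (nat n)" using n by simp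
  then obtain N where N: "n = int N" "N > 0" using n by (metis of_nat_0_less_iff)
  show ?thesis
  proof (cases "m \<ge> 0")
   case True
   then obtain k where "m = int k" using nonneg_int_cases by blast
   hence "pt A a q = pt A (a [^]\<^bsub>A\<^esub> k) (1 / of_nat N)" using a q N by (simp add: pt_nat_pow)
   thus ?thesis using N a by (meson A.nat_pow_closed)
  next
   case False
   then obtain k where k: "m = - int k" by (metis linear nonpos_int_cases)
   hence "pt A a q = pt A (inv\<^bsub>A\<^esub> (a [^]\<^bsub>A\<^esub> k)) (1 / of_nat N)"
    using a q N by (simp add: pt_inv pt_nat_pow pt_uminus[symmetric])
   thus ?thesis using N a by (meson A.nat_pow_closed A.inv_closed)
  qed
 qed
 show ?thesis using g
 proof (induction rule: generate.induct)
  case one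
  show ?case by (rule bexI[of _ "\<one>\<^bsub>A\<^esub>"], rule exI[of _ 1]) (auto simp: pt_one_left)
 next
  case (incl h) thus ?case using pq by auto
 next
  case (inv h)
  then obtain a q where "a : carrier A" "h = pt A a q" by auto
  thus ?case using pq[of a "- q"] by (simp add: pt_uminus)
 next
  case (eng h1 h2)
  then obtain a n b m where *: "a : carrier A" "b : carrier A" "n > 0" "m > (0::nat)"
   "h1 = pt A a (1 / of_nat n)" "h2 = pt A b (1 / of_nat m)" by blast
  have "h1 = pt A (a [^]\<^bsub>A\<^esub> m) (1 / of_nat (n * m))" "h2 = pt A (b [^]\<^bsub>A\<^esub> n) (1 / of_nat (n * m))"
   using * by (simp_all add: pt_nat_pow)
  hence "h1 \<otimes>\<^bsub>rt A\<^esub> h2 = pt A (a [^]\<^bsub>A\<^esub> m \<otimes>\<^bsub>A\<^esub> b [^]\<^bsub>A\<^esub> n) (1 / of_nat (n * m))"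
   using * by (simp add: pt_add_left)
  moreover have "n * m > 0" using * by simp
  ultimately show ?case using * by (meson A.m_closed A.nat_pow_closed)
 qed
qed

lemma rt_hom_exists:
 assumes B: "comm_group B" and b: "!!a q. a : carrier A ==> b a q : carrier B"
  and l: "!!a a' q. a : carrier A ==> a' : carrier A ==> b (a \<otimes>\<^bsub>A\<^esub> a') q = b a q \<otimes>\<^bsub>B\<^esub> b a' q"
  and r: "!!a q q'. a : carrier A ==> b a (q + q') = b a q \<otimes>\<^bsub>B\<^esub> b a q'"
 obtains h where "h : hom (rt A) B" "!!a q. a : carrier A ==> h (pt A a q) = b a q"
proof -
 interpret B: comm_group B by (rule B)
 let ?S = "carrier A \<times> carrier rat_group"
 interpret Fr: comm_group "free_Abelian_group ?S" by (rule abelian_free_Abelian_group)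
 have rel: "h u = \<one>\<^bsub>B\<^esub>"
  if h: "h : hom (free_Abelian_group ?S) B" "!!s. s : ?S ==> h (frag_of s) = (%(a, q). b a q) s"
   and u: "u : trels A" for h u
 proof -
  interpret h: group_hom "free_Abelian_group ?S" B h
   using h(1) by (simp add: group_hom_def group_hom_axioms_def B.is_group)
  have diff: "h (frag_of x - frag_of y - frag_of z) = h (frag_of x) \<otimes>\<^bsub>B\<^esub> inv\<^bsub>B\<^esub> (h (frag_of y) \<otimes>\<^bsub>B\<^esub> h (frag_of z))"
   if "x : ?S" "y : ?S" "z : ?S" for x y z
  proof -
   have k: "keys (frag_of y + frag_of z) <= ?S"
    using that by (intro order_trans[OF keys_add]) auto
   have "frag_of x - frag_of y - frag_of z = frag_of x \<otimes>\<^bsub>free_Abelian_group ?S\<^esub> inv\<^bsub>free_Abelian_group ?S\<^esub> (frag_of y + frag_of z)"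
    using k by (simp add: inv_free_Abelian_group)
   hence "h (frag_of x - frag_of y - frag_of z) = h (frag_of x) \<otimes>\<^bsub>B\<^esub> inv\<^bsub>B\<^esub> (h (frag_of y + frag_of z))"
    using that k h.hom_mult[of "frag_of x" "inv\<^bsub>free_Abelian_group ?S\<^esub> (frag_of y + frag_of z)"] h.hom_inv[of "frag_of y + frag_of z"]
    Fr.inv_closed[of "frag_of y + frag_of z"] unfolding carrier_free_Abelian_group_iff mult_free_Abelian_group by (metis frag_of_in_free_Abelian_group carrier_free_Abelian_group_iff)
   moreover have "h (frag_of y + frag_of z) = h (frag_of y) \<otimes>\<^bsub>B\<^esub> h (frag_of z)"
    using that h.hom_mult[of "frag_of y" "frag_of z"] by simp
   ultimately show ?thesis by simp
  qed
  from u show ?thesis unfolding trels_def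
  proof (elim UnE CollectE exE conjE)
   fix a a' q assume *: "u = frag_of (a \<otimes>\<^bsub>A\<^esub> a', q) - frag_of (a, q) - frag_of (a', q)"
    "a : carrier A" "a' : carrier A"
   thus ?thesis using diff[of "(a \<otimes>\<^bsub>A\<^esub> a', q)" "(a, q)" "(a', q)"] h(2) b l
    by (simp add: case_prod_unfold)
  next
   fix a q q' assume *: "u = frag_of (a, q \<otimes>\<^bsub>rat_group\<^esub> q') - frag_of (a, q) - frag_of (a, q')"
    "a : carrier A"
   thus ?thesis using diff[of "(a, q + q')" "(a, q)" "(a, q')"] h(2) b r
    by (simp add: case_prod_unfold)
  qed
 qed
 have "(%(a, q). b a q) : ?S \<rightarrow> carrier B" using b by auto
 from presented_hom_exists[OF trels_carrier B this] rel
 obtain h where "h : hom (presented ?S (trels A)) B"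
  "!!s. s : ?S ==> h (pgen ?S (trels A) (frag_of s)) = (%(a, q). b a q) s" by blast
 thus ?thesis using that[of h] by (simp add: rt_eq pt_eq)
qed

lemma rt_hom_eqI:
 assumes "group B" "h : hom (rt A) B" "k : hom (rt A) B" "x : carrier (rt A)"
  and "!!a n. a : carrier A ==> n > (0::nat) ==> h (pt A a (1 / of_nat n)) = k (pt A a (1 / of_nat n))"
 shows "h x = k x"
 using rt_pure[OF assms(4)] assms(5) by auto

end

lemma rat_map_spec:
 assumes A: "comm_group A" and B: "comm_group B" and f: "f : hom A B"
 shows "rat_map A B f : hom (rt A) (rt B)"
  and "!!a q. a : carrier A ==> rat_map A B f (pt A a q) = pt B (f a) q"
proof -
 interpret A: comm_group A by (rule A)
 interpret B: comm_group B by (rule B)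
 interpret TA: comm_group "rt A" by (rule comm_group_rt[OF A])
 interpret TB: comm_group "rt B" by (rule comm_group_rt[OF B])
 have c: "!!a. a : carrier A ==> f a : carrier B" using f by (auto simp: hom_def)
 obtain h where h: "h : hom (rt A) (rt B)" "!!a q. a : carrier A ==> h (pt A a q) = pt B (f a) q"
  by (rule rt_hom_exists[OF A comm_group_rt[OF B], of "%a q. pt B (f a) q"])
   (use c f in \<open>auto simp: pt_closed[OF B] pt_add_left[OF B] pt_add_right[OF B] hom_def\<close>)
 note sp = hom_on_spec[OF TA.is_group TB.is_group carrier_rt[OF A] _ h(1), of "%(a, q). pt B (f a) q"]
 show "rat_map A B f : hom (rt A) (rt B)"
  unfolding rat_map_def by (rule sp(1)) (auto simp: pt_closed[OF A] h(2))
 show "rat_map A B f (pt A a q) = pt B (f a) q" if "a : carrier A" for a q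
  unfolding rat_map_def using sp(3)[of "(a, q)"] that h(2) by (fastforce simp: pt_closed[OF A])
qed

section \<open>Groups generated by antisymmetric classes\<close>

locale antisym =
 fixes X :: "'x set" and r :: "'x rel" and rv :: "'x => 'x"
 assumes equiv: "equiv X r" and rv_in: "x : X ==> rv x : X"
begin

abbreviation "rels \<equiv> {frag_of (r `` {rv x}) + frag_of (r `` {x}) | x. x : X}"

lemma rels_carrier: "rels <= carrier (free_Abelian_group (X // r))"
proof (safe)
 fix x assume "x : X"
 hence "r `` {rv x} : X // r" "r `` {x} : X // r" using rv_in by (auto intro: quotientI)
 thus "frag_of (r `` {rv x}) + frag_of (r `` {x}) : carrier (free_Abelian_group (X // r))"
  using keys_add[of "frag_of (r `` {rv x})" "frag_of (r `` {x})"] by auto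
qed

lemma group_eq: "antisym_group X r rv = presented (X // r) rels"
 by (simp add: antisym_group_def antisym_rels_def)

lemma gen_eq: "antisym_gen X r rv x = pgen (X // r) rels (frag_of (r `` {x}))"
 by (simp add: antisym_gen_def antisym_rels_def)

lemma comm_group: "comm_group (antisym_group X r rv)"
 unfolding group_eq by (rule comm_group_presented[OF rels_carrier])

lemma carrier: "carrier (antisym_group X r rv) = generate (antisym_group X r rv) (antisym_gen X r rv ` X)"
proof -
 have "(%s. pgen (X // r) rels (frag_of s)) ` (X // r) = antisym_gen X r rv ` X"
  by (auto simp: gen_eq quotient_def)
 thus ?thesis using carrier_presented[OF rels_carrier] by (simp add: group_eq)
qed

lemma gen_closed: "x : X ==> antisym_gen X r rv x : carrier (antisym_group X r rv)"
 unfolding carrier by (rule generate.incl) auto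

lemma gen_cong: "(x, y) : r ==> antisym_gen X r rv x = antisym_gen X r rv y"
 using equiv_class_eq[OF equiv] by (simp add: gen_eq)

lemma gen_rv: assumes "x : X"
 shows "antisym_gen X r rv (rv x) = inv\<^bsub>antisym_group X r rv\<^esub> antisym_gen X r rv x"
proof -
 interpret G: comm_group "antisym_group X r rv" by (rule comm_group)
 interpret h: group_hom "free_Abelian_group (X // r)" "antisym_group X r rv" "pgen (X // r) rels"
  using pgen_hom[OF rels_carrier] by (simp add: group_hom_def group_hom_axioms_def G.is_group group_eq[symmetric])
 have "pgen (X // r) rels (frag_of (r `` {rv x}) + frag_of (r `` {x})) = \<one>\<^bsub>antisym_group X r rv\<^esub>"
  unfolding group_eq by (rule pgen_rel[OF rels_carrier]) (use assms in auto)
 hence "antisym_gen X r rv (rv x) \<otimes>\<^bsub>antisym_group X r rv\<^esub> antisym_gen X r rv x = \<one>\<^bsub>antisym_group X r rv\<^esub>"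
  using h.hom_mult[of "frag_of (r `` {rv x})" "frag_of (r `` {x})"] assms rv_in
  by (simp add: gen_eq quotientI)
 thus ?thesis using G.inv_equality assms rv_in gen_closed by metis
qed

lemma hom_exists:
 assumes B: "comm_group B" and v: "!!x. x : X ==> v x : carrier B"
  and cong: "!!x y. (x, y) : r ==> v x = v y" and anti: "!!x. x : X ==> v (rv x) = inv\<^bsub>B\<^esub> v x"
 obtains h where "h : hom (antisym_group X r rv) B" "!!x. x : X ==> h (antisym_gen X r rv x) = v x"
proof -
 interpret B: comm_group B by (rule B)
 define w where "w c = v (SOME x. x : c)" for c
 have w: "w (r `` {x}) = v x" if "x : X" for x
 proof -
  have "x : r `` {x}" using equiv that by (rule equiv_class_self)
  hence "(SOME y. y : r `` {x}) : r `` {x}" by (rule someI)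
  thus ?thesis using cong by (auto simp: w_def)
 qed
 have wc: "w : X // r \<rightarrow> carrier B" using w v by (auto simp: quotient_def)
 have rel: "h u = \<one>\<^bsub>B\<^esub>" if h: "h : hom (free_Abelian_group (X // r)) B"
  "!!s. s : X // r ==> h (frag_of s) = w s" and u: "u : rels" for h u
 proof -
  from u obtain x where x: "x : X" and u: "u = frag_of (r `` {rv x}) + frag_of (r `` {x})" by auto
  interpret h: group_hom "free_Abelian_group (X // r)" B h
   using h(1) by (simp add: group_hom_def group_hom_axioms_def B.is_group)
  show ?thesis using h.hom_mult[of "frag_of (r `` {rv x})" "frag_of (r `` {x})"] x u rv_in h(2) w v anti
   by (simp add: quotientI)
 qed
 obtain h where "h : hom (presented (X // r) rels) B" "!!s. s : X // r ==> h (pgen (X // r) rels (frag_of s)) = w s"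
  using presented_hom_exists[OF rels_carrier B wc] rel by blast
 thus ?thesis using that[of h] w by (simp add: group_eq gen_eq quotientI)
qed

lemma hom_on:
 assumes B: "comm_group B" and v: "!!x. x : X ==> v x : carrier B"
  and cong: "!!x y. (x, y) : r ==> v x = v y" and anti: "!!x. x : X ==> v (rv x) = inv\<^bsub>B\<^esub> v x"
 shows "hom_on (antisym_group X r rv) B X (antisym_gen X r rv) v : hom (antisym_group X r rv) B"
  and "!!x. x : X ==> hom_on (antisym_group X r rv) B X (antisym_gen X r rv) v (antisym_gen X r rv x) = v x"
proof -
 obtain h where h: "h : hom (antisym_group X r rv) B" "!!x. x : X ==> h (antisym_gen X r rv x) = v x"
  using hom_exists[where v = v, OF B v cong anti] by blast
 have c: "antisym_gen X r rv ` X <= carrier (antisym_group X r rv)" using gen_closed by auto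
 note sp = hom_on_spec[OF comm_group.axioms(2)[OF comm_group] comm_group.axioms(2)[OF B] carrier c h]
 show "hom_on (antisym_group X r rv) B X (antisym_gen X r rv) v : hom (antisym_group X r rv) B"
  using sp by simp
 show "hom_on (antisym_group X r rv) B X (antisym_gen X r rv) v (antisym_gen X r rv x) = v x" if "x : X" for x
  using sp that by simp
qed

lemma hom_eq:
 assumes "group B" "h : hom (antisym_group X r rv) B" "k : hom (antisym_group X r rv) B"
  and "!!x. x : X ==> h (antisym_gen X r rv x) = k (antisym_gen X r rv x)"
  and "u : carrier (antisym_group X r rv)"
 shows "h u = k u"
 by (rule hom_eq_on_generate[where h = h and k = k, OF comm_group.axioms(2)[OF comm_group] assms(1-3), of "antisym_gen X r rv ` X"])
  (use assms gen_closed carrier in auto)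

end

text \<open>
 A product over equivalence classes, each term being the value at a chosen representative, does
 not change under a map that matches the classes and the values.
\<close>

lemma finprod_classes_transfer:
 assumes B: "comm_group B" and r: "equiv X r" "equiv X' r'"
  and t: "!!z. z : X ==> t z : X'"
  and iff: "!!z w. z : X ==> w : X ==> (z, w) : r \<longleftrightarrow> (t z, t w) : r'"
  and surj: "!!w. w : X' ==> EX z:X. (t z, w) : r'"
  and P: "!!z. z : X ==> P' (t z) = P z"
  and c: "!!z. z : X' ==> P' z : carrier B"
  and inv': "!!z w. (z, w) : r' ==> P' z = P' w"
 shows "finprod B (%c. P' (SOME z. z : c)) (X' // r') = finprod B (%c. P (SOME z. z : c)) (X // r)"
proof -
 interpret B: comm_group B by (rule B)
 define T where "T c = r' `` {t (SOME z. z : c)}" for c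
 have rep: "(SOME z. z : c) : X" "c = r `` {SOME z. z : c}" if "c : X // r" for c
 proof -
  obtain x where "x : X" "c = r `` {x}" using \<open>c : X // r\<close> by (auto simp: quotient_def)
  hence "x : c" using equiv_class_self[OF r(1)] by simp
  hence s: "(SOME z. z : c) : c" by (rule someI)
  hence "(x, SOME z. z : c) : r" using \<open>c = _\<close> by auto
  thus "c = r `` {SOME z. z : c}" using \<open>c = _\<close> equiv_class_eq[OF r(1)] by blast
  show "(SOME z. z : c) : X" using \<open>(x, _) : r\<close> r(1) by (auto simp: equiv_def refl_on_def)
 qed
 have rep': "(SOME z. z : r' `` {w}, w) : r'" if "w : X'" for w
 proof -
  have "w : r' `` {w}" using equiv_class_self[OF r(2) that] .
  hence "(SOME z. z : r' `` {w}) : r' `` {w}" by (rule someI)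
  thus ?thesis using r(2) by (auto simp: equiv_def sym_def)
 qed
 have inj: "inj_on T (X // r)"
 proof (rule inj_onI)
  fix c d assume cd: "c : X // r" "d : X // r" "T c = T d"
  hence "(t (SOME z. z : c), t (SOME z. z : d)) : r'"
   using eq_equiv_class[OF _ r(2)] t rep(1) unfolding T_def by metis
  hence "(SOME z. z : c, SOME z. z : d) : r" using iff rep(1) cd by blast
  thus "c = d" using rep(2) cd equiv_class_eq[OF r(1)] by metis
 qed
 have img: "T ` (X // r) = X' // r'"
 proof
  show "T ` (X // r) <= X' // r'" using rep t by (auto simp: T_def intro!: quotientI)
  show "X' // r' <= T ` (X // r)"
  proof
   fix c' assume "c' : X' // r'"
   then obtain w where w: "w : X'" "c' = r' `` {w}" by (auto simp: quotient_def)
   then obtain z where z: "z : X" "(t z, w) : r'" using surj by blast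
   have "r `` {z} : X // r" using z by (auto intro: quotientI)
   from rep[OF this] have "(z, SOME y. y : r `` {z}) : r" "(SOME y. y : r `` {z}) : X"
    using eq_equiv_class[OF _ r(1)] z by metis+
   hence "(t z, t (SOME y. y : r `` {z})) : r'" using iff z by blast
   hence "T (r `` {z}) = c'" using w z equiv_class_eq[OF r(2)] unfolding T_def by metis
   thus "c' : T ` (X // r)" using \<open>r `` {z} : X // r\<close> by auto
  qed
 qed
 have "finprod B (%c. P' (SOME z. z : c)) (X' // r') = finprod B (%c. P' (SOME z. z : T c)) (X // r)"
  unfolding img[symmetric]
 proof (rule B.finprod_reindex[OF _ inj])
  show "(%c. P' (SOME z. z : c)) : T ` (X // r) \<rightarrow> carrier B"
  proof
   fix c' assume "c' : T ` (X // r)"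
   then obtain w where "w : X'" "c' = r' `` {w}" using img by (auto simp: quotient_def)
   thus "P' (SOME z. z : c') : carrier B" using rep' inv' c by metis
  qed
 qed
 also have "... = finprod B (%c. P (SOME z. z : c)) (X // r)"
 proof (rule B.finprod_cong')
  show "(%c. P (SOME z. z : c)) : X // r \<rightarrow> carrier B"
  proof
   fix c0 assume "c0 : X // r"
   hence "(SOME z. z : c0) : X" by (rule rep)
   thus "P (SOME z. z : c0) : carrier B" using P t c by metis
  qed
  fix c0 assume "c0 : X // r"
  hence *: "(SOME z. z : c0) : X" by (rule rep)
  show "P' (SOME z. z : T c0) = P (SOME z. z : c0)"
   using inv'[OF rep'[OF t[OF *]]] P[OF *] unfolding T_def by simp
 qed simp
 finally show ?thesis .
qed

section \<open>Orientations as parities of words\<close>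

definition basis_change :: "'a::real_vector list => 'a list => real mat => bool" where
 "basis_change bs cs A \<longleftrightarrow> length cs = length bs & A : carrier_mat (length bs) (length bs) \<and>
  (ALL j<length bs. cs ! j = (\<Sum>i<length bs. A $$ (i, j) *\<^sub>R bs ! i))"

lemma basis_change_trans:
 assumes "basis_change bs cs A" "basis_change cs ds C"
 shows "basis_change bs ds (A * C)"
proof -
 let ?n = "length bs"
 have A: "A : carrier_mat ?n ?n" and C: "C : carrier_mat ?n ?n" and l: "length cs = ?n" "length ds = ?n"
  using assms by (auto simp: basis_change_def)
 have "ds ! j = (\<Sum>i<?n. (A * C) $$ (i, j) *\<^sub>R bs ! i)" if j: "j < ?n" for j
 proof -
  have "ds ! j = (\<Sum>k<?n. C $$ (k, j) *\<^sub>R (\<Sum>i<?n. A $$ (i, k) *\<^sub>R bs ! i))"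
   using assms j l by (auto simp: basis_change_def intro!: sum.cong)
  also have "... = (\<Sum>k<?n. \<Sum>i<?n. (A $$ (i, k) * C $$ (k, j)) *\<^sub>R bs ! i)"
   by (simp add: scaleR_sum_right mult.commute)
  also have "... = (\<Sum>i<?n. \<Sum>k<?n. (A $$ (i, k) * C $$ (k, j)) *\<^sub>R bs ! i)" by (rule sum.swap)
  also have "... = (\<Sum>i<?n. (A * C) $$ (i, j) *\<^sub>R bs ! i)"
   using A C j by (intro sum.cong refl)
    (auto simp: scalar_prod_def scaleR_sum_left[symmetric] atLeast0LessThan)
  finally show ?thesis .
 qed
 thus ?thesis using A C l by (auto simp: basis_change_def)
qed

lemma basis_change_refl: "basis_change bs bs (1\<^sub>m (length bs))"
proof -
 have "(\<Sum>i<length bs. (1\<^sub>m (length bs) $$ (i, j)) *\<^sub>R bs ! i) = bs ! j" if "j < length bs" for j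
 proof -
  have "(\<Sum>i<length bs. (1\<^sub>m (length bs) $$ (i, j)) *\<^sub>R bs ! i) = (\<Sum>i<length bs. if i = j then bs ! i else 0)"
   using that by (intro sum.cong) auto
  thus ?thesis using that by simp
 qed
 thus ?thesis by (auto simp: basis_change_def)
qed

lemma basis_change_unique:
 assumes "distinct bs" "independent (set bs)" "basis_change bs cs A" "basis_change bs cs A'"
 shows "A = A'"
proof (rule eq_matI)
 let ?n = "length bs"
 show "dim_row A = dim_row A'" "dim_col A = dim_col A'" using assms by (auto simp: basis_change_def)
 fix i j assume "i < dim_row A'" "j < dim_col A'"
 hence ij: "i < ?n" "j < ?n" using assms by (auto simp: basis_change_def)
 define u where "u v = A $$ (the_inv_into {..<?n} ((!) bs) v, j) - A' $$ (the_inv_into {..<?n} ((!) bs) v, j)" for v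
 have bij: "bij_betw ((!) bs) {..<?n} (set bs)" using assms(1) by (rule bij_betw_nth) auto
 have inv: "the_inv_into {..<?n} ((!) bs) (bs ! k) = k" if "k < ?n" for k
  using that bij by (auto simp: bij_betw_def the_inv_into_f_f)
 have "(SUM v:set bs. u v *\<^sub>R v) = (\<Sum>k<?n. u (bs ! k) *\<^sub>R bs ! k)"
  by (rule sum.reindex_bij_betw[OF bij, symmetric])
 also have "... = (\<Sum>k<?n. A $$ (k, j) *\<^sub>R bs ! k) - (\<Sum>k<?n. A' $$ (k, j) *\<^sub>R bs ! k)"
  by (simp add: u_def inv scaleR_diff_left sum_subtractf)
 also have "... = 0" using assms(3,4) ij by (auto simp: basis_change_def)
 finally have "(SUM v:set bs. u v *\<^sub>R v) = 0" .
 hence "u (bs ! i) = 0"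
  using real_vector.independentD[OF assms(2) _ subset_refl, of u "bs ! i"] ij by simp
 thus "A $$ (i, j) = A' $$ (i, j)" using ij by (simp add: u_def inv)
qed

context
 fixes B :: "'b set"
 assumes fin: "finite B"
begin

lemma ordered_bases_length:
 assumes "bs : ordered_bases B" "cs : ordered_bases B"
 shows "length cs = length bs"
proof -
 have "length ds = real_vector.dim (span (unit_vec ` B) :: ('b \<Rightarrow>\<^sub>0 real) set)" if "ds : ordered_bases B" for ds
 proof -
  have ds: "distinct ds" "independent (set ds)" "span (set ds) = span (unit_vec ` B)"
   using that unfolding ordered_bases_def by blast+
  have "card (set ds) = real_vector.dim (span (set ds))"
   by (rule real_vector.basis_card_eq_dim[OF real_vector.span_superset subset_refl ds(2)])
  thus ?thesis using distinct_card[OF ds(1)] unfolding ds(3) by metis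
 qed
 thus ?thesis using assms by metis
qed

lemma basis_change_exists:
 assumes "bs : ordered_bases B" "cs : ordered_bases B"
 shows "EX A. basis_change bs cs A"
proof -
 let ?n = "length bs"
 let ?A = "mat ?n ?n (%(i, j). real_vector.representation (set bs) (cs ! j) (bs ! i))"
 have d: "distinct bs" and ind: "independent (set bs)" and sp: "span (set bs) = span (set cs)"
  using assms by (auto simp: ordered_bases_def)
 have bij: "bij_betw ((!) bs) {..<?n} (set bs)" using d by (rule bij_betw_nth) auto
 have "cs ! j = (\<Sum>i<?n. ?A $$ (i, j) *\<^sub>R bs ! i)" if "j < ?n" for j
 proof -
  have "cs ! j : span (set bs)"
   using that ordered_bases_length[OF assms] sp by (simp add: real_vector.span_base)
  hence "cs ! j = (SUM b:set bs. real_vector.representation (set bs) (cs ! j) b *\<^sub>R b)"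
   using real_vector.sum_representation_eq[OF ind, of "cs ! j" "set bs"] by simp
  also have "... = (\<Sum>i<?n. real_vector.representation (set bs) (cs ! j) (bs ! i) *\<^sub>R bs ! i)"
   by (rule sum.reindex_bij_betw[OF bij, symmetric])
  finally show ?thesis using that by simp
 qed
 thus ?thesis using ordered_bases_length[OF assms] by (intro exI[of _ ?A]) (auto simp: basis_change_def)
qed

definition change_det :: "('b \<Rightarrow>\<^sub>0 real) list => ('b \<Rightarrow>\<^sub>0 real) list => real" where
 "change_det bs cs = Determinant.det (SOME A. basis_change bs cs A)"

lemma change_det_eq:
 assumes "bs : ordered_bases B" "basis_change bs cs A"
 shows "change_det bs cs = Determinant.det A"
proof -
 have "basis_change bs cs (SOME A. basis_change bs cs A)" using assms(2) by (rule someI)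
 thus ?thesis using basis_change_unique[of bs cs] assms unfolding change_det_def ordered_bases_def by blast
qed

lemma change_det_mult:
 assumes "bs : ordered_bases B" "cs : ordered_bases B" "ds : ordered_bases B"
 shows "change_det bs ds = change_det bs cs * change_det cs ds"
proof -
 obtain A C where AC: "basis_change bs cs A" "basis_change cs ds C"
  using assms basis_change_exists by blast
 have "A : carrier_mat (length bs) (length bs)" "C : carrier_mat (length bs) (length bs)"
  using AC by (auto simp: basis_change_def)
 hence "Determinant.det (A * C) = Determinant.det A * Determinant.det C" by (rule det_mult)
 thus ?thesis
  using change_det_eq[OF assms(1) basis_change_trans[OF AC]] change_det_eq[OF assms(1) AC(1)]
   change_det_eq[OF assms(2) AC(2)] by simp
qed

lemma change_det_refl: "bs : ordered_bases B ==> change_det bs bs = 1"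
 by (simp add: change_det_eq[OF _ basis_change_refl])

lemma change_det_nonzero:
 assumes "bs : ordered_bases B" "cs : ordered_bases B" shows "change_det bs cs ~= 0"
 using change_det_mult[OF assms assms(1)] change_det_refl[OF assms(1)] by auto

lemma mem_orientation_class:
 assumes "bs : ordered_bases B" "cs : ordered_bases B"
 shows "cs : orientation_class B bs \<longleftrightarrow> change_det bs cs > 0"
proof
 assume "cs : orientation_class B bs"
 then obtain A where "basis_change bs cs A" "Determinant.det A > 0"
  by (auto simp: orientation_class_def same_orientation_def basis_change_def)
 thus "change_det bs cs > 0" using change_det_eq[OF assms(1)] by metis
next
 obtain A where A: "basis_change bs cs A" using assms basis_change_exists by blast
 assume "change_det bs cs > 0"
 hence "Determinant.det A > 0" using change_det_eq[OF assms(1) A] by simp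
 thus "cs : orientation_class B bs" using A assms
  by (auto simp: orientation_class_def same_orientation_def basis_change_def)
qed

lemma orientation_class_pos:
 assumes "bs : ordered_bases B" "cs : ordered_bases B" "change_det bs cs > 0"
 shows "orientation_class B cs = orientation_class B bs"
proof (rule Set.set_eqI)
 fix ds
 show "ds : orientation_class B cs \<longleftrightarrow> ds : orientation_class B bs"
 proof (cases "ds : ordered_bases B")
  case True
  thus ?thesis using assms mem_orientation_class[of _ ds] change_det_mult[of bs cs ds]
   by (simp add: zero_less_mult_iff)
 qed (auto simp: orientation_class_def)
qed

lemma orientation_class_neg:
 assumes "bs : ordered_bases B" "cs : ordered_bases B" "change_det bs cs < 0"
 shows "orientation_class B cs = ordered_bases B - orientation_class B bs"
proof (rule Set.set_eqI)
 fix ds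
 show "ds : orientation_class B cs \<longleftrightarrow> ds : ordered_bases B - orientation_class B bs"
 proof (cases "ds : ordered_bases B")
  case True
  thus ?thesis using assms mem_orientation_class[of _ ds] change_det_mult[of bs cs ds]
    change_det_nonzero[of cs ds]
   by (auto simp: zero_less_mult_iff)
 qed (auto simp: orientation_class_def)
qed

lemma orientation_dichotomy:
 assumes "\<omega> : orientations B" "bs : ordered_bases B"
 shows "\<omega> = orientation_class B bs \<or> \<omega> = ordered_bases B - orientation_class B bs"
proof -
 obtain cs where cs: "cs : ordered_bases B" "\<omega> = orientation_class B cs"
  using assms(1) by (auto simp: orientations_def)
 show ?thesis
  using orientation_class_pos[OF assms(2) cs(1)] orientation_class_neg[OF assms(2) cs(1)]
   change_det_nonzero[OF assms(2) cs(1)] cs(2) by (metis linorder_neqE_linordered_idom)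
qed

lemma self_in_orientation_class: "bs : ordered_bases B ==> bs : orientation_class B bs"
 using mem_orientation_class change_det_refl by simp

end

lemma lookup_scaleR: "lookup (r *\<^sub>R f) x = r *\<^sub>R lookup f x"
 by (simp add: scaleR_poly_mapping.rep_eq)

lemma inj_unit_vec: "inj unit_vec"
 by (rule injI) (metis lookup_single_eq lookup_single_not_eq unit_vec_def zero_neq_one)

lemma word_ordered_basis:
 assumes "distinct w"
 shows "map unit_vec w : ordered_bases (set w)"
proof -
 have "independent (unit_vec ` set w :: ('a \<Rightarrow>\<^sub>0 real) set)"
 proof (rule real_vector.independent_if_scalars_zero)
  fix f x assume s: "(SUM x:unit_vec ` set w. f x *\<^sub>R x) = (0 :: 'a \<Rightarrow>\<^sub>0 real)" and "x : unit_vec ` set w"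
  then obtain b where b: "b : set w" "x = unit_vec b" by auto
  have "0 = lookup (SUM c:set w. f (unit_vec c) *\<^sub>R unit_vec c) b"
   using s by (subst (asm) sum.reindex) (auto intro: inj_on_subset[OF inj_unit_vec])
  also have "... = (SUM c:set w. if c = b then f (unit_vec c) else 0)"
   unfolding lookup_sum by (rule sum.cong) (auto simp: lookup_scaleR unit_vec_def lookup_single when_def)
  finally show "f x = 0" using b by simp
 qed auto
 thus ?thesis using assms
  by (auto simp: ordered_bases_def distinct_map intro: inj_on_subset[OF inj_unit_vec])
qed

lemma change_det_swap:
 assumes d: "distinct (p @ x # y # q)"
 shows "change_det (map unit_vec (p @ x # y # q)) (map unit_vec (p @ y # x # q)) = - 1"
proof -
 let ?bs = "map unit_vec (p @ x # y # q) :: ('a \<Rightarrow>\<^sub>0 real) list"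
 let ?cs = "map unit_vec (p @ y # x # q) :: ('a \<Rightarrow>\<^sub>0 real) list"
 let ?n = "length ?bs" and ?k = "length p" and ?l = "Suc (length p)"
 let ?A = "swaprows_mat ?n ?k ?l :: real mat"
 have kl: "?k < ?n" "?l < ?n" "?k ~= ?l" by auto
 have "?cs ! j = (\<Sum>i<?n. ?A $$ (i, j) *\<^sub>R ?bs ! i)" if j: "j < ?n" for j
 proof -
  define j' where "j' = (if j = ?k then ?l else if j = ?l then ?k else j)"
  have "(\<Sum>i<?n. ?A $$ (i, j) *\<^sub>R ?bs ! i) = (\<Sum>i<?n. if i = j' then ?bs ! i else 0)"
   using j kl by (intro sum.cong) (auto simp: j'_def)
  also have "... = ?bs ! j'" using j kl by (auto simp: j'_def)
  also have "... = ?cs ! j"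
   using j by (auto simp: j'_def nth_append nth_Cons split: nat.splits)
  finally show ?thesis by simp
 qed
 hence "basis_change ?bs ?cs ?A" by (auto simp: basis_change_def)
 hence "change_det ?bs ?cs = Determinant.det ?A"
  by (intro change_det_eq[OF _ word_ordered_basis[OF d]]) auto
 also have "... = - 1" by (rule det_swaprows_mat[OF kl])
 finally show ?thesis .
qed

text \<open>
 \<open>rearr xs ys b\<close>: the list \<open>ys\<close> arises from \<open>xs\<close> by adjacent transpositions, an odd number of
 them iff \<open>b\<close>. For lists with repetitions both parities are possible; for words of an oriented
 graph the parity is detected by the orientation.
\<close>

inductive rearr :: "'a list => 'a list => bool => bool" where
 rearr_refl: "rearr xs xs False"
| rearr_swap: "rearr xs (p @ x # y # q) b ==> rearr xs (p @ y # x # q) (\<not> b)"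

lemma rearr_trans: "rearr ys zs c ==> rearr xs ys b ==> rearr xs zs (b ~= c)"
proof (induction rule: rearr.induct)
 case (rearr_swap ys p x y q c)
 thus ?case using rearr.rearr_swap[of xs p x y q "b ~= c"] by (cases b; cases c) auto
qed simp

lemma rearr_swap1: "rearr (p @ x # y # q) (p @ y # x # q) True"
 using rearr.rearr_swap[OF rearr_refl, of p x y q] by simp

lemma rearr_sym: "rearr xs ys b ==> rearr ys xs b"
proof (induction rule: rearr.induct)
 case (rearr_swap xs p x y q b)
 thus ?case using rearr_trans[OF rearr_swap.IH rearr_swap1[of p y x q]] by (cases b) auto
qed (rule rearr_refl)

lemma rearr_ctxt: "rearr xs ys b ==> rearr (u @ xs @ v) (u @ ys @ v) b"
proof (induction rule: rearr.induct)
 case (rearr_swap xs p x y q b)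
 thus ?case using rearr.rearr_swap[of "u @ xs @ v" "u @ p" x y "q @ v" b] by simp
qed (rule rearr_refl)

lemma rearr_append: "rearr xs ys b ==> rearr us vs c ==> rearr (xs @ us) (ys @ vs) (b ~= c)"
 using rearr_trans[of "ys @ us" "ys @ vs" c "xs @ us" b] rearr_ctxt[of us vs c ys "[]"] rearr_ctxt[of xs ys b "[]" us] by simp

lemma rearr_Cons: "rearr xs ys b ==> rearr (x # xs) (x # ys) b"
 using rearr_ctxt[of xs ys b "[x]" "[]"] by simp

lemma rearr_map: "rearr xs ys b ==> rearr (map f xs) (map f ys) b"
proof (induction rule: rearr.induct)
 case (rearr_swap xs p x y q b)
 thus ?case using rearr.rearr_swap[of "map f xs" "map f p" "f x" "f y" "map f q" b] by simp
qed (rule rearr_refl)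

lemma rearr_front: "rearr (p @ x # q) (x # p @ q) (odd (length p))"
proof (induction p)
 case (Cons a p)
 have "rearr (a # p @ x # q) (a # x # p @ q) (odd (length p))" using rearr_Cons[OF Cons] by simp
 from rearr.rearr_swap[of _ "[]" a x "p @ q", simplified, OF this] show ?case by simp
qed (simp add: rearr_refl)

lemma rearr_blocks: "rearr (u @ v) (v @ u) (odd (length u * length v))"
proof (induction v arbitrary: u)
 case (Cons x v)
 have 1: "rearr (u @ x # v) (x # u @ v) (odd (length u))" by (rule rearr_front)
 have 2: "rearr (x # u @ v) (x # v @ u) (odd (length u * length v))" by (rule rearr_Cons[OF Cons])
 show ?case using rearr_trans[OF 2 1] by (cases "odd (length u)"; cases "odd (length v)") auto
qed (simp add: rearr_refl)

lemma rearr_exists: "mset ys = mset xs ==> EX b. rearr xs ys b"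
proof (induction xs arbitrary: ys)
 case Nil
 thus ?case by (auto intro: rearr_refl)
next
 case (Cons x xs)
 hence "x : set ys" by (metis list.set_intros(1) set_mset_mset)
 then obtain p q where ys: "ys = p @ x # q" by (auto simp: in_set_conv_decomp)
 hence "mset (p @ q) = mset xs" using Cons.prems by simp
 then obtain b where b: "rearr xs (p @ q) b" using Cons.IH by blast
 from rearr_trans[OF rearr_sym[OF rearr_front] rearr_Cons[OF b]] ys show ?case by blast
qed

lemma rearr_exists_set: "distinct xs ==> distinct ys ==> set xs = set ys ==> EX b. rearr xs ys b"
 by (metis rearr_exists set_eq_iff_mset_eq_distinct)

definition flip :: "'h ribbon => bool => 'h orient => 'h orient" where
 "flip G b \<omega> = (if b then ordered_bases (cells G) - \<omega> else \<omega>)"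

lemma flip_False [simp]: "flip G False \<omega> = \<omega>" by (simp add: flip_def)

lemma orev_flip: "orev x = (fst x, flip (fst x) True (snd x))"
 by (simp add: orev_def flip_def)

lemma word_orient_cases:
 assumes "is_word G w" "\<omega> : orientations (cells G)"
 shows "EX b. \<omega> = flip G b (word_orient G w)"
proof -
 have f: "finite (cells G)" using assms(1) unfolding is_word_def by (metis List.finite_set)
 have "map unit_vec w : ordered_bases (cells G)"
  using assms word_ordered_basis[of w] by (auto simp: is_word_def)
 from orientation_dichotomy[OF f assms(2) this] show ?thesis
  by (auto simp: flip_def word_orient_def intro: exI[of _ True] exI[of _ False])
qed

lemma flip_flip:
 assumes "\<omega> <= ordered_bases (cells G)" shows "flip G b (flip G c \<omega>) = flip G (b ~= c) \<omega>"
 using assms by (auto simp: flip_def)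

lemma word_orient_subset: "word_orient G w <= ordered_bases (cells G)"
 by (auto simp: word_orient_def orientation_class_def)

lemma orientations_subset: "\<omega> : orientations (cells G) ==> \<omega> <= ordered_bases (cells G)"
 by (auto simp: orientations_def orientation_class_def)

text \<open>A transposition of two letters is a change of basis of determinant \<open>-1\<close>.\<close>

lemma word_orient_rearr:
 assumes "rearr w w' b" "is_word G w"
 shows "is_word G w' & word_orient G w' = flip G b (word_orient G w)"
 using assms
proof (induction rule: rearr.induct)
 case (rearr_swap xs p x y q b)
 let ?u = "p @ x # y # q" and ?u' = "p @ y # x # q"
 have w: "is_word G ?u" "word_orient G ?u = flip G b (word_orient G xs)" using rearr_swap by auto
 hence d: "distinct ?u" and s: "set ?u = cells G" by (auto simp: is_word_def)
 hence d': "distinct ?u'" and s': "set ?u' = cells G" by auto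
 have f: "finite (cells G)" using s by (metis List.finite_set)
 have "word_orient G ?u' = flip G True (word_orient G ?u)"
  unfolding word_orient_def flip_def
  using orientation_class_neg[OF f, of "map unit_vec ?u" "map unit_vec ?u'"]
   word_ordered_basis[OF d] word_ordered_basis[OF d'] change_det_swap[OF d] s s' by simp
 also have "... = flip G (\<not> b) (word_orient G xs)"
  unfolding w(2) by (cases b) (simp_all add: flip_flip[OF word_orient_subset])
 finally show ?case using d' s' by (simp add: is_word_def)
qed simp

lemma word_orient_in: "is_word G w ==> word_orient G w : orientations (cells G)"
 using word_ordered_basis[of w] by (auto simp: is_word_def word_orient_def orientations_def)

lemma word_orient_flip_inj:
 assumes "is_word G w" "flip G b (word_orient G w) = flip G c (word_orient G w)"
 shows "b = c"
proof -
 have f: "finite (cells G)" using assms(1) unfolding is_word_def by (metis List.finite_set)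
 have o: "map unit_vec w : ordered_bases (cells G)"
  using assms word_ordered_basis[of w] by (auto simp: is_word_def)
 have "map unit_vec w : word_orient G w"
  unfolding word_orient_def by (rule self_in_orientation_class[OF f o])
 thus ?thesis using assms(2) o by (cases b; cases c) (auto simp: flip_def)
qed

text \<open>A word with two letters can be rearranged by a transposition, which gives a basis in the other class.\<close>

lemma flip_in_orientations:
 assumes w: "is_word G w" "length w \<ge> 2" and \<omega>: "\<omega> : orientations (cells G)"
 shows "flip G b \<omega> : orientations (cells G)"
proof -
 obtain x y q where xy: "w = x # y # q" using w(2) by (cases w rule: remdups_adj.cases) auto
 have r: "rearr (x # y # q) (y # x # q) True" using rearr_swap1[of "[]" x y q] by simp
 have T: "is_word G (y # x # q)" "word_orient G (y # x # q) = flip G True (word_orient G w)"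
  using word_orient_rearr[OF r] w xy by auto
 have all: "flip G c (word_orient G w) : orientations (cells G)" for c
  using word_orient_in[OF w(1)] word_orient_in[OF T(1)] T(2) by (cases c) auto
 obtain c where "\<omega> = flip G c (word_orient G w)" using word_orient_cases[OF w(1) \<omega>] by blast
 thus ?thesis using all by (simp add: flip_flip[OF word_orient_subset])
qed

section \<open>Collapsing an edge of a ribbon graph\<close>

context
 fixes G :: "'h ribbon"
 assumes G: "ribbon_graph G"
begin

lemma finite_halves: "finite (halves G)" using G by (simp add: ribbon_graph_def)

lemma verts_Union: "\<Union> (verts G) = halves G" and edges_Union: "\<Union> (edges G) = halves G"
 using G by (auto simp: ribbon_graph_def partition_on_def)

lemma vert_subset: "v : verts G ==> v <= halves G" using verts_Union by blast
lemma edge_subset: "e : edges G ==> e <= halves G" using edges_Union by blast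

lemma vert_exists: "h : halves G ==> EX v:verts G. h : v" using verts_Union by blast

lemma finite_vert: "v : verts G ==> finite v" using vert_subset finite_halves finite_subset by blast
lemma finite_verts: "finite (verts G)"
 using vert_subset finite_halves finite_subset[of "verts G" "Pow (halves G)"] by auto

lemma card_vert: "v : verts G ==> card v \<ge> 3" using G by (simp add: ribbon_graph_def)

lemma vert_eq: "u : verts G ==> v : verts G ==> h : u ==> h : v ==> u = v"
 using G unfolding ribbon_graph_def partition_on_def disjoint_def by (metis disjoint_iff)

lemma vert_disjoint: "u : verts G ==> v : verts G ==> u ~= v ==> u \<inter> v = {}"
 using vert_eq by blast

lemma edge_eq: "u : edges G ==> v : edges G ==> h : u ==> h : v ==> u = v"
 using G unfolding ribbon_graph_def partition_on_def disjoint_def by (metis disjoint_iff)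

lemma card_edge: "e : edges G ==> card e = 2" using G by (simp add: ribbon_graph_def)

lemma nxt_permutes: "nxt G permutes halves G" using G by (simp add: ribbon_graph_def)

lemma nxt_inj: "nxt G h = nxt G k \<longleftrightarrow> h = k"
 using permutes_inj[OF nxt_permutes] by (auto dest: injD)

lemma nxt_outside: "h ~: halves G ==> nxt G h = h"
 using nxt_permutes by (simp add: permutes_def)

lemma vert_orbit: assumes "v : verts G" "h : v" shows "v = orbit (nxt G) h"
 using G assms orbit_cyclic_eq3[of "nxt G" v h] by (auto simp: ribbon_graph_def)

lemma nxt_vert: assumes "v : verts G" shows "nxt G h : v \<longleftrightarrow> h : v"
proof
 show "h : v ==> nxt G h : v" using vert_orbit[OF assms] orbit.base by metis
 assume n: "nxt G h : v"
 hence "nxt G h : halves G" using vert_subset assms by blast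
 hence "h : halves G" using permutes_in_image[OF nxt_permutes] by blast
 then obtain u where u: "u : verts G" "h : u" using vert_exists by blast
 hence "nxt G h : u" using vert_orbit[of u h] orbit.base by metis
 thus "h : v" using vert_eq[OF u(1) assms] n u(2) by blast
qed

text \<open>The successor acts transitively on a vertex.\<close>

lemma vert_subset_closed:
 assumes v: "v : verts G" and x: "x : v" "x : T" and cl: "!!h. h : v ==> h : T ==> nxt G h : T"
 shows "v <= T"
proof
 fix y assume "y : v"
 hence "y : orbit (nxt G) x" using vert_orbit[OF v x(1)] by simp
 hence "y : v & y : T"
  by induction (use x cl nxt_vert[OF v] in auto)
 thus "y : T" ..
qed

lemma vert_other: assumes "v : verts G" shows "EX h:v. h ~= a & h ~= b"
proof (rule ccontr)
 assume "\<not> ?thesis"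
 hence "v <= {a, b}" by blast
 hence "card v \<le> card {a, b}" by (intro card_mono) auto
 also have "... \<le> 2" by (simp add: card_insert_if)
 finally show False using card_vert[OF assms] by simp
qed

lemma nxt_neq: assumes "h : halves G" shows "nxt G h ~= h"
proof
 assume *: "nxt G h = h"
 obtain v where v: "v : verts G" "h : v" using vert_exists assms by blast
 have "v <= {h}" by (rule vert_subset_closed[OF v]) (use * in auto)
 thus False using vert_other[OF v(1), of h h] by auto
qed

lemma edge_pair: assumes "e : edges G" obtains a b where "e = {a, b}" "a ~= b"
 using card_edge[OF assms] by (auto simp: card_2_iff)

end

lemma cyclic_onI:
 assumes "s : v" "!!h. h : v ==> f h : v"
  and "!!T. T <= v ==> T ~= {} ==> (!!h. h : T ==> f h : T) ==> v <= T"
 shows "cyclic_on f v"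
proof -
 have "orbit f s <= v"
 proof
  fix x assume "x : orbit f s" thus "x : v" by induction (use assms in auto)
 qed
 moreover have "v <= orbit f s"
  by (rule assms(3)[OF calculation]) (auto simp: orbit_nonempty intro: orbit.step)
 ultimately show ?thesis using assms(1) by (auto simp: cyclic_on_def)
qed

locale nonloop =
 fixes G :: "'h ribbon" and a b v1 v2
 assumes G: "ribbon_graph G" and e: "{a, b} : edges G"
  and v: "v1 : verts G" "v2 : verts G" "v1 ~= v2" and ab: "a : v1" "b : v2"
begin

abbreviation "n \<equiv> nxt G"
abbreviation "D \<equiv> collapse G {a, b}"
abbreviation "M \<equiv> (v1 - {a}) \<union> (v2 - {b})"

lemma swap: "nonloop G b a v2 v1"
 using G e v ab by unfold_locales (auto simp: insert_commute)

lemma ab': "a ~= b" "a ~: v2" "b ~: v1" "v1 \<inter> v2 = {}"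
 using ab v vert_eq[OF G] by blast+

lemma in_nonloops: "{a, b} : nonloops G"
proof -
 have "\<not> is_loop G {a, b}"
 proof
  assume "is_loop G {a, b}"
  then obtain w where "w : verts G" "a : w" "b : w" by (auto simp: is_loop_def)
  thus False using vert_eq[OF G _ v(1), of w a] ab ab' by blast
 qed
 thus ?thesis using e by (simp add: nonloops_def)
qed

lemma other_half [simp]: "other_half {a, b} a = b" "other_half {a, b} b = a"
 unfolding other_half_def using ab' by (auto intro!: the_equality)

lemma merged: "merged_vertex G {a, b} = M"
proof -
 have "{v : verts G. v \<inter> {a, b} ~= {}} = {v1, v2}"
  using v ab vert_eq[OF G] by blast
 thus ?thesis unfolding merged_vertex_def using ab' by auto
qed

lemma verts_collapse: "verts D = insert M (verts G - {v1, v2})"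
proof -
 have "{v : verts G. v \<inter> {a, b} = {}} = verts G - {v1, v2}"
  using v ab vert_eq[OF G] by blast
 thus ?thesis by (simp add: collapse_def merged)
qed

lemma halves_collapse: "halves D = halves G - {a, b}"
 and edges_collapse: "edges D = edges G - {{a, b}}"
 by (simp_all add: collapse_def)

lemma nxt_collapse: "h : halves G ==> h ~= a ==> h ~= b ==>
 nxt D h = (if n h = a then n b else if n h = b then n a else n h)"
 using ab' by (auto simp: collapse_def)

lemma nxt_collapse_outside: "h ~: halves G - {a, b} ==> nxt D h = h"
 by (auto simp: collapse_def)

lemma halves_ab: "a : halves G" "b : halves G" using e edge_subset[OF G] by blast+

lemma n_ab: "n a : v1 - {a}" "n b : v2 - {b}"
 using ab nxt_vert[OF G] v nxt_neq[OF G] halves_ab by auto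

lemma M_nonempty: "M ~= {}" using n_ab by blast

lemma M_notin: "M ~: verts G"
proof
 assume "M : verts G"
 hence "M = v1" using n_ab(1) v vert_eq[OF G, of M v1 "n a"] by blast
 moreover have "a ~: M" using ab' by blast
 ultimately show False using ab by simp
qed

lemma M_disjoint: "w : verts G ==> w ~= v1 ==> w ~= v2 ==> w \<inter> (v1 \<union> v2) = {}"
 using v vert_eq[OF G] by blast

lemma card_M: "card M = (card v1 - 1) + (card v2 - 1)"
proof -
 have "card M = card (v1 - {a}) + card (v2 - {b})"
  using ab' finite_vert[OF G] v by (intro card_Un_disjoint) auto
 thus ?thesis using ab finite_vert[OF G] v by simp
qed

text \<open>
 The successor in the merged vertex runs through the remainder of one end of the edge and then jumps to the
 remainder of the other end.
\<close>

lemma collapse_cyclic_M: "cyclic_on (nxt D) M"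
proof (rule cyclic_onI)
 show "n a : M" using n_ab by blast
 have sub: "v1 <= halves G" "v2 <= halves G" using vert_subset[OF G] v by auto
 show "nxt D h : M" if h: "h : M" for h
 proof -
  have "h : halves G" "h ~= a" "h ~= b" using h sub ab' by auto
  moreover have "n h : v1 \<longleftrightarrow> h : v1" "n h : v2 \<longleftrightarrow> h : v2" using nxt_vert[OF G] v by auto
  ultimately show ?thesis using h n_ab by (auto simp: nxt_collapse)
 qed
 fix T assume T: "T <= M" "T ~= {}" and cl: "!!h. h : T ==> nxt D h : T"
 have nT: "nxt D h = (if n h = a then n b else if n h = b then n a else n h)" if "h : T" for h
  using that T sub ab' by (intro nxt_collapse) auto
 \<comment> \<open>Walking around the vertex of a half-edge in \<open>T\<close> one meets the collapsed edge and continues at its other end.\<close>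
 have cross1: "n b : T" if "x : T" "x : v1" for x
 proof (rule ccontr)
  assume nb: "n b ~: T"
  have "v1 <= T"
  proof (rule vert_subset_closed[OF G v(1) that(2,1)])
   fix h assume h: "h : v1" "h : T"
   hence "n h ~= b" using nxt_vert[OF G v(1), of h] ab' by auto
   thus "n h : T" using cl[OF h(2)] nT[OF h(2)] nb by (auto split: if_splits)
  qed
  thus False using ab T ab' by blast
 qed
 have cross2: "n a : T" if "x : T" "x : v2" for x
 proof (rule ccontr)
  assume na: "n a ~: T"
  have "v2 <= T"
  proof (rule vert_subset_closed[OF G v(2) that(2,1)])
   fix h assume h: "h : v2" "h : T"
   hence "n h ~= a" using nxt_vert[OF G v(2), of h] ab' by auto
   thus "n h : T" using cl[OF h(2)] nT[OF h(2)] na by (auto split: if_splits)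
  qed
  thus False using ab T ab' by blast
 qed
 have in12: "n a : T" "n b : T"
 proof -
  obtain x where x: "x : T" using T(2) by blast
  hence "x : v1 \<or> x : v2" using T(1) by blast
  thus "n a : T" "n b : T" using x cross1 cross2 n_ab by blast+
 qed
 have "w <= T \<union> {a, b}" if "w = v1 \<or> w = v2" for w
 proof (rule vert_subset_closed[OF G])
  show "w : verts G" using that v by auto
  show "(if w = v1 then a else b) : w" "(if w = v1 then a else b) : T \<union> {a, b}" using that ab by auto
  fix h assume "h : w" "h : T \<union> {a, b}"
  thus "n h : T \<union> {a, b}" using in12 cl[of h] nT[of h] by (auto split: if_splits)
 qed
 thus "M <= T" using ab' by blast
qed

lemma collapse_joins:
 assumes "f : edges G" "u : verts G" "w : verts G" "joins f u w" "f ~= {a, b}"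
 shows "joins f (if u = v1 \<or> u = v2 then M else u) (if w = v1 \<or> w = v2 then M else w)"
proof -
 obtain c d where cd: "f = {c, d}" "c : u" "d : w" using assms(4) by (auto simp: joins_def)
 have "c ~: {a, b}" "d ~: {a, b}"
  using edge_eq[OF G assms(1) e] assms(5) cd(1) by blast+
 hence "c : (if u = v1 \<or> u = v2 then M else u)" "d : (if w = v1 \<or> w = v2 then M else w)"
  using cd by auto
 thus ?thesis unfolding joins_def using cd(1) by blast
qed

lemma collapse_connected: "connected_graph D"
proof -
 define q where "q u = (if u = v1 \<or> u = v2 then M else u)" for u
 let ?R = "{(u', v'). u' : verts G & v' : verts G & (EX e:edges G. joins e u' v')}"
 let ?R' = "{(u', v'). u' : verts D & v' : verts D & (EX e:edges D. joins e u' v')}"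
 have step: "(q u, q w) : ?R'\<^sup>*" if "(u, w) : ?R" for u w
 proof -
  from that obtain f where f: "f : edges G" "joins f u w" "u : verts G" "w : verts G" by blast
  have qv: "q u : verts D" "q w : verts D" using f by (auto simp: q_def verts_collapse)
  show ?thesis
  proof (cases "f = {a, b}")
   case True
   hence "{u, w} <= {v1, v2}" using f ab v vert_eq[OF G] unfolding joins_def by (auto simp: doubleton_eq_iff)
   thus ?thesis by (auto simp: q_def)
  next
   case False
   hence "joins f (q u) (q w)" using collapse_joins f by (simp add: q_def)
   thus ?thesis using qv f False by (intro r_into_rtrancl) (auto simp: edges_collapse)
  qed
 qed
 have path: "(q u, q w) : ?R'\<^sup>*" if "(u, w) : ?R\<^sup>*" for u w
  using that by induction (use step in \<open>auto intro: rtrancl_trans\<close>)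
 have surj: "EX u:verts G. q u = x" if "x : verts D" for x
  using that v by (auto simp: verts_collapse q_def intro: bexI[of _ v1])
 have "(x, y) : ?R'\<^sup>*" if xy: "x : verts D" "y : verts D" for x y
 proof -
  obtain u w where "u : verts G" "q u = x" "w : verts G" "q w = y" using surj xy by metis
  moreover have "(u, w) : ?R\<^sup>*" using G calculation by (auto simp: ribbon_graph_def connected_graph_def)
  ultimately show ?thesis using path by blast
 qed
 thus ?thesis unfolding connected_graph_def by (simp add: verts_collapse)
qed

lemma collapse_permutes: "nxt D permutes halves D"
proof (rule inj_imp_permutes)
 have n_in: "n h : halves G \<longleftrightarrow> h : halves G" for h using permutes_in_image[OF nxt_permutes[OF G]] .
 have nn: "n a ~= a" "n a ~= b" "n b ~= a" "n b ~= b" using n_ab ab' by auto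
 show "inj_on (nxt D) (halves D)"
  by (rule inj_onI) (auto simp: halves_collapse nxt_collapse nxt_inj[OF G] split: if_splits)
 show "nxt D x : halves D" if "x : halves D" for x
  using that nn n_in halves_ab by (auto simp: halves_collapse nxt_collapse)
 show "finite (halves D)" using finite_halves[OF G] by (simp add: halves_collapse)
 show "nxt D x = x" if "x ~: halves D" for x using that by (auto simp: halves_collapse nxt_collapse_outside)
qed

lemma collapse_ribbon: "ribbon_graph D"
 unfolding ribbon_graph_def
proof (intro conjI ballI)
 show "finite (halves D)" using finite_halves[OF G] by (simp add: halves_collapse)
 show "partition_on (halves D) (edges D)"
  using G e edge_eq[OF G _ e] unfolding partition_on_def ribbon_graph_def disjoint_def
  by (auto simp: halves_collapse edges_collapse)
 show "card f = 2" if "f : edges D" for f using that card_edge[OF G] by (simp add: edges_collapse)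
 have "disjoint (verts D)"
  unfolding disjoint_def
 proof (intro ballI impI)
  fix u w assume uw: "u : verts D" "w : verts D" "u ~= w"
  have M: "w \<inter> M = {}" if "w : verts G - {v1, v2}" for w
   using that M_disjoint[of w] by auto
  consider "u = M" "w : verts G - {v1, v2}" | "w = M" "u : verts G - {v1, v2}"
   | "u : verts G" "w : verts G" using uw unfolding verts_collapse by blast
  thus "u \<inter> w = {}"
  proof cases
   case 3
   thus ?thesis using vert_eq[OF G, of u w] uw(3) by blast
  qed (use M in \<open>auto simp: Int_commute\<close>)
 qed
 moreover have "\<Union> (verts D) = halves D"
 proof -
  have "\<Union> (verts G) = v1 \<union> v2 \<union> \<Union> (verts G - {v1, v2})" using v by blast
  moreover have "\<Union> (verts G - {v1, v2}) \<inter> (v1 \<union> v2) = {}" using M_disjoint by blast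
  ultimately show ?thesis using ab ab'
   unfolding verts_collapse halves_collapse verts_Union[OF G, symmetric] by auto
 qed
 moreover have "{} ~: verts D" using M_nonempty card_vert[OF G, of "{}"] by (auto simp: verts_collapse)
 ultimately show "partition_on (halves D) (verts D)" by (simp add: partition_on_def)
 show "card w \<ge> 3" if "w : verts D" for w
  using that card_M card_vert[OF G v(1)] card_vert[OF G v(2)] card_vert[OF G, of w]
  by (cases "w = M") (auto simp: verts_collapse)
 show "nxt D permutes halves D" by (rule collapse_permutes)
 show "connected_graph D" by (rule collapse_connected)
 fix w assume "w : verts D"
 then consider "w = M" | "w : verts G" "w ~= v1" "w ~= v2" by (auto simp: verts_collapse)
 thus "cyclic_on (nxt D) w"
 proof cases
  case 2
  have "nxt D h = n h" if "h : w" for h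
  proof -
   have "h : halves G" "n h : w" using that 2 vert_subset[OF G] nxt_vert[OF G] by auto
   thus ?thesis using that M_disjoint[OF 2] ab by (subst nxt_collapse) auto
  qed
  moreover have "cyclic_on n w" using G 2 by (simp add: ribbon_graph_def)
  ultimately show ?thesis by (subst cyclic_cong[where g = n]) auto
 qed (simp add: collapse_cyclic_M)
qed

lemma codim_collapse: "codim D = Suc (codim G)"
proof -
 have "codim G = (card v1 - 3) + ((card v2 - 3) + (SUM v:verts G - {v1, v2}. card v - 3))"
  unfolding codim_def using v finite_verts[OF G]
  by (simp add: sum.remove[of _ v1] sum.remove[of "verts G - {v1}" v2] Diff_insert2[symmetric] insert_commute)
 moreover have "codim D = (card M - 3) + (SUM v:verts G - {v1, v2}. card v - 3)"
  unfolding codim_def verts_collapse using finite_verts[OF G] M_notin by (subst sum.insert) auto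
 moreover have "card M - 3 = Suc ((card v1 - 3) + (card v2 - 3))"
  using card_M card_vert[OF G v(1)] card_vert[OF G v(2)] by linarith
 ultimately show ?thesis by simp
qed

end

lemma nonloopE:
 assumes "ribbon_graph G" "e : nonloops G"
 obtains a b v1 v2 where "e = {a, b}" "nonloop G a b v1 v2"
proof -
 have e: "e : edges G" "\<not> is_loop G e" using assms(2) by (auto simp: nonloops_def)
 obtain a b where ab: "e = {a, b}" "a ~= b" using edge_pair[OF assms(1) e(1)] by blast
 hence "a : halves G" "b : halves G" using edge_subset[OF assms(1) e(1)] by auto
 then obtain v1 v2 where "v1 : verts G" "a : v1" "v2 : verts G" "b : v2"
  using vert_exists[OF assms(1)] by blast
 moreover from this have "v1 ~= v2" using e(2) ab by (auto simp: is_loop_def)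
 ultimately show ?thesis using that ab e(1) assms(1) by (auto simp: nonloop_def)
qed

lemma ribbon_collapse: "ribbon_graph G ==> e : nonloops G ==> ribbon_graph (collapse G e)"
 by (metis nonloopE nonloop.collapse_ribbon)

lemma codim_collapse: "ribbon_graph G ==> e : nonloops G ==> codim (collapse G e) = Suc (codim G)"
 by (metis nonloopE nonloop.codim_collapse)

section \<open>Isomorphisms and morphisms of ribbon graphs\<close>

definition pm :: "'a set => ('a => 'b) => 'a \<rightharpoonup> 'b" where
 "pm A F = (%h. if h : A then Some (F h) else None)"

abbreviation idm :: "'h ribbon => 'h mor" where "idm G \<equiv> pm (halves G) (%h. h)"

definition minv :: "('a \<rightharpoonup> 'b) => 'b \<rightharpoonup> 'a" where
 "minv f = pm (ran f) (%k. SOME h. f h = Some k)"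

lemma pm_simps [simp]: "h : A ==> pm A F h = Some (F h)" "h ~: A ==> pm A F h = None" "dom (pm A F) = A"
 by (auto simp: pm_def dom_def)

lemma ran_pm [simp]: "ran (pm A F) = F ` A" by (auto simp: pm_def ran_def)

lemma img_pm: "B <= A ==> img (pm A F) B = F ` B" by (auto simp: img_def pm_def)

lemma img_pm': "img (pm A F) B = F ` (B \<inter> A)" by (auto simp: img_def pm_def split: if_splits)

lemma pm_cong: "A = B ==> (!!x. x : B ==> F x = G x) ==> pm A F = pm B G"
 by (auto simp: pm_def fun_eq_iff)

lemma pm_eta: "f = pm (dom f) (%h. the (f h))" by (auto simp: pm_def fun_eq_iff)

lemma map_comp_assoc: "(h o_m g) o_m f = h o_m (g o_m f)"
 by (auto simp: map_comp_def fun_eq_iff split: option.splits)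

lemma img_comp: "img (g o_m f) A = img g (img f A)"
 by (auto simp: img_def map_comp_def split: option.splits)

lemma minv_left: assumes "inj_on f (dom f)" "f h = Some k" shows "minv f k = Some h"
proof -
 have "k : ran f" using assms by (auto simp: ran_def)
 moreover have "(SOME h. f h = Some k) = h"
  by (rule some_equality) (use assms in \<open>auto simp: inj_on_def dom_def\<close>)
 ultimately show ?thesis by (simp add: minv_def)
qed

lemma minv_SomeD: "minv f k = Some h ==> f h = Some k"
 unfolding minv_def by (cases "k : ran f") (auto simp: ran_def intro: someI)

lemma dom_minv [simp]: "dom (minv f) = ran f" by (simp add: minv_def)
lemma minv_comp: assumes "inj_on f (dom f)" shows "minv f o_m f = pm (dom f) (%h. h)"
proof
 fix h show "(minv f o_m f) h = pm (dom f) (%h. h) h"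
  by (cases "f h") (auto simp: map_comp_def pm_def dom_def minv_left[OF assms])
qed

lemma comp_minv: "f o_m minv f = pm (ran f) (%h. h)"
proof
 fix k show "(f o_m minv f) k = pm (ran f) (%h. h) k"
 proof (cases "minv f k")
  case None
  hence "k ~: ran f" using dom_minv[of f] by blast
  thus ?thesis using None by simp
 next
  case (Some h)
  hence "f h = Some k" by (rule minv_SomeD)
  thus ?thesis using Some by (simp add: ran_def pm_def) blast
 qed
qed

lemma comp_idm: assumes "dom f <= A" shows "f o_m pm A (%h. h) = f"
proof
 fix x show "(f o_m pm A (%h. h)) x = f x"
  using assms by (cases "f x") (auto simp: map_comp_def pm_def)
qed

lemma idm_comp: "ran f <= A ==> pm A (%h. h) o_m f = f"
 by (auto simp: map_comp_def pm_def fun_eq_iff ran_def split: option.splits)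

definition rib_bij :: "'h ribbon => ('h => 'h) => 'h ribbon => bool" where
 "rib_bij G F G' \<longleftrightarrow> bij_betw F (halves G) (halves G') & (`) F ` edges G = edges G' \<and>
  (`) F ` verts G = verts G' & (ALL h:halves G. F (nxt G h) = nxt G' (F h))"

lemma ribbon_iso_iff:
 assumes G: "ribbon_graph G"
 shows "ribbon_iso G f G' \<longleftrightarrow> (EX F. f = pm (halves G) F & rib_bij G F G')"
proof -
 have *: "ribbon_iso G (pm (halves G) F) G' \<longleftrightarrow> rib_bij G F G'" for F
 proof -
  have "img (pm (halves G) F) ` edges G = (`) F ` edges G" "img (pm (halves G) F) ` verts G = (`) F ` verts G"
   using edge_subset[OF G] vert_subset[OF G] by (auto intro!: image_cong img_pm)
  moreover have "inj_on (pm (halves G) F) (halves G) \<longleftrightarrow> inj_on F (halves G)" by (auto simp: inj_on_def)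
  moreover have "nxt G h : halves G" if "h : halves G" for h
   using that permutes_in_image[OF nxt_permutes[OF G]] by blast
  ultimately show ?thesis unfolding ribbon_iso_def rib_bij_def bij_betw_def by auto
 qed
 show ?thesis
 proof
  assume f: "ribbon_iso G f G'"
  hence "f = pm (halves G) (%h. the (f h))" using pm_eta[of f] by (simp add: ribbon_iso_def)
  thus "EX F. f = pm (halves G) F & rib_bij G F G'" using f * by metis
 qed (use * in auto)
qed

lemma rib_bijI:
 assumes G: "ribbon_graph G" and G': "ribbon_graph G'" and b: "bij_betw F (halves G) (halves G')"
  and e: "(`) F ` edges G = edges G'" and n: "!!h. h : halves G ==> F (nxt G h) = nxt G' (F h)"
 shows "rib_bij G F G'"
proof -
 \<comment> \<open>The vertices are the orbits of the successor maps, so it suffices that \<open>F\<close> commutes with these.\<close>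
 have vv: "F ` v = v'" if v: "v : verts G" "h : v" and v': "v' : verts G'" "F h : v'" for v h v'
 proof
  have s: "v <= halves G" using vert_subset[OF G] v by blast
  have "v <= {x. F x : v'}"
   by (rule vert_subset_closed[OF G v]) (use v' n nxt_vert[OF G' v'(1)] s in auto)
  thus "F ` v <= v'" by blast
  show "v' <= F ` v"
  proof (rule vert_subset_closed[OF G' v'])
   show "F h : F ` v" using v by blast
   fix k assume "k : F ` v"
   then obtain x where x: "x : v" "k = F x" by blast
   hence "nxt G' k = F (nxt G x)" using n s by auto
   thus "nxt G' k : F ` v" using nxt_vert[OF G v(1)] x by auto
  qed
 qed
 have "(`) F ` verts G = verts G'"
 proof (intro equalityI subsetI)
  fix w assume "w : (`) F ` verts G"
  then obtain v where v: "v : verts G" "w = F ` v" by blast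
  then obtain h where h: "h : v" using vert_other[OF G] by blast
  hence "F h : halves G'" using b vert_subset[OF G v(1)] by (auto simp: bij_betw_def)
  then obtain v' where "v' : verts G'" "F h : v'" using vert_exists[OF G'] by blast
  thus "w : verts G'" using vv[OF v(1) h] v by simp
 next
  fix v' assume v': "v' : verts G'"
  then obtain k where k: "k : v'" using vert_other[OF G'] by blast
  hence "k : halves G'" using vert_subset[OF G' v'] by blast
  then obtain h where h: "h : halves G" "k = F h" using b by (auto simp: bij_betw_def)
  then obtain v where "v : verts G" "h : v" using vert_exists[OF G] by blast
  thus "v' : (`) F ` verts G" using vv[of v h v'] v' k h by auto
 qed
 thus ?thesis using b e n by (auto simp: rib_bij_def)
qed

lemma ribbon_isoI: "ribbon_graph G ==> ribbon_graph G' ==> bij_betw F (halves G) (halves G') ==>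
  (`) F ` edges G = edges G' ==> (!!h. h : halves G ==> F (nxt G h) = nxt G' (F h)) ==>
 ribbon_iso G (pm (halves G) F) G'"
 unfolding ribbon_iso_iff using rib_bijI[of G G' F] by (intro exI[of _ F]) simp

lemma ribbon_iso_refl: "ribbon_graph G ==> ribbon_iso G (idm G) G"
 by (rule ribbon_isoI) (auto simp: bij_betw_def)

lemma ribbon_iso_comp:
 assumes "ribbon_iso G f G'" "ribbon_iso G' g G''"
 shows "ribbon_iso G (g o_m f) G''"
proof -
 have d: "dom f = halves G" "ran f = halves G'" "dom g = halves G'" "ran g = halves G''"
  and inj: "inj_on f (dom f)" "inj_on g (dom g)"
  using assms by (auto simp: ribbon_iso_def)
 have st: "EX k l. f h = Some k & k : halves G' & g k = Some l" if "h : halves G" for h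
 proof -
  from that d obtain k where "f h = Some k" by blast
  moreover from this have "k : halves G'" using d by (auto simp: ran_def)
  ultimately show ?thesis using d by blast
 qed
 have dom: "dom (g o_m f) = halves G"
  using st d by (fastforce simp: map_comp_def dom_def split: option.splits)
 have ran: "ran (g o_m f) = halves G''"
 proof
  have "ran (g o_m f) <= ran g" by (auto simp: ran_def map_comp_def split: option.splits)
  thus "ran (g o_m f) <= halves G''" using d by simp
  show "halves G'' <= ran (g o_m f)"
  proof
   fix l assume "l : halves G''"
   hence "l : ran g" using d by simp
   then obtain k where k: "g k = Some l" by (auto simp: ran_def)
   hence "k : ran f" using d by auto
   then obtain h where "f h = Some k" by (auto simp: ran_def)
   hence "(g o_m f) h = Some l" using k by simp
   thus "l : ran (g o_m f)" by (auto simp: ran_def)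
  qed
 qed
 have inj': "inj_on (g o_m f) (dom (g o_m f))"
  unfolding dom
 proof (rule inj_onI)
  fix x y assume xy: "x : halves G" "y : halves G" "(g o_m f) x = (g o_m f) y"
  obtain k l where k: "f x = Some k" "k : halves G'" "g k = Some l" using st[OF xy(1)] by blast
  obtain k' l' where k': "f y = Some k'" "k' : halves G'" "g k' = Some l'" using st[OF xy(2)] by blast
  have "g k = g k'" using xy k k' by simp
  hence "k = k'" using inj(2) k k' d by (auto simp: inj_on_def)
  thus "x = y" using inj(1) k k' xy d by (auto simp: inj_on_def)
 qed
 have im: "img (g o_m f) = (%A. img g (img f A))" by (auto simp: img_comp)
 have "(g o_m f) (nxt G h) = map_option (nxt G'') ((g o_m f) h)" if h: "h : halves G" for h
 proof -
  obtain k l where k: "f h = Some k" "k : halves G'" "g k = Some l" using st[OF h] by blast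
  have "f (nxt G h) = Some (nxt G' k)" using assms(1) h k by (simp add: ribbon_iso_def)
  thus ?thesis using assms(2) k by (simp add: ribbon_iso_def)
 qed
 moreover have "img (g o_m f) ` edges G = edges G''" "img (g o_m f) ` verts G = verts G''"
  using assms by (simp_all add: im ribbon_iso_def image_image[symmetric])
 ultimately show ?thesis unfolding ribbon_iso_def using dom ran inj' by auto
qed

lemma ribbon_iso_inv:
 assumes G: "ribbon_graph G" and G': "ribbon_graph G'" and f: "ribbon_iso G f G'"
 shows "ribbon_iso G' (minv f) G"
proof -
 obtain F where F: "f = pm (halves G) F" "rib_bij G F G'" using ribbon_iso_iff[OF G] f by blast
 hence b: "bij_betw F (halves G) (halves G')" by (simp add: rib_bij_def)
 let ?G = "inv_into (halves G) F"
 have GF: "?G (F h) = h" if "h : halves G" for h using b that by (auto simp: bij_betw_def)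
 have "minv f = pm (halves G') ?G"
 proof
  fix k show "minv f k = pm (halves G') ?G k"
  proof (cases "k : halves G'")
   case True
   then obtain h where "h : halves G" "k = F h" using b by (auto simp: bij_betw_def)
   thus ?thesis using minv_left[of f h k] f F True GF by (auto simp: ribbon_iso_def)
  qed (use F b in \<open>simp add: minv_def bij_betw_def\<close>)
 qed
 moreover have "ribbon_iso G' (pm (halves G') ?G) G"
 proof (rule ribbon_isoI[OF G' G])
  show "bij_betw ?G (halves G') (halves G)" using b by (rule bij_betw_inv_into)
  have "?G ` F ` e = e" if "e : edges G" for e
   using edge_subset[OF G that] GF by (force simp: image_image)
  hence "(%e. ?G ` F ` e) ` edges G = edges G" by auto
  moreover have "edges G' = (`) F ` edges G" using F(2) by (simp add: rib_bij_def)
  ultimately show "(`) ?G ` edges G' = edges G" by (simp add: image_image)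
  fix k assume "k : halves G'"
  then obtain h where h: "h : halves G" "k = F h" using b by (auto simp: bij_betw_def)
  hence "nxt G h : halves G" using permutes_in_image[OF nxt_permutes[OF G]] by blast
  moreover have "nxt G' k = F (nxt G h)" using F(2) h by (simp add: rib_bij_def)
  ultimately show "?G (nxt G' k) = nxt G (?G k)" using h GF by simp
 qed
 ultimately show ?thesis by simp
qed

lemma ribbon_isoD:
 assumes "ribbon_iso G f G'"
 shows "dom f = halves G" "ran f = halves G'" "inj_on f (dom f)" "img f ` edges G = edges G'"
  "img f ` verts G = verts G'"
 using assms by (auto simp only: ribbon_iso_def)

lemma rib_bij_collapse:
 assumes nl: "nonloop G a b v1 v2" and G': "ribbon_graph G'" and F: "rib_bij G F G'"
 shows "nonloop G' (F a) (F b) (F ` v1) (F ` v2)"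
  and "rib_bij (collapse G {a, b}) F (collapse G' {F a, F b})"
proof -
 interpret nonloop G a b v1 v2 by (rule nl)
 have inj: "inj_on F (halves G)" and im: "F ` halves G = halves G'" and n: "!!h. h : halves G ==> F (n h) = nxt G' (F h)"
  using F by (auto simp: rib_bij_def bij_betw_def)
 have inj_im: "F ` A = F ` B \<longleftrightarrow> A = B" if "A <= halves G" "B <= halves G" for A B
  using inj_on_image_eq_iff[OF inj that] .
 have "F ` v1 : verts G'" "F ` v2 : verts G'" "F ` {a, b} : edges G'"   proof -
  have "(`) F ` edges G = edges G'" "(`) F ` verts G = verts G'" using F by (auto simp only: rib_bij_def)
  thus "F ` v1 : verts G'" "F ` v2 : verts G'" "F ` {a, b} : edges G'"
   using imageI[OF v(1), of "(`) F"] imageI[OF v(2), of "(`) F"] imageI[OF e, of "(`) F"] by auto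
 qed
 thus N: "nonloop G' (F a) (F b) (F ` v1) (F ` v2)"
  using G' ab v inj_im[of v1 v2] vert_subset[OF G] by unfold_locales auto
 interpret N: nonloop G' "F a" "F b" "F ` v1" "F ` v2" by (rule N)
 show "rib_bij (collapse G {a, b}) F (collapse G' {F a, F b})"
 proof (rule rib_bijI[OF collapse_ribbon N.collapse_ribbon])
  show "bij_betw F (halves D) (halves N.D)"
   unfolding bij_betw_def halves_collapse N.halves_collapse im[symmetric]
   using inj halves_ab by (auto simp: inj_on_def)
  have "(`) F ` (edges G - {{a, b}}) = (`) F ` edges G - (`) F ` {{a, b}}"
   by (rule inj_on_image_set_diff[where C = "edges G"]) (use e inj_im edge_subset[OF G] in \<open>auto simp: inj_on_def\<close>)
  thus "(`) F ` edges D = edges N.D"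
   using F by (simp add: rib_bij_def edges_collapse N.edges_collapse)
  fix h assume "h : halves D"
  hence h: "h : halves G" "h ~= a" "h ~= b" by (auto simp: halves_collapse)
  hence Fh: "F h : halves G'" "F h ~= F a" "F h ~= F b"
   using inj halves_ab im by (auto dest: inj_onD)
  have "n h : halves G" using h permutes_in_image[OF nxt_permutes[OF G]] by blast
  hence "F (n h) = F a \<longleftrightarrow> n h = a" "F (n h) = F b \<longleftrightarrow> n h = b"
   using inj halves_ab by (auto dest: inj_onD)
  thus "F (nxt D h) = nxt N.D (F h)"
   unfolding nxt_collapse[OF h] N.nxt_collapse[OF Fh] using n h halves_ab by auto
 qed
qed

lemma ribbon_iso_collapse:
 assumes G: "ribbon_graph G" and G': "ribbon_graph G'" and f: "ribbon_iso G f G'" and e: "e : nonloops G"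
 shows "img f e : nonloops G'" "ribbon_iso (collapse G e) (f |` (- e)) (collapse G' (img f e))"
proof -
 obtain a b v1 v2 where eab: "e = {a, b}" and nl: "nonloop G a b v1 v2" using nonloopE[OF G e] by blast
 interpret nonloop G a b v1 v2 by (rule nl)
 obtain F where F: "f = pm (halves G) F" "rib_bij G F G'" using ribbon_iso_iff[OF G] f by blast
 note N = rib_bij_collapse[OF nl G' F(2)]
 have im: "img f e = {F a, F b}" using halves_ab by (simp add: img_pm F(1) eab)
 show "img f e : nonloops G'" using nonloop.in_nonloops[OF N(1)] im by simp
 have "f |` (- e) = pm (halves D) F"
  using F eab by (auto simp: restrict_map_def pm_def halves_collapse fun_eq_iff)
 thus "ribbon_iso (collapse G e) (f |` (- e)) (collapse G' (img f e))"
  using N(2) im eab ribbon_iso_iff[OF collapse_ribbon] by auto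
qed

text \<open>
 Collapsing nonloops one after another never uses up a cycle: if the edges in \<open>F\<close> can be collapsed
 successively then every subset \<open>S\<close> of \<open>F\<close> is cut out, inside \<open>F\<close>, by a two-colouring of the
 vertices. On a cycle the number of colour changes is even, so \<open>S\<close> consisting of a single edge of the
 cycle is impossible.
\<close>

lemma collapses_cut:
 assumes "collapses G F D" "ribbon_graph G"
 shows "EX p. (ALL v:verts G. ALL x:v. ALL y:v. p x = p y) \<and>
  (ALL x y. {x, y} : F \<longrightarrow> x ~= y \<longrightarrow> (p x ~= (p y :: bool) \<longleftrightarrow> {x, y} : S))"
 using assms
proof (induction arbitrary: S rule: collapses.induct)
 case (collapses_empty G)
 thus ?case by (intro exI[of _ "%_. True"]) auto
next
 case (collapses_insert e G F D)
 obtain a b v1 v2 where eab: "e = {a, b}" and nl: "nonloop G a b v1 v2"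
  using nonloopE collapses_insert by metis
 interpret nonloop G a b v1 v2 by (rule nl)
 define S' where "S' = {f. (f : S) ~= (e : S & (EX x y. f = {x, y} & x : v2 & y ~: v2))}"
 obtain p where "(ALL v:verts (collapse G e). ALL x:v. ALL y:v. p x = p y) \<and>
  (ALL x y. {x, y} : F \<longrightarrow> x ~= y \<longrightarrow> (p x ~= (p y :: bool) \<longleftrightarrow> {x, y} : S'))"
  using collapses_insert.IH[OF ribbon_collapse[OF G collapses_insert.hyps(1)], of S'] by (elim exE)
 hence p: "!!v x y. v : verts (collapse G e) ==> x : v ==> y : v ==> p x = p y"
  "!!x y. {x, y} : F ==> x ~= y ==> (p x ~= p y \<longleftrightarrow> {x, y} : S')" by blast+
 define pM where "pM = p (n a)"
 define q where "q h = (if h : v1 then pM else if h : v2 then pM ~= (e : S) else p h)" for h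
 have pM: "p x = pM" if "x : M" for x
  using p(1)[of M x "n a"] that n_ab eab by (simp add: verts_collapse pM_def)
 have q: "q h = (p h ~= (h : v2 & e : S))" if "h ~= a" "h ~= b" for h
  using that pM[of h] ab' by (auto simp: q_def)
 have Fe: "x ~: e" if "collapses G' F D'" "G' = collapse G e" "{x, y} : F" for x y G' D'
 proof -
  have "F <= edges G'" using that(1)
   by induction (auto simp: nonloops_def collapse_def)
  hence "{x, y} : edges G" "{x, y} ~= e" using that(2,3) eab by (auto simp: edges_collapse)
  thus ?thesis using edge_eq[OF G _ e, of "{x, y}" x] eab by blast
 qed
 have v2sep: "(EX x' y'. {x, y} = {x', y'} & x' : v2 & y' ~: v2) \<longleftrightarrow> (x : v2) ~= (y : v2)" for x y
  by (auto simp: doubleton_eq_iff)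
 show ?case
 proof (intro exI[of _ q] conjI ballI allI impI)
  fix v x y assume vxy: "v : verts G" "x : v" "y : v"
  show "q x = q y"
  proof (cases "v = v1 \<or> v = v2")
   case True
   thus ?thesis using vxy ab' by (auto simp: q_def)
  next
   case False
   hence "v : verts (collapse G e)" using vxy eab by (simp add: verts_collapse)
   hence "p x = p y" using p(1) vxy by blast
   moreover have "x ~: v1" "x ~: v2" "y ~: v1" "y ~: v2" using False vxy M_disjoint by blast+
   ultimately show ?thesis by (simp add: q_def)
  qed
 next
  fix x y assume xy: "{x, y} : insert e F" "x ~= y"
  show "q x ~= q y \<longleftrightarrow> {x, y} : S"
  proof (cases "{x, y} = e")
   case True
   hence xy': "(x = a & y = b) \<or> (x = b & y = a)" using eab by (auto simp: doubleton_eq_iff)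
   show ?thesis using True ab' xy' v ab by (auto simp: q_def)
  next
   case False
   hence F: "{x, y} : F" "{y, x} : F" using xy by (auto simp: insert_commute)
   have "x ~: e" "y ~: e" using Fe[OF collapses_insert.hyps(2) HOL.refl] F by blast+
   hence "q x = (p x ~= (x : v2 & e : S))" "q y = (p y ~= (y : v2 & e : S))" using q eab by auto
   moreover have "p x ~= p y \<longleftrightarrow> {x, y} : S'" using p(2)[OF F(1) xy(2)] .
   ultimately show ?thesis unfolding S'_def mem_Collect_eq v2sep by auto
  qed
 qed
qed

lemma collapses_forest:
 assumes c: "collapses G F D" and G: "ribbon_graph G"
 shows "spanning_forest G F"
 unfolding spanning_forest_def
proof (intro conjI notI)
 show "F <= edges G" using c by induction (auto simp: nonloops_def collapse_def)
 assume "EX vs es. is_cycle G vs es & set es <= F"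
 then obtain vs es where cyc: "is_cycle G vs es" and es: "set es <= F" by blast
 define m where "m = length es"
 have m: "m > 0" "length vs = m" using cyc by (auto simp: is_cycle_def m_def)
 obtain p where "(ALL v:verts G. ALL x:v. ALL y:v. p x = p y) \<and>
  (ALL x y. {x, y} : F \<longrightarrow> x ~= y \<longrightarrow> (p x ~= (p y :: bool) \<longleftrightarrow> {x, y} : {es ! 0}))"
  using collapses_cut[OF assms, of "{es ! 0}"] by (elim exE)
 hence p: "!!v x y. v : verts G ==> x : v ==> y : v ==> p x = p y"
  "!!x y. {x, y} : F ==> x ~= y ==> (p x ~= p y \<longleftrightarrow> {x, y} : {es ! 0})" by blast+
 define P where "P i = p (SOME x. x : vs ! i)" for i
 have P: "p x = P i" if "i < m" "x : vs ! i" for i x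
  unfolding P_def using p(1) that cyc m by (metis is_cycle_def nth_mem someI subsetD)
 have step: "P i ~= P (Suc i mod m) \<longleftrightarrow> i = 0" if i: "i < m" for i
 proof -
  obtain a b where ab: "es ! i = {a, b}" "a : vs ! i" "b : vs ! (Suc i mod m)"
   using cyc i by (auto simp: is_cycle_def joins_def m_def)
  have "es ! i : edges G" "es ! i : F" using cyc i es by (auto simp: is_cycle_def m_def)
  hence "a ~= b" "{a, b} : F" using ab card_edge[OF G, of "es ! i"] by auto
  hence "p a ~= p b \<longleftrightarrow> es ! i = es ! 0" using p(2)[of a b] ab by simp
  also have "... \<longleftrightarrow> i = 0" using cyc i m by (auto simp: is_cycle_def nth_eq_iff_index_eq m_def)
  finally show ?thesis using P[OF i ab(2)] P[of "Suc i mod m" b] ab(3) m by auto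
 qed
 have same: "P i = P (1 mod m)" if "0 < i" "i < m" for i
  using that
 proof (induction i)
  case (Suc i)
  thus ?case using step[of i] by (cases "i = 0") auto
 qed simp
 have "P (m - 1) = P (1 mod m)" if "m > 1" using same[of "m - 1"] that by simp
 thus False using step[of 0] step[of "m - 1"] m by (cases "m > 1") auto
qed

lemma Mor_iff: "ribbon_graph G0 ==> f : Mor G0 G1 \<longleftrightarrow> (EX F D. collapses G0 F D & ribbon_iso D f G1)"
 unfolding Mor_def using collapses_forest by blast

lemma collapses_facts:
 assumes "collapses G F D" "ribbon_graph G"
 shows "ribbon_graph D & halves D <= halves G & codim G \<le> codim D & (codim G = codim D \<longrightarrow> D = G)"
 using assms
proof (induction rule: collapses.induct)
 case (collapses_insert e G F D)
 thus ?case using ribbon_collapse[of G e] codim_collapse[of G e] by (auto simp: collapse_def)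
qed auto

lemma collapses_trans:
 "collapses G F D ==> collapses D F' D' ==> collapses G (F \<union> F') D'"
 by (induction rule: collapses.induct) (auto intro: collapses.intros)

lemma iso_collapses:
 assumes "collapses G' F D'" "ribbon_graph G'" "ribbon_graph G" "ribbon_iso G f G'"
 shows "EX F' D. collapses G F' D & ribbon_iso D (f |` halves D) D'"
 using assms
proof (induction arbitrary: G f rule: collapses.induct)
 case (collapses_empty G')
 hence "dom f = halves G" by (simp add: ribbon_iso_def)
 hence "(f |` halves G) h = f h" for h by (cases "f h") (auto simp: restrict_map_def)
 hence "f |` halves G = f" by blast
 thus ?case using collapses_empty collapses.collapses_empty by metis
next
 case (collapses_insert e G' F D')
 note inv = ribbon_iso_inv[OF collapses_insert.prems(2,1,3)]
 define e' where "e' = img (minv f) e"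
 have e': "e' : nonloops G" unfolding e'_def
  by (rule ribbon_iso_collapse(1)[OF collapses_insert.prems(1,2) inv collapses_insert.hyps(1)])
 have "e <= ran f" using collapses_insert edge_subset by (force simp: nonloops_def ribbon_iso_def)
 hence im: "img f e' = e"
  unfolding e'_def img_comp[symmetric] comp_minv by (auto simp: img_pm)
 note c = ribbon_iso_collapse[OF collapses_insert.prems(2,1,3) e', unfolded im]
 obtain F' D where d: "collapses (collapse G e') F' D" "ribbon_iso D ((f |` (- e')) |` halves D) D'"
  using collapses_insert.IH[OF ribbon_collapse[OF collapses_insert.prems(1) collapses_insert.hyps(1)]
   ribbon_collapse[OF collapses_insert.prems(2) e'] c(2)] by blast
 have "halves D <= - e'" using collapses_facts[OF d(1) ribbon_collapse[OF collapses_insert.prems(2) e']]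
  by (auto simp: collapse_def)
 hence "(f |` (- e')) |` halves D = f |` halves D" by (auto simp: restrict_map_def fun_eq_iff)
 thus ?case using d collapses.collapses_insert[OF e' d(1)] by auto
qed

lemma iso_in_Mor: "ribbon_graph G ==> ribbon_iso G f G' ==> f : Mor G G'"
 using Mor_iff collapses.collapses_empty by blast

lemma Mor_comp:
 assumes G: "ribbon_graph G0" "ribbon_graph G1" and f: "f : Mor G0 G1" and g: "g : Mor G1 G2"
 shows "g o_m f : Mor G0 G2"
proof -
 obtain F D where F: "collapses G0 F D" "ribbon_iso D f G1" using Mor_iff[OF G(1)] f by blast
 obtain F1 D1 where F1: "collapses G1 F1 D1" "ribbon_iso D1 g G2" using Mor_iff[OF G(2)] g by blast
 have D: "ribbon_graph D" using collapses_facts[OF F(1) G(1)] by blast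
 obtain F2 D2 where F2: "collapses D F2 D2" "ribbon_iso D2 (f |` halves D2) D1"
  using iso_collapses[OF F1(1) G(2) D F(2)] by blast
 have inj: "inj_on f (dom f)" using ribbon_isoD[OF F(2)] by blast
 have "g o_m f = g o_m (f |` halves D2)"
 proof
  fix h show "(g o_m f) h = (g o_m (f |` halves D2)) h"
  proof (cases "h : halves D2")
   case False
   have "g k = None" if "f h = Some k" for k
   proof (rule ccontr)
    assume "g k ~= None"
    hence "k : halves D1" using F1(2) by (auto simp: ribbon_iso_def)
    hence "k : ran (f |` halves D2)" using F2(2) by (simp add: ribbon_iso_def)
    then obtain h' where "h' : halves D2" "f h' = Some k"
    by (auto simp: ran_def restrict_map_def split: if_splits)
    thus False using that inj False by (metis domI inj_onD)
   qed
   thus ?thesis using False by (cases "f h") auto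
  qed (simp add: map_comp_def)
 qed
 hence "ribbon_iso D2 (g o_m f) G2" using ribbon_iso_comp[OF F2(2) F1(2)] by simp
 thus ?thesis using collapses_trans[OF F(1) F2(1)] Mor_iff[OF G(1)] by blast
qed

lemma Mor_facts:
 assumes "ribbon_graph G0" "f : Mor G0 G1"
 shows "dom f <= halves G0" "ran f = halves G1" "inj_on f (dom f)"
proof -
 obtain F D where F: "collapses G0 F D" "ribbon_iso D f G1" using Mor_iff[OF assms(1)] assms(2) by blast
 thus "dom f <= halves G0" "ran f = halves G1" "inj_on f (dom f)"
  using collapses_facts[OF F(1) assms(1)] ribbon_isoD[OF F(2)] by blast+
qed

lemma codim_iso:
 assumes "ribbon_graph G" "ribbon_iso G f G'"
 shows "codim G' = codim G"
proof -
 obtain F where F: "rib_bij G F G'" using ribbon_iso_iff assms by blast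
 hence inj: "inj_on F (halves G)" by (simp add: rib_bij_def bij_betw_def)
 have injv: "inj_on ((`) F) (verts G)"
  by (rule inj_onI) (metis inj_on_image_eq_iff[OF inj] vert_subset[OF assms(1)])
 hence "codim G' = (SUM v:verts G. card (F ` v) - 3)"
  using F sum.reindex[OF injv, of "%v. card v - 3"] by (simp add: codim_def rib_bij_def)
 also have "... = codim G" unfolding codim_def
 proof (rule sum.cong)
  fix v assume "v : verts G"
  hence "inj_on F v" using inj_on_subset[OF inj vert_subset[OF assms(1)]] by blast
  thus "card (F ` v) - 3 = card v - 3" by (simp add: card_image)
 qed simp
 finally show ?thesis .
qed

lemma Mor_codim:
 assumes "ribbon_graph G" "f : Mor G G'" "codim G = codim G'"
 shows "ribbon_iso G f G'"
 using assms Mor_iff[of G f G'] collapses_facts[of G] codim_iso by metis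

section \<open>Oriented ribbon graphs\<close>

definition ograph :: "'h ograph => bool" where
 "ograph x \<longleftrightarrow> ribbon_graph (fst x) & snd x : orientations (cells (fst x))"

lemma ographs_iff: "x : ographs n \<longleftrightarrow> ograph x & codim (fst x) = n"
 by (auto simp: ographs_def ograph_def)

lemma finite_cells: "ribbon_graph G ==> finite (cells G)"
 using finite_halves finite_verts by (auto simp: cells_def)

lemma word_extend:
 assumes "ribbon_graph G" "distinct u" "set u <= cells G"
 obtains w where "is_word G (u @ w)"
proof -
 obtain w where "set w = cells G - set u" "distinct w"
  using finite_cells[OF assms(1)] finite_distinct_list[of "cells G - set u"] by auto
 thus ?thesis using that[of w] assms by (auto simp: is_word_def)
qed

lemma word_length: assumes "ribbon_graph G" "is_word G w" shows "length w \<ge> 2"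
proof -
 obtain v where v: "v : verts G" using assms(1) by (auto simp: ribbon_graph_def connected_graph_def)
 then obtain h where h: "h : v" using vert_other[OF assms(1)] by blast
 hence "{Inl v, Inr h} <= set w"
  using assms v vert_subset[OF assms(1) v] by (auto simp: is_word_def cells_def)
 hence "card {Inl v, Inr h :: 'a cell} \<le> card (set w)" by (intro card_mono) auto
 thus ?thesis using card_length[of w] by simp
qed

lemma ograph_flip: "ograph x ==> is_word (fst x) w ==> EX b. snd x = flip (fst x) b (word_orient (fst x) w)"
 using word_orient_cases by (auto simp: ograph_def)

lemma ograph_word: assumes "ograph x" obtains w where "is_word (fst x) w" "snd x = word_orient (fst x) w"
proof -
 have r: "ribbon_graph (fst x)" using assms by (simp add: ograph_def)
 obtain w where w: "is_word (fst x) w" using word_extend[OF r, of "[]"] by auto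
 obtain b where b: "snd x = flip (fst x) b (word_orient (fst x) w)" using ograph_flip[OF assms w] by blast
 obtain y z q where yz: "w = y # z # q" using word_length[OF r w] by (cases w rule: remdups_adj.cases) auto
 have "rearr w (z # y # q) True" using rearr_swap1[of "[]" y z q] yz by simp
 from word_orient_rearr[OF this w] show ?thesis using that w b by (cases b) auto
qed

lemma ograph_orev: assumes "ograph x" shows "ograph (orev x)"
proof -
 have r: "ribbon_graph (fst x)" using assms by (simp add: ograph_def)
 obtain w where "is_word (fst x) w" using word_extend[OF r, of "[]"] by auto
 from flip_in_orientations[OF this word_length[OF r this]] show ?thesis
  using assms by (simp add: ograph_def orev_flip)
qed

lemma fst_orev [simp]: "fst (orev x) = fst x" by (simp add: orev_def)
lemma snd_orev: "snd (orev x) = flip (fst x) True (snd x)" by (simp add: orev_flip)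

lemma orev_orev [simp]: "ograph x ==> orev (orev x) = x"
 using orientations_subset[of "snd x" "fst x"]
 by (auto simp: orev_flip flip_flip ograph_def)

lemma orev_neq: assumes "ograph x" shows "orev x ~= x"
proof
 assume *: "orev x = x"
 obtain w where w: "is_word (fst x) w" "snd x = word_orient (fst x) w" using ograph_word[OF assms] .
 thus False using word_orient_flip_inj[OF w(1), of True False] * by (metis flip_False snd_orev)
qed

lemma orev_ographs: "x : ographs n ==> orev x : ographs n"
 by (simp add: ographs_iff ograph_orev)

lemma ograph_cases: assumes "ograph x" "ograph y" "fst x = fst y" shows "x = y \<or> x = orev y"
proof -
 obtain w where w: "is_word (fst y) w" "snd y = word_orient (fst y) w" using ograph_word[OF assms(2)] .
 obtain b where "snd x = flip (fst y) b (snd y)" using ograph_flip[OF assms(1), of w] w assms(3) by auto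
 thus ?thesis using assms(3) by (cases b) (auto simp: orev_flip prod_eq_iff)
qed

lemma word_map:
 assumes G: "ribbon_graph G" and f: "ribbon_iso G f G'" and w: "is_word G w"
 shows "is_word G' (map (cell_map f) w)"
proof -
 obtain F where F: "f = pm (halves G) F" "rib_bij G F G'" using ribbon_iso_iff[OF G] f by blast
 have inj: "inj_on F (halves G)" and im: "F ` halves G = halves G'" and vs: "(`) F ` verts G = verts G'"
  using F(2) by (auto simp only: rib_bij_def bij_betw_def)
 have cm: "cell_map f (Inl v) = Inl (F ` v)" if "v : verts G" for v
  using img_pm[OF vert_subset[OF G that]] by (simp add: cell_map_def F(1))
 have cm': "cell_map f (Inr h) = Inr (F h)" if "h : halves G" for h
  using that by (simp add: cell_map_def F(1))
 have "inj_on (cell_map f) (cells G)"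
 proof (rule inj_onI)
  fix c d assume cd: "c : cells G" "d : cells G" "cell_map f c = cell_map f d"
  show "c = d"
  proof (cases c; cases d)
   fix u v assume uv: "c = Inl u" "d = Inl v"
   hence "u : verts G" "v : verts G" using cd by (auto simp: cells_def)
   thus "c = d" using uv cd cm inj_on_image_eq_iff[OF inj vert_subset[OF G] vert_subset[OF G]] by simp
  next
   fix h k assume hk: "c = Inr h" "d = Inr k"
   hence "h : halves G" "k : halves G" using cd by (auto simp: cells_def)
   thus "c = d" using hk cd cm' inj by (auto dest: inj_onD)
  qed (use cd in \<open>auto simp: cell_map_def\<close>)
 qed
 moreover have "cell_map f ` cells G = cells G'"
 proof -
  have "cell_map f ` Inl ` verts G = Inl ` (`) F ` verts G" using cm by (force simp: image_iff)
  moreover have "cell_map f ` Inr ` halves G = Inr ` F ` halves G" using cm' by (force simp: image_iff)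
  ultimately show ?thesis unfolding cells_def image_Un im vs by simp
 qed
 ultimately show ?thesis using w by (simp add: is_word_def distinct_map)
qed

lemma oriented_iso_word:
 assumes "oriented_iso x f y" "ribbon_graph (fst x)" "is_word (fst x) w"
  "snd x = flip (fst x) b (word_orient (fst x) w)"
 shows "snd y = flip (fst y) b (word_orient (fst y) (map (cell_map f) w))"
proof -
 obtain u where iso: "ribbon_iso (fst x) f (fst y)" and u: "is_word (fst x) u" "snd x = word_orient (fst x) u"
  "snd y = word_orient (fst y) (map (cell_map f) u)" using assms(1) by (auto simp: oriented_iso_def)
 obtain c where c: "rearr u w c" using rearr_exists_set[of u w] u(1) assms(3) by (auto simp: is_word_def)
 have 1: "word_orient (fst x) w = flip (fst x) c (snd x)" using word_orient_rearr[OF c u(1)] u(2) by simp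
 have "flip (fst x) False (word_orient (fst x) u) = flip (fst x) (b ~= c) (word_orient (fst x) u)"
  using assms(4) u(2) 1 by (simp add: flip_flip[OF word_orient_subset])
 hence "b = c" using word_orient_flip_inj[OF u(1)] by blast
 moreover have "word_orient (fst y) (map (cell_map f) w) = flip (fst y) c (snd y)"
  using word_orient_rearr[OF rearr_map[OF c] word_map[OF assms(2) iso u(1)]] u(3) by simp
 ultimately show ?thesis using u(3) by (simp add: flip_flip[OF word_orient_subset])
qed

lemma oriented_isoI:
 assumes "ribbon_iso (fst x) f (fst y)" "ograph x" "is_word (fst x) w"
  "snd x = flip (fst x) b (word_orient (fst x) w)"
  "snd y = flip (fst y) b (word_orient (fst y) (map (cell_map f) w))"
 shows "oriented_iso x f y"
proof -
 obtain u where u: "is_word (fst x) u" "snd x = word_orient (fst x) u" using ograph_word[OF assms(2)] .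
 have r: "ribbon_graph (fst x)" using assms(2) by (simp add: ograph_def)
 obtain c where c: "rearr w u c" using rearr_exists_set[of w u] u(1) assms(3) by (auto simp: is_word_def)
 have "flip (fst x) b (word_orient (fst x) w) = flip (fst x) c (word_orient (fst x) w)"
  using word_orient_rearr[OF c assms(3)] u(2) assms(4) by simp
 hence "b = c" using word_orient_flip_inj[OF assms(3)] by blast
 moreover have "word_orient (fst y) (map (cell_map f) u) = flip (fst y) c (word_orient (fst y) (map (cell_map f) w))"
  using word_orient_rearr[OF rearr_map[OF c] word_map[OF r assms(1,3)]] by simp
 ultimately show ?thesis using assms(1,5) u unfolding oriented_iso_def by auto
qed

lemma oriented_isoD: "oriented_iso x f y ==> ribbon_iso (fst x) f (fst y)" by (simp add: oriented_iso_def)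

lemma cell_map_idm:
 assumes G: "ribbon_graph G" and w: "is_word G w"
 shows "map (cell_map (idm G)) w = w"
proof (rule map_idI)
 fix c assume "c : set w"
 hence c: "c : cells G" using w by (simp add: is_word_def)
 show "cell_map (idm G) c = c"
 proof (cases c)
  case (Inl v)
  hence "v : verts G" using c by (auto simp: cells_def)
  thus ?thesis using img_pm[OF vert_subset[OF G], of v "%h. h"] Inl by (simp add: cell_map_def)
 next
  case (Inr h)
  thus ?thesis using c by (auto simp: cells_def cell_map_def)
 qed
qed

lemma oriented_iso_refl: assumes "ograph x" shows "oriented_iso x (idm (fst x)) x"
proof -
 obtain w where w: "is_word (fst x) w" "snd x = word_orient (fst x) w" using ograph_word[OF assms] .
 have r: "ribbon_graph (fst x)" using assms by (simp add: ograph_def)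
 show ?thesis unfolding oriented_iso_def using w ribbon_iso_refl[OF r] cell_map_idm[OF r w(1)] by auto
qed

lemma cell_map_comp:
 assumes G: "ribbon_graph G" and f: "ribbon_iso G f G'" and w: "is_word G w"
 shows "map (cell_map (g o_m f)) w = map (cell_map g) (map (cell_map f) w)"
proof -
 have "cell_map (g o_m f) c = cell_map g (cell_map f c)" if "c : set w" for c
 proof (cases c)
  case (Inr h)
  hence "h : dom f" using that w ribbon_isoD(1)[OF f] by (auto simp: is_word_def cells_def)
  thus ?thesis using Inr by (auto simp: cell_map_def)
 qed (simp add: cell_map_def img_comp)
 thus ?thesis by simp
qed

lemma oriented_iso_comp:
 assumes x: "ograph x" and y: "ograph y" and f: "oriented_iso x f y" and g: "oriented_iso y g z"
 shows "oriented_iso x (g o_m f) z"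
proof -
 obtain w where iso: "ribbon_iso (fst x) f (fst y)" and w: "is_word (fst x) w" "snd x = word_orient (fst x) w"
  "snd y = word_orient (fst y) (map (cell_map f) w)" using f by (auto simp: oriented_iso_def)
 have r: "ribbon_graph (fst x)" "ribbon_graph (fst y)" using x y by (simp_all add: ograph_def)
 have "snd z = word_orient (fst z) (map (cell_map g) (map (cell_map f) w))"
  using oriented_iso_word[OF g r(2) word_map[OF r(1) iso w(1)], of False] w(3) by simp
 thus ?thesis unfolding oriented_iso_def
  using ribbon_iso_comp[OF iso oriented_isoD[OF g]] w cell_map_comp[OF r(1) iso w(1)] by metis
qed

lemma oriented_iso_orev:
 assumes x: "ograph x" and f: "oriented_iso x f y"
 shows "oriented_iso (orev x) f (orev y)"
proof -
 obtain w where iso: "ribbon_iso (fst x) f (fst y)" and w: "is_word (fst x) w" "snd x = word_orient (fst x) w"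
  "snd y = word_orient (fst y) (map (cell_map f) w)" using f by (auto simp: oriented_iso_def)
 show ?thesis
  by (rule oriented_isoI[of _ _ _ w True]) (use iso w ograph_orev[OF x] in \<open>auto simp: snd_orev\<close>)
qed

lemma oriented_iso_unique:
 assumes "ograph x" "oriented_iso x f y" "oriented_iso x f z" "fst y = fst z" shows "y = z"
proof -
 obtain w where w: "is_word (fst x) w" "snd x = word_orient (fst x) w" using ograph_word[OF assms(1)] .
 have r: "ribbon_graph (fst x)" using assms(1) by (simp add: ograph_def)
 show ?thesis
  using oriented_iso_word[OF assms(2) r w(1), of False] oriented_iso_word[OF assms(3) r w(1), of False] w(2) assms(4)
  by (simp add: prod_eq_iff)
qed

lemma oriented_iso_dichotomy:
 assumes x: "ograph x" and y: "ograph y" and f: "ribbon_iso (fst x) f (fst y)"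
 shows "oriented_iso x f y \<or> oriented_iso x f (orev y)"
proof -
 obtain w where w: "is_word (fst x) w" "snd x = word_orient (fst x) w" using ograph_word[OF x] .
 have r: "ribbon_graph (fst x)" using x by (simp add: ograph_def)
 define z where "z = (fst y, word_orient (fst y) (map (cell_map f) w))"
 have w': "is_word (fst y) (map (cell_map f) w)" by (rule word_map[OF r f w(1)])
 have z: "ograph z" using y word_orient_in[OF w'] by (simp add: z_def ograph_def)
 have "oriented_iso x f z" unfolding oriented_iso_def z_def using f w by auto
 thus ?thesis using ograph_cases[OF z y] by (auto simp: z_def)
qed

lemma oriented_iso_inv:
 assumes x: "ograph x" and y: "ograph y" and f: "oriented_iso x f y"
 shows "oriented_iso y (minv f) x"
proof -
 have r: "ribbon_graph (fst x)" "ribbon_graph (fst y)" using x y by (simp_all add: ograph_def)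
 note iso = oriented_isoD[OF f]
 note inv = ribbon_iso_inv[OF r iso]
 have id: "minv f o_m f = idm (fst x)" using minv_comp[of f] ribbon_isoD[OF iso] by simp
 have "\<not> oriented_iso y (minv f) (orev x)"
 proof
  assume "oriented_iso y (minv f) (orev x)"
  hence "oriented_iso x (idm (fst x)) (orev x)" using oriented_iso_comp[OF x y f] id by metis
  hence "x = orev x" by (rule oriented_iso_unique[OF x oriented_iso_refl[OF x]]) simp
  thus False using orev_neq[OF x] by simp
 qed
 thus ?thesis using oriented_iso_dichotomy[OF y x inv] by blast
qed

lemma finite_Aut: assumes "ribbon_graph G" shows "finite {f. ribbon_iso G f G'}"
proof (cases "EX f. ribbon_iso G f G'")
 case True
 have "{f. ribbon_iso G f G'} <= {f. dom f = halves G & ran f <= halves G'}"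
  using ribbon_isoD(1,2) by blast
 moreover have "finite (halves G')"
 proof -
  obtain f where f: "ribbon_iso G f G'" using True by blast
  have "finite (dom f)" using ribbon_isoD(1)[OF f] finite_halves[OF assms] by simp
  thus ?thesis using ribbon_isoD(2)[OF f] finite_ran by metis
 qed
 ultimately show ?thesis
  using finite_set_of_finite_maps[OF finite_halves[OF assms]] finite_subset by blast
qed auto

section \<open>The orientation of a collapsed graph\<close>

context nonloop
begin

abbreviation "pre w \<equiv> Inl v1 # Inl v2 # Inr a # Inr b # (w :: 'h cell list)"

lemma pre_cells: "set (pre []) <= cells G" "distinct (pre [])"
 using v halves_ab ab' by (auto simp: cells_def)

lemma word_pre_exists: obtains w where "is_word G (pre w)"
 using word_extend[OF G pre_cells(2,1)] by auto

lemma word_collapse: assumes "is_word G (pre w)" shows "is_word D (Inl M # w)"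
proof -
 have d: "distinct w" "set w = cells G - {Inl v1, Inl v2, Inr a, Inr b}"
  using assms by (auto simp: is_word_def)
 have "cells D = insert (Inl M) (cells G - {Inl v1, Inl v2, Inr a, Inr b})"
  by (auto simp: cells_def verts_collapse halves_collapse)
 moreover have "Inl M ~: set w" using d(2) M_notin by (auto simp: cells_def)
 ultimately show ?thesis using d by (simp add: is_word_def)
qed

lemma swap_pre: "rearr (pre w) (nonloop.pre b a v2 v1 w) False"
proof -
 interpret s: nonloop G b a v2 v1 by (rule swap)
 have "rearr (pre w) (Inl v2 # Inl v1 # Inr a # Inr b # w) True"
  using rearr_swap1[of "[]" "Inl v1" "Inl v2" "Inr a # Inr b # w"] by simp
 from rearr_trans[OF rearr_swap1[of "[Inl v2, Inl v1]" "Inr a" "Inr b" w], simplified, OF this]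
 show ?thesis by simp
qed

lemma tail_length: assumes "is_word G (pre w)" shows "EX x y q. w = x # y # q"
proof -
 have "n a : halves G" "n b : halves G" using n_ab v vert_subset[OF G] by auto
 hence "{Inr (n a), Inr (n b)} <= set (pre w)" using assms by (auto simp: is_word_def cells_def)
 hence "{Inr (n a), Inr (n b)} <= set w" using n_ab ab' by auto
 moreover have "n a ~= n b" using n_ab ab' by auto
 ultimately show ?thesis by (cases w rule: remdups_adj.cases) auto
qed

lemma collapse_orientI:
 assumes w: "is_word G (pre w)" and \<omega>: "\<omega> = flip G c (word_orient G (pre w))"
 shows "collapse_orient G {a, b} \<omega> (flip D c (word_orient D (Inl M # w)))"
proof -
 have main: "collapse_orient G {a, b} (word_orient G (pre u)) (word_orient D (Inl M # u))" if "is_word G (pre u)" for u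
  unfolding collapse_orient_def merged using that ab v by blast
 obtain x y q where xy: "w = x # y # q" using tail_length[OF w] by blast
 have r: "rearr w (y # x # q) True" using rearr_swap1[of "[]" x y q] xy by simp
 have "rearr (pre w) (pre (y # x # q)) True" using rearr_ctxt[OF r, of "pre []" "[]"] by simp
 note 1 = word_orient_rearr[OF this w]
 have "rearr (Inl M # w) (Inl M # y # x # q) True" by (rule rearr_Cons[OF r])
 note 2 = word_orient_rearr[OF this word_collapse[OF w]]
 show ?thesis using main[OF w] main[of "y # x # q"] 1 2 \<omega> by (cases c) auto
qed

lemma collapse_orientD:
 assumes c: "collapse_orient G {a, b} \<omega> \<omega>'" and w: "is_word G (pre w)" and \<omega>: "\<omega> = flip G p (word_orient G (pre w))"
 shows "\<omega>' = flip D p (word_orient D (Inl M # w))"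
proof -
 obtain a' b' u1 u2 u where u: "{a, b} = {a', b'}" "u1 : verts G" "u2 : verts G" "a' : u1" "b' : u2"
  "is_word G (Inl u1 # Inl u2 # Inr a' # Inr b' # u)"
  "\<omega> = word_orient G (Inl u1 # Inl u2 # Inr a' # Inr b' # u)" "\<omega>' = word_orient D (Inl M # u)"
  using c unfolding collapse_orient_def merged by blast
 have pu: "is_word G (pre u) & \<omega> = word_orient G (pre u)"
 proof (cases "a' = a")
  case True
  hence "b' = b" using u(1) ab' by (auto simp: doubleton_eq_iff)
  moreover have "u1 = v1" "u2 = v2" using vert_eq[OF G] u v ab True \<open>b' = b\<close> by blast+
  ultimately show ?thesis using u True by simp
 next
  case False
  hence 1: "a' = b" "b' = a" using u(1) by (auto simp: doubleton_eq_iff)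
  hence 2: "u1 = v2" "u2 = v1" using vert_eq[OF G] u v ab by blast+
  interpret s: nonloop G b a v2 v1 by (rule swap)
  show ?thesis using word_orient_rearr[OF s.swap_pre u(6)[unfolded 1 2]] u(7)[unfolded 1 2] by simp
 qed
 have "mset (pre u) = mset (pre w)"
  using pu w by (intro iffD1[OF set_eq_iff_mset_eq_distinct]) (auto simp: is_word_def)
 then obtain d where d: "rearr u w d" using rearr_exists[of w u] by auto
 have "rearr (pre u) (pre w) d" using rearr_ctxt[OF d, of "pre []" "[]"] by simp
 hence "word_orient G (pre w) = flip G d \<omega>" using word_orient_rearr pu by metis
 hence "word_orient G (pre u) = flip G p (flip G d (word_orient G (pre u)))"
  using \<omega> pu by metis
 hence "flip G False (word_orient G (pre u)) = flip G (p ~= d) (word_orient G (pre u))"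
  by (simp only: flip_flip[OF word_orient_subset] flip_False)
 hence "p = d" using word_orient_flip_inj pu by blast
 moreover have "word_orient D (Inl M # w) = flip D d (word_orient D (Inl M # u))"
  using word_orient_rearr[OF rearr_Cons[OF d]] word_collapse pu by blast
 ultimately show ?thesis using u(8) by (simp add: flip_flip[OF word_orient_subset])
qed

lemma ocollapse_word:
 assumes w: "is_word G (pre w)" and x: "fst x = G" and \<omega>: "snd x = flip G c (word_orient G (pre w))"
 shows "ocollapse x {a, b} = (D, flip D c (word_orient D (Inl M # w)))"
proof -
 have "(THE \<omega>'. collapse_orient G {a, b} (snd x) \<omega>') = flip D c (word_orient D (Inl M # w))"
 proof (rule the_equality)
  show "collapse_orient G {a, b} (snd x) (flip D c (word_orient D (Inl M # w)))"
   by (rule collapse_orientI[OF w \<omega>])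
  show "\<omega>' = flip D c (word_orient D (Inl M # w))" if "collapse_orient G {a, b} (snd x) \<omega>'" for \<omega>'
   by (rule collapse_orientD[OF that w \<omega>])
 qed
 thus ?thesis by (simp add: ocollapse_def x)
qed

end

lemma ocollapse_spec:
 assumes "ograph x" "e : nonloops (fst x)"
 shows "collapse_orient (fst x) e (snd x) \<omega> \<longleftrightarrow> ocollapse x e = (collapse (fst x) e, \<omega>)" "ograph (ocollapse x e)"
proof -
 have r: "ribbon_graph (fst x)" using assms(1) by (simp add: ograph_def)
 obtain a b v1 v2 where eab: "e = {a, b}" and "nonloop (fst x) a b v1 v2" using nonloopE[OF r assms(2)] by blast
 then interpret nonloop "fst x" a b v1 v2 by simp
 obtain w where w: "is_word (fst x) (pre w)" using word_pre_exists .
 obtain c where c: "snd x = flip (fst x) c (word_orient (fst x) (pre w))" using ograph_flip[OF assms(1) w] by blast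
 note o = ocollapse_word[OF w HOL.refl c]
 show "collapse_orient (fst x) e (snd x) \<omega> \<longleftrightarrow> ocollapse x e = (collapse (fst x) e, \<omega>)"
  unfolding eab o using collapse_orientI[OF w c] collapse_orientD[OF _ w c, of \<omega>]
  by (metis prod.inject)
 have "flip D c (word_orient D (Inl M # w)) : orientations (cells D)"
  using flip_in_orientations[OF word_collapse[OF w] word_length[OF collapse_ribbon word_collapse[OF w]]
   word_orient_in[OF word_collapse[OF w]]] .
 thus "ograph (ocollapse x e)" unfolding eab o using collapse_ribbon by (simp add: ograph_def)
qed

lemma fst_ocollapse [simp]: "fst (ocollapse x e) = collapse (fst x) e" by (simp add: ocollapse_def)

lemma ocollapse_orev:
 assumes "ograph x" "e : nonloops (fst x)"
 shows "ocollapse (orev x) e = orev (ocollapse x e)"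
proof -
 have r: "ribbon_graph (fst x)" using assms(1) by (simp add: ograph_def)
 obtain a b v1 v2 where eab: "e = {a, b}" and "nonloop (fst x) a b v1 v2" using nonloopE[OF r assms(2)] by blast
 then interpret nonloop "fst x" a b v1 v2 by simp
 obtain w where w: "is_word (fst x) (pre w)" using word_pre_exists .
 obtain c where c: "snd x = flip (fst x) c (word_orient (fst x) (pre w))" using ograph_flip[OF assms(1) w] by blast
 have c': "snd (orev x) = flip (fst x) (\<not> c) (word_orient (fst x) (pre w))"
  using c by (simp add: snd_orev flip_flip[OF word_orient_subset])
 show ?thesis unfolding eab ocollapse_word[OF w HOL.refl c] ocollapse_word[OF w fst_orev c']
  by (simp add: orev_flip flip_flip[OF word_orient_subset])
qed

lemma oriented_iso_collapse:
 assumes x: "ograph x" and y: "ograph y" and f: "oriented_iso x f y" and en: "e : nonloops (fst x)"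
 shows "oriented_iso (ocollapse x e) (f |` (- e)) (ocollapse y (img f e))"
proof -
 have r: "ribbon_graph (fst x)" "ribbon_graph (fst y)" using x y by (simp_all add: ograph_def)
 obtain a b v1 v2 where eab: "e = {a, b}" and N: "nonloop (fst x) a b v1 v2" using nonloopE[OF r(1) en] by blast
 then interpret nonloop "fst x" a b v1 v2 by simp
 note iso = oriented_isoD[OF f]
 obtain F where F: "f = pm (halves (fst x)) F" "rib_bij (fst x) F (fst y)" using ribbon_iso_iff[OF r(1)] iso by blast
 interpret N: nonloop "fst y" "F a" "F b" "F ` v1" "F ` v2" by (rule rib_bij_collapse(1)[OF N r(2) F(2)])
 have im: "img f e = {F a, F b}" using halves_ab by (simp add: img_pm F(1) eab)
 obtain w where w: "is_word (fst x) (pre w)" using word_pre_exists .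
 obtain c where c: "snd x = flip (fst x) c (word_orient (fst x) (pre w))" using ograph_flip[OF x w] by blast
 have cm: "map (cell_map f) (pre w) = N.pre (map (cell_map f) w)"
  using vert_subset[OF r(1)] v halves_ab by (simp add: cell_map_def F(1) img_pm)
 have w': "is_word (fst y) (N.pre (map (cell_map f) w))" using word_map[OF r(1) iso w] cm by simp
 have c': "snd y = flip (fst y) c (word_orient (fst y) (N.pre (map (cell_map f) w)))"
  using oriented_iso_word[OF f r(1) w c] cm by simp
 have ow: "ocollapse x e = (D, flip D c (word_orient D (Inl M # w)))"
  unfolding eab by (rule ocollapse_word[OF w HOL.refl c])
 have ow': "ocollapse y (img f e) = (N.D, flip N.D c (word_orient N.D (Inl N.M # map (cell_map f) w)))"
  unfolding im by (rule N.ocollapse_word[OF w' HOL.refl c'])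
 have inj: "inj_on F (halves (fst x))" using F(2) by (simp add: rib_bij_def bij_betw_def)
 have MM: "M <= halves (fst x) - {a, b}" using vert_subset[OF r(1)] v ab' by auto
 have FM: "F ` M = N.M"
  using vert_subset[OF r(1)] v inj ab inj_on_image_set_diff[OF inj, of v1 "{a}"] inj_on_image_set_diff[OF inj, of v2 "{b}"]
  by (auto simp: image_Un)
 from this have "cell_map (f |` (- e)) (Inl M) = Inl N.M"
 proof -
  have "f |` (- e) = pm (halves (fst x) - {a, b}) F"
   by (rule ext) (simp add: restrict_map_def pm_def F(1) eab)
  thus ?thesis using FM img_pm[OF MM, of F] by (simp add: cell_map_def)
 qed
 moreover have "map (cell_map (f |` (- e))) w = map (cell_map f) w"
 proof (rule map_cong[OF HOL.refl])
  fix c assume "c : set w"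
  hence c: "c : cells (fst x)" "c ~= Inl v1" "c ~= Inl v2" "c ~= Inr a" "c ~= Inr b"
   using w by (auto simp: is_word_def)
  show "cell_map (f |` (- e)) c = cell_map f c"
  proof (cases c)
   case (Inl u)
   hence "u : verts (fst x)" "u ~= v1" "u ~= v2" using c by (auto simp: cells_def)
   hence "u \<inter> e = {}" using M_disjoint[of u] ab eab by blast
   thus ?thesis using Inl by (auto simp: cell_map_def img_def restrict_map_def)
  qed (use c in \<open>auto simp: cell_map_def eab restrict_map_def\<close>)
 qed
 ultimately have cm': "map (cell_map (f |` (- e))) (Inl M # w) = Inl N.M # map (cell_map f) w" by simp
 show ?thesis
 proof (rule oriented_isoI[of _ _ _ "Inl M # w" c])
  show "ribbon_iso (fst (ocollapse x e)) (f |` (- e)) (fst (ocollapse y (img f e)))"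
   using ribbon_iso_collapse(2)[OF r iso en] by simp
  show "ograph (ocollapse x e)" by (rule ocollapse_spec(2)[OF x en])
  show "is_word (fst (ocollapse x e)) (Inl M # w)" using word_collapse[OF w] ow by simp
  show "snd (ocollapse x e) = flip (fst (ocollapse x e)) c (word_orient (fst (ocollapse x e)) (Inl M # w))"
   by (simp add: ow)
  show "snd (ocollapse y (img f e)) = flip (fst (ocollapse y (img f e))) c
   (word_orient (fst (ocollapse y (img f e))) (map (cell_map (f |` (- e))) (Inl M # w)))"
   unfolding cm' by (simp add: ow')
 qed
qed

section \<open>Collapsing two edges in either order\<close>

lemma ribbon_eqI: "halves G = halves G' ==> edges G = edges G' ==> verts G = verts G' ==> nxt G = nxt G' ==>
 G = (G' :: 'h ribbon)" by simp

text \<open>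
 Two disjoint edges: write the orientation as a word that starts with the ends and half-edges of both. These
 two blocks have even length and can be exchanged freely, but each collapse replaces a block by one letter,
 and the two letters for the merged vertices come out in opposite orders.
\<close>

lemma ocollapse_commute_disjoint:
 assumes x: "ograph x" and A: "nonloop (fst x) a b v1 v2" and C: "nonloop (fst x) c d v3 v4"
  and dis: "{v1, v2} \<inter> {v3, v4} = {}"
 shows "{a, b} : nonloops (collapse (fst x) {c, d})"
  "ocollapse (ocollapse x {c, d}) {a, b} = orev (ocollapse (ocollapse x {a, b}) {c, d})"
proof -
 let ?G = "fst x"
 interpret A: nonloop ?G a b v1 v2 by (rule A)
 interpret C: nonloop ?G c d v3 v4 by (rule C)
 have vd: "v1 \<inter> v3 = {}" "v1 \<inter> v4 = {}" "v2 \<inter> v3 = {}" "v2 \<inter> v4 = {}"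
  using vert_disjoint[OF A.G A.v(1) C.v(1)] vert_disjoint[OF A.G A.v(1) C.v(2)]
   vert_disjoint[OF A.G A.v(2) C.v(1)] vert_disjoint[OF A.G A.v(2) C.v(2)] dis by fastforce+
 have ne: "a ~= c" "a ~= d" "b ~= c" "b ~= d" "{a, b} ~= {c, d}" using vd A.ab C.ab by auto
 interpret AC: nonloop A.D c d v3 v4
  using A.collapse_ribbon C.e C.v C.ab dis ne by unfold_locales (auto simp: A.edges_collapse A.verts_collapse)
 interpret CA: nonloop C.D a b v1 v2
  using C.collapse_ribbon A.e A.v A.ab dis ne by unfold_locales (auto simp: C.edges_collapse C.verts_collapse)
 show "{a, b} : nonloops (collapse ?G {c, d})" by (rule CA.in_nonloops)
 have nn: "A.n a ~= c" "A.n a ~= d" "A.n b ~= c" "A.n b ~= d" "A.n c ~= a" "A.n c ~= b" "A.n d ~= a" "A.n d ~= b"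
  using A.n_ab C.n_ab A.ab C.ab vd by blast+
 have eq: "CA.D = AC.D"
 proof (rule ribbon_eqI)
  show "nxt CA.D = nxt AC.D"
  proof
   fix h show "nxt CA.D h = nxt AC.D h"
   proof (cases "h : halves ?G - {a, b, c, d}")
    case True
    thus ?thesis using nn ne A.halves_ab C.halves_ab A.ab' C.ab'
    by (simp add: AC.nxt_collapse CA.nxt_collapse A.nxt_collapse C.nxt_collapse A.halves_collapse C.halves_collapse)
   next
    case False
    hence 1: "h ~: halves A.D - {c, d}" and 2: "h ~: halves C.D - {a, b}"
    by (auto simp: A.halves_collapse C.halves_collapse)
    show ?thesis unfolding AC.nxt_collapse_outside[OF 1] CA.nxt_collapse_outside[OF 2] ..
   qed
  qed
  have "A.M ~= v3" "A.M ~= v4" "C.M ~= v1" "C.M ~= v2" using A.M_notin C.M_notin A.v C.v by metis+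
  hence "verts AC.D = insert C.M (insert A.M (verts ?G - {v1, v2} - {v3, v4}))"
   "verts CA.D = insert A.M (insert C.M (verts ?G - {v3, v4} - {v1, v2}))"
   unfolding AC.verts_collapse CA.verts_collapse A.verts_collapse C.verts_collapse
   by (simp_all add: insert_Diff_if)
  moreover have "verts ?G - {v1, v2} - {v3, v4} = verts ?G - {v3, v4} - {v1, v2}" by blast
  ultimately show "verts CA.D = verts AC.D" using insert_commute by metis
 qed (auto simp: AC.halves_collapse CA.halves_collapse A.halves_collapse C.halves_collapse
   AC.edges_collapse CA.edges_collapse A.edges_collapse C.edges_collapse)
 have "distinct [Inl v1, Inl v2, Inr a, Inr b, Inl v3, Inl v4, Inr c, Inr d :: 'a cell]"
  using A.ab' C.ab' ne dis A.v C.v by auto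
 then obtain r where r: "is_word ?G ([Inl v1, Inl v2, Inr a, Inr b, Inl v3, Inl v4, Inr c, Inr d] @ r)"
  by (rule word_extend[OF A.G]) (use A.pre_cells(1) C.pre_cells(1) in auto)
 hence wA: "is_word ?G (A.pre (C.pre r))" by simp
 obtain p where p: "snd x = flip ?G p (word_orient ?G (A.pre (C.pre r)))" using ograph_flip[OF x wA] by blast
 have blk: "rearr (A.pre (C.pre r)) (C.pre (A.pre r)) False"
  using rearr_ctxt[OF rearr_blocks[of "A.pre []" "C.pre []"], of "[]" r] by simp
 note wC = word_orient_rearr[OF blk wA]
 have p': "snd x = flip ?G p (word_orient ?G (C.pre (A.pre r)))" using p wC by simp
 have m1: "rearr (Inl A.M # C.pre r) (C.pre (Inl A.M # r)) False"
  using rearr_ctxt[OF rearr_blocks[of "[Inl A.M]" "C.pre []"], of "[]" r] by simp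
 have m2: "rearr (Inl C.M # A.pre r) (A.pre (Inl C.M # r)) False"
  using rearr_ctxt[OF rearr_blocks[of "[Inl C.M]" "A.pre []"], of "[]" r] by simp
 note q1 = word_orient_rearr[OF m1 A.word_collapse[OF wA]]
 note q2 = word_orient_rearr[OF m2 C.word_collapse[OF conjunct1[OF wC]]]
 have s1: "ocollapse x {a, b} = (A.D, flip A.D p (word_orient A.D (C.pre (Inl A.M # r))))"
  using A.ocollapse_word[OF wA HOL.refl p] q1 by simp
 have s2: "ocollapse x {c, d} = (C.D, flip C.D p (word_orient C.D (A.pre (Inl C.M # r))))"
  using C.ocollapse_word[OF conjunct1[OF wC] HOL.refl p'] q2 by simp
 have t1: "ocollapse (ocollapse x {a, b}) {c, d} = (AC.D, flip AC.D p (word_orient AC.D (Inl C.M # Inl A.M # r)))"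
  by (rule AC.ocollapse_word) (use q1 s1 in auto)
 have t2: "ocollapse (ocollapse x {c, d}) {a, b} = (AC.D, flip AC.D p (word_orient AC.D (Inl A.M # Inl C.M # r)))"
  unfolding eq[symmetric] by (rule CA.ocollapse_word) (use q2 s2 in auto)
 have wf: "is_word AC.D (Inl C.M # Inl A.M # r)" by (rule AC.word_collapse) (use q1 in auto)
 have "word_orient AC.D (Inl A.M # Inl C.M # r) = flip AC.D True (word_orient AC.D (Inl C.M # Inl A.M # r))"
  using word_orient_rearr[OF rearr_swap1[of "[]" "Inl C.M" "Inl A.M" r], simplified, OF wf] by simp
 thus "ocollapse (ocollapse x {c, d}) {a, b} = orev (ocollapse (ocollapse x {a, b}) {c, d})"
  unfolding t1 t2 by (auto simp: orev_flip flip_flip[OF word_orient_subset])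
qed

text \<open>
 Two edges with one common vertex merge three vertices into one. The sign comes from bringing the letters of
 the second edge to the front, either before or after the first collapse.
\<close>

lemma ocollapse_commute_adjacent:
 assumes x: "ograph x" and A: "nonloop (fst x) a b v1 v2" and C: "nonloop (fst x) c d v2 v3"
  and v13: "v1 ~= v3" and bc: "b ~= c"
 shows "{a, b} : nonloops (collapse (fst x) {c, d})"
  "ocollapse (ocollapse x {c, d}) {a, b} = orev (ocollapse (ocollapse x {a, b}) {c, d})"
proof -
 let ?G = "fst x"
 interpret A: nonloop ?G a b v1 v2 by (rule A)
 interpret C: nonloop ?G c d v2 v3 by (rule C)
 have vd: "v1 \<inter> v3 = {}" "v1 \<inter> v2 = {}" "v2 \<inter> v3 = {}"
  using vert_disjoint[OF A.G A.v(1) C.v(2) v13] A.ab' C.ab' by simp_all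
 have ne: "a ~= c" "a ~= d" "b ~= c" "b ~= d" "{a, b} ~= {c, d}" using vd A.ab C.ab bc by auto
 have MA: "c : A.M" "A.M ~= v3" and MC: "b : C.M" "C.M ~= v1"
  using A.M_notin C.M_notin A.v C.v C.ab A.ab bc by auto
 interpret AC: nonloop A.D c d A.M v3
  using A.collapse_ribbon C.e C.v C.ab v13 ne MA by unfold_locales (auto simp: A.edges_collapse A.verts_collapse)
 interpret CA: nonloop C.D a b v1 C.M
  using C.collapse_ribbon A.e A.v A.ab v13 ne MC by unfold_locales (auto simp: C.edges_collapse C.verts_collapse)
 show "{a, b} : nonloops (collapse ?G {c, d})" by (rule CA.in_nonloops)
 have nn: "A.n a ~= c" "A.n a ~= d" "A.n b ~= d" "A.n c ~= a" "A.n d ~= a" "A.n d ~= b"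
  using A.n_ab C.n_ab A.ab C.ab vd by blast+
 have M3: "AC.M = CA.M" using vd A.ab C.ab ne by auto
 have eq: "CA.D = AC.D"
 proof (rule ribbon_eqI)
  show "nxt CA.D = nxt AC.D"
  proof
   fix h show "nxt CA.D h = nxt AC.D h"
   proof (cases "h : halves ?G - {a, b, c, d}")
    case True
    thus ?thesis using nn ne A.halves_ab C.halves_ab A.ab' C.ab'
    by (simp add: AC.nxt_collapse CA.nxt_collapse A.nxt_collapse C.nxt_collapse A.halves_collapse C.halves_collapse)
   next
    case False
    hence 1: "h ~: halves A.D - {c, d}" and 2: "h ~: halves C.D - {a, b}"
    by (auto simp: A.halves_collapse C.halves_collapse)
    show ?thesis unfolding AC.nxt_collapse_outside[OF 1] CA.nxt_collapse_outside[OF 2] ..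
   qed
  qed
  have 1: "verts AC.D = insert AC.M (verts ?G - {v1, v2, v3})"
   using A.M_notin by (auto simp only: AC.verts_collapse A.verts_collapse)
  have 2: "verts CA.D = insert CA.M (verts ?G - {v1, v2, v3})"
   using C.M_notin by (auto simp only: CA.verts_collapse C.verts_collapse)
  show "verts CA.D = verts AC.D" unfolding 1 2 M3 ..
 qed (auto simp: AC.halves_collapse CA.halves_collapse A.halves_collapse C.halves_collapse
   AC.edges_collapse CA.edges_collapse A.edges_collapse C.edges_collapse)
 have "distinct [Inl v1, Inl v2, Inr a, Inr b, Inl v3, Inr c, Inr d :: 'a cell]"
  using A.ab' C.ab' ne v13 A.v C.v by auto
 then obtain r where r: "is_word ?G ([Inl v1, Inl v2, Inr a, Inr b, Inl v3, Inr c, Inr d] @ r)"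
  by (rule word_extend[OF A.G]) (use A.pre_cells(1) C.pre_cells(1) in auto)
 let ?wA = "A.pre (Inl v3 # Inr c # Inr d # r)" and ?wC = "C.pre (Inl v1 # Inr a # Inr b # r)"
 have wA: "is_word ?G ?wA" using r by simp
 obtain p where p: "snd x = flip ?G p (word_orient ?G ?wA)" using ograph_flip[OF x wA] by blast
 \<comment> \<open>Move \<open>v1\<close> behind \<open>v2 a b v3 c d\<close>, then \<open>a b\<close> behind \<open>v3 c d v1\<close>: both even.\<close>
 have "rearr ?wA (Inl v2 # Inr a # Inr b # Inl v3 # Inr c # Inr d # Inl v1 # r) False"
  using rearr_ctxt[OF rearr_blocks[of "[Inl v1]" "[Inl v2, Inr a, Inr b, Inl v3, Inr c, Inr d]"], of "[]" r] by simp
 from rearr_trans[OF _ this] rearr_ctxt[OF rearr_blocks[of "[Inr a, Inr b]" "[Inl v3, Inr c, Inr d, Inl v1]"], of "[Inl v2]" r]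
 have blk: "rearr ?wA ?wC False" by simp
 note wC = word_orient_rearr[OF blk wA]
 have p': "snd x = flip ?G p (word_orient ?G ?wC)" using p wC by simp
 let ?uC = "Inl C.M # Inl v1 # Inr a # Inr b # r"
 have m2: "rearr ?uC (CA.pre r) True" using rearr_swap1[of "[]" "Inl C.M" "Inl v1" "Inr a # Inr b # r"] by simp
 note q2 = word_orient_rearr[OF m2 C.word_collapse[OF conjunct1[OF wC]]]
 have s1: "ocollapse x {a, b} = (A.D, flip A.D p (word_orient A.D (AC.pre r)))"
  using A.ocollapse_word[OF wA HOL.refl p] by simp
 have s2: "ocollapse x {c, d} = (C.D, flip C.D (\<not> p) (word_orient C.D (CA.pre r)))"
  using C.ocollapse_word[OF conjunct1[OF wC] HOL.refl p'] q2 by (simp add: flip_flip[OF word_orient_subset])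
 have t1: "ocollapse (ocollapse x {a, b}) {c, d} = (AC.D, flip AC.D p (word_orient AC.D (Inl AC.M # r)))"
  by (rule AC.ocollapse_word) (use A.word_collapse[OF wA] s1 in auto)
 have t2: "ocollapse (ocollapse x {c, d}) {a, b} = (AC.D, flip AC.D (\<not> p) (word_orient AC.D (Inl AC.M # r)))"
  unfolding eq[symmetric] M3 by (rule CA.ocollapse_word) (use q2 s2 in auto)
 show "ocollapse (ocollapse x {c, d}) {a, b} = orev (ocollapse (ocollapse x {a, b}) {c, d})"
  unfolding t1 t2 by (auto simp: orev_flip flip_flip[OF word_orient_subset])
qed

text \<open>
 The two orders of collapsing a pair of edges lead to opposite orientations of the same ribbon
 graph. This is what makes the square of the boundary of the forest complex vanish.
\<close>

lemma ocollapse_commute: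
 assumes x: "ograph x" and e: "e : nonloops (fst x)" and f: "f : nonloops (collapse (fst x) e)"
 shows "f : nonloops (fst x)" "e : nonloops (collapse (fst x) f)"
  "ocollapse (ocollapse x f) e = orev (ocollapse (ocollapse x e) f)"
proof -
 let ?G = "fst x"
 let ?C = "f : nonloops (fst x) & e : nonloops (collapse (fst x) f) \<and>
  ocollapse (ocollapse x f) e = orev (ocollapse (ocollapse x e) f)"
 have r: "ribbon_graph ?G" using x by (simp add: ograph_def)
 \<comment> \<open>If one end of \<open>f\<close> lies on the merged vertex, one may name the ends so that it lies on the vertex of \<open>b\<close>.\<close>
 have adj: ?C if N: "nonloop ?G a b v1 v2" "e = {a, b}" and cd: "f = {c, d}" "c : v2" "c ~= b" "d : v3"
  "v3 : verts ?G" "v3 ~= v1" "v3 ~= v2" "f : edges ?G" for a b v1 v2 c d v3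
 proof -
  interpret nonloop ?G a b v1 v2 by (rule N(1))
  have N': "nonloop ?G c d v2 v3" using r cd v by unfold_locales auto
  from ocollapse_commute_adjacent[OF x N(1) N'] show ?thesis
   using nonloop.in_nonloops[OF N'] cd N by auto
 qed
 obtain a b v1 v2 where eab: "e = {a, b}" and N: "nonloop ?G a b v1 v2" using nonloopE[OF r e] by blast
 interpret nonloop ?G a b v1 v2 by (rule N)
 obtain c d w1 w2 where fcd: "f = {c, d}" and N2: "nonloop D c d w1 w2"
  using nonloopE[OF collapse_ribbon f[unfolded eab]] by blast
 interpret N2: nonloop D c d w1 w2 by (rule N2)
 have fe: "f : edges ?G" "f ~= e" using N2.e fcd eab by (auto simp: edges_collapse)
 have cd_ne: "c ~= a" "c ~= b" "d ~= a" "d ~= b"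
  using N2.halves_ab by (auto simp: halves_collapse)
 have mixed: ?C if "f = {p, q}" "p : M" "q : w" "w : verts ?G - {v1, v2}" "p ~= a" "p ~= b" for p q w
 proof (cases "p : v2")
  case True
  thus ?thesis using adj[OF N eab that(1) True _ that(3)] that fe by blast
 next
  case False
  hence "p : v1" using that by blast
  moreover have "e = {b, a}" using eab by auto
  ultimately show ?thesis using adj[OF swap _ that(1) _ _ that(3)] that fe by blast
 qed
 have ?C
 proof -
  consider "w1 = M" "w2 : verts ?G - {v1, v2}" | "w2 = M" "w1 : verts ?G - {v1, v2}"
   | "w1 : verts ?G - {v1, v2}" "w2 : verts ?G - {v1, v2}"
  proof -
   have w: "u = M \<or> u : verts ?G - {v1, v2}" if "u : verts D" for u
    using that unfolding verts_collapse insert_iff .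
   show thesis using w[OF N2.v(1)] w[OF N2.v(2)] N2.v(3) that by metis
  qed
  thus ?thesis
  proof cases
   case 1
   thus ?thesis using mixed[OF fcd _ N2.ab(2)] N2.ab cd_ne by blast
  next
   case 2
   have "f = {d, c}" using fcd by auto
   from mixed[OF this _ N2.ab(1)] show ?thesis using 2 N2.ab cd_ne by blast
  next
   case 3
   have N': "nonloop ?G c d w1 w2" using r 3 N2.v N2.ab fe fcd by unfold_locales auto
   from ocollapse_commute_disjoint[OF x N N'] show ?thesis
    using nonloop.in_nonloops[OF N'] 3 fcd eab by auto
  qed
 qed
 thus "f : nonloops (fst x)" "e : nonloops (collapse (fst x) f)"
  "ocollapse (ocollapse x f) e = orev (ocollapse (ocollapse x e) f)" by blast+
qed

section \<open>Overgraphs and expansions\<close>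

lemma overgraphs_iff: "(x, f) : overgraphs G0 k \<longleftrightarrow> x : ographs k & f : Mor (fst x) G0"
 by (simp add: overgraphs_def)

lemma ographD: "x : ographs k ==> ograph x" "x : ographs k ==> ribbon_graph (fst x)"
 by (auto simp: ographs_iff ograph_def)

lemma over_relI: "(x, f) : overgraphs G0 k ==> (y, g) : overgraphs G0 k ==> oriented_iso x A y ==> g o_m A = f ==>
 ((x, f), (y, g)) : over_rel G0 k"
 by (auto simp: over_rel_def)

lemma equiv_over_rel: "equiv (overgraphs G0 k) (over_rel G0 k)"
proof (rule equivI)
 show "over_rel G0 k <= overgraphs G0 k \<times> overgraphs G0 k" by (auto simp: over_rel_def)
 show "refl_on (overgraphs G0 k) (over_rel G0 k)"
 proof (rule refl_onI)
  fix z assume z: "z : overgraphs G0 k"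
  obtain x f where xf: "z = (x, f)" by (cases z)
  hence x: "x : ographs k" "f : Mor (fst x) G0" using z by (auto simp: overgraphs_iff)
  have "f o_m idm (fst x) = f" by (rule comp_idm[OF Mor_facts(1)[OF ographD(2)[OF x(1)] x(2)]])
  with z xf oriented_iso_refl[OF ographD(1)[OF x(1)]] show "(z, z) : over_rel G0 k"
   using over_relI by metis
 qed
 show "sym (over_rel G0 k)"
 proof (rule symI)
  fix z z' assume "(z, z') : over_rel G0 k"
  then obtain x f y g A where z: "z = (x, f)" "z' = (y, g)" "(x, f) : overgraphs G0 k" "(y, g) : overgraphs G0 k"
   "oriented_iso x A y" "g o_m A = f" by (auto simp: over_rel_def)
  hence xy: "x : ographs k" "y : ographs k" "g : Mor (fst y) G0" by (auto simp: overgraphs_iff)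
  have "f o_m minv A = g o_m (A o_m minv A)" using z(6) by (simp add: map_comp_assoc[symmetric])
  also have "... = g" unfolding comp_minv
   using Mor_facts(1)[OF ographD(2)[OF xy(2)] xy(3)] ribbon_isoD(2)[OF oriented_isoD[OF z(5)]] by (intro comp_idm) simp
  finally show "(z', z) : over_rel G0 k"
   using z xy oriented_iso_inv[OF ographD(1)[OF xy(1)] ographD(1)[OF xy(2)] z(5)] by (auto intro: over_relI)
 qed
 show "trans (over_rel G0 k)"
 proof (rule transI)
  fix z z' z'' assume "(z, z') : over_rel G0 k" "(z', z'') : over_rel G0 k"
  then obtain x f y g w h A p where z: "z = (x, f)" "z' = (y, g)" "z'' = (w, h)" "(x, f) : overgraphs G0 k" "(y, g) : overgraphs G0 k"
   "(w, h) : overgraphs G0 k" "oriented_iso x A y" "g o_m A = f" "oriented_iso y p w" "h o_m p = g"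
   by (auto simp: over_rel_def)
  hence xy: "ograph x" "ograph y" by (auto simp: overgraphs_iff ographs_iff)
  have "h o_m (p o_m A) = f" using z by (simp add: map_comp_assoc[symmetric])
  thus "(z, z'') : over_rel G0 k" using z oriented_iso_comp[OF xy z(7,9)] by (auto intro: over_relI)
 qed
qed

interpretation over: antisym "overgraphs G0 k" "over_rel G0 k" over_rev for G0 k
 by unfold_locales (use equiv_over_rel in \<open>auto simp: over_rev_def overgraphs_iff orev_ographs\<close>)

lemma equiv_oiso_rel: "equiv (ographs n) (oiso_rel n)"
proof (rule equivI)
 show "oiso_rel n <= ographs n \<times> ographs n" by (auto simp: oiso_rel_def)
 show "refl_on (ographs n) (oiso_rel n)"
 proof (rule refl_onI)
  fix x assume x: "x : ographs n"
  thus "(x, x) : oiso_rel n" using oriented_iso_refl[OF ographD(1)[OF x]] by (auto simp: oiso_rel_def)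
 qed
 show "sym (oiso_rel n)"
 proof (rule symI)
  fix x y assume "(x, y) : oiso_rel n"
  then obtain f where f: "x : ographs n" "y : ographs n" "oriented_iso x f y" by (auto simp: oiso_rel_def)
  thus "(y, x) : oiso_rel n"
   using oriented_iso_inv[OF ographD(1)[OF f(1)] ographD(1)[OF f(2)] f(3)] by (auto simp: oiso_rel_def)
 qed
 show "trans (oiso_rel n)"
 proof (rule transI)
  fix x y z assume "(x, y) : oiso_rel n" "(y, z) : oiso_rel n"
  then obtain f g where f: "x : ographs n" "y : ographs n" "z : ographs n" "oriented_iso x f y" "oriented_iso y g z"
   by (auto simp: oiso_rel_def)
  thus "(x, z) : oiso_rel n"
   using oriented_iso_comp[OF ographD(1)[OF f(1)] ographD(1)[OF f(2)] f(4,5)] by (auto simp: oiso_rel_def)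
 qed
qed

interpretation oiso: antisym "ographs n" "oiso_rel n" orev for n
 by unfold_locales (use equiv_oiso_rel orev_ographs in auto)

lemma over_rel_rev:
 assumes "(z, z') : over_rel G0 k" shows "(over_rev z, over_rev z') : over_rel G0 k"
 using assms oriented_iso_orev ographD(1) over.rv_in
 unfolding over_rel_def over_rev_def overgraphs_iff by (fastforce simp: orev_ographs)

lemma over_rev_rev: "z : overgraphs G0 k ==> over_rev (over_rev z) = z"
 by (cases z) (auto simp: over_rev_def overgraphs_iff ographD)

text \<open>The one-edge expansions of \<open>x\<close>, before passing to isomorphism classes.\<close>

definition Exps :: "nat => 'h ograph => 'h overgraph set" where
 "Exps k x = {z : overgraphs (fst x) k. expands z x}"

lemma expands_iff:
 assumes "ograph y"
 shows "expands (y, g) x \<longleftrightarrow> (EX e:nonloops (fst y). oriented_iso (ocollapse y e) g x)"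
proof -
 have "expands (y, g) x \<longleftrightarrow> (EX e \<omega>. e : nonloops (fst y) \<and>
  collapse_orient (fst y) e (snd y) \<omega> & oriented_iso (collapse (fst y) e, \<omega>) g x)"
  by (simp add: expands_def)
 also have "... \<longleftrightarrow> (EX e:nonloops (fst y). EX \<omega>. ocollapse y e = (collapse (fst y) e, \<omega>) \<and>
   oriented_iso (ocollapse y e) g x)"
  using ocollapse_spec(1)[OF assms] by (metis (no_types, lifting))
 also have "... \<longleftrightarrow> (EX e:nonloops (fst y). oriented_iso (ocollapse y e) g x)"
  by (auto simp: ocollapse_def)
 finally show ?thesis .
qed

lemma ocollapse_ographs: "x : ographs k ==> e : nonloops (fst x) ==> ocollapse x e : ographs (Suc k)"
 by (auto simp: ographs_iff codim_collapse ocollapse_spec ograph_def[of x])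

lemma ocollapse_Mor:
 assumes "ograph y" "e : nonloops (fst y)" "ribbon_iso (collapse (fst y) e) g G"
 shows "g : Mor (fst y) G"
 using Mor_iff[of "fst y" g G] collapses.collapses_insert[OF assms(2) collapses.collapses_empty] assms
 by (auto simp: ograph_def)

lemma ExpsI:
 assumes "y : ographs k" "e : nonloops (fst y)" "oriented_iso (ocollapse y e) g x"
 shows "(y, g) : Exps k x"
proof -
 have "ribbon_iso (collapse (fst y) e) g (fst x)" using oriented_isoD[OF assms(3)] by simp
 from ocollapse_Mor[OF ographD(1)[OF assms(1)] assms(2) this]
 have "(y, g) : overgraphs (fst x) k" using assms(1) by (simp add: overgraphs_iff)
 moreover have "expands (y, g) x" using expands_iff[OF ographD(1)[OF assms(1)]] assms(2,3) by blast
 ultimately show ?thesis by (simp add: Exps_def)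
qed

lemma ExpsE:
 assumes "(y, g) : Exps k x"
 obtains e where "y : ographs k" "e : nonloops (fst y)" "oriented_iso (ocollapse y e) g x" "g : Mor (fst y) (fst x)"
  "dom g = halves (fst y) - e"
proof -
 have y: "y : ographs k" "g : Mor (fst y) (fst x)" "expands (y, g) x" using assms by (auto simp: Exps_def overgraphs_iff)
 then obtain e where e: "e : nonloops (fst y)" "oriented_iso (ocollapse y e) g x"
  using expands_iff[OF ographD(1)[OF y(1)]] by blast
 hence "dom g = halves (fst y) - e" using ribbon_isoD(1)[OF oriented_isoD[OF e(2)]] by (simp add: collapse_def)
 thus ?thesis using that y e by blast
qed

lemma Exps_rel:
 assumes "(z, z') : over_rel (fst x) k" "z : Exps k x" shows "z' : Exps k x"
proof -
 obtain y g y' g' A where z: "z = (y, g)" "z' = (y', g')" "y : ographs k" "y' : ographs k" "oriented_iso y A y'" "g' o_m A = g"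
  using assms(1) by (auto simp: over_rel_def overgraphs_iff)
 obtain e where e: "e : nonloops (fst y)" "oriented_iso (ocollapse y e) g x" "dom g = halves (fst y) - e"
  using ExpsE assms(2) z(1) by metis
 note o = ographD(1)[OF z(3)] ographD(1)[OF z(4)]
 note r = ographD(2)[OF z(3)] ographD(2)[OF z(4)]
 let ?e = "img A e"
 have e': "?e : nonloops (fst y')" by (rule ribbon_iso_collapse(1)[OF r oriented_isoD[OF z(5)] e(1)])
 note c = oriented_iso_collapse[OF o z(5) e(1)]
 let ?p = "A |` (- e)"
 note oc = ocollapse_spec(2)[OF o(1) e(1)] ocollapse_spec(2)[OF o(2) e']
 have inv: "oriented_iso (ocollapse y' ?e) (minv ?p) (ocollapse y e)" by (rule oriented_iso_inv[OF oc c])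
 have "oriented_iso (ocollapse y' ?e) (g o_m minv ?p) x" by (rule oriented_iso_comp[OF oc(2,1) inv e(2)])
 moreover have "g o_m minv ?p = g'"
 proof -
  have "g = g' o_m ?p"
  proof
   fix h show "g h = (g' o_m ?p) h"
   proof (cases "h : e")
    case True
    thus ?thesis using e(3) by (auto simp: domIff)
   next
    case False
    thus ?thesis using z(6) by (auto simp: map_comp_def)
   qed
  qed
  hence "g o_m minv ?p = g' o_m pm (halves (collapse (fst y') ?e)) (%h. h)"
   using ribbon_isoD(2)[OF oriented_isoD[OF c]] by (simp add: map_comp_assoc comp_minv)
  also have "... = g'"
  proof (rule comp_idm)
   have "dom g' <= halves (fst y')" using assms(1) z(2) Mor_facts(1)[OF r(2)] by (auto simp: over_rel_def overgraphs_iff)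
   moreover have "h ~: dom g'" if "h : ?e" for h
   proof -
    from that obtain l where l: "l : e" "A l = Some h" by (auto simp: img_def)
    hence "g l = g' h" using z(6) by (metis map_comp_simps(2))
    thus ?thesis using e(3) l by (auto simp: domIff)
   qed
   ultimately show "dom g' <= halves (collapse (fst y') ?e)" by (auto simp: collapse_def)
  qed
  finally show ?thesis .
 qed
 ultimately show ?thesis using ExpsI[OF z(4) e'] z(2) by simp
qed

lemma Exps_overgraphs: "z : Exps k x ==> z : overgraphs (fst x) k" by (simp add: Exps_def)

definition exrel :: "nat => 'h ograph => 'h overgraph rel" where
 "exrel k x = over_rel (fst x) k \<inter> (Exps k x \<times> Exps k x)"

lemma equiv_exrel: "equiv (Exps k x) (exrel k x)"
proof -
 note eq = equiv_over_rel[of "fst x" k]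
 show ?thesis
 proof (rule equivI)
  show "refl_on (Exps k x) (exrel k x)"
  proof (rule refl_onI)
   fix z assume z: "z : Exps k x"
   thus "(z, z) : exrel k x" using eq Exps_overgraphs[OF z] by (simp add: exrel_def equiv_def refl_on_def)
  qed
  show "sym (exrel k x)" using eq by (auto simp: exrel_def sym_def equiv_def)
  show "trans (exrel k x)" using eq unfolding exrel_def equiv_def trans_def by blast
 qed (auto simp: exrel_def)
qed

lemma expansions_eq: "expansions k x = Exps k x // exrel k x"
proof -
 have "over_rel (fst x) k `` {z} = exrel k x `` {z}" if "z : Exps k x" for z
  using that Exps_rel[of z _ x k] by (auto simp: exrel_def)
 hence "(UN z:Exps k x. {over_rel (fst x) k `` {z}}) = (UN z:Exps k x. {exrel k x `` {z}})"
  by (intro SUP_cong) auto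
 thus ?thesis unfolding expansions_def Exps_def[symmetric] quotient_def .
qed

abbreviation rep :: "'a set => 'a" where "rep c \<equiv> (SOME z. z : c)"

lemma rep_expansion:
 assumes "c : expansions k x"
 shows "rep c : Exps k x" "c = exrel k x `` {rep c}"
proof -
 obtain z where z: "z : Exps k x" "c = exrel k x `` {z}" using assms by (auto simp: expansions_eq quotient_def)
 hence "z : c" using equiv_class_self[OF equiv_exrel] by simp
 hence "rep c : c" by (rule someI)
 hence "(z, rep c) : exrel k x" using z by auto
 thus "rep c : Exps k x" "c = exrel k x `` {rep c}"
  using z(2) equiv_class_eq[OF equiv_exrel] unfolding exrel_def by blast+
qed

lemma expansion_eqI: "c : expansions k x ==> d : expansions k x ==> (rep c, rep d) : over_rel (fst x) k ==> c = d"
 using rep_expansion[of c k x] rep_expansion[of d k x] equiv_class_eq[OF equiv_exrel, of "rep c" "rep d" k x]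
 by (metis IntI SigmaI exrel_def)

lemma expansion_exists:
 assumes "z : Exps k x"
 obtains c where "c : expansions k x" "(z, rep c) : over_rel (fst x) k"
proof -
 have c: "exrel k x `` {z} : expansions k x" using assms by (auto simp: expansions_eq intro: quotientI)
 have "(z, rep (exrel k x `` {z})) : exrel k x"
  using rep_expansion(2)[OF c] rep_expansion(1)[OF c] eq_equiv_class[OF _ equiv_exrel] by metis
 thus ?thesis using that[OF c] by (auto simp: exrel_def)
qed

lemma Exps_rev: assumes x: "ograph x" and z: "z : Exps k x" shows "over_rev z : Exps k (orev x)"
proof -
 obtain y g where zy: "z = (y, g)" by (cases z)
 obtain e where e: "y : ographs k" "e : nonloops (fst y)" "oriented_iso (ocollapse y e) g x"
  using ExpsE z zy by metis
 note o = ographD(1)[OF e(1)]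
 have "oriented_iso (ocollapse (orev y) e) g (orev x)"
  unfolding ocollapse_orev[OF o e(2)] by (rule oriented_iso_orev[OF ocollapse_spec(2)[OF o e(2)] e(3)])
 thus ?thesis unfolding zy over_rev_def using ExpsI[of "orev y" k e g "orev x"] orev_ographs[OF e(1)] e(2) by simp
qed

lemma Exps_not_rev: assumes x: "ograph x" and z: "z : Exps k x" shows "over_rev z ~: Exps k x"
proof
 assume z': "over_rev z : Exps k x"
 obtain y g where zy: "z = (y, g)" by (cases z)
 obtain e where e: "y : ographs k" "e : nonloops (fst y)" "oriented_iso (ocollapse y e) g x" "dom g = halves (fst y) - e"
  using ExpsE z zy by metis
 obtain e' where e': "e' : nonloops (fst y)" "oriented_iso (ocollapse (orev y) e') g x" "dom g = halves (fst y) - e'"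
 proof -
  have "(orev y, g) : Exps k x" using z' by (simp add: zy over_rev_def)
  then obtain e' where "e' : nonloops (fst (orev y))" "oriented_iso (ocollapse (orev y) e') g x"
   "dom g = halves (fst (orev y)) - e'" by (rule ExpsE)
  thus thesis using that[of e'] by simp
 qed
 note o = ographD(1)[OF e(1)]
 have "e <= halves (fst y)" "e' <= halves (fst y)"
  using edge_subset[OF ographD(2)[OF e(1)]] e(2) e'(1) by (auto simp: nonloops_def)
 hence "e = e'" using e(4) e'(3) by auto
 hence 1: "oriented_iso (orev (ocollapse y e)) g x" using e' ocollapse_orev[OF o e(2)] by simp
 have oc: "ograph (ocollapse y e)" by (rule ocollapse_spec(2)[OF o e(2)])
 have "x = orev x"
  by (rule oriented_iso_unique[OF ograph_orev[OF oc] 1 oriented_iso_orev[OF oc e(3)]]) simp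
 thus False using orev_neq[OF x] by simp
qed

lemma Exps_iso:
 assumes x: "x : ographs (Suc k)" "x' : ographs (Suc k)" and A: "oriented_iso x A x'" and z: "(y, g) : Exps k x"
 shows "(y, A o_m g) : Exps k x'"
proof -
 obtain e where e: "y : ographs k" "e : nonloops (fst y)" "oriented_iso (ocollapse y e) g x"
  using ExpsE z by metis
 show ?thesis
  by (rule ExpsI[OF e(1,2) oriented_iso_comp[OF ocollapse_spec(2)[OF ographD(1)[OF e(1)] e(2)] ographD(1)[OF x(1)] e(3) A]])
qed

lemma Mor_iso_cancel:
 assumes y: "ribbon_graph G" and x: "ribbon_graph G0" "ribbon_graph G1" and g: "g : Mor G G0" and A: "ribbon_iso G0 A G1"
 shows "minv A o_m (A o_m g) = g"
proof -
 have "minv A o_m (A o_m g) = (minv A o_m A) o_m g" by (simp add: map_comp_assoc)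
 also have "... = g" using minv_comp[OF ribbon_isoD(3)[OF A]] ribbon_isoD(1)[OF A] Mor_facts(2)[OF y g]
  by (simp add: idm_comp)
 finally show ?thesis .
qed

text \<open>Composition with the isomorphism matches the classes of expansions.\<close>

lemma expansions_iso:
 assumes B: "comm_group B" and x: "x : ographs (Suc k)" "x' : ographs (Suc k)" and A: "oriented_iso x A x'"
  and P: "!!y g. (y, g) : Exps k x ==> P' (y, A o_m g) = P (y, g)"
  and c: "!!z. z : Exps k x' ==> P' z : carrier B"
  and inv': "!!z w. (z, w) : over_rel (fst x') k ==> P' z = P' w"
 shows "finprod B (%c. P' (rep c)) (expansions k x') = finprod B (%c. P (rep c)) (expansions k x)"
 unfolding expansions_eq
proof (rule finprod_classes_transfer[OF B equiv_exrel equiv_exrel, where t = "%(y, g). (y, A o_m g)"])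
 let ?t = "%(y, g). (y, A o_m g)"
 note o = ographD(1)[OF x(1)] ographD(1)[OF x(2)]
 note r = ographD(2)[OF x(1)] ographD(2)[OF x(2)]
 note iso = oriented_isoD[OF A]
 note inv = oriented_iso_inv[OF o A]
 show t: "?t z : Exps k x'" if "z : Exps k x" for z using Exps_iso[OF x A] that by (cases z) auto
 have cancel: "minv A o_m (A o_m g) = g" if "(y, g) : Exps k x" for y g
 proof -
  have yg: "y : ographs k" "g : Mor (fst y) (fst x)" using Exps_overgraphs[OF that] by (auto simp: overgraphs_iff)
  show ?thesis by (rule Mor_iso_cancel[OF ographD(2)[OF yg(1)] r yg(2) iso])
 qed
 show "(z, w) : exrel k x \<longleftrightarrow> (?t z, ?t w) : exrel k x'" if zw: "z : Exps k x" "w : Exps k x" for z w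
 proof -
  obtain y g y' g' where yg: "z = (y, g)" "w = (y', g')" by (cases z; cases w)
  have "g' o_m p = g \<longleftrightarrow> (A o_m g') o_m p = A o_m g" for p
   using cancel zw yg by (metis map_comp_assoc)
  thus ?thesis using zw t[OF zw(1)] t[OF zw(2)] yg
   by (auto simp: exrel_def over_rel_def dest: Exps_overgraphs)
 qed
 show "EX z:Exps k x. (?t z, w) : exrel k x'" if w: "w : Exps k x'" for w
 proof -
  obtain y g where yg: "w = (y, g)" by (cases w)
  have z: "(y, minv A o_m g) : Exps k x" using Exps_iso[OF x(2,1) inv] w yg by simp
  have "y : ographs k" "g : Mor (fst y) (fst x')" using Exps_overgraphs[OF w] yg by (auto simp: overgraphs_iff)
  hence "g : Mor (fst y) (fst x')" "ribbon_graph (fst y)" by (simp_all add: ographD(2))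
  hence "A o_m (minv A o_m g) = g"
   using comp_minv[of A] ribbon_isoD(2)[OF iso] Mor_facts(2)[of "fst y" g "fst x'"] idm_comp[of g "halves (fst x')"]
   by (simp add: map_comp_assoc[symmetric])
  thus ?thesis using z w yg equiv_exrel[of k x'] by (auto simp: equiv_def refl_on_def intro!: bexI[OF _ z])
 qed
qed (use P c inv' in \<open>auto simp: exrel_def\<close>)

lemma expansions_rev:
 assumes B: "comm_group B" and x: "x : ographs (Suc k)"
  and P: "!!z. z : Exps k x ==> P' (over_rev z) = P z"
  and c: "!!z. z : Exps k (orev x) ==> P' z : carrier B"
  and inv': "!!z w. (z, w) : over_rel (fst x) k ==> P' z = P' w"
 shows "finprod B (%c. P' (rep c)) (expansions k (orev x)) = finprod B (%c. P (rep c)) (expansions k x)"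
 unfolding expansions_eq
proof (rule finprod_classes_transfer[OF B equiv_exrel equiv_exrel, where t = over_rev])
 note o = ographD(1)[OF x]
 show t: "over_rev z : Exps k (orev x)" if "z : Exps k x" for z by (rule Exps_rev[OF o that])
 have rr: "over_rev (over_rev z) = z" if "z : Exps k x" for z using over_rev_rev Exps_overgraphs[OF that] by blast
 show "(z, w) : exrel k x \<longleftrightarrow> (over_rev z, over_rev w) : exrel k (orev x)" if zw: "z : Exps k x" "w : Exps k x" for z w
  using over_rel_rev[of z w "fst x" k] over_rel_rev[of "over_rev z" "over_rev w" "fst x" k] rr[OF zw(1)] rr[OF zw(2)]
   zw t[OF zw(1)] t[OF zw(2)] by (auto simp: exrel_def)
 show "EX z:Exps k x. (over_rev z, w) : exrel k (orev x)" if w: "w : Exps k (orev x)" for w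
 proof -
  have z: "over_rev w : Exps k x" using Exps_rev[OF ograph_orev[OF o] w] o by simp
  have "over_rev (over_rev w) = w" using over_rev_rev Exps_overgraphs[OF w] by blast
  thus ?thesis using w equiv_exrel[of k "orev x"] by (auto simp: equiv_def refl_on_def intro!: bexI[OF _ z])
 qed
qed (use P c inv' in \<open>auto simp: exrel_def\<close>)

text \<open>
 An automorphism over the collapsed graph fixes all half-edges outside the collapsed edge. Each end
 of this edge lies on a vertex with a fixed half-edge, hence it is fixed as well.
\<close>

lemma Exps_faithful:
 assumes z: "(y, g) : Exps k x" and A: "ribbon_iso (fst y) A (fst y)" "g o_m A = g"
 shows "A = idm (fst y)"
proof -
 obtain e where e: "y : ographs k" "e : nonloops (fst y)" "g : Mor (fst y) (fst x)" "dom g = halves (fst y) - e"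
  using ExpsE z by metis
 note r = ographD(2)[OF e(1)]
 obtain F where F: "A = pm (halves (fst y)) F" "rib_bij (fst y) F (fst y)" using ribbon_iso_iff[OF r] A(1) by blast
 have fix1: "F h = h" if "h : halves (fst y)" "h ~: e" for h
 proof -
  have "g (F h) = g h" using fun_cong[OF A(2), of h] F(1) that by simp
  thus ?thesis using Mor_facts(3)[OF r e(3)] that e(4) by (metis Diff_iff domIff inj_onD)
 qed
 obtain a b v1 v2 where "e = {a, b}" and N: "nonloop (fst y) a b v1 v2" using nonloopE[OF r e(2)] by blast
 have fix2: "F h = h" if h: "h : halves (fst y)" for h
 proof -
  obtain v where v: "v : verts (fst y)" "h : v" using vert_exists[OF r h] by blast
  obtain l where l: "l : v" "l ~: e" using vert_other[OF r v(1), of a b] \<open>e = {a, b}\<close> by blast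
  have "v <= {l. F l = l}"
  proof (rule vert_subset_closed[OF r v(1) l(1)])
   show "l : {l. F l = l}" using fix1 l vert_subset[OF r v(1)] by blast
   show "nxt (fst y) l' : {l. F l = l}" if "l' : v" "l' : {l. F l = l}" for l'
    using F(2) that vert_subset[OF r v(1)] by (auto simp: rib_bij_def)
  qed
  thus ?thesis using v by blast
 qed
 show ?thesis unfolding F(1) by (rule pm_cong) (use fix2 in auto)
qed

subsection \<open>There are finitely many expansions\<close>

lemma Exps_rel_iso:
 assumes x: "ograph x" and z: "(y, g) : Exps k x" "(y', g') : Exps k x"
  and p: "ribbon_iso (fst y) p (fst y')" "g' o_m p = g"
 shows "((y, g), (y', g')) : over_rel (fst x) k"
proof -
 have o: "(y, g) : overgraphs (fst x) k" "(y', g') : overgraphs (fst x) k" using Exps_overgraphs[OF z(1)] Exps_overgraphs[OF z(2)] by simp_all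
 hence oy: "ograph y" "ograph y'" using ographD(1) overgraphs_iff by blast+
 have "\<not> oriented_iso y p (orev y')"
 proof
  assume "oriented_iso y p (orev y')"
  moreover have "(orev y', g') : overgraphs (fst x) k" using o(2) by (simp add: overgraphs_iff orev_ographs)
  ultimately have "((y, g), over_rev (y', g')) : over_rel (fst x) k"
   using p(2) o(1) by (auto simp: over_rev_def intro: over_relI)
  hence "over_rev (y', g') : Exps k x" using Exps_rel z(1) by blast
  thus False using Exps_not_rev[OF x z(2)] by blast
 qed
 hence "oriented_iso y p y'" using oriented_iso_dichotomy[OF oy p(1)] by blast
 thus ?thesis using over_relI[OF o] p(2) by blast
qed

text \<open>
 Label the half-edges of an expansion by their images, and the two new ones by two fixed symbols.
 The expansion is determined by its edges and its successor function in terms of these labels.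
\<close>

lemma finite_expansions: assumes x: "ograph x" shows "finite (expansions k x)"
proof -
 define Y where "Y c = fst (fst (rep c))" for c :: "'a overgraph set"
 define g where "g c = snd (rep c)" for c :: "'a overgraph set"
 let ?C = "expansions k x"
 have rY: "ribbon_graph (Y c)" and gM: "g c : Mor (Y c) (fst x)" if "c : ?C" for c
 proof -
  have "fst (rep c) : ographs k" "snd (rep c) : Mor (fst (fst (rep c))) (fst x)"
   using Exps_overgraphs[OF rep_expansion(1)[OF that]] by (simp_all add: overgraphs_def case_prod_unfold)
  thus "ribbon_graph (Y c)" "g c : Mor (Y c) (fst x)" using ographD(2) unfolding Y_def g_def by blast+
 qed
 have "EX p. fst p ~= snd p & dom (g c) = halves (Y c) - {fst p, snd p} & {fst p, snd p} <= halves (Y c)"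
  if c: "c : ?C" for c
 proof -
  have *: "(fst (rep c), snd (rep c)) : Exps k x" using rep_expansion(1)[OF c] by simp
  have "EX e. e : nonloops (Y c) & dom (g c) = halves (Y c) - e"
   unfolding Y_def g_def by (rule ExpsE[OF *]) blast
  then obtain e where e: "e : nonloops (Y c)" "dom (g c) = halves (Y c) - e" by blast
  hence e': "e : edges (Y c)" by (simp add: nonloops_def)
  then obtain a b where "e = {a, b}" "a ~= b" using edge_pair[OF rY[OF c]] by blast
  thus ?thesis using e(2) edge_subset[OF rY[OF c] e'] by (intro exI[of _ "(a, b)"]) simp
 qed
 then obtain p where p: "ALL c:?C. fst (p c) ~= snd (p c) & dom (g c) = halves (Y c) - {fst (p c), snd (p c)} & {fst (p c), snd (p c)} <= halves (Y c)"
  by metis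
 define L where "L c h = (case g c h of Some l => Inl l | None => Inr (h = fst (p c)))" for c h
 let ?T = "Inl ` halves (fst x) \<union> Inr ` (UNIV :: bool set)"
 have L: "bij_betw (L c) (halves (Y c)) ?T" if c: "c : ?C" for c
 proof -
  note M = Mor_facts[OF rY[OF c] gM[OF c]] and pc = bspec[OF p c]
  have d: "h = fst (p c) \<or> h = snd (p c)" if "h : halves (Y c)" "g c h = None" for h using that pc by blast
  have "inj_on (L c) (halves (Y c))"
  proof (rule inj_onI)
   fix h l assume h: "h : halves (Y c)" "l : halves (Y c)" "L c h = L c l"
   show "h = l"
   proof (cases "g c h")
    case None
    hence "g c l = None" "h = fst (p c) \<longleftrightarrow> l = fst (p c)" using h(3) by (auto simp: L_def split: option.splits)
    thus ?thesis using d[OF h(1) None] d[OF h(2)] pc by metis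
   next
    case (Some m)
    hence "g c l = Some m" using h(3) by (auto simp: L_def split: option.splits)
    thus ?thesis using inj_onD[OF M(3), of h l] Some by (simp add: dom_def)
   qed
  qed
  moreover have "L c ` halves (Y c) = ?T"
  proof
   have r: "l : halves (fst x)" if "g c h = Some l" for h l using ranI[of "g c", OF that] M(2) by simp
   show "L c ` halves (Y c) <= ?T" by (auto simp: L_def r split: option.splits)
   have n: "g c (fst (p c)) = None" "g c (snd (p c)) = None" using pc by blast+
   have "Inl l : L c ` halves (Y c)" if "l : halves (fst x)" for l
    using that M(1) unfolding M(2)[symmetric] by (auto simp: L_def ran_def intro!: rev_image_eqI)
   moreover have "Inr q : L c ` halves (Y c)" for q
    using n pc by (cases q) (auto simp: L_def intro: rev_image_eqI[of "fst (p c)"] rev_image_eqI[of "snd (p c)"])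
   ultimately show "?T <= L c ` halves (Y c)" by blast
  qed
  ultimately show ?thesis by (simp add: bij_betw_def)
 qed
 let ?D = "%c. ((%h. (L c h, L c (nxt (Y c) h))) ` halves (Y c), (`) (L c) ` edges (Y c))"
 show ?thesis
 proof (rule inj_on_finite[where f = ?D])
  show "inj_on ?D ?C"
  proof (rule inj_onI)
   fix c d assume cd: "c : ?C" "d : ?C" and eq: "?D c = ?D d"
   define F where "F h = inv_into (halves (Y d)) (L d) (L c h)" for h
   note b = L[OF cd(1)] L[OF cd(2)]
   have bF: "bij_betw F (halves (Y c)) (halves (Y d))"
    unfolding F_def using bij_betw_trans[OF b(1) bij_betw_inv_into[OF b(2)]] by (simp add: comp_def)
   have F: "F h : halves (Y d)" "L d (F h) = L c h" if "h : halves (Y c)" for h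
   proof -
    have "L c h : L d ` halves (Y d)" using imageI[OF that, of "L c"] b by (simp add: bij_betw_def)
    thus "L d (F h) = L c h" unfolding F_def by (rule f_inv_into_f)
    show "F h : halves (Y d)" using that bF by (auto simp: bij_betw_def)
   qed
   have Fu: "F h = l" if "l : halves (Y d)" "L d l = L c h" for h l
    using that b(2) by (auto simp: F_def bij_betw_def simp flip: that(2))
   have "(`) F ` edges (Y c) = (`) (inv_into (halves (Y d)) (L d)) ` ((`) (L c) ` edges (Y c))"
    by (auto simp: F_def image_image)
   also have "... = (`) (inv_into (halves (Y d)) (L d)) ` ((`) (L d) ` edges (Y d))" using eq by simp
   also have "... = (%e. e) ` edges (Y d)"
    unfolding image_image[of "(`) _"]
    by (rule image_cong[OF HOL.refl]) (use b(2) edge_subset[OF rY[OF cd(2)]] in \<open>simp add: bij_betw_def inv_into_image_cancel\<close>)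
   finally have ed: "(`) F ` edges (Y c) = edges (Y d)" by simp
   have nx: "F (nxt (Y c) h) = nxt (Y d) (F h)" if h: "h : halves (Y c)" for h
   proof -
    have "(L c h, L c (nxt (Y c) h)) : fst (?D c)" using h by auto
    then obtain l where l: "l : halves (Y d)" "L d l = L c h" "L d (nxt (Y d) l) = L c (nxt (Y c) h)" unfolding eq by auto
    have "nxt (Y d) l : halves (Y d)" using permutes_in_image[OF nxt_permutes[OF rY[OF cd(2)]]] l(1) by blast
    thus ?thesis using Fu[OF l(1,2)] Fu[OF _ l(3)] by simp
   qed
   have iso: "ribbon_iso (Y c) (pm (halves (Y c)) F) (Y d)" by (rule ribbon_isoI[OF rY[OF cd(1)] rY[OF cd(2)] bF ed nx])
   have "(g d o_m pm (halves (Y c)) F) h = g c h" for h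
   proof (cases "h : halves (Y c)")
    case True
    thus ?thesis using F(2)[OF True] by (auto simp: map_comp_def L_def split: option.splits)
   next
    case False
    thus ?thesis using Mor_facts(1)[OF rY[OF cd(1)] gM[OF cd(1)]] by (auto simp: map_comp_def intro!: sym[of "g c h"])
   qed
   hence "g d o_m pm (halves (Y c)) F = g c" by blast
   hence "(rep c, rep d) : over_rel (fst x) k"
    using Exps_rel_iso[OF x _ _ iso[unfolded Y_def], of "snd (rep c)" k "snd (rep d)"]
    rep_expansion(1)[OF cd(1)] rep_expansion(1)[OF cd(2)] by (simp add: g_def Y_def)
   thus "c = d" by (rule expansion_eqI[OF cd])
  qed
  have "ribbon_graph (fst x)" using x by (simp add: ograph_def)
  hence f: "finite ?T" by (simp add: finite_halves)
  show "finite (Pow (?T \<times> ?T) \<times> Pow (Pow ?T))" using f by (intro finite_cartesian_product finite_Pow_iff[THEN iffD2])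
  show "?D ` ?C <= Pow (?T \<times> ?T) \<times> Pow (Pow ?T)"
  proof
   fix t assume "t : ?D ` ?C"
   then obtain c where c: "c : ?C" "t = ?D c" by blast
   have i: "L c ` halves (Y c) = ?T" using L[OF c(1)] by (simp add: bij_betw_def)
   have n: "nxt (Y c) h : halves (Y c)" if "h : halves (Y c)" for h
    using permutes_in_image[OF nxt_permutes[OF rY[OF c(1)]]] that by blast
   have li: "L c h : ?T" if "h : halves (Y c)" for h using imageI[OF that, of "L c"] unfolding i .
   have "fst (?D c) <= ?T \<times> ?T" using li n by auto
   moreover have "snd (?D c) <= Pow ?T" using li edge_subset[OF rY[OF c(1)]] by (fastforce simp: image_subset_iff)
   ultimately show "t : Pow (?T \<times> ?T) \<times> Pow (Pow ?T)" unfolding c(2) mem_Times_iff Pow_iff by blast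
  qed
 qed
qed

definition split_of :: "'h overgraph => 'h set set" where
 "split_of z = img (snd z) ` verts (fst (fst z))"

subsection \<open>Every graph of positive codimension has expansions\<close>

text \<open>
 Split the cyclically ordered vertex \<open>(h, n h, n (n h), \<dots>, p)\<close> into \<open>(a, h, n h)\<close> and
 \<open>(b, n (n h), \<dots>, p)\<close> by two new half-edges \<open>a\<close> and \<open>b\<close>.
\<close>

lemma expansion_graph:
 fixes G :: "('h::infinite) ribbon"
 assumes G: "ribbon_graph G" and v: "v : verts G" "card v \<ge> 4" and h: "h : v"
 obtains G' a b where "nonloop G' a b {a, h, nxt G h} (insert b (v - {h, nxt G h}))"
  "collapse G' {a, b} = G" "verts G' = (verts G - {v}) \<union> {{a, h, nxt G h}, insert b (v - {h, nxt G h})}"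
  "a ~: halves G" "b ~: halves G"
proof -
 let ?n = "nxt G"
 define q where "q = ?n h"
 define r where "r = ?n q"
 obtain a where a: "a ~: halves G" using ex_new_if_finite[OF infinite_UNIV finite_halves[OF G]] by blast
 obtain b where "b ~: insert a (halves G)"
  using ex_new_if_finite[OF infinite_UNIV, of "insert a (halves G)"] finite_halves[OF G] by auto
 hence b: "b ~: halves G" "b ~= a" by auto
 have hH: "h : halves G" using h vert_subset[OF G v(1)] by blast
 have perm: "bij ?n" using permutes_bij[OF nxt_permutes[OF G]] .
 obtain p where p: "?n p = h" using perm by (metis bij_pointE)
 have n_in: "?n l : v \<longleftrightarrow> l : v" for l by (rule nxt_vert[OF G v(1)])
 have inv: "p : v" "q : v" "r : v" using h n_in p q_def r_def by metis+
 have sub: "v <= halves G" by (rule vert_subset[OF G v(1)])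
 have nn: "?n l ~= l" if "l : v" for l using nxt_neq[OF G] that sub by blast
 have inj: "?n k = ?n l \<longleftrightarrow> k = l" for k l by (rule nxt_inj[OF G])
 have closed: False if "T <= {h, q, r}" "h : T" "!!l. l : T ==> ?n l : T" for T
 proof -
  have "v <= T" by (rule vert_subset_closed[OF G v(1) h that(2,3)])
  hence "card v \<le> card {h, q, r}" using that(1) by (intro card_mono) auto
  also have "... \<le> 3" by (simp add: card_insert_if)
  finally show False using v(2) by simp
 qed
 have ne: "q ~= h" "r ~= q" "p ~= h" using nn[OF h] nn[OF inv(2)] nn[OF inv(1)] p by (auto simp: q_def r_def)
 have rh: "r ~= h" using closed[of "{h, q}"] by (auto simp: q_def r_def)
 have pq: "p ~= q" using p rh r_def by auto
 have pr: "p ~= r"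
 proof
  assume "p = r"
  hence nr: "?n r = h" using p by simp
  have "?n l : {h, q, r}" if "l : {h, q, r}" for l
   using that nr q_def r_def by (metis insert_iff empty_iff)
  thus False using closed[of "{h, q, r}"] by blast
 qed
 define v1 where "v1 = {a, h, q}"
 define v2 where "v2 = insert b (v - {h, q})"
 define n' where "n' = ?n(a := h, q := a, b := r, p := b)"
 define G' where "G' = \<lparr>halves = insert a (insert b (halves G)), edges = insert {a, b} (edges G),
  verts = (verts G - {v}) \<union> {v1, v2}, nxt = n'\<rparr>"
 have abv: "a ~: v" "b ~: v" using a b sub by auto
 have nab: "a ~= p" "a ~= q" "b ~= p" "b ~= q" "a ~= h" "b ~= h" "a ~= r" "b ~= r" using abv inv h by metis+
 have n'_simps: "n' a = h" "n' q = a" "n' b = r" "n' p = b" "n' h = q"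
  using nab ne b pq by (auto simp: n'_def q_def)
 have n'_other: "n' l = ?n l" if "l ~= a" "l ~= b" "l ~= p" "l ~= q" for l using that by (simp add: n'_def)
 have v_disj: "u \<inter> v = {}" if "u : verts G - {v}" for u using vert_disjoint[OF G _ v(1), of u] that by blast
 have out_a: "a ~: u" "b ~: u" if "u : verts G" for u using vert_subset[OF G that] a b by auto
 have v12: "v1 \<inter> v2 = {}" "v1 \<union> v2 = insert a (insert b v)"
  using abv b nab h inv by (auto simp: v1_def v2_def)
 have vin: "v1 ~= v2" "v1 ~: verts G" "v2 ~: verts G" "v1 ~= {}" "v2 ~= {}"
  using v12(1) out_a by (auto simp: v1_def v2_def)
 have rg: "ribbon_graph G'"
  unfolding ribbon_graph_def
 proof (intro conjI ballI)
  show "finite (halves G')" using finite_halves[OF G] by (simp add: G'_def)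
  have eH: "f <= halves G" if "f : edges G" for f using edge_subset[OF G that] .
  have "disjoint (edges G')"
   unfolding disjoint_def
  proof (intro ballI impI)
   fix f g assume fg: "f : edges G'" "g : edges G'" "f ~= g"
   have dj: "f \<inter> {a, b} = {}" if "f : edges G" for f using eH[OF that] a b by auto
   consider "f = {a, b}" "g : edges G" | "g = {a, b}" "f : edges G" | "f : edges G" "g : edges G"
    using fg by (auto simp: G'_def)
   thus "f \<inter> g = {}"
   proof cases
    case 3
    thus ?thesis using edge_eq[OF G, of f g] fg(3) by blast
   qed (use dj in \<open>auto simp: Int_commute\<close>)
  qed
  moreover have "\<Union> (edges G') = halves G'" using edges_Union[OF G] by (simp add: G'_def)
  moreover have "{} ~: edges G'" using card_edge[OF G, of "{}"] by (auto simp: G'_def)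
  ultimately show "partition_on (halves G') (edges G')" by (simp add: partition_on_def)
  show "card f = 2" if "f : edges G'" for f
   using that card_edge[OF G, of f] b(2) by (auto simp: G'_def card_insert_if)
  have "disjoint (verts G')"
   unfolding disjoint_def
  proof (intro ballI impI)
   fix u w assume uw: "u : verts G'" "w : verts G'" "u ~= w"
   have dj: "u \<inter> (v1 \<union> v2) = {}" if "u : verts G - {v}" for u
    using v_disj[OF that] out_a[of u] that v12(2) by auto
   consider "u : {v1, v2}" "w : {v1, v2}" | "u : {v1, v2}" "w : verts G - {v}"
    | "w : {v1, v2}" "u : verts G - {v}" | "u : verts G" "w : verts G"
    using uw by (auto simp: G'_def)
   thus "u \<inter> w = {}"
   proof cases
    case 1
    thus ?thesis using v12(1) uw(3) by auto
   next
    case 2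
    thus ?thesis using dj[of w] by auto
   next
    case 3
    thus ?thesis using dj[of u] by auto
   next
    case 4
    thus ?thesis using vert_disjoint[OF G] uw(3) by blast
   qed
  qed
  moreover have "\<Union> (verts G') = halves G'"
  proof -
   have "\<Union> (verts G') = \<Union> (verts G - {v}) \<union> (v1 \<union> v2)" by (auto simp: G'_def)
   also have "... = insert a (insert b (\<Union> (verts G)))" unfolding v12(2) using v(1) by auto
   finally show ?thesis using verts_Union[OF G] by (simp add: G'_def)
  qed
  moreover have "{} ~: verts G'" using vin card_vert[OF G, of "{}"] by (auto simp: G'_def)
  ultimately show "partition_on (halves G') (verts G')" by (simp add: partition_on_def)
  have "card v1 = 3" using nab ne by (simp add: v1_def)
  moreover have "card v2 \<ge> 3"
  proof -
   have "card (v - {h, q}) = card v - 2"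
    using h inv ne finite_vert[OF G v(1)] by (simp add: card_Diff_subset)
   thus ?thesis unfolding v2_def using abv finite_vert[OF G v(1)] v(2) by simp
  qed
  ultimately show "card u \<ge> 3" if "u : verts G'" for u
   using that card_vert[OF G] by (auto simp: G'_def)
  have np: "nxt G permutes halves G" by (rule nxt_permutes[OF G])
  have n_inH: "?n l : halves G \<longleftrightarrow> l : halves G" for l using permutes_in_image[OF np] .
  have pre: "?n l = h \<longleftrightarrow> l = p" "?n l = r \<longleftrightarrow> l = q" "?n l = q \<longleftrightarrow> l = h" for l
   using inj[of l p] inj[of l q] inj[of l h] p by (simp_all add: q_def r_def)
  show "nxt G' permutes halves G'"
  proof (rule inj_imp_permutes)
   have a': "?n l ~= a" "?n l ~= b" if "l : halves G" for l using n_inH that a b by metis+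
   show "inj_on (nxt G') (halves G')"
   proof (rule inj_onI)
    fix k l assume kl: "k : halves G'" "l : halves G'" "nxt G' k = nxt G' l"
    have kH: "k : halves G \<or> k = a \<or> k = b" "l : halves G \<or> l = a \<or> l = b" using kl by (auto simp: G'_def)
    have val: "n' x = (if x = a then h else if x = q then a else if x = b then r else if x = p then b else ?n x)" for x
    using nab pq b by (auto simp: n'_def)
    have "n' k = n' l" using kl by (simp add: G'_def)
    thus "k = l" using kH a' pre nab rh b inj
    unfolding val by (auto split: if_splits)
   qed
   show "nxt G' x : halves G'" if "x : halves G'" for x
    using that n_inH hH inv sub by (auto simp: G'_def n'_def)
   show "finite (halves G')" using finite_halves[OF G] by (simp add: G'_def)
   show "nxt G' x = x" if "x ~: halves G'" for x
    using that inv sub nxt_outside[OF G, of x] by (auto simp: G'_def n'_def)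
  qed
  show "cyclic_on (nxt G') u" if u: "u : verts G'" for u
  proof -
   have nG: "nxt G' = n'" by (simp add: G'_def)
   consider "u = v1" | "u = v2" | "u : verts G" "u ~= v" using u by (auto simp: G'_def)
   thus ?thesis
   proof cases
    case 1
    show ?thesis unfolding nG 1
    proof (rule cyclic_onI)
    show "a : v1" by (simp add: v1_def)
    show "n' l : v1" if "l : v1" for l using that n'_simps by (auto simp: v1_def)
    fix T assume T: "T <= v1" "T ~= {}" "!!l. l : T ==> n' l : T"
    obtain l where "l : T" using T(2) by blast
    hence "l = a \<or> l = h \<or> l = q" using T(1) by (auto simp: v1_def)
    hence "a : T" using \<open>l : T\<close> T(3)[of l] T(3)[of q] n'_simps by auto
    thus "v1 <= T" using T(3)[of a] T(3)[of h] n'_simps by (auto simp: v1_def)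
    qed
   next
    case 2
    have inv2: "n' l : v2" if "l : v2" for l
    proof (cases "l = b \<or> l = p")
    case True
    thus ?thesis using n'_simps inv ne rh by (auto simp: v2_def)
    next
    case False
    hence l: "l : v" "l ~= h" "l ~= q" using that by (auto simp: v2_def)
    hence "n' l = ?n l" using n'_other False abv by metis
    thus ?thesis using l n_in pre False by (auto simp: v2_def)
    qed
    show ?thesis unfolding nG 2
    proof (rule cyclic_onI)
    show "b : v2" by (simp add: v2_def)
    show "n' l : v2" if "l : v2" for l by (rule inv2[OF that])
    fix T assume T: "T <= v2" "T ~= {}" "!!l. l : T ==> n' l : T"
    have step: "?n l : T" if "l : T" "l ~= b" "l ~= p" for l
    proof -
    have "l ~= a" "l ~= q" using T(1) that v12(1) by (auto simp: v1_def v2_def)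
    thus ?thesis using T(3)[OF that(1)] n'_other that by metis
    qed
    have bT: "b : T"
    proof (rule ccontr)
    assume nb: "b ~: T"
    hence np: "p ~: T" using T(3)[of p] n'_simps by auto
    obtain l where l: "l : T" using T(2) by blast
    hence lv: "l : v" using T(1) nb by (auto simp: v2_def)
    have "v <= T" by (rule vert_subset_closed[OF G v(1) lv l]) (use step nb np in blast)
    thus False using np inv by blast
    qed
    hence rT: "r : T" using T(3)[of b] n'_simps by auto
    have "v <= T \<union> {h, q}"
    proof (rule vert_subset_closed[OF G v(1) inv(3)])
    show "r : T \<union> {h, q}" using rT by blast
    fix l assume l: "l : v" "l : T \<union> {h, q}"
    show "?n l : T \<union> {h, q}"
    proof (cases "l : T & l ~= p")
    case True
    thus ?thesis using step[of l] l abv by auto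
    next
    case False
    then consider "l = p" | "l = h" | "l = q" using l by blast
    thus ?thesis using p rT q_def r_def by cases auto
    qed
    qed
    thus "v2 <= T" using bT by (auto simp: v2_def)
    qed
   next
    case 3
    have "n' l = ?n l" if "l : u" for l
    proof -
    have "u \<inter> v = {}" using v_disj 3 by blast
    thus ?thesis using that inv out_a[OF 3(1)] by (intro n'_other) auto
    qed
    moreover have "cyclic_on ?n u" using G 3 by (simp add: ribbon_graph_def)
    ultimately show ?thesis unfolding nG by (subst cyclic_cong[where g = ?n]) auto
   qed
  qed
  show "connected_graph G'"
  proof -
   let ?R = "{(u', v'). u' : verts G & v' : verts G & (EX e:edges G. joins e u' v')}"
   let ?R' = "{(u', v'). u' : verts G' & v' : verts G' & (EX e:edges G'. joins e u' v')}"
   have V': "verts G' = (verts G - {v}) \<union> {v1, v2}" and E': "edges G' = insert {a, b} (edges G)"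
    by (auto simp: G'_def)
   have "joins {a, b} v1 v2" "joins {a, b} v2 v1" by (auto simp: joins_def v1_def v2_def)
   hence 12: "(v1, v2) : ?R'" "(v2, v1) : ?R'" by (auto simp: V' E')
   define Q where "Q u = (if u = v then {v1, v2} else {u})" for u
   have Qsame: "(s, t) : ?R'\<^sup>*" if "s : Q u" "t : Q u" for s t u
    using that 12 by (auto simp: Q_def split: if_splits)
   have Q_V: "s : verts G'" if "u : verts G" "s : Q u" for s u using that by (auto simp: Q_def V' split: if_splits)
   have Q_mem: "EX s:Q u. c : s" if "c : u" for c u
    using that v12(2) by (auto simp: Q_def)
   have step: "EX s:Q u. EX t:Q w. (s, t) : ?R'" if uw: "(u, w) : ?R" for u w
   proof -
    obtain f c d where f: "f : edges G" "f = {c, d}" "c : u" "d : w" "u : verts G" "w : verts G"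
    using uw by (auto simp: joins_def)
    obtain s t where st: "s : Q u" "c : s" "t : Q w" "d : t" using Q_mem f by meson
    hence "joins f s t" using f by (auto simp: joins_def)
    hence "(s, t) : ?R'" using f st Q_V by (auto simp: E')
    thus ?thesis using st by blast
   qed
   have path: "ALL s:Q u. ALL t:Q w. (s, t) : ?R'\<^sup>*" if "(u, w) : ?R\<^sup>*" for u w
    using that
   proof induction
    case base
    thus ?case using Qsame by blast
   next
    case (step w x)
    obtain s' t' where st: "s' : Q w" "t' : Q x" "(s', t') : ?R'"
    using \<open>(w, x) : ?R\<close> \<open>!!u w. (u, w) : ?R ==> EX s:Q u. EX t:Q w. (s, t) : ?R'\<close> by meson
    show ?case
    proof (intro ballI)
    fix s t assume s: "s : Q u" and t: "t : Q x"
    have "(s, s') : ?R'\<^sup>*" using step.IH s st(1) by blast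
    moreover have "(t', t) : ?R'\<^sup>*" using Qsame st(2) t by blast
    ultimately show "(s, t) : ?R'\<^sup>*" using st(3) by (meson r_into_rtrancl rtrancl_trans)
    qed
   qed
   have surj: "EX u:verts G. s : Q u" if "s : verts G'" for s
    using that v(1) by (auto simp: V' Q_def intro: bexI[of _ v])
   have "(s, t) : ?R'\<^sup>*" if s: "s : verts G'" and t: "t : verts G'" for s t
   proof -
    obtain u w where uw: "u : verts G" "s : Q u" "w : verts G" "t : Q w" using surj[OF s] surj[OF t] by blast
    have "(u, w) : ?R\<^sup>*" using G uw(1,3) by (auto simp: ribbon_graph_def connected_graph_def)
    thus ?thesis using path uw by blast
   qed
   thus ?thesis unfolding connected_graph_def by (auto simp: V')
  qed
 qed
 have N: "nonloop G' a b v1 v2"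
  using rg vin by unfold_locales (auto simp: G'_def v1_def v2_def)
 interpret N: nonloop G' a b v1 v2 by (rule N)
 have M: "N.M = v" using h inv abv nab by (auto simp: v1_def v2_def)
 have "collapse G' {a, b} = G"
 proof (rule ribbon_eqI)
  show "halves N.D = halves G" unfolding N.halves_collapse using a b by (auto simp: G'_def)
  have "{a, b} ~: edges G" using edge_subset[OF G] a by blast
  thus "edges N.D = edges G" unfolding N.edges_collapse by (auto simp: G'_def)
  show "verts N.D = verts G" unfolding N.verts_collapse M using v(1) vin by (auto simp: G'_def)
  show "nxt N.D = nxt G"
  proof
   fix l show "nxt N.D l = nxt G l"
   proof (cases "l : halves G")
    case True
    hence l: "l : halves G'" "l ~= a" "l ~= b" using a b by (auto simp: G'_def)
    have nG: "nxt G' = n'" by (simp add: G'_def)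
    have "?n l : halves G" using True permutes_in_image[OF nxt_permutes[OF G]] by blast
    hence "?n l ~= a" "?n l ~= b" using a b by auto
    thus ?thesis unfolding N.nxt_collapse[OF l] nG using n'_simps n'_other[of l] l p b
    by (cases "l = p"; cases "l = q") (auto simp: r_def)
   next
    case False
    hence "l ~: halves G' - {a, b}" by (auto simp: G'_def)
    thus ?thesis using N.nxt_collapse_outside[of l] nxt_outside[OF G False] by metis
   qed
  qed
 qed
 moreover have "verts G' = (verts G - {v}) \<union> {v1, v2}" by (simp add: G'_def)
 ultimately show ?thesis using that[of G' a b] N a b unfolding v1_def v2_def q_def by simp
qed

lemma expansion_at:
 fixes x :: "('h::infinite) ograph"
 assumes x: "x : ographs (Suc k)" and v: "v : verts (fst x)" "card v \<ge> 4" and h: "h : v"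
 obtains z where "z : Exps k x"
  "split_of z = (verts (fst x) - {v}) \<union> {{h, nxt (fst x) h}, v - {h, nxt (fst x) h}}"
proof -
 let ?G = "fst x" and ?q = "nxt (fst x) h"
 note r = ographD(2)[OF x]
 obtain G' a b where N: "nonloop G' a b {a, h, ?q} (insert b (v - {h, ?q}))"
  and G: "collapse G' {a, b} = ?G" "verts G' = (verts ?G - {v}) \<union> {{a, h, ?q}, insert b (v - {h, ?q})}"
  and ab: "a ~: halves ?G" "b ~: halves ?G" by (rule expansion_graph[OF r v h])
 interpret N: nonloop G' a b "{a, h, ?q}" "insert b (v - {h, ?q})" by (rule N)
 have cod: "codim G' = k" using N.codim_collapse G(1) x by (simp add: ographs_iff)
 obtain w where w: "is_word G' w" using word_extend[OF N.G, of "[]"] by auto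
 define y0 where "y0 = (G', word_orient G' w)"
 have y0: "ograph y0" using N.G word_orient_in[OF w] by (simp add: y0_def ograph_def)
 have e: "{a, b} : nonloops (fst y0)" using N.in_nonloops by (simp add: y0_def)
 have "EX y. y : ographs k & fst y = G' & ocollapse y {a, b} = x"
 proof -
  have "ocollapse y0 {a, b} = x \<or> ocollapse y0 {a, b} = orev x"
   using ograph_cases[OF ocollapse_spec(2)[OF y0 e] ographD(1)[OF x]] G(1) by (simp add: y0_def)
  hence "ocollapse y0 {a, b} = x \<or> ocollapse (orev y0) {a, b} = x"
   using ocollapse_orev[OF y0 e] ographD(1)[OF x] by auto
  moreover have "y0 : ographs k" "orev y0 : ographs k" "fst y0 = G'" "fst (orev y0) = G'"
   using y0 ograph_orev[OF y0] cod by (simp_all add: ographs_iff) (simp_all add: y0_def)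
  ultimately show ?thesis by blast
 qed
 then obtain y where y: "y : ographs k" "fst y = G'" "ocollapse y {a, b} = x" by blast
 have z: "(y, idm ?G) : Exps k x"
  by (rule ExpsI[OF y(1), of "{a, b}"]) (use y(2,3) N.in_nonloops oriented_iso_refl[OF ographD(1)[OF x]] in auto)
 have vH: "v <= halves ?G" "h : halves ?G" "?q : halves ?G"
  using vert_subset[OF r v(1)] h nxt_vert[OF r v(1), of h] by auto
 have im: "img (idm ?G) u = u \<inter> halves ?G" for u by (simp add: img_pm')
 have "split_of (y, idm ?G) = (%u. u \<inter> halves ?G) ` ((verts ?G - {v}) \<union> {{a, h, ?q}, insert b (v - {h, ?q})})"
  by (simp add: split_of_def y(2) G(2) im)
 also have "... = (%u. u \<inter> halves ?G) ` (verts ?G - {v}) \<union> {{h, ?q}, v - {h, ?q}}"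
  using ab vH by auto
 also have "(%u. u \<inter> halves ?G) ` (verts ?G - {v}) = verts ?G - {v}"
 proof -
  have "u \<inter> halves ?G = u" if "u : verts ?G - {v}" for u using vert_subset[OF r] that by blast
  hence "(%u. u \<inter> halves ?G) ` (verts ?G - {v}) = (%u. u) ` (verts ?G - {v})"
   by (rule image_cong[OF HOL.refl])
  thus ?thesis by simp
 qed
 finally show ?thesis using that z by blast
qed

lemma split_of_rel: assumes "(z, z') : over_rel G0 k" shows "split_of z = split_of z'"
proof -
 obtain x f y g A where z: "z = (x, f)" "z' = (y, g)" "oriented_iso x A y" "g o_m A = f"
  using assms by (auto simp: over_rel_def)
 have "img f ` verts (fst x) = img g ` (img A ` verts (fst x))" using z(4) by (auto simp: img_comp)
 also have "img A ` verts (fst x) = verts (fst y)" by (rule ribbon_isoD(5)[OF oriented_isoD[OF z(3)]])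
 finally show ?thesis using z by (simp add: split_of_def)
qed

text \<open>
 Some vertex has at least four half-edges. Splitting off two consecutive ones, starting at \<open>h\<close> or at the successor
 of \<open>h\<close>, induces different partitions of the half-edges of \<open>x\<close>, and this partition is an invariant of the class.
\<close>

lemma two_expansions:
 fixes x :: "('h::infinite) ograph"
 assumes x: "x : ographs (Suc k)"
 obtains z z' where "z : Exps k x" "z' : Exps k x" "(z, z') ~: over_rel (fst x) k"
proof -
 let ?n = "nxt (fst x)"
 note r = ographD(2)[OF x]
 obtain v where v: "v : verts (fst x)" "card v \<ge> 4"
 proof (rule ccontr)
  assume "\<not> thesis"
  hence "card v - 3 = 0" if "v : verts (fst x)" for v using that \<open>!!v. _ ==> _ ==> thesis\<close> by (cases "card v \<ge> 4") auto
  hence "codim (fst x) = 0" by (simp add: codim_def)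
  thus False using x by (simp add: ographs_iff)
 qed
 obtain h where h: "h : v" using vert_other[OF r v(1)] by blast
 have q: "?n h : v" "?n (?n h) : v" using h nxt_vert[OF r v(1)] by auto
 have ne: "?n h ~= h" "?n (?n h) ~= ?n h" using nxt_neq[OF r] h q vert_subset[OF r v(1)] by blast+
 have "?n (?n h) ~= h"
 proof
  assume *: "?n (?n h) = h"
  have "v <= {h, ?n h}" by (rule vert_subset_closed[OF r v(1) h]) (use * in auto)
  hence "card v \<le> card {h, ?n h}" by (intro card_mono) auto
  also have "... \<le> 2" by (simp add: card_insert_if)
  finally show False using v(2) by simp
 qed
 obtain z where z: "z : Exps k x" "split_of z = (verts (fst x) - {v}) \<union> {{h, ?n h}, v - {h, ?n h}}"
  by (rule expansion_at[OF x v h])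
 obtain z' where z': "z' : Exps k x"
  "split_of z' = (verts (fst x) - {v}) \<union> {{?n h, ?n (?n h)}, v - {?n h, ?n (?n h)}}"
  by (rule expansion_at[OF x v q(1)])
 have "{h, ?n h} : split_of z" using z by simp
 moreover have "{h, ?n h} ~: split_of z'"
 proof -
  have "{h, ?n h} ~: verts (fst x)" using card_vert[OF r, of "{h, ?n h}"] ne by (auto simp: card_insert_if)
  moreover have "{h, ?n h} ~= {?n h, ?n (?n h)}" using \<open>?n (?n h) ~= h\<close> ne by auto
  moreover have "{h, ?n h} ~= v - {?n h, ?n (?n h)}" by auto
  ultimately show ?thesis using z'(2) by simp
 qed
 ultimately have "split_of z ~= split_of z'" by metis
 hence "(z, z') ~: over_rel (fst x) k" using split_of_rel by blast
 thus ?thesis using that z(1) z'(1) by blast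
qed

section \<open>Expanding twice\<close>

text \<open>
 A pair of successive expansions of \<open>x\<close> is, up to isomorphism, a graph \<open>w\<close> with a morphism to \<open>x\<close>
 collapsing two edges and a choice of the edge that is collapsed first. Exchanging the two edges
 reverses the orientation, so the terms of an antisymmetric sum cancel in pairs.
\<close>

definition tower_rel :: "('h ograph \<times> 'h mor \<times> 'h set) => ('h ograph \<times> 'h mor \<times> 'h set) => bool" where
 "tower_rel = (%(w, m, f) (w', m', f'). ograph w & ograph w' & dom m' <= halves (fst w') \<and>
  f <= halves (fst w) & f' <= halves (fst w') \<and>
  (EX p. oriented_iso w p w' & m' o_m p = m & img p f = f'))"

lemma tower_rel_trans:
 assumes "tower_rel (w, m, f) (w', m', f')" "tower_rel (w', m', f') (w'', m'', f'')"
 shows "tower_rel (w, m, f) (w'', m'', f'')"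
proof -
 obtain p \<gamma> where o: "ograph w" "ograph w'" "ograph w''" "dom m'' <= halves (fst w'')" "f <= halves (fst w)" "f'' <= halves (fst w'')"
  and p: "oriented_iso w p w'" "m' o_m p = m" "img p f = f'"
  and \<gamma>: "oriented_iso w' \<gamma> w''" "m'' o_m \<gamma> = m'" "img \<gamma> f' = f''" using assms by (auto simp: tower_rel_def)
 have "m'' o_m (\<gamma> o_m p) = m" "img (\<gamma> o_m p) f = f''" using p \<gamma> by (auto simp: map_comp_assoc[symmetric] img_comp)
 thus ?thesis using o oriented_iso_comp[OF o(1,2) p(1) \<gamma>(1)] by (auto simp: tower_rel_def)
qed

lemma tower_rel_rev:
 assumes "tower_rel (w, m, f) (w', m', f')" "f \<inter> g = {}" "f \<union> g = halves (fst w) - dom m"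
  "f' \<inter> g' = {}" "f' \<union> g' = halves (fst w') - dom m'"
 shows "tower_rel (orev w, m, g) (orev w', m', g')"
proof -
 obtain p where o: "ograph w" "ograph w'" "dom m' <= halves (fst w')" "f <= halves (fst w)" "f' <= halves (fst w')"
  and p: "oriented_iso w p w'" "m' o_m p = m" "img p f = f'" using assms(1) by (auto simp: tower_rel_def)
 have r: "ribbon_graph (fst w)" using o(1) by (simp add: ograph_def)
 obtain F where F: "p = pm (halves (fst w)) F" "rib_bij (fst w) F (fst w')"
  using ribbon_iso_iff[OF r] oriented_isoD[OF p(1)] by blast
 have inj: "inj_on F (halves (fst w))" and im: "F ` halves (fst w) = halves (fst w')"
  using F(2) by (auto simp: rib_bij_def bij_betw_def)
 have Ff: "F ` f = f'" using p(3) o(4) F(1) by (simp add: img_pm)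
 have dm: "h : dom m \<longleftrightarrow> F h : dom m'" if "h : halves (fst w)" for h
  using fun_cong[OF p(2), of h] that F(1) by (auto simp: domIff)
 have g: "g <= halves (fst w)" "g' <= halves (fst w')" using assms by auto
 have "F ` g = g'"
 proof -
  have "g = {h : halves (fst w). h ~: f & h ~: dom m}" using assms(2,3) o(4) by blast
  moreover have "g' = {h : halves (fst w'). h ~: f' & h ~: dom m'}" using assms(4,5) o(5) by blast
  moreover have "h : f \<longleftrightarrow> F h : f'" if "h : halves (fst w)" for h
   using inj_on_image_mem_iff[OF inj that o(4)] Ff by simp
  moreover have "F ` {h : halves (fst w). h ~: f & h ~: dom m} = {h : F ` halves (fst w). h ~: f' & h ~: dom m'}"
   using dm calculation(3) by blast
  ultimately show ?thesis unfolding im by simp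
 qed
 hence "img p g = g'" using g F(1) by (simp add: img_pm)
 thus ?thesis using o g p(2) ograph_orev[OF o(1)] ograph_orev[OF o(2)] oriented_iso_orev[OF o(1) p(1)] by (auto simp: tower_rel_def)
qed

context
 fixes x :: "'h ograph" and k :: nat
 assumes x: "x : ographs (Suc (Suc k))"
begin

definition pairs :: "('h overgraph set \<times> 'h overgraph set) set" where
 "pairs = (SIGMA c:expansions (Suc k) x. expansions k (fst (rep c)))"

definition tower :: "'h overgraph set \<times> 'h overgraph set => 'h ograph \<times> 'h mor \<times> 'h set" where
 "tower i = (let (y, g) = rep (fst i); (w, m) = rep (snd i) in (w, g o_m m, halves (fst w) - dom m))"

lemma pairsE:
 assumes "i : pairs"
 obtains y g w m where "rep (fst i) = (y, g)" "rep (snd i) = (w, m)" "(y, g) : Exps (Suc k) x" "(w, m) : Exps k y"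
  "fst i : expansions (Suc k) x" "snd i : expansions k y" "tower i = (w, g o_m m, halves (fst w) - dom m)"
proof -
 obtain c d where i: "i = (c, d)" by (cases i)
 hence c: "c : expansions (Suc k) x" and d: "d : expansions k (fst (rep c))" using assms by (auto simp: pairs_def)
 obtain y g where yg: "rep c = (y, g)" by (cases "rep c")
 obtain w m where wm: "rep d = (w, m)" by (cases "rep d")
 show ?thesis
  by (rule that[of y g w m])
   (use i c d yg wm rep_expansion(1)[OF c] rep_expansion(1)[OF d] in \<open>simp_all add: tower_def\<close>)
qed

lemma comp_restrict: assumes *: "dom g \<inter> img p f = {}" shows "g o_m (p |` (- f)) = g o_m p"
proof
 fix h
 show "(g o_m (p |` (- f))) h = (g o_m p) h"
 proof (cases "h : f")
  case True
  have "g l = None" if "p h = Some l" for l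
  proof -
   have "l : img p f" using that True by (auto simp: img_def)
   thus ?thesis using * by (auto simp: domIff)
  qed
  thus ?thesis using True by (cases "p h") (auto simp: restrict_map_def)
 qed (simp add: map_comp_def)
qed

lemma tower_inj:
 assumes i: "i : pairs" and j: "j : pairs" and rel: "tower_rel (tower i) (tower j)"
 shows "i = j"
proof -
 obtain y g w m where 1: "rep (fst i) = (y, g)" "rep (snd i) = (w, m)" "(y, g) : Exps (Suc k) x" "(w, m) : Exps k y"
  "fst i : expansions (Suc k) x" "snd i : expansions k y" "tower i = (w, g o_m m, halves (fst w) - dom m)"
  by (rule pairsE[OF i])
 obtain y' g' w' m' where 2: "rep (fst j) = (y', g')" "rep (snd j) = (w', m')" "(y', g') : Exps (Suc k) x" "(w', m') : Exps k y'"
  "fst j : expansions (Suc k) x" "snd j : expansions k y'" "tower j = (w', g' o_m m', halves (fst w') - dom m')"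
  by (rule pairsE[OF j])
 obtain f where f: "w : ographs k" "f : nonloops (fst w)" "oriented_iso (ocollapse w f) m y" "m : Mor (fst w) (fst y)"
  "dom m = halves (fst w) - f" by (rule ExpsE[OF 1(4)])
 obtain f' where f': "w' : ographs k" "f' : nonloops (fst w')" "oriented_iso (ocollapse w' f') m' y'" "m' : Mor (fst w') (fst y')"
  "dom m' = halves (fst w') - f'" by (rule ExpsE[OF 2(4)])
 have yo: "(y, g) : overgraphs (fst x) (Suc k)" "(y', g') : overgraphs (fst x) (Suc k)"
  using Exps_overgraphs[OF 1(3)] Exps_overgraphs[OF 2(3)] by auto
 hence y: "y : ographs (Suc k)" "g : Mor (fst y) (fst x)" "y' : ographs (Suc k)" "g' : Mor (fst y') (fst x)"
  by (auto simp: overgraphs_iff)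
 have ff: "f <= halves (fst w)" "f' <= halves (fst w')"
  using edge_subset[OF ographD(2)[OF f(1)]] f(2) edge_subset[OF ographD(2)[OF f'(1)]] f'(2) by (auto simp: nonloops_def)
 have df: "halves (fst w) - dom m = f" "halves (fst w') - dom m' = f'" using ff f(5) f'(5) by auto
 obtain p where p: "oriented_iso w p w'" "(g' o_m m') o_m p = g o_m m" "img p f = f'"
  using rel unfolding 1(7) 2(7) df by (auto simp: tower_rel_def)
 note o = ographD(1)[OF f(1)] ographD(1)[OF f'(1)] ographD(1)[OF y(1)] ographD(1)[OF y(3)]
 let ?p = "p |` (- f)"
 have c: "oriented_iso (ocollapse w f) ?p (ocollapse w' f')"
  using oriented_iso_collapse[OF o(1,2) p(1) f(2)] p(3) by simp
 note oc = ocollapse_spec(2)[OF o(1) f(2)] ocollapse_spec(2)[OF o(2) f'(2)]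
 define A where "A = (m' o_m ?p) o_m minv m"
 have A: "oriented_iso y A y'"
  unfolding A_def
  by (rule oriented_iso_comp[OF o(3) oc(1) oriented_iso_inv[OF oc(1) o(3) f(3)] oriented_iso_comp[OF oc c f'(3)]])
 have mp: "m' o_m ?p = m' o_m p" by (rule comp_restrict) (use f'(5) p(3) in auto)
 have ran_m: "m o_m minv m = idm (fst y)" using comp_minv[of m] ribbon_isoD(2)[OF oriented_isoD[OF f(3)]] by simp
 have "g' o_m A = ((g' o_m m') o_m p) o_m minv m" unfolding A_def mp by (simp add: map_comp_assoc)
 also have "... = g o_m idm (fst y)" unfolding p(2) by (simp add: map_comp_assoc ran_m)
 also have "... = g" by (rule comp_idm[OF Mor_facts(1)[OF ographD(2)[OF y(1)] y(2)]])
 finally have gA: "g' o_m A = g" .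
 have "((y, g), (y', g')) : over_rel (fst x) (Suc k)" by (rule over_relI[OF yo A gA])
 hence eq1: "fst i = fst j" using expansion_eqI[OF 1(5) 2(5)] 1(1) 2(1) by simp
 hence yy: "y' = y" "g' = g" using 1(1) 2(1) by auto
 have "A = idm (fst y)"
  by (rule Exps_faithful[OF 1(3)]) (use oriented_isoD[OF A] gA yy in auto)
 moreover have "A o_m m = m' o_m p"
 proof -
  have "minv m o_m m = pm (halves (fst w) - f) (%h. h)" using minv_comp[OF Mor_facts(3)[OF ographD(2)[OF f(1)] f(4)]] f(5) by simp
  moreover have "dom (m' o_m ?p) <= halves (fst w) - f"
   using ribbon_isoD(1)[OF oriented_isoD[OF oriented_iso_comp[OF oc c f'(3)]]] by (simp add: collapse_def)
  ultimately show ?thesis unfolding A_def mp[symmetric] by (simp add: map_comp_assoc[of _ "minv m" m] comp_idm)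
 qed
 moreover have "idm (fst y) o_m m = m" using Mor_facts(2)[OF ographD(2)[OF f(1)] f(4)] by (intro idm_comp) simp
 ultimately have "m' o_m p = m" by simp
 hence "((w, m), (w', m')) : over_rel (fst y) k"
  using over_relI[OF Exps_overgraphs[OF 1(4)] _ p(1)] Exps_overgraphs[OF 2(4)] yy by simp
 hence "snd i = snd j" using expansion_eqI[OF 1(6)] 2(6) 1(2) 2(2) yy by simp
 thus ?thesis using eq1 by (simp add: prod_eq_iff)
qed

lemma tower_edges:
 assumes i: "i : pairs" and t: "tower i = (w, m, f)"
 obtains e where "f : nonloops (fst w)" "e : nonloops (fst w)" "e \<inter> f = {}" "e \<union> f = halves (fst w) - dom m"
  "w : ographs k" "e : nonloops (collapse (fst w) f)" "oriented_iso (ocollapse (ocollapse w f) e) m x"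
proof -
 obtain y g w' m' where 1: "rep (fst i) = (y, g)" "rep (snd i) = (w', m')" "(y, g) : Exps (Suc k) x" "(w', m') : Exps k y"
  "fst i : expansions (Suc k) x" "snd i : expansions k y" "tower i = (w', g o_m m', halves (fst w') - dom m')"
  by (rule pairsE[OF i])
 have w: "w' = w" "m = g o_m m'" "f = halves (fst w) - dom m'" using t 1(7) by auto
 obtain f0 where f0: "w : ographs k" "f0 : nonloops (fst w)" "oriented_iso (ocollapse w f0) m' y" "m' : Mor (fst w) (fst y)"
  "dom m' = halves (fst w) - f0" using ExpsE[OF 1(4)] w(1) by metis
 have r: "ribbon_graph (fst w)" by (rule ographD(2)[OF f0(1)])
 have f0H: "f0 <= halves (fst w)" using edge_subset[OF r] f0(2) by (auto simp: nonloops_def)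
 hence ff: "f = f0" using w(3) f0(5) by auto
 obtain d where d: "y : ographs (Suc k)" "d : nonloops (fst y)" "oriented_iso (ocollapse y d) g x" "g : Mor (fst y) (fst x)"
  "dom g = halves (fst y) - d" by (rule ExpsE[OF 1(3)])
 note o = ographD(1)[OF f0(1)] ographD(1)[OF d(1)]
 have fn: "f : nonloops (fst w)" using f0(2) ff by simp
 note oc = ocollapse_spec(2)[OF o(1) fn]
 have rf: "ribbon_graph (collapse (fst w) f)" by (rule ribbon_collapse[OF r fn])
 have m': "oriented_iso (ocollapse w f) m' y" using f0(3) ff by simp
 have isom: "ribbon_iso (collapse (fst w) f) m' (fst y)" using oriented_isoD[OF m'] by simp
 note ry = ographD(2)[OF d(1)]
 note inv = ribbon_iso_inv[OF rf ry isom]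
 define e where "e = img (minv m') d"
 have e: "e : nonloops (collapse (fst w) f)" unfolding e_def by (rule ribbon_iso_collapse(1)[OF ry rf inv d(2)])
 have dH: "d <= halves (fst y)" using edge_subset[OF ry] d(2) by (auto simp: nonloops_def)
 have im: "img m' e = d"
  unfolding e_def img_comp[symmetric] comp_minv using dH ribbon_isoD(2)[OF isom] by (simp add: img_pm)
 have eH: "e <= halves (fst w) - f" using edge_subset[OF rf] e by (auto simp: nonloops_def collapse_def)
 have mm: "g o_m (m' |` (- e)) = m" unfolding w(2) by (rule comp_restrict) (use d(5) im in auto)
 have iso: "oriented_iso (ocollapse (ocollapse w f) e) m x"
 proof -
  have "oriented_iso (ocollapse (ocollapse w f) e) (m' |` (- e)) (ocollapse y d)"
   using oriented_iso_collapse[OF oc o(2) m', of e] e im by simp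
  from oriented_iso_comp[OF ocollapse_spec(2)[OF oc] ocollapse_spec(2)[OF o(2) d(2)] this d(3)] mm e
  show ?thesis by simp
 qed
 have "dom m = halves (fst w) - f - e" using ribbon_isoD(1)[OF oriented_isoD[OF iso]] by (simp add: collapse_def)
 hence "e \<union> f = halves (fst w) - dom m" using eH f0H ff by auto
 moreover have "e \<inter> f = {}" using eH by auto
 moreover have "e : nonloops (fst w)" by (rule ocollapse_commute(1)[OF o(1) fn e])
 ultimately show ?thesis using that[OF fn] f0(1) e iso by blast
qed

lemma tower_swap:
 assumes i: "i : pairs" and t: "tower i = (w, m, f)" and e: "e \<inter> f = {}" "e \<union> f = halves (fst w) - dom m"
 shows "EX j:pairs. tower_rel (orev w, m, e) (tower j)"
proof -
 obtain e0 where e0: "f : nonloops (fst w)" "e0 : nonloops (fst w)" "e0 \<inter> f = {}" "e0 \<union> f = halves (fst w) - dom m"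
  "w : ographs k" "e0 : nonloops (collapse (fst w) f)" "oriented_iso (ocollapse (ocollapse w f) e0) m x"
  by (rule tower_edges[OF i t])
 have "e0 = (halves (fst w) - dom m) - f" using e0(3,4) by blast
 also have "... = e" using e by blast
 finally have [simp]: "e0 = e" .
 note o = ographD(1)[OF e0(5)]
 note cm = ocollapse_commute[OF o e0(1,6)]
 let ?w = "orev w"
 have wk: "?w : ographs k" by (rule orev_ographs[OF e0(5)])
 have en: "e : nonloops (fst ?w)" using e0(2) by simp
 let ?y = "ocollapse ?w e"
 have yk: "?y : ographs (Suc k)" by (rule ocollapse_ographs[OF wk en])
 have fn: "f : nonloops (fst ?y)" using ocollapse_commute(2)[OF o e0(1,6)] by simp
 have oce: "ograph (ocollapse w e)" using ocollapse_spec(2)[OF o] e0(2) by simp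
 have "ocollapse ?y f = orev (ocollapse (ocollapse w e) f)"
  using ocollapse_orev[OF o, of e] ocollapse_orev[OF oce, of f] e0(2) fn by simp
 also have "... = ocollapse (ocollapse w f) e"
  using cm(3) ocollapse_spec(2)[OF ocollapse_spec(2)[OF o e0(1)], of e] e0(6) by simp
 finally have yx: "oriented_iso (ocollapse ?y f) m x" using e0(7) by simp
 have "(?y, m) : Exps (Suc k) x" by (rule ExpsI[OF yk fn yx])
 then obtain c where c: "c : expansions (Suc k) x" "((?y, m), rep c) : over_rel (fst x) (Suc k)"
  by (rule expansion_exists)
 obtain y' g' where yg: "rep c = (y', g')" by (cases "rep c")
 then obtain A where A: "oriented_iso ?y A y'" "g' o_m A = m" using c(2) by (auto simp: over_rel_def)
 have "(?w, A) : Exps k y'" by (rule ExpsI[OF wk en A(1)])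
 then obtain d where d: "d : expansions k y'" "((?w, A), rep d) : over_rel (fst y') k"
  by (rule expansion_exists)
 obtain w' m' where wm: "rep d = (w', m')" by (cases "rep d")
 then obtain p where p: "oriented_iso ?w p w'" "m' o_m p = A" using d(2) by (auto simp: over_rel_def)
 have j: "(c, d) : pairs" using c d yg by (simp add: pairs_def)
 have tj: "tower (c, d) = (w', g' o_m m', halves (fst w') - dom m')" using yg wm by (simp add: tower_def)
 have w'k: "w' : ographs k" "m' : Mor (fst w') (fst y')"
  using Exps_overgraphs[OF rep_expansion(1)[OF d(1)]] wm by (auto simp: overgraphs_iff)
 have r: "ribbon_graph (fst ?w)" by (rule ographD(2)[OF wk])
 obtain F where F: "p = pm (halves (fst w)) F" "rib_bij (fst w) F (fst w')"
  using ribbon_iso_iff[OF r] oriented_isoD[OF p(1)] by auto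
 have imF: "F ` halves (fst w) = halves (fst w')" using F(2) by (auto simp: rib_bij_def bij_betw_def)
 have "dom A = halves (fst w) - e" using ribbon_isoD(1)[OF oriented_isoD[OF A(1)]] by (simp add: collapse_def)
 moreover have "h : dom A \<longleftrightarrow> F h : dom m'" if "h : halves (fst w)" for h
  using fun_cong[OF p(2), of h] that F(1) by (auto simp: domIff)
 moreover have eH: "e <= halves (fst w)" using e by blast
 ultimately have "F ` e = {l : F ` halves (fst w). l ~: dom m'}" by blast
 hence "F ` e = halves (fst w') - dom m'" unfolding imF by blast
 hence "img p e = halves (fst w') - dom m'" using F(1) eH by (simp add: img_pm)
 moreover have "(g' o_m m') o_m p = m" using A(2) p(2) by (simp add: map_comp_assoc)
 moreover have "dom (g' o_m m') <= halves (fst w')"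
  using Mor_facts(1)[OF ographD(2)[OF w'k(1)] w'k(2)] by (auto simp: map_comp_def split: option.splits)
 ultimately have "tower_rel (?w, m, e) (tower (c, d))"
  unfolding tj tower_rel_def using ographD(1)[OF wk] ographD(1)[OF w'k(1)] eH p(1) by auto
 thus ?thesis using j by blast
qed

text \<open>
 Exchanging the two edges is a sign-reversing bijection of the towers. The conclusion is stated in the form
 \<open>s = - s\<close>, which makes sense in any abelian group; over the rationals it gives \<open>s = 0\<close>.
\<close>

lemma expansions_twice:
 fixes P :: "'h overgraph => 'v::ab_group_add"
 assumes inv: "!!z z'. (z, z') : over_rel (fst x) k ==> P z = P z'"
  and anti: "!!z. z : overgraphs (fst x) k ==> P (over_rev z) = - P z"
 defines "s \<equiv> (SUM c:expansions (Suc k) x. SUM d:expansions k (fst (rep c)). P (fst (rep d), snd (rep c) o_m snd (rep d)))"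
 shows "s = - s"
proof -
 define Q where "Q i = P (fst (tower i), fst (snd (tower i)))" for i
 have s: "s = (SUM i:pairs. Q i)"
 proof -
  have fin: "finite (expansions (Suc k) x)" by (rule finite_expansions[OF ographD(1)[OF x]])
  have fin': "ALL c:expansions (Suc k) x. finite (expansions k (fst (rep c)))"
  proof
   fix c assume "c : expansions (Suc k) x"
   hence "rep c : overgraphs (fst x) (Suc k)" using Exps_overgraphs rep_expansion(1) by blast
   hence "fst (rep c) : ographs (Suc k)" by (cases "rep c") (simp add: overgraphs_iff)
   thus "finite (expansions k (fst (rep c)))" using finite_expansions ographD(1) by blast
  qed
  show ?thesis unfolding s_def pairs_def
   by (subst sum.Sigma[OF fin fin']) (auto simp: Q_def tower_def Let_def case_prod_unfold intro!: sum.cong)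
 qed
 have ov: "(w, m) : overgraphs (fst x) k" if "i : pairs" "tower i = (w, m, f)" for i w m f
 proof -
  from that(1) obtain y g w' m' where 1: "(y, g) : Exps (Suc k) x" "(w', m') : Exps k y"
   "tower i = (w', g o_m m', halves (fst w') - dom m')"
   by (rule pairsE) blast
  have a: "w' : ographs k" "m' : Mor (fst w') (fst y)" "y : ographs (Suc k)" "g : Mor (fst y) (fst x)"
   using Exps_overgraphs[OF 1(1)] Exps_overgraphs[OF 1(2)] by (auto simp: overgraphs_iff)
  show ?thesis using Mor_comp[OF ographD(2)[OF a(1)] ographD(2)[OF a(3)] a(2,4)] a(1) 1(3) that(2) by (simp add: overgraphs_iff)
 qed
 have ex: "EX j:pairs. EX w m f e. tower i = (w, m, f) & e \<inter> f = {} & e \<union> f = halves (fst w) - dom m \<and>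
   tower_rel (orev w, m, e) (tower j)" if i: "i : pairs" for i
 proof -
  obtain w m f where t: "tower i = (w, m, f)" by (cases "tower i")
  obtain e where e: "e \<inter> f = {}" "e \<union> f = halves (fst w) - dom m" by (rule tower_edges[OF i t])
  from tower_swap[OF i t e] show ?thesis using t e by blast
 qed
 then obtain N where N: "!!i. i : pairs ==> N i : pairs"
  "!!i. i : pairs ==> EX w m f e. tower i = (w, m, f) & e \<inter> f = {} & e \<union> f = halves (fst w) - dom m \<and>
   tower_rel (orev w, m, e) (tower (N i))" by metis
 have QN: "Q (N i) = - Q i" and NN: "N (N i) = i" if i: "i : pairs" for i
 proof -
  obtain w m f e where a: "tower i = (w, m, f)" "e \<inter> f = {}" "e \<union> f = halves (fst w) - dom m" "tower_rel (orev w, m, e) (tower (N i))"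
   using N(2)[OF i] by blast
  obtain w' m' f' e' where b: "tower (N i) = (w', m', f')" "e' \<inter> f' = {}" "e' \<union> f' = halves (fst w') - dom m'"
   "tower_rel (orev w', m', e') (tower (N (N i)))"
   using N(2)[OF N(1)[OF i]] by blast
  have wk: "w : ographs k" using ov[OF i a(1)] by (simp add: overgraphs_iff)
  have ab: "tower_rel (orev w, m, e) (w', m', f')" using a(4) b(1) by simp
  then obtain p where "oriented_iso (orev w) p w'" "m' o_m p = m" by (auto simp: tower_rel_def)
  hence "(over_rev (w, m), (w', m')) : over_rel (fst x) k"
   using over.rv_in[OF ov[OF i a(1)]] ov[OF N(1)[OF i] b(1)] by (auto simp: over_rev_def intro: over_relI)
  from inv[OF this] anti[OF ov[OF i a(1)]] show "Q (N i) = - Q i" using a(1) b(1) by (simp add: Q_def)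
  have "tower_rel (orev (orev w), m, f) (orev w', m', e')"
   by (rule tower_rel_rev[OF ab]) (use a b in auto)
  hence "tower_rel (tower i) (orev w', m', e')" using a(1) ographD(1)[OF wk] by simp
  moreover obtain w2 m2 f2 where t2: "tower (N (N i)) = (w2, m2, f2)" by (cases "tower (N (N i))")
  ultimately have "tower_rel (tower i) (tower (N (N i)))"
   using tower_rel_trans[of w m f "orev w'" m' e' w2 m2 f2] b(4) a(1) by simp
  thus "N (N i) = i" using tower_inj[OF i] N(1) i by metis
 qed
 have "(SUM i:pairs. Q i) = (SUM i:pairs. Q (N i))"
  by (rule sum.reindex_bij_witness[of _ N N]) (use N(1) NN in auto)
 also have "... = - (SUM i:pairs. Q i)" using QN by (simp add: sum_negf)
 finally show ?thesis unfolding s .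
qed

end

section \<open>The natural orientation of a trivalent graph\<close>

definition blk :: "'h ribbon => ('h set => 'h) => 'h set => 'h cell list" where
 "blk G b v = [Inl v, Inr (b v), Inr (nxt G (b v)), Inr (nxt G (nxt G (b v)))]"

context
 fixes G :: "'h ribbon"
 assumes G: "ribbon_graph G" and tri: "codim G = 0"
begin

lemma trivalent: assumes "v : verts G" shows "card v = 3"
proof -
 have "card v - 3 = 0" using tri assms finite_verts[OF G] by (auto simp: codim_def)
 thus ?thesis using card_vert[OF G assms] by simp
qed

lemma trivalent_vert:
 assumes v: "v : verts G" "h : v"
 shows "v = {h, nxt G h, nxt G (nxt G h)}" "distinct [h, nxt G h, nxt G (nxt G h)]" "nxt G (nxt G (nxt G h)) = h"
proof -
 let ?n = "nxt G"
 have q: "?n h : v" "?n (?n h) : v" "?n (?n (?n h)) : v" using v nxt_vert[OF G v(1)] by auto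
 have neq: "?n l ~= l" if "l : v" for l using nxt_neq[OF G] vert_subset[OF G v(1)] that by blast
 have "?n (?n h) ~= h"
 proof
  assume *: "?n (?n h) = h"
  have "v <= {h, ?n h}" by (rule vert_subset_closed[OF G v]) (use * in auto)
  hence "card v \<le> card {h, ?n h}" by (intro card_mono) auto
  also have "... \<le> 2" by (simp add: card_insert_if)
  finally show False using trivalent[OF v(1)] by simp
 qed
 thus d: "distinct [h, ?n h, ?n (?n h)]" using neq[OF v(2)] neq[OF q(1)] by auto
 hence "card {h, ?n h, ?n (?n h)} = card v" using trivalent[OF v(1)] by simp
 thus s: "v = {h, ?n h, ?n (?n h)}"
  using card_subset_eq[OF finite_vert[OF G v(1)], of "{h, ?n h, ?n (?n h)}"] v(2) q by simp
 have "?n (?n (?n h)) : {h, ?n h, ?n (?n h)}" using q(3) s by simp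
 thus "?n (?n (?n h)) = h" using neq[OF q(2)] nxt_inj[OF G, of "?n (?n h)" h] d by auto
qed

lemma natural_word:
 assumes vs: "distinct vs" "set vs = verts G" and b: "ALL v:verts G. b v : v"
 shows "is_word G (concat (map (blk G b) vs))"
  "map (%v. Inl v # map (%i. Inr ((nxt G ^^ i) (b v))) [0..<card v]) vs = map (blk G b) vs"
proof -
 have sb: "set (blk G b v) = insert (Inl v) (Inr ` v)" if "v : verts G" for v
  using trivalent_vert(1)[OF that, of "b v"] b that by (auto simp: blk_def)
 have "set (concat (map (blk G b) vs)) = (UN v:verts G. insert (Inl v) (Inr ` v))"
  using sb vs(2) by auto
 also have "... = cells G" using verts_Union[OF G] by (auto simp: cells_def)
 finally have s: "set (concat (map (blk G b) vs)) = cells G" .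
 have "distinct (concat (map (blk G b) vs))"
 proof (rule distinct_concat)
  have "inj_on (blk G b) (set vs)" by (rule inj_onI) (simp add: blk_def)
  thus "distinct (map (blk G b) vs)" using vs(1) by (simp add: distinct_map)
  show "distinct ys" if "ys : set (map (blk G b) vs)" for ys
   using that trivalent_vert(2) b vs(2) by (auto simp: blk_def)
  fix ys zs assume yz: "ys : set (map (blk G b) vs)" "zs : set (map (blk G b) vs)" "ys ~= zs"
  then obtain u v where uv: "u : verts G" "v : verts G" "ys = blk G b u" "zs = blk G b v" "u ~= v" using vs(2) by auto
  thus "set ys \<inter> set zs = {}" using vert_disjoint[OF G uv(1,2,5)] unfolding uv(3,4) sb[OF uv(1)] sb[OF uv(2)] by auto
 qed
 thus "is_word G (concat (map (blk G b) vs))" using s by (simp add: is_word_def)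
 show "map (%v. Inl v # map (%i. Inr ((nxt G ^^ i) (b v))) [0..<card v]) vs = map (blk G b) vs"
  using trivalent vs(2) by (auto simp: blk_def numeral_3_eq_3)
qed

lemma natural_unique:
 assumes vs: "distinct vs" "set vs = verts G" and b: "ALL v:verts G. b v : v"
  and vs': "distinct vs'" "set vs' = verts G" and b': "ALL v:verts G. b' v : v"
 shows "rearr (concat (map (blk G b) vs)) (concat (map (blk G b') vs')) False"
proof -
 \<comment> \<open>A cyclic rotation of three letters is even, and so is the exchange of two blocks of length four.\<close>
 have one: "rearr (blk G b v) (blk G b' v) False" if v: "v : verts G" for v
 proof -
  let ?h = "b v" and ?n = "nxt G"
  have h: "?h : v" "b' v : v" using b b' v by auto
  have t: "?n (?n (?n ?h)) = ?h" by (rule trivalent_vert(3)[OF v h(1)])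
  have "b' v = ?h \<or> b' v = ?n ?h \<or> b' v = ?n (?n ?h)" using trivalent_vert(1)[OF v h(1)] h(2) by blast
  thus ?thesis
  proof (elim disjE)
   assume "b' v = ?h"
   thus ?thesis by (simp add: blk_def rearr_refl)
  next
   assume *: "b' v = ?n ?h"
   show ?thesis using rearr_ctxt[OF rearr_blocks[of "[Inr ?h]" "[Inr (?n ?h), Inr (?n (?n ?h))]"], of "[Inl v]" "[]"] t
    by (simp add: blk_def *)
  next
   assume *: "b' v = ?n (?n ?h)"
   show ?thesis using rearr_ctxt[OF rearr_blocks[of "[Inr ?h, Inr (?n ?h)]" "[Inr (?n (?n ?h))]"], of "[Inl v]" "[]"] t
    by (simp add: blk_def *)
  qed
 qed
 have "rearr (concat (map (blk G b) us)) (concat (map (blk G b') us)) False" if "set us <= verts G" for us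
  using that
 proof (induction us)
  case (Cons u us)
  thus ?case using rearr_append[OF one[of u]] by simp
 qed (simp add: rearr_refl)
 hence 1: "rearr (concat (map (blk G b) vs)) (concat (map (blk G b') vs)) False" using vs(2) by simp
 have 2: "rearr (concat (map (blk G b') us)) (concat (map (blk G b') us')) False" if "rearr us us' d" for us us' d
  using that
 proof (induction rule: rearr.induct)
  case (rearr_swap xs p u w q d)
  have "rearr (blk G b' u @ blk G b' w) (blk G b' w @ blk G b' u) False"
   using rearr_blocks[of "blk G b' u" "blk G b' w"] by (simp add: blk_def)
  from rearr_trans[OF rearr_ctxt[OF this, of "concat (map (blk G b') p)" "concat (map (blk G b') q)"]] rearr_swap.IH
  show ?case by simp
 qed (simp add: rearr_refl)
 obtain d where "rearr vs vs' d" using rearr_exists_set[of vs vs'] vs vs' by auto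
 from rearr_trans[OF 2[OF this] 1] show ?thesis by simp
qed

end

lemma is_natural_iff:
 assumes x: "x : ographs 0" and vs: "distinct vs" "set vs = verts (fst x)" "ALL v:verts (fst x). b v : v"
 shows "is_natural x \<longleftrightarrow> snd x = word_orient (fst x) (concat (map (blk (fst x) b) vs))"
proof -
 have g: "ribbon_graph (fst x)" "codim (fst x) = 0" using x ographD by (auto simp: ographs_iff ograph_def)
 show ?thesis
 proof
  assume "is_natural x"
  then obtain vs' b' where n: "distinct vs'" "set vs' = verts (fst x)" "ALL v:verts (fst x). b' v : v"
   "snd x = word_orient (fst x)
    (concat (map (%v. Inl v # map (%i. Inr ((nxt (fst x) ^^ i) (b' v))) [0..<card v]) vs'))"
   unfolding is_natural_def by blast
  have "snd x = word_orient (fst x) (concat (map (blk (fst x) b') vs'))"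
   using n(4) unfolding natural_word(2)[OF g n(1-3)] .
  with n(1-3) show "snd x = word_orient (fst x) (concat (map (blk (fst x) b) vs))"
   using word_orient_rearr[OF natural_unique[OF g vs], of vs' b'] natural_word(1)[OF g vs] by simp
 next
  assume "snd x = word_orient (fst x) (concat (map (blk (fst x) b) vs))"
  thus "is_natural x" unfolding is_natural_def
   by (intro exI[of _ vs] exI[of _ b] conjI) (simp_all add: vs natural_word(2)[OF g vs])
 qed
qed

lemma natural_choice:
 assumes "ribbon_graph G"
 obtains vs b where "distinct vs" "set vs = verts G" "ALL v:verts G. b v : v"
proof -
 obtain vs where "set vs = verts G" "distinct vs" using finite_distinct_list[OF finite_verts[OF assms]] by blast
 moreover have "ALL v:verts G. (SOME h. h : v) : v" using vert_other[OF assms] by (metis someI)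
 ultimately show ?thesis using that[of vs "%v. SOME h. h : v"] by blast
qed

lemma orient_sign_orev: assumes x: "x : ographs 0" shows "orient_sign (orev x) = - orient_sign x"
proof -
 have g: "ribbon_graph (fst x)" "codim (fst x) = 0" using x ographD by (auto simp: ographs_iff ograph_def)
 obtain vs b where vs: "distinct vs" "set vs = verts (fst x)" "ALL v:verts (fst x). b v : v" using natural_choice[OF g(1)] .
 let ?W = "concat (map (blk (fst x) b) vs)"
 have w: "is_word (fst x) ?W" by (rule natural_word(1)[OF g vs])
 obtain c where c: "snd x = flip (fst x) c (word_orient (fst x) ?W)" using ograph_flip[OF ographD(1)[OF x] w] by blast
 have inj: "flip (fst x) d (word_orient (fst x) ?W) = word_orient (fst x) ?W \<longleftrightarrow> \<not> d" for d
  using word_orient_flip_inj[OF w, of d False] by (cases d) auto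
 have "is_natural x \<longleftrightarrow> \<not> c" unfolding is_natural_iff[OF x vs] c inj ..
 moreover have "snd (orev x) = flip (fst x) (\<not> c) (word_orient (fst x) ?W)"
  using c by (simp add: snd_orev flip_flip[OF word_orient_subset])
 hence "is_natural (orev x) \<longleftrightarrow> c"
  using is_natural_iff[OF orev_ographs[OF x], of vs b] vs inj[of "\<not> c"] by simp
 ultimately show ?thesis by (simp add: orient_sign_def)
qed

lemma orient_sign_iso:
 assumes x: "x : ographs 0" "y : ographs 0" and f: "oriented_iso x f y"
 shows "orient_sign y = orient_sign x"
proof -
 have imp: "is_natural y" if x: "x : ographs 0" "y : ographs 0" and f: "oriented_iso x f y" and n: "is_natural x" for x y :: "'h ograph" and f
 proof -
  have g: "ribbon_graph (fst x)" "codim (fst x) = 0" using x ographD by (auto simp: ographs_iff ograph_def)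
  obtain vs b where vs: "distinct vs" "set vs = verts (fst x)" "ALL v:verts (fst x). b v : v" using natural_choice[OF g(1)] .
  let ?W = "concat (map (blk (fst x) b) vs)"
  have w: "is_word (fst x) ?W" by (rule natural_word(1)[OF g vs])
  have sx: "snd x = flip (fst x) False (word_orient (fst x) ?W)" using is_natural_iff[OF x(1) vs] n by simp
  obtain F where F: "f = pm (halves (fst x)) F" "rib_bij (fst x) F (fst y)"
   using ribbon_iso_iff[OF g(1)] oriented_isoD[OF f] by blast
  have inj: "inj_on F (halves (fst x))" and im: "(`) F ` verts (fst x) = verts (fst y)"
   and n: "!!h. h : halves (fst x) ==> F (nxt (fst x) h) = nxt (fst y) (F h)"
   using F(2) by (auto simp: rib_bij_def bij_betw_def)
  have injv: "inj_on ((`) F) (verts (fst x))"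
   by (rule inj_onI) (metis inj_on_image_eq_iff[OF inj] vert_subset[OF g(1)])
  define b' where "b' u = F (b (inv_into (verts (fst x)) ((`) F) u))" for u
  have b': "b' (F ` v) = F (b v)" if "v : verts (fst x)" for v using that injv by (simp add: b'_def)
  have "map (cell_map f) (blk (fst x) b v) = blk (fst y) b' (F ` v)" if v: "v : verts (fst x)" for v
  proof -
   have h: "b v : halves (fst x)" "nxt (fst x) (b v) : halves (fst x)" "nxt (fst x) (nxt (fst x) (b v)) : halves (fst x)"
    using vs(3) v vert_subset[OF g(1) v] nxt_vert[OF g(1) v] by auto
   thus ?thesis using n b'[OF v] vert_subset[OF g(1) v] by (simp add: blk_def cell_map_def F(1) img_pm)
  qed
  hence "map (cell_map f) ?W = concat (map (blk (fst y) b') (map ((`) F) vs))"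
  proof -
   have "map (%v. map (cell_map f) (blk (fst x) b v)) vs = map (%v. blk (fst y) b' (F ` v)) vs"
    using \<open>!!v. v : verts (fst x) ==> map (cell_map f) (blk (fst x) b v) = blk (fst y) b' (F ` v)\<close> vs(2)
    by (intro map_cong) auto
   thus ?thesis by (simp add: map_concat comp_def del: map_eq_conv)
  qed
  moreover have "snd y = word_orient (fst y) (map (cell_map f) ?W)"
   using oriented_iso_word[OF f g(1) w sx] by simp
  moreover have "distinct (map ((`) F) vs)" "set (map ((`) F) vs) = verts (fst y)"
   using vs(1,2) injv im by (auto simp: distinct_map)
  moreover have "ALL u:verts (fst y). b' u : u" 
  proof
   fix u assume "u : verts (fst y)"
   then obtain v where v: "v : verts (fst x)" "u = F ` v" unfolding im[symmetric] by (rule imageE)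
   thus "b' u : u" using b'[OF v(1)] vs(3) by simp
  qed
  ultimately show "is_natural y" using is_natural_iff[OF x(2)] by metis
 qed
 have "is_natural x \<longleftrightarrow> is_natural y"
  using imp[OF x f] imp[OF x(2,1) oriented_iso_inv[OF ographD(1)[OF x(1)] ographD(1)[OF x(2)] f]] by blast
 thus ?thesis by (simp add: orient_sign_def)
qed

section \<open>Rational chains\<close>

definition qs :: "rat => ('s \<Rightarrow>\<^sub>0 rat) => ('s \<Rightarrow>\<^sub>0 rat)" where
 "qs q x = Poly_Mapping.map (%c. q * c) x"

abbreviation bas :: "'s => ('s \<Rightarrow>\<^sub>0 rat)" where "bas s \<equiv> Poly_Mapping.single s 1"

definition qext :: "('s => ('t \<Rightarrow>\<^sub>0 rat)) => ('s \<Rightarrow>\<^sub>0 rat) => ('t \<Rightarrow>\<^sub>0 rat)" where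
 "qext f x = (SUM s:keys x. qs (lookup x s) (f s))"

lemma lookup_qs [simp]: "lookup (qs q x) s = q * lookup x s"
 by (simp add: qs_def Poly_Mapping.map.rep_eq when_def)

lemma qs_simps [simp]: "qs q 0 = 0" "qs 0 x = 0" "qs 1 x = x" "qs q (qs r x) = qs (q * r) x"
 by (auto intro!: poly_mapping_eqI)

lemma qs_add: "qs q (x + y) = qs q x + qs q y" and qs_add_left: "qs (q + r) x = qs q x + qs r x"
 and qs_minus: "qs q (x - y) = qs q x - qs q y" and qs_uminus: "qs q (- x) = - qs q x" "qs (- q) x = - qs q x"
 by (auto intro!: poly_mapping_eqI simp: lookup_add lookup_minus algebra_simps)

lemma qs_sum: "qs q (sum f A) = (SUM a:A. qs q (f a))"
 by (induction A rule: infinite_finite_induct) (auto simp: qs_add)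

lemma eq_uminus_qs: assumes "x = - x" shows "(x :: 's \<Rightarrow>\<^sub>0 rat) = 0"
proof (rule poly_mapping_eqI)
 fix s have "lookup x s = - lookup x s" using assms by (metis lookup_uminus)
 thus "lookup x s = lookup 0 s" by simp
qed

lemma keys_qs: "keys (qs q x) <= keys x"
 by (auto simp: in_keys_iff)

lemma qext_superset:
 assumes "finite A" "keys x <= A"
 shows "qext f x = (SUM s:A. qs (lookup x s) (f s))"
 unfolding qext_def by (rule sum.mono_neutral_left) (use assms in \<open>auto simp: in_keys_iff\<close>)

lemma qext_add: "qext f (x + y) = qext f x + qext f y"
proof -
 let ?A = "keys x \<union> keys y"
 have "qext f (x + y) = (SUM s:?A. qs (lookup (x + y) s) (f s))"
  by (rule qext_superset) (use keys_add[of x y] in auto)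
 also have "... = qext f x + qext f y"
  by (simp add: qext_superset[of ?A x] qext_superset[of ?A y] lookup_add qs_add_left sum.distrib)
 finally show ?thesis .
qed

lemma qext_qs: "qext f (qs q x) = qs q (qext f x)"
proof -
 have "qext f (qs q x) = (SUM s:keys x. qs (lookup (qs q x) s) (f s))"
  by (rule qext_superset) (use keys_qs[of q x] in auto)
 thus ?thesis by (simp add: qext_def qs_sum)
qed

lemma qext_single [simp]: "qext f (Poly_Mapping.single s q) = qs q (f s)"
 by (cases "q = 0") (auto simp: qext_def)

lemma qext_zero [simp]: "qext f 0 = 0" by (simp add: qext_def)

lemma qext_uminus: "qext f (- x) = - qext f x"
 using qext_qs[of f "- 1" x] by (simp add: qs_uminus)

lemma qext_diff: "qext f (x - y) = qext f x - qext f y"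
 using qext_add[of f x "- y"] by (simp add: qext_uminus)

lemma qext_sum: "qext f (sum g A) = (SUM a:A. qext f (g a))"
 by (induction A rule: infinite_finite_induct) (auto simp: qext_add)

lemma qext_cong: "(!!s. s : keys x ==> f s = g s) ==> qext f x = qext g x"
 by (auto simp: qext_def intro!: sum.cong)

lemma qext_comp: "qext g (qext f x) = qext (%s. qext g (f s)) x"
 by (simp add: qext_def[of f] qext_def[of "%s. qext g (f s)"] qext_sum qext_qs)

lemma qext_bas [simp]: "qext bas x = x"
proof (rule poly_mapping_eqI)
 fix s
 have "lookup (qext bas x) s = (SUM t:keys x. lookup x t * (if t = s then 1 else 0))"
  by (simp add: qext_def lookup_sum lookup_single when_def)
 also have "... = lookup x s" by (auto simp: if_distrib in_keys_iff cong: if_cong)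
 finally show "lookup (qext bas x) s = lookup x s" .
qed

lemma qext_fun_add: "qext (%s. f s + g s) x = qext f x + qext g x"
 by (simp add: qext_def qs_add sum.distrib)

lemma qext_fun_diff: "qext (%s. f s - g s) x = qext f x - qext g x"
 by (simp add: qext_def qs_minus sum_subtractf)

lemma qext_fun_qs: "qext (%s. qs q (f s)) x = qs q (qext f x)"
 by (simp add: qext_def qs_sum mult.commute)

lemma keys_qext: "keys (qext f x) <= (UN s:keys x. keys (f s))"
proof -
 have "keys (SUM s:A. qs (c s) (f s)) <= (UN s:A. keys (f s))" for A c
 proof (induction A rule: infinite_finite_induct)
  case (insert a A)
  thus ?case using keys_add[of "qs (c a) (f a)" "SUM s:A. qs (c s) (f s)"] keys_qs[of "c a" "f a"] by auto
 qed auto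
 thus ?thesis by (simp add: qext_def)
qed

definition emb :: "('s \<Rightarrow>\<^sub>0 int) => ('s \<Rightarrow>\<^sub>0 rat)" where
 "emb c = Poly_Mapping.map of_int c"

lemma lookup_emb [simp]: "lookup (emb c) s = of_int (lookup c s)"
 by (simp add: emb_def Poly_Mapping.map.rep_eq when_def)

lemma emb_simps [simp]: "emb 0 = 0" "emb (frag_of s) = bas s" "emb (c + d) = emb c + emb d" "emb (c - d) = emb c - emb d"
 "emb (frag_cmul k c) = qs (of_int k) (emb c)" "emb (- c) = - emb c"
 by (auto intro!: poly_mapping_eqI simp: lookup_add lookup_minus lookup_single when_def)

lemma emb_sum: "emb (sum f A) = (SUM a:A. emb (f a))"
 by (induction A rule: infinite_finite_induct) auto

lemma keys_emb [simp]: "keys (emb c) = keys c" by (auto simp: in_keys_iff)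

lemma emb_inject: "emb c = emb d ==> c = d"
 by (rule poly_mapping_eqI) (metis lookup_emb of_int_eq_iff)

lemma emb_frag_extend: "emb (frag_extend f c) = qext (%s. emb (f s)) (emb c)"
 by (simp add: frag_extend_def emb_sum qext_def)

lemma qext_integral:
 fixes f :: "'s => ('t \<Rightarrow>\<^sub>0 rat)"
 assumes "h : hom (free_Abelian_group S) add_group" "!!s. s : S ==> h (frag_of s) = f s" "keys c <= S"
 shows "h c = qext f (emb c)"
proof -
 have k: "(%c. qext f (emb c)) : hom (free_Abelian_group S) add_group"
  by (auto simp: hom_def qext_add)
 interpret h: group_hom "free_Abelian_group S" add_group h
  using assms(1) by (simp add: group_hom_def group_hom_axioms_def comm_group.axioms(2)[OF comm_group_add_group])
 show ?thesis using assms(3)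
 proof (rule free_Abelian_group_induct)
  show "h 0 = qext f (emb 0)" using h.hom_one by simp
  fix x y assume xy: "keys x <= S" "keys y <= S" "h x = qext f (emb x)" "h y = qext f (emb y)"
  thus "h (x - y) = qext f (emb (x - y))"
   using h.hom_mult[of x "- y"] h.hom_inv[of y] by (simp add: qext_diff)
 qed (use assms(2) in auto)
qed

text \<open>Multiply by the product of the denominators of all coefficients.\<close>

lemma clear_denominators: "EX N c. N > (0::nat) & emb c = qs (of_nat N) (x :: 's \<Rightarrow>\<^sub>0 rat)"
proof -
 define N where "N = (\<Prod>s\<in>keys x. nat (snd (quotient_of (lookup x s))))"
 have pos: "snd (quotient_of r) > 0" for r :: rat using quotient_of_denom_pos' by blast
 have N: "N > 0" unfolding N_def using pos by (intro prod_pos) simp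
 have int: "of_nat N * lookup x s : \<int>" for s
 proof (cases "s : keys x")
  case True
  let ?q = "quotient_of (lookup x s)"
  have "nat (snd ?q) dvd N" unfolding N_def by (rule dvd_prodI[OF finite_keys True])
  then obtain M where M: "N = nat (snd ?q) * M" by blast
  obtain a b where q: "?q = (a, b)" by (cases ?q)
  have b: "b > 0" using pos[of "lookup x s"] q by simp
  have "of_nat N * lookup x s = of_int (int M * a)"
   unfolding M q using b quotient_of_div[OF q] by (simp add: of_nat_nat)
  thus ?thesis by (metis Ints_of_int)
 qed (simp add: in_keys_iff)
 define c where "c = Poly_Mapping.map (%r. \<lfloor>of_nat N * r\<rfloor>) x"
 have "lookup c s = \<lfloor>of_nat N * lookup x s\<rfloor>" for s
  by (simp add: c_def Poly_Mapping.map.rep_eq when_def)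
 hence "emb c = qs (of_nat N) x"
  using int by (intro poly_mapping_eqI) (simp add: of_int_floor_cancel)
 thus ?thesis using N by blast
qed

section \<open>Chains on the slices of the category of ribbon graphs\<close>

lemma fat_simps [simp]: "Obj fat = {G. ribbon_graph G}" "Arr fat = Mor" "Comp fat = (o_m)"
 by (simp_all add: fat_def)

type_synonym 'h ssimplex = "('h ribbon \<times> 'h mor, 'h mor) simplex"

abbreviation NS :: "'h ribbon => nat => 'h ssimplex set" where
 "NS G n \<equiv> nerve (slice fat G) n"

text \<open>
 The nerve of the category and those of its slices share one formula for faces, since the slices inherit the
 composition of maps.
\<close>

definition mf :: "nat => ('o, 'h mor) simplex => ('o, 'h mor) simplex" where
 "mf i = (%(xs, fs).
  (take i xs @ drop (Suc i) xs,
   if i = 0 then tl fs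
   else if i = length fs then butlast fs
   else take (i - 1) fs @ [fs ! i o_m fs ! (i - 1)] @ drop (Suc i) fs))"

lemma face_eq: "face fat i = mf i" "face (slice fat G) i = mf i"
 by (auto simp: face_def mf_def slice_def fun_eq_iff)

definition bd :: "nat => ('o, 'h mor) simplex => (('o, 'h mor) simplex \<Rightarrow>\<^sub>0 rat)" where
 "bd n M = (\<Sum>i\<le>n. qs ((- 1) ^ i) (bas (mf i M)))"

abbreviation qbd :: "nat => (('o, 'h mor) simplex \<Rightarrow>\<^sub>0 rat) => (('o, 'h mor) simplex \<Rightarrow>\<^sub>0 rat)" where
 "qbd n \<equiv> qext (bd n)"

definition omap :: "('o => 'p) => ('o, 'm) simplex => ('p, 'm) simplex" where
 "omap u = (%(xs, fs). (map u xs, fs))"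

abbreviation qomap :: "('o => 'p) => (('o, 'm) simplex \<Rightarrow>\<^sub>0 rat) => (('p, 'm) simplex \<Rightarrow>\<^sub>0 rat)" where
 "qomap u \<equiv> qext (%M. bas (omap u M))"

lemma mf_omap: "mf i (omap u M) = omap u (mf i M)"
 by (auto simp: mf_def omap_def take_map drop_map split: prod.splits)

lemma qbd_omap: "qbd n (qomap u x) = qomap u (qbd n x)"
 unfolding qext_comp by (rule qext_cong) (simp add: bd_def qext_sum qext_qs mf_omap)

lemma qomap_comp: "qomap u (qomap w x) = qomap (%z. u (w z)) x"
 unfolding qext_comp by (rule qext_cong) (simp add: omap_def case_prod_unfold comp_def)

abbreviation push :: "'h mor => 'h ribbon \<times> 'h mor => 'h ribbon \<times> 'h mor" where
 "push m \<equiv> (%(x, f). (x, m o_m f))"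

abbreviation qpush :: "'h mor => ('h ssimplex \<Rightarrow>\<^sub>0 rat) => ('h ssimplex \<Rightarrow>\<^sub>0 rat)" where
 "qpush m \<equiv> qomap (push m)"

lemma qpush_comp: "qpush m (qpush k x) = qpush (m o_m k) x"
 unfolding qomap_comp by (simp add: case_prod_unfold map_comp_assoc)

lemma qpush_forget: "qomap fst (qpush m x) = qomap fst x"
 unfolding qomap_comp by (simp add: case_prod_unfold)

lemma NS_iff:
 "(xs, fs) : NS G n \<longleftrightarrow> length xs = Suc n & length fs = n \<and>
  (ALL i<=n. ribbon_graph (fst (xs ! i)) & snd (xs ! i) : Mor (fst (xs ! i)) G) \<and>
  (ALL i<n. fs ! i : Mor (fst (xs ! i)) (fst (xs ! Suc i)) & snd (xs ! Suc i) o_m fs ! i = snd (xs ! i))"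
proof -
 have "set xs <= {(x, f). ribbon_graph x & f : Mor x G} \<longleftrightarrow>
  (ALL i<=n. ribbon_graph (fst (xs ! i)) & snd (xs ! i) : Mor (fst (xs ! i)) G)" if "length xs = Suc n"
 proof -
  have "set xs <= A \<longleftrightarrow> (ALL i<=n. xs ! i : A)" for A
   unfolding subset_iff in_set_conv_nth that less_Suc_eq_le by blast
  thus ?thesis by (simp add: case_prod_unfold)
 qed
 thus ?thesis by (auto simp: nerve_def slice_def case_prod_unfold)
qed

lemma fat_nerve_iff:
 "(xs, fs) : nerve fat n \<longleftrightarrow> length xs = Suc n & length fs = n & (ALL i<=n. ribbon_graph (xs ! i)) \<and>
  (ALL i<n. fs ! i : Mor (xs ! i) (xs ! Suc i))"
proof -
 have "set xs <= {x. ribbon_graph x} \<longleftrightarrow> (ALL i<=n. ribbon_graph (xs ! i))" if "length xs = Suc n"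
  using that by (force simp: set_conv_nth less_Suc_eq_le)
 thus ?thesis by (auto simp: nerve_def)
qed

lemma face_nerve:
 assumes comp: "!!x y z f g. x : Obj C ==> y : Obj C ==> z : Obj C ==> f : Arr C x y ==> g : Arr C y z ==> Comp C g f : Arr C x z"
  and M: "M : nerve C (Suc n)" and i: "i \<le> Suc n"
 shows "face C i M : nerve C n"
proof -
 obtain xs fs where s: "M = (xs, fs)" by (cases M)
 have l: "length xs = Suc (Suc n)" "length fs = Suc n" "set xs <= Obj C"
  and a: "!!j. j < Suc n ==> fs ! j : Arr C (xs ! j) (xs ! Suc j)" using M s by (auto simp: nerve_def)
 let ?xs = "take i xs @ drop (Suc i) xs"
 let ?fs = "if i = 0 then tl fs else if i = length fs then butlast fs
   else take (i - 1) fs @ [Comp C (fs ! i) (fs ! (i - 1))] @ drop (Suc i) fs"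
 have xn: "?xs ! j = (if j < i then xs ! j else xs ! Suc j)" if "j \<le> n" for j
  using that l i by (auto simp: nth_append min_def)
 have fn: "?fs ! j = (if i = 0 then fs ! Suc j else if i = Suc n then fs ! j else if j < i - 1 then fs ! j
   else if j = i - 1 then Comp C (fs ! i) (fs ! (i - 1)) else fs ! Suc j)" if "j < n" for j
 proof -
  consider "i = 0" | "i = Suc n" "i ~= 0" | "0 < i" "i < Suc n" using i by linarith
  thus ?thesis
  proof cases
   case 3
   have "(take (i - 1) fs @ [c] @ drop (Suc i) fs) ! j = (if j < i - 1 then fs ! j else if j = i - 1 then c else fs ! Suc j)" for c
    using 3 that l by (auto simp: nth_append nth_Cons' min_def)
   thus ?thesis using 3 l by simp
  qed (use that l in \<open>auto simp: nth_tl nth_butlast\<close>)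
 qed
 have "?fs ! j : Arr C (?xs ! j) (?xs ! Suc j)" if j: "j < n" for j
 proof -
  have o: "xs ! k : Obj C" if "k \<le> Suc n" for k using l(1,3) that nth_mem[of k xs] by auto
  have c: "Comp C (fs ! Suc k) (fs ! k) : Arr C (xs ! k) (xs ! Suc (Suc k))" if "Suc k \<le> n" for k
   using comp[of "xs ! k" "xs ! Suc k" "xs ! Suc (Suc k)" "fs ! k" "fs ! Suc k"] o a that by auto
  show ?thesis
   unfolding fn[OF j] using xn[of j] xn[of "Suc j"] j i a[of j] a[of "Suc j"] c[of j] by (cases i) auto
 qed
 moreover have "length ?xs = Suc n" "length ?fs = n" using l i by auto
 moreover have "set ?xs <= Obj C" using l(3) set_take_subset[of i xs] set_drop_subset[of "Suc i" xs] by auto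
 ultimately show ?thesis unfolding s face_def nerve_def by simp
qed

lemma mf_NS:
 assumes G: "ribbon_graph G" and "M : NS G (Suc n)" "i \<le> Suc n"
 shows "mf i M : NS G n"
proof -
 have "face (slice fat G) i M : NS G n"
 proof (rule face_nerve[OF _ assms(2,3)])
  fix x y z f g
  assume "x : Obj (slice fat G)" "y : Obj (slice fat G)" "z : Obj (slice fat G)"
   "f : Arr (slice fat G) x y" "g : Arr (slice fat G) y z"
  thus "Comp (slice fat G) g f : Arr (slice fat G) x z"
   using Mor_comp[of "fst x" "fst y" f g "fst z"]
   by (auto simp: slice_def case_prod_unfold map_comp_assoc[symmetric])
 qed
 thus ?thesis by (simp add: face_eq)
qed

lemma mf_fat: "M : nerve fat (Suc n) ==> i \<le> Suc n ==> mf i M : nerve fat n"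
 unfolding face_eq(1)[symmetric] by (rule face_nerve) (auto intro: Mor_comp)

definition CS :: "'h ribbon => nat => ('h ssimplex \<Rightarrow>\<^sub>0 rat) set" where
 "CS G n = {x. keys x <= NS G n}"

lemma CS_zero: "0 : CS G n" by (simp add: CS_def)
lemma CS_add: "x : CS G n ==> y : CS G n ==> x + y : CS G n" using keys_add[of x y] by (auto simp: CS_def)
lemma CS_diff: "x : CS G n ==> y : CS G n ==> x - y : CS G n" using keys_diff[of x y] by (auto simp: CS_def)
lemma CS_qs: "x : CS G n ==> qs q x : CS G n" using keys_qs[of q x] by (auto simp: CS_def)
lemma CS_sum: "(!!a. a : A ==> f a : CS G n) ==> sum f A : CS G n"
 by (induction A rule: infinite_finite_induct) (auto intro: CS_zero CS_add)
lemma CS_bas: "M : NS G n ==> bas M : CS G n" by (simp add: CS_def)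
lemma CS_qext: "x : CS G n ==> (!!M. M : NS G n ==> f M : CS G' k) ==> qext f x : CS G' k"
 using keys_qext[of f x] by (fastforce simp: CS_def)

lemma CS_qbd: "ribbon_graph G ==> x : CS G (Suc n) ==> qbd (Suc n) x : CS G n"
 by (erule CS_qext, unfold bd_def, intro CS_sum CS_qs CS_bas mf_NS) auto

lemma push_NS:
 assumes "ribbon_graph G" "m : Mor G G'" "M : NS G n"
 shows "omap (push m) M : NS G' n"
proof -
 obtain xs fs where s: "M = (xs, fs)" by (cases M)
 hence *: "(xs, fs) : NS G n" using assms(3) by simp
 have p: "push m z = (fst z, m o_m snd z)" for z :: "'a ribbon \<times> 'a mor" by (cases z) simp
 show ?thesis unfolding s omap_def prod.case
  using * Mor_comp[OF _ assms(1) _ assms(2)] unfolding NS_iff by (auto simp: p map_comp_assoc)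
qed

lemma CS_push: "ribbon_graph G ==> m : Mor G G' ==> x : CS G n ==> qpush m x : CS G' n"
 by (erule CS_qext) (auto intro: CS_bas push_NS)

text \<open>\<open>J R p\<close> appends the isomorphism \<open>p\<close> from \<open>R\<close> to the terminal object of the slice.\<close>

definition J :: "'h ribbon => 'h mor => 'h ssimplex => 'h ssimplex" where
 "J R p = (%(xs, fs). (xs @ [(R, p)], fs @ [minv p o_m snd (last xs)]))"

lemma J_NS:
 assumes R: "ribbon_graph R" "ribbon_graph G" "ribbon_iso R p G" and M: "M : NS G n"
 shows "J R p M : NS G (Suc n)"
proof -
 obtain xs fs where s: "M = (xs, fs)" by (cases M)
 have *: "length xs = Suc n" "length fs = n"
  "!!i. i \<le> n ==> ribbon_graph (fst (xs ! i)) & snd (xs ! i) : Mor (fst (xs ! i)) G"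
  "!!i. i < n ==> fs ! i : Mor (fst (xs ! i)) (fst (xs ! Suc i)) & snd (xs ! Suc i) o_m fs ! i = snd (xs ! i)"
  using M[unfolded s NS_iff] by auto
 have la: "last xs = xs ! n" using *(1) by (metis diff_Suc_1 last_conv_nth list.size(3) nat.distinct(1))
 let ?f = "snd (xs ! n)" and ?X = "fst (xs ! n)"
 have X: "ribbon_graph ?X" "?f : Mor ?X G" using *(3) by auto
 have inv: "minv p : Mor G R" by (rule iso_in_Mor[OF R(2) ribbon_iso_inv[OF R]])
 have m: "minv p o_m ?f : Mor ?X R" by (rule Mor_comp[OF X(1) R(2) X(2) inv])
 have "p o_m (minv p o_m ?f) = ?f"
  using comp_minv[of p] ribbon_isoD(2)[OF R(3)] Mor_facts(2)[OF X] by (simp add: map_comp_assoc[symmetric] idm_comp)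
 thus ?thesis
  unfolding s J_def prod.case NS_iff la
  using * m R(1) iso_in_Mor[OF R(1,3)] by (auto simp: nth_append less_Suc_eq le_Suc_eq)
qed

lemma mf_J_last: assumes "length (fst M) = Suc n" "length (snd M) = n" shows "mf (Suc n) (J R p M) = M"
 using assms by (cases M) (auto simp: mf_def J_def)

lemma mf_J:
 assumes M: "M : NS G n" and n: "n \<ge> 1" and i: "i \<le> n"
 shows "mf i (J R p M) = J R p (mf i M)"
proof -
 obtain xs fs where s: "M = (xs, fs)" by (cases M)
 have l: "length xs = Suc n" "length fs = n"
  and c: "!!i. i < n ==> snd (xs ! Suc i) o_m fs ! i = snd (xs ! i)"
  using M[unfolded s NS_iff] by auto
 have la: "last xs = xs ! n" using l(1) by (metis diff_Suc_1 last_conv_nth list.size(3) nat.distinct(1))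
 consider "i = 0" | "0 < i" "i < n" | "i = n" "0 < i" using i n by linarith
 thus ?thesis
 proof cases
  case 1
  have "drop (Suc 0) xs ~= []" "fs ~= []" using l n by auto
  moreover from this have "last (drop (Suc 0) xs) = last xs" by simp
  ultimately show ?thesis using 1 l n by (simp add: s mf_def J_def)
 next
  case 2
  have ne: "drop (Suc i) xs ~= []" using l 2 by auto
  hence "last (take i xs @ drop (Suc i) xs) = last xs" by simp
  moreover have "i - Suc 0 < n" using 2 by linarith
  ultimately show ?thesis using 2 l ne by (simp add: s mf_def J_def nth_append)
 next
  case 3
  have "last (take n xs) = xs ! (n - 1)" using l 3 by (subst last_conv_nth) auto
  moreover have "minv p o_m snd (xs ! n) o_m fs ! (n - 1) = minv p o_m snd (xs ! (n - 1))"
   using c[of "n - 1"] 3 by (simp add: map_comp_assoc)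
  moreover have "take (n - 1) fs = butlast fs" using l by (simp add: butlast_conv_take)
  ultimately show ?thesis using 3 l n by (simp add: s mf_def J_def nth_append la)
 qed
qed

abbreviation qJ :: "'h ribbon => 'h mor => ('h ssimplex \<Rightarrow>\<^sub>0 rat) => ('h ssimplex \<Rightarrow>\<^sub>0 rat)" where
 "qJ R p \<equiv> qext (%M. bas (J R p M))"

lemma bd_J:
 assumes M: "M : NS G (Suc n)"
 shows "bd (Suc (Suc n)) (J R p M) = qJ R p (bd (Suc n) M) + qs ((- 1) ^ Suc (Suc n)) (bas M)"
proof -
 have l: "length (fst M) = Suc (Suc n)" "length (snd M) = Suc n" using M NS_iff by (cases M; auto)+
 have "bd (Suc (Suc n)) (J R p M) = (\<Sum>i\<le>Suc n. qs ((- 1) ^ i) (bas (mf i (J R p M)))) + qs ((- 1) ^ Suc (Suc n)) (bas M)"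
  unfolding bd_def sum.atMost_Suc[of _ "Suc n"] using mf_J_last[OF l] by simp
 also have "(\<Sum>i\<le>Suc n. qs ((- 1) ^ i) (bas (mf i (J R p M)))) = qJ R p (bd (Suc n) M)"
  unfolding bd_def qext_sum by (intro sum.cong) (auto simp: qext_qs mf_J[OF M])
 finally show ?thesis .
qed

definition aug :: "('s \<Rightarrow>\<^sub>0 rat) => rat" where
 "aug x = (SUM s:keys x. lookup x s)"

lemma aug_qext: "aug x = lookup (qext (%_. bas ()) x) ()"
 by (simp add: aug_def qext_def lookup_sum)

lemma aug_simps: "aug (x + y) = aug x + aug y" "aug (x - y) = aug x - aug y" "aug (qs q x) = q * aug x"
 "aug (sum f A) = (SUM a:A. aug (f a))" "aug (bas s) = 1" "aug 0 = 0"
 by (simp_all add: aug_qext qext_add qext_diff qext_qs qext_sum lookup_add lookup_minus lookup_sum)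

lemma aug_qomap: "aug (qomap u x) = aug x" by (simp add: aug_qext qext_comp)

lemma aug_bd1: "aug (qbd 1 x) = 0"
proof -
 have "aug (qbd 1 x) = lookup (qext (%s. qext (%_. bas ()) (bd 1 s)) x) ()"
  by (simp add: aug_qext qext_comp)
 also have "(%s. qext (%_. bas ()) (bd 1 s)) = (%s. 0)"
  by (rule ext) (simp add: bd_def qext_add qext_diff qext_qs qext_uminus qs_uminus)
 finally show ?thesis by (simp add: qext_def)
qed

lemma bd_J0:
 assumes "M : NS G 0" shows "bd (Suc 0) (J R p M) = bas ([(R, p)], []) - bas M"
proof -
 obtain xs fs where s: "M = (xs, fs)" "length xs = 1" "fs = []" using assms NS_iff[of _ _ G 0] by (cases M) auto
 then obtain x where x: "xs = [x]" by (auto simp: length_Suc_conv)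
 show ?thesis by (simp add: bd_def mf_def J_def s x qs_uminus)
qed

lemma qbd_J: "x : CS G (Suc n) ==>
 qbd (Suc (Suc n)) (qJ R p x) = qJ R p (qbd (Suc n) x) + qs ((- 1) ^ Suc (Suc n)) x"
proof -
 assume x: "x : CS G (Suc n)"
 have "qbd (Suc (Suc n)) (qJ R p x) = qext (%M. qJ R p (bd (Suc n) M) + qs ((- 1) ^ Suc (Suc n)) (bas M)) x"
  unfolding qext_comp by (rule qext_cong) (use x in \<open>auto simp: CS_def bd_J\<close>)
 thus ?thesis by (simp add: qext_fun_add qext_comp qext_fun_qs del: power_Suc)
qed

lemma qbd_J0: "x : CS G 0 ==> qbd (Suc 0) (qJ R p x) = qs (aug x) (bas ([(R, p)], [])) - x"
proof -
 assume x: "x : CS G 0"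
 have "qbd (Suc 0) (qJ R p x) = qext (%M. bas ([(R, p)], []) - bas M) x"
  unfolding qext_comp by (rule qext_cong) (use x in \<open>auto simp: CS_def bd_J0\<close>)
 also have "... = qext (%M. bas ([(R, p)], [])) x - x" by (simp add: qext_fun_diff)
 also have "qext (%M. bas ([(R, p)], [])) x = qs (aug x) (bas ([(R, p)], []))"
  by (rule poly_mapping_eqI) (simp add: qext_def aug_def lookup_sum sum_distrib_right)
 finally show ?thesis .
qed

text \<open>
 The canonical lift of a simplex to the slice over its last vertex. Every simplex of a slice is a
 push-forward of such a lift.
\<close>

fun hats :: "'h ribbon list => 'h mor list => ('h ribbon \<times> 'h mor) list" where
 "hats [] fs = []"
| "hats [G] fs = [(G, idm G)]"
| "hats (G # G' # Gs) fs = (G, snd (hd (hats (G' # Gs) (tl fs))) o_m hd fs) # hats (G' # Gs) (tl fs)"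

definition hat :: "('h ribbon, 'h mor) simplex => 'h ssimplex" where
 "hat = (%(Gs, fs). (hats Gs fs, fs))"

lemma hats_map_fst: "map fst (hats Gs fs) = Gs" by (induction Gs fs rule: hats.induct) auto

lemma hats_ne: "Gs ~= [] ==> hats Gs fs ~= []"
 using hats_map_fst[of Gs fs] by auto

lemma hats_last: "Gs ~= [] ==> last (hats Gs fs) = (last Gs, idm (last Gs))"
 by (induction Gs fs rule: hats.induct) (auto simp: hats_ne)

lemma NS_Cons:
 "(x # y # xs, f # fs) : NS G (Suc n) \<longleftrightarrow> (y # xs, fs) : NS G n & ribbon_graph (fst x) & snd x : Mor (fst x) G \<and>
  f : Mor (fst x) (fst y) & snd y o_m f = snd x"
proof -
 have 1: "(ALL i<=Suc n. P i) \<longleftrightarrow> P 0 & (ALL i<=n. P (Suc i))" for P :: "nat => bool" using All_less_Suc2[of "Suc n" P] by (simp add: less_Suc_eq_le)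
 have 2: "(ALL i<Suc n. P i) \<longleftrightarrow> P 0 & (ALL i<n. P (Suc i))" for P :: "nat => bool" by (rule All_less_Suc2)
 show ?thesis unfolding NS_iff 1 2 by auto
qed

lemma hat_NS: assumes "(Gs, fs) : nerve fat n" shows "(hats Gs fs, fs) : NS (last Gs) n"
 using assms
proof (induction Gs fs arbitrary: n rule: hats.induct)
 case (1 fs) thus ?case by (simp add: fat_nerve_iff)
next
 case (2 G fs)
 hence "n = 0" "fs = []" "ribbon_graph G" by (auto simp: fat_nerve_iff)
 thus ?case using iso_in_Mor[OF _ ribbon_iso_refl] by (auto simp: NS_iff)
next
 case (3 G G' Gs fs)
 define m where "m = length Gs"
 have n: "n = Suc m" using 3(3) by (simp add: fat_nerve_iff m_def)
 obtain f fs' where fs: "fs = f # fs'" using 3(3) n by (cases fs) (auto simp: fat_nerve_iff)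
 have nv: "(G' # Gs, fs') : nerve fat m" and f: "ribbon_graph G" "ribbon_graph G'" "f : Mor G G'"
  using 3(3) unfolding n fs fat_nerve_iff by force+
 have IH: "(hats (G' # Gs) fs', fs') : NS (last (G' # Gs)) m" using 3(1)[of m] nv fs by simp
 obtain y ys where y: "hats (G' # Gs) fs' = y # ys" using hats_ne[of "G' # Gs"] by (cases "hats (G' # Gs) fs'") auto
 have fy: "fst y = G'" using hats_map_fst[of "G' # Gs" fs'] y by simp
 have "snd y : Mor G' (last (G' # Gs))" using IH y fy by (auto simp: NS_iff)
 hence "snd y o_m f : Mor G (last (G' # Gs))" using Mor_comp[OF f(1,2,3)] by blast
 hence "((G, snd y o_m f) # y # ys, f # fs') : NS (last (G' # Gs)) (Suc m)"
  unfolding NS_Cons using IH[unfolded y] f by (simp add: fy)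
 thus ?case using y by (simp add: n fs)
qed

lemma NS_forget: "M : NS G n ==> omap fst M : nerve fat n"
 by (cases M) (auto simp: NS_iff fat_nerve_iff omap_def)

lemma hats_push:
 assumes "(xs, fs) : NS G n"
 shows "xs = map (push (snd (last xs))) (hats (map fst xs) fs)"
 using assms
proof (induction xs arbitrary: fs n)
 case (Cons x xs)
 show ?case
 proof (cases xs)
  case Nil
  have "snd x : Mor (fst x) G" "ribbon_graph (fst x)" using Cons.prems by (auto simp: NS_iff)
  hence "snd x o_m idm (fst x) = snd x" by (intro comp_idm Mor_facts(1))
  thus ?thesis using Nil by (simp add: prod_eq_iff)
 next
  case (Cons y ys)
  obtain m where n: "n = Suc m" using Cons.prems Cons by (auto simp: NS_iff)
  obtain f fs' where fs: "fs = f # fs'" using Cons.prems n by (cases fs) (auto simp: NS_iff)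
  have *: "(y # ys, fs') : NS G m" "snd y o_m f = snd x" using Cons.prems unfolding Cons n fs NS_Cons by auto
  have IH: "y # ys = map (push (snd (last (y # ys)))) (hats (map fst (y # ys)) fs')"
   by (rule Cons.IH[unfolded Cons, OF *(1)])
  obtain z zs where z: "hats (map fst (y # ys)) fs' = z # zs" using hats_ne[of "map fst (y # ys)"]
   by (cases "hats (map fst (y # ys)) fs'") auto
  define p where "p = snd (last (y # ys))"
  have "y # ys = map (push p) (z # zs)" using IH unfolding z p_def .
  hence "snd y = p o_m snd z" by (cases z) simp
  hence "snd y = snd (last (y # ys)) o_m snd z" unfolding p_def .
  hence "snd x = snd (last (y # ys)) o_m (snd z o_m f)" using *(2) by (simp add: map_comp_assoc)
  hence p: "push (snd (last (y # ys))) (fst x, snd z o_m f) = x" by (simp add: prod_eq_iff)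
  have h: "hats (map fst (x # y # ys)) (f # fs') = (fst x, snd z o_m f) # hats (map fst (y # ys)) fs'"
   using z by simp
  have l: "last (x # y # ys) = last (y # ys)" by simp
  show ?thesis unfolding Cons fs l h
   unfolding list.map(2) p IH[symmetric, unfolded list.map(2)] ..
 qed
qed (simp add: NS_iff)

lemma hat_push: assumes "M : NS G n" shows "M = omap (push (snd (last (fst M)))) (hat (omap fst M))"
 using hats_push[of "fst M" "snd M" G n] assms by (cases M) (simp add: hat_def omap_def)

lemma hat_J:
 assumes "N : nerve fat (Suc n)" "X = last (fst N)"
 shows "ribbon_graph X & (EX \<rho>:NS X n. hat N = J X (idm X) \<rho>)"
proof -
 obtain Gs fs where t: "N = (Gs, fs)" by (cases N)
 have nv: "(Gs, fs) : nerve fat (Suc n)" using assms t by simp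
 let ?xs = "hats Gs fs"
 have H: "(?xs, fs) : NS X (Suc n)" using hat_NS[OF nv] assms(2) t by simp
 hence l: "length ?xs = Suc (Suc n)" "length fs = Suc n" by (auto simp: NS_iff)
 have ne: "Gs ~= []" using nv by (auto simp: fat_nerve_iff)
 have X: "X = Gs ! Suc n" using assms(2) t nv ne by (simp add: fat_nerve_iff last_conv_nth)
 hence rX: "ribbon_graph X" using nv by (simp add: fat_nerve_iff)
 have la: "?xs ! Suc n = (X, idm X)"
  using hats_last[OF ne, of fs] l assms(2) t by (metis diff_Suc_1 fst_conv last_conv_nth length_0_conv nat.distinct(1))
 have "(butlast ?xs, butlast fs) : NS X n"
  using H l unfolding NS_iff by (auto simp: nth_butlast)
 moreover have "J X (idm X) (butlast ?xs, butlast fs) = (?xs, fs)"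
 proof -
  have "length (butlast ?xs) = Suc n" using l by simp
  hence "butlast ?xs ~= []" by (metis length_0_conv nat.distinct(1))
  hence lb: "last (butlast ?xs) = ?xs ! n" using l by (subst last_conv_nth) (auto simp: nth_butlast)
  have "snd (?xs ! n) = idm X o_m fs ! n" and r: "fs ! n : Mor (fst (?xs ! n)) X" "ribbon_graph (fst (?xs ! n))"
   using H la unfolding NS_iff by (auto dest: spec[of _ n])
  moreover have "idm X o_m fs ! n = fs ! n" by (rule idm_comp) (simp add: Mor_facts(2)[OF r(2,1)])
  ultimately have sn: "snd (?xs ! n) = fs ! n" by simp
  have "minv (idm X) = idm X"
  proof -
   have "inj_on (idm X) (dom (idm X))" by (auto simp: inj_on_def pm_def split: if_splits)
   from minv_comp[OF this] have "minv (idm X) o_m idm X = idm X" by simp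
   moreover have "minv (idm X) o_m idm X = minv (idm X)" by (rule comp_idm) simp
   ultimately show ?thesis by simp
  qed
  hence mi: "minv (idm X) o_m fs ! n = fs ! n" using \<open>idm X o_m fs ! n = fs ! n\<close> by simp
  have "butlast ?xs @ [(X, idm X)] = ?xs" using l la hats_ne[OF ne, of fs] append_butlast_last_id[of ?xs] last_conv_nth[of ?xs] by auto
  moreover have "fs ~= []" using l by auto
  hence "butlast fs @ [fs ! n] = fs" using l append_butlast_last_id[of fs] last_conv_nth[of fs] by auto
  ultimately show ?thesis by (simp add: J_def lb sn mi)
 qed
 ultimately show ?thesis using rX t by (auto simp: hat_def intro!: bexI[of _ "(butlast ?xs, butlast fs)"])
qed

lemma bd_bd:
 assumes "M : NS G (Suc (Suc n))"
 shows "qbd (Suc n) (bd (Suc (Suc n)) M) = 0"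
 using assms
proof (induction n arbitrary: G M)
 case n: (0 G M)
 let ?N = "omap fst M" let ?X = "last (fst ?N)"
 obtain \<rho> where X: "ribbon_graph ?X" and \<rho>: "\<rho> : NS ?X (Suc 0)" "hat ?N = J ?X (idm ?X) \<rho>"
  using hat_J[OF NS_forget[OF n] HOL.refl] by blast
 have d: "bd (Suc 0) \<rho> : CS ?X 0" using CS_qbd[OF X CS_bas[OF \<rho>(1)]] by simp
 have "qbd (Suc 0) (bd (Suc (Suc 0)) (hat ?N)) = qbd (Suc 0) (qJ ?X (idm ?X) (bd (Suc 0) \<rho>)) + bd (Suc 0) \<rho>"
  unfolding \<rho>(2) bd_J[OF \<rho>(1)] by (simp add: qext_add)
 also have "... = 0" unfolding qbd_J0[OF d] using aug_bd1[of "bas \<rho>"] by simp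
 finally have "qbd (Suc 0) (qbd (Suc (Suc 0)) (bas (hat ?N))) = 0" by simp
 hence "qbd (Suc 0) (qbd (Suc (Suc 0)) (qpush (snd (last (fst M))) (bas (hat ?N)))) = 0"
  unfolding qbd_omap by simp
 thus ?case using hat_push[OF n] by simp
next
 case (Suc n G M)
 let ?N = "omap fst M" let ?X = "last (fst ?N)"
 obtain \<rho> where X: "ribbon_graph ?X" and \<rho>: "\<rho> : NS ?X (Suc (Suc n))" "hat ?N = J ?X (idm ?X) \<rho>"
  using hat_J[OF NS_forget[OF Suc.prems] HOL.refl] by blast
 let ?s = "(- 1) ^ Suc (Suc n) :: rat"
 have d: "bd (Suc (Suc n)) \<rho> : CS ?X (Suc n)" using CS_qbd[OF X CS_bas[OF \<rho>(1)]] by simp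
 have "qbd (Suc (Suc n)) (bd (Suc (Suc (Suc n))) (hat ?N)) =
  qbd (Suc (Suc n)) (qJ ?X (idm ?X) (bd (Suc (Suc n)) \<rho>)) + qs (- ?s) (bd (Suc (Suc n)) \<rho>)"
  unfolding \<rho>(2) bd_J[OF \<rho>(1)] by (simp add: qext_add qext_qs)
 also have "... = qJ ?X (idm ?X) (qbd (Suc n) (bd (Suc (Suc n)) \<rho>))"
  unfolding qbd_J[OF d] by (simp add: qs_uminus)
 also have "... = 0" using Suc.IH[OF \<rho>(1)] by simp
 finally have "qbd (Suc (Suc n)) (qbd (Suc (Suc (Suc n))) (bas (hat ?N))) = 0" by simp
 hence "qbd (Suc (Suc n)) (qbd (Suc (Suc (Suc n))) (qpush (snd (last (fst M))) (bas (hat ?N)))) = 0"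
  unfolding qbd_omap by simp
 thus ?case using hat_push[OF Suc.prems] by simp
qed

lemma qbd_qbd: "x : CS G (Suc (Suc n)) ==> qbd (Suc n) (qbd (Suc (Suc n)) x) = 0"
proof -
 assume x: "x : CS G (Suc (Suc n))"
 have "qbd (Suc n) (qbd (Suc (Suc n)) x) = qext (%_. 0) x"
  unfolding qext_comp by (rule qext_cong, rule bd_bd) (use x in \<open>auto simp: CS_def\<close>)
 thus ?thesis by (simp add: qext_def)
qed

subsection \<open>A contraction of the slices that is natural for isomorphisms\<close>

text \<open>
 Each slice has the identity as a terminal object and is contracted by the cone on it. Averaging over
 all isomorphisms from a chosen graph in the isomorphism class gives a contraction that commutes with
 isomorphisms; this is where rational coefficients are needed.
\<close>

definition rp :: "'h ribbon => 'h ribbon" where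
 "rp G = (SOME R. ribbon_graph R & (EX p. ribbon_iso R p G))"

definition isos :: "'h ribbon => 'h mor set" where "isos G = {p. ribbon_iso (rp G) p G}"

text \<open>
 The averaged terminal object and the averaged cone. The sign \<open>(-1)^(n+1)\<close> is the one with which the base of the
 cone, its last face, occurs in the boundary.
\<close>

definition top :: "'h ribbon => ('h ssimplex \<Rightarrow>\<^sub>0 rat)" where
 "top G = qs (1 / of_nat (card (isos G))) (SUM p:isos G. bas ([(rp G, p)], []))"

definition ctr :: "nat => 'h ribbon => ('h ssimplex \<Rightarrow>\<^sub>0 rat) => ('h ssimplex \<Rightarrow>\<^sub>0 rat)" where
 "ctr n G x = qs ((- 1) ^ Suc n / of_nat (card (isos G))) (SUM p:isos G. qJ (rp G) p x)"

context
 fixes G :: "'h ribbon"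
 assumes G: "ribbon_graph G"
begin

lemma rp_ribbon: "ribbon_graph (rp G)" and isos_nonempty: "isos G ~= {}"
proof -
 have "EX R. ribbon_graph R & (EX p. ribbon_iso R p G)" using G ribbon_iso_refl by blast
 hence "ribbon_graph (rp G) & (EX p. ribbon_iso (rp G) p G)" unfolding rp_def by (rule someI_ex)
 thus "ribbon_graph (rp G)" "isos G ~= {}" by (auto simp: isos_def)
qed

lemma finite_isos: "finite (isos G)" unfolding isos_def by (rule finite_Aut[OF rp_ribbon])

lemma card_isos: "of_nat (card (isos G)) ~= (0::rat)" using finite_isos isos_nonempty by simp

lemma top_CS: "top G : CS G 0"
 unfolding top_def by (intro CS_qs CS_sum CS_bas) (auto simp: NS_iff isos_def rp_ribbon iso_in_Mor)

lemma aug_top: "aug (top G) = 1" using card_isos by (simp add: top_def aug_simps)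

lemma ctr_CS: "x : CS G n ==> ctr n G x : CS G (Suc n)"
 unfolding ctr_def by (intro CS_qs CS_sum, erule CS_qext) (auto simp: isos_def intro!: CS_bas J_NS rp_ribbon G)

lemma ctr_contraction:
 assumes x: "x : CS G (Suc n)"
 shows "qbd (Suc (Suc n)) (ctr (Suc n) G x) + ctr n G (qbd (Suc n) x) = x"
proof -
 let ?c = "1 / of_nat (card (isos G)) :: rat" and ?s = "(- 1) ^ Suc (Suc n) :: rat"
 let ?T = "SUM p:isos G. qJ (rp G) p (qbd (Suc n) x)"
 have "qbd (Suc (Suc n)) (ctr (Suc n) G x) = qs (?s * ?c) (SUM p:isos G. qJ (rp G) p (qbd (Suc n) x) + qs ?s x)"
  unfolding ctr_def qext_qs qext_sum qbd_J[OF x] by simp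
 also have "... = qs (?s * ?c) ?T + qs (?s * ?c) (qs (of_nat (card (isos G)) * ?s) x)"
  by (simp add: sum.distrib qs_add del: power_Suc) (auto intro!: poly_mapping_eqI simp: lookup_sum)
 also have "qs (?s * ?c) (qs (of_nat (card (isos G)) * ?s) x) = x"
 proof -
  have "?s * ?s = 1" by (simp add: power_mult_distrib[symmetric])
  hence "(?s * ?c) * (of_nat (card (isos G)) * ?s) = 1" using card_isos by (simp add: field_simps del: power_Suc)
  thus ?thesis by (simp del: power_Suc)
 qed
 finally have "qbd (Suc (Suc n)) (ctr (Suc n) G x) = qs (?s * ?c) ?T + x" .
 moreover have "ctr n G (qbd (Suc n) x) = - qs (?s * ?c) ?T"
  by (simp add: ctr_def qs_uminus)
 ultimately show ?thesis by simp
qed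

lemma ctr_contraction0:
 assumes x: "x : CS G 0" "aug x = 0" shows "qbd (Suc 0) (ctr 0 G x) = x"
proof -
 have "qbd (Suc 0) (ctr 0 G x) = qs (- 1 / of_nat (card (isos G))) (SUM p:isos G. - x)"
  unfolding ctr_def qext_qs qext_sum qbd_J0[OF x(1)] using x(2) by simp
 also have "... = x" using card_isos by (intro poly_mapping_eqI) (simp add: lookup_sum)
 finally show ?thesis .
qed

lemma cycle_ctr: "x : CS G (Suc n) ==> qbd (Suc n) x = 0 ==> qbd (Suc (Suc n)) (ctr (Suc n) G x) = x"
 using ctr_contraction[of x n] by (simp add: ctr_def[of n])

lemma isos_transport:
 assumes G': "ribbon_graph G'" and A: "ribbon_iso G A G'"
 shows "rp G' = rp G" "bij_betw (%p. A o_m p) (isos G) (isos G')"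
proof -
 note inv = ribbon_iso_inv[OF G G' A]
 have "(EX p. ribbon_iso R p G') \<longleftrightarrow> (EX p. ribbon_iso R p G)" for R
  using ribbon_iso_comp[OF _ A, of R] ribbon_iso_comp[OF _ inv, of R] by blast
 thus rp: "rp G' = rp G" by (simp add: rp_def)
 have c1: "minv A o_m (A o_m p) = p" if "p : isos G" for p
 proof -
  have "ran p = halves G" using that ribbon_isoD(2) by (auto simp: isos_def)
  thus ?thesis using minv_comp[OF ribbon_isoD(3)[OF A]] ribbon_isoD(1)[OF A]
   by (simp add: map_comp_assoc[symmetric] idm_comp)
 qed
 have c2: "A o_m (minv A o_m p) = p" if "p : isos G'" for p
 proof -
  have "ran p = halves G'" using that ribbon_isoD(2) by (auto simp: isos_def)
  thus ?thesis using comp_minv[of A] ribbon_isoD(2)[OF A] by (simp add: map_comp_assoc[symmetric] idm_comp)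
 qed
 show "bij_betw (%p. A o_m p) (isos G) (isos G')"
  by (rule bij_betw_byWitness[where f' = "%p. minv A o_m p"])
   (use c1 c2 ribbon_iso_comp[OF _ A] ribbon_iso_comp[OF _ inv] rp in \<open>auto simp: isos_def\<close>)
qed

lemma top_natural:
 assumes G': "ribbon_graph G'" and A: "ribbon_iso G A G'"
 shows "qpush A (top G) = top G'"
proof -
 note t = isos_transport[OF G' A]
 have "qpush A (top G) = qs (1 / of_nat (card (isos G))) (SUM p:isos G. bas ([(rp G', A o_m p)], []))"
  by (simp add: top_def qext_qs qext_sum omap_def t)
 also have "(SUM p:isos G. bas ([(rp G', A o_m p)], [])) = (SUM p:isos G'. bas ([(rp G', p)], []))"
  by (rule sum.reindex_bij_betw[OF t(2)])
 finally show ?thesis using bij_betw_same_card[OF t(2)] by (simp add: top_def)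
qed

lemma ctr_natural:
 assumes G': "ribbon_graph G'" and A: "ribbon_iso G A G'" and x: "x : CS G n"
 shows "qpush A (ctr n G x) = ctr n G' (qpush A x)"
proof -
 note t = isos_transport[OF G' A]
 have J: "omap (push A) (J (rp G) p M) = J (rp G') (A o_m p) (omap (push A) M)"
  if p: "p : isos G" and M: "M : NS G n" for p M
 proof -
  obtain xs fs where s: "M = (xs, fs)" by (cases M)
  have l: "length xs = Suc n" and rx: "ribbon_graph (fst (xs ! n))" "snd (xs ! n) : Mor (fst (xs ! n)) G"
   using M[unfolded s NS_iff] by auto
  have "xs ~= []" using l by auto
  hence la: "last xs = xs ! n" "xs ~= []" using l by (auto simp: last_conv_nth)
  have iso: "ribbon_iso (rp G) p G" using p by (simp add: isos_def)
  have iso': "ribbon_iso (rp G) (A o_m p) G'" by (rule ribbon_iso_comp[OF iso A])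
  have "minv (A o_m p) o_m A = minv p"
  proof -
   have "minv (A o_m p) o_m A = (minv (A o_m p) o_m A) o_m (p o_m minv p)"
    using comp_minv[of p] ribbon_isoD(2)[OF iso] ribbon_isoD(1)[OF ribbon_iso_comp[OF A ribbon_iso_inv[OF rp_ribbon G' iso']]]
    by (simp add: comp_idm)
   also have "... = (minv (A o_m p) o_m (A o_m p)) o_m minv p" by (simp add: map_comp_assoc)
   also have "... = minv p"
    using minv_comp[OF ribbon_isoD(3)[OF iso']] ribbon_isoD(1)[OF iso'] ribbon_isoD(2)[OF ribbon_iso_inv[OF rp_ribbon G iso]]
    by (simp add: idm_comp)
   finally show ?thesis .
  qed
  hence "minv (A o_m p) o_m (A o_m snd (xs ! n)) = minv p o_m snd (xs ! n)"
   by (simp add: map_comp_assoc[symmetric])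
  thus ?thesis using la t(1) by (simp add: s omap_def J_def last_map case_prod_unfold)
 qed
 have qJ: "qpush A (qJ (rp G) p x) = qJ (rp G') (A o_m p) (qpush A x)" if "p : isos G" for p
  unfolding qext_comp by (rule qext_cong) (use x J[OF that] in \<open>auto simp: CS_def\<close>)
 have "qpush A (ctr n G x) = qs ((- 1) ^ Suc n / of_nat (card (isos G))) (SUM p:isos G. qJ (rp G') (A o_m p) (qpush A x))"
  unfolding ctr_def qext_qs qext_sum using qJ by simp
 also have "(SUM p:isos G. qJ (rp G') (A o_m p) (qpush A x)) = (SUM p:isos G'. qJ (rp G') p (qpush A x))"
  by (rule sum.reindex_bij_betw[OF t(2)])
 finally show ?thesis using bij_betw_same_card[OF t(2)] by (simp add: ctr_def)
qed

end

section \<open>Rational functionals on chains\<close>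

definition rext :: "('s => rat) => ('s \<Rightarrow>\<^sub>0 rat) => rat" where
 "rext f c = (SUM s:keys c. lookup c s * f s)"

lemma rext_qext: "rext f c = lookup (qext (%s. Poly_Mapping.single () (f s)) c) ()"
 by (simp add: rext_def qext_def lookup_sum)

lemma rext_simps: "rext f (x + y) = rext f x + rext f y" "rext f (x - y) = rext f x - rext f y" "rext f (qs q x) = q * rext f x"
 "rext f (sum g A) = (SUM a:A. rext f (g a))" "rext f (bas s) = f s" "rext f 0 = 0"
 by (simp_all add: rext_qext qext_add qext_diff qext_qs qext_sum lookup_add lookup_minus lookup_sum)

lemma rext_cong: "(!!s. s : keys c ==> f s = g s) ==> rext f c = rext g c"
 by (simp add: rext_def)

lemma rext_comp: "rext f (qext g c) = rext (%s. rext f (g s)) c"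
 by (simp add: qext_def[of g] rext_simps) (simp add: rext_def)

lemma rext_scale: "rext (%s. f s * q) c = rext f c * q"
 by (simp add: rext_def sum_distrib_right mult.assoc)

lemma rext_integral:
 assumes "h : hom (free_Abelian_group S) add_group" "keys c <= S"
 shows "h c = rext (%s. h (frag_of s)) (emb c)"
proof -
 interpret h: group_hom "free_Abelian_group S" add_group h
  using assms(1) by (simp add: group_hom_def group_hom_axioms_def comm_group.axioms(2)[OF comm_group_add_group])
 show ?thesis using assms(2)
 proof (rule free_Abelian_group_induct)
  show "h 0 = rext (%s. h (frag_of s)) (emb 0)" using h.hom_one by (simp add: rext_simps)
  fix x y assume xy: "keys x <= S" "keys y <= S"
   "h x = rext (%s. h (frag_of s)) (emb x)" "h y = rext (%s. h (frag_of s)) (emb y)"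
  thus "h (x - y) = rext (%s. h (frag_of s)) (emb (x - y))"
   using h.hom_mult[of x "- y"] h.hom_inv[of y] by (simp add: rext_simps)
 qed (simp add: rext_simps)
qed

section \<open>The forest carrier\<close>

text \<open>
 A class that differs from its negative can be detected by a homomorphism that is 1 on it and 0 on all classes
 other than it and its negative. Such homomorphisms serve as coordinates, with no choice of a basis.
\<close>

lemma (in antisym) delta_exists:
 assumes rel: "!!x y. (x, y) : r ==> (rv x, rv y) : r" and rr: "!!x. x : X ==> rv (rv x) = x"
  and z: "z : X" "(rv z, z) ~: r"
 obtains h :: "_ => 'c::ring_1" where "h : hom (antisym_group X r rv) add_group"
  "!!x. x : X ==> h (antisym_gen X r rv x) = (if (x, z) : r then 1 else if (rv x, z) : r then - 1 else 0)"
proof -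
 let ?v = "%x. if (x, z) : r then 1 else if (rv x, z) : r then - 1 else (0::'c)"
 have sy: "(x, y) : r ==> (y, x) : r" and tr: "(x, y) : r ==> (y, w) : r ==> (x, w) : r" for x y w
  using equiv by (auto simp: equiv_def elim: symE transE)
 have ex: "\<not> ((x, z) : r & (rv x, z) : r)" if "x : X" for x
 proof
  assume *: "(x, z) : r & (rv x, z) : r"
  hence "(rv x, rv z) : r" using rel by blast
  hence "(rv z, z) : r" using * sy tr by blast
  thus False using z by blast
 qed
 have cong: "(x, z) : r \<longleftrightarrow> (y, z) : r" if "(x, y) : r" for x y using sy tr that by blast
 show thesis
 proof (rule hom_exists[where v = ?v, OF comm_group_add_group])
  show "?v x : carrier add_group" for x by simp
  show "?v x = ?v y" if "(x, y) : r" for x y using cong[OF that] cong[OF rel[OF that]] by simp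
  show "?v (rv x) = inv\<^bsub>add_group\<^esub> ?v x" if "x : X" for x using ex[OF that] rr[OF that] by auto
 qed (rule that)
qed

abbreviation opush :: "'h mor => 'h overgraph => 'h overgraph" where
 "opush f z \<equiv> (fst z, f o_m snd z)"

lemma opush_over:
 assumes "ribbon_graph G" "f : Mor G G'" "z : overgraphs G k" shows "opush f z : overgraphs G' k"
 using assms by (cases z) (auto simp: overgraphs_iff intro: Mor_comp dest: ographD(2))

lemma opush_rel:
 assumes "ribbon_graph G" "f : Mor G G'" "(z, w) : over_rel G k" shows "(opush f z, opush f w) : over_rel G' k"
proof -
 obtain x g y h A where z: "z = (x, g)" "w = (y, h)" "(x, g) : overgraphs G k" "(y, h) : overgraphs G k"
  "oriented_iso x A y" "h o_m A = g"
  using assms(3) by (auto simp: over_rel_def)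
 have "(f o_m h) o_m A = f o_m g" using z(6) by (simp add: map_comp_assoc)
 thus ?thesis using over_relI[OF _ _ z(5)] opush_over[OF assms(1,2) z(3)] opush_over[OF assms(1,2) z(4)] z(1,2) by simp
qed

lemma group_add_group: "group add_group" by (rule comm_group.axioms(2)[OF comm_group_add_group])

lemma F_comm: "comm_group (F_grp G k)" unfolding F_grp_def by (rule over.comm_group)

lemma F_gen_closed: "z : overgraphs G k ==> F_gen G k z : carrier (F_grp G k)"
 unfolding F_grp_def F_gen_def by (rule over.gen_closed)

lemma F_gen_cong: "(z, w) : over_rel G k ==> F_gen G k z = F_gen G k w"
 unfolding F_gen_def by (rule over.gen_cong)

lemma F_gen_rev: "z : overgraphs G k ==> F_gen G k (over_rev z) = inv\<^bsub>F_grp G k\<^esub> F_gen G k z"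
 unfolding F_grp_def F_gen_def by (rule over.gen_rv)

lemma F_hom_eq:
 assumes "group B" "h : hom (F_grp G k) B" "h' : hom (F_grp G k) B"
  and "!!x f. (x, f) : overgraphs G k ==> h (F_gen G k (x, f)) = h' (F_gen G k (x, f))"
  and "u : carrier (F_grp G k)"
 shows "h u = h' u"
 using over.hom_eq[of B h G k h' u] assms unfolding F_grp_def F_gen_def by auto

lemma F_hom_on:
 assumes "comm_group B" and "!!z. z : overgraphs G k ==> v z : carrier B"
  and "!!z w. (z, w) : over_rel G k ==> v z = v w"
  and "!!z. z : overgraphs G k ==> v (over_rev z) = inv\<^bsub>B\<^esub> v z"
 shows "hom_on (F_grp G k) B (overgraphs G k) (F_gen G k) v : hom (F_grp G k) B"
  and "!!z. z : overgraphs G k ==> hom_on (F_grp G k) B (overgraphs G k) (F_gen G k) v (F_gen G k z) = v z"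
 unfolding F_grp_def F_gen_def by (rule over.hom_on, (erule assms | rule assms)+) (rule over.hom_on(2), (assumption | erule assms | rule assms)+)

lemma F_delta:
 assumes z: "z : overgraphs G k" "(over_rev z, z) ~: over_rel G k"
 shows "EX \<delta> :: 'h felem => rat. \<delta> : hom (F_grp G k) add_group & (ALL w:overgraphs G k. \<delta> (F_gen G k w) =
   (if (w, z) : over_rel G k then 1 else if (over_rev w, z) : over_rel G k then - 1 else 0))"
  (is ?thesis)
proof -
 show ?thesis
 proof (rule over.delta_exists[where 'c = rat and z = z and ?G0.0 = G and k = k])
  show "(over_rev x, over_rev y) : over_rel G k" if "(x, y) : over_rel G k" for x y by (rule over_rel_rev[OF that])
  show "over_rev (over_rev x) = x" if "x : overgraphs G k" for x by (rule over_rev_rev[OF that])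
  fix h :: "'h felem => rat"
  assume "h : hom (antisym_group (overgraphs G k) (over_rel G k) over_rev) add_group"
   "!!w. w : overgraphs G k ==> h (antisym_gen (overgraphs G k) (over_rel G k) over_rev w) =
    (if (w, z) : over_rel G k then 1 else if (over_rev w, z) : over_rel G k then - 1 else 0)"
  thus ?thesis unfolding F_grp_def F_gen_def by blast
 qed (use z in auto)
qed

lemma over_rev_over: "z : overgraphs G k ==> over_rev z : overgraphs G k" by (rule over.rv_in)

lemma comp_group_hom: "h : hom A B ==> k : hom B C ==> (%u. k (h u)) : hom A C"
 by (auto simp: hom_def Pi_def)

text \<open>
 This makes the boundary of the forest carrier well defined: the sum over the expansions depends only on the
 class of the graph over \<open>G\<close>, and it changes sign with the orientation.
\<close>

lemma expansion_sum:
 fixes v :: "'h overgraph => 'b"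
 assumes B: "comm_group B" and G: "ribbon_graph G"
  and v: "!!z. z : overgraphs G k ==> v z : carrier B"
  and cong: "!!z w. (z, w) : over_rel G k ==> v z = v w"
  and anti: "!!z. z : overgraphs G k ==> v (over_rev z) = inv\<^bsub>B\<^esub> v z"
 defines "S \<equiv> %z. finprod B (%c. v (opush (snd z) (rep c))) (expansions k (fst z))"
 shows "!!z. z : overgraphs G (Suc k) ==> S z : carrier B"
  and "!!z w. (z, w) : over_rel G (Suc k) ==> S z = S w"
  and "!!z. z : overgraphs G (Suc k) ==> S (over_rev z) = inv\<^bsub>B\<^esub> S z"
proof -
 interpret B: comm_group B by (rule B)
 have cl: "v (opush f z) : carrier B" if "(x, f) : overgraphs G (Suc k)" "z : Exps k x" for x f z
 proof -
  have "x : ographs (Suc k)" "f : Mor (fst x) G" using that(1) by (auto simp: overgraphs_iff)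
  thus ?thesis by (intro v opush_over[OF _ _ Exps_overgraphs[OF that(2)]] ographD(2))
 qed
 have inv: "v (opush f z) = v (opush f w)" if "(x, f) : overgraphs G (Suc k)" "(z, w) : over_rel (fst x) k" for x f z w
 proof -
  have "x : ographs (Suc k)" "f : Mor (fst x) G" using that(1) by (auto simp: overgraphs_iff)
  thus ?thesis by (intro cong opush_rel[OF _ _ that(2)] ographD(2))
 qed
 show S: "S z : carrier B" if "z : overgraphs G (Suc k)" for z
  unfolding S_def using cl[of "fst z" "snd z" "rep _", OF _ rep_expansion(1)] that by (intro B.finprod_closed) auto
 show "S z = S w" if zw: "(z, w) : over_rel G (Suc k)" for z w
 proof -
  obtain x f x' f' A where z: "z = (x, f)" "w = (x', f')" "(x, f) : overgraphs G (Suc k)" "(x', f') : overgraphs G (Suc k)"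
   "oriented_iso x A x'" "f' o_m A = f"
   using zw by (auto simp: over_rel_def)
  have "finprod B (%c. v (opush f' (rep c))) (expansions k x') = finprod B (%c. v (opush f (rep c))) (expansions k x)"
  proof (rule expansions_iso[OF B _ _ z(5), where P = "%z. v (opush f z)" and P' = "%z. v (opush f' z)"])
   show "v (opush f' (y, A o_m g)) = v (opush f (y, g))" for y g using z(6) by (auto simp: map_comp_assoc[symmetric])
   show "v (opush f' z) : carrier B" if "z : Exps k x'" for z using cl[OF z(4) that] .
   show "v (opush f' z) = v (opush f' w)" if "(z, w) : over_rel (fst x') k" for z w using inv[OF z(4) that] .
  qed (use z in \<open>auto simp: overgraphs_iff\<close>)
  thus ?thesis by (simp add: S_def z)
 qed
 show "S (over_rev z) = inv\<^bsub>B\<^esub> S z" if z: "z : overgraphs G (Suc k)" for z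
 proof -
  obtain x f where zz: "z = (x, f)" by (cases z)
  have xf: "(x, f) : overgraphs G (Suc k)" using z zz by simp
  have r: "(orev x, f) : overgraphs G (Suc k)" using over_rev_over[OF xf] by (simp add: over_rev_def)
  have "finprod B (%c. v (opush f (rep c))) (expansions k (orev x)) = finprod B (%c. inv\<^bsub>B\<^esub> v (opush f (rep c))) (expansions k x)"
  proof (rule expansions_rev[OF B, where P = "%z. inv\<^bsub>B\<^esub> v (opush f z)" and P' = "%z. v (opush f z)"])
   show "v (opush f (over_rev z)) = inv\<^bsub>B\<^esub> v (opush f z)" if "z : Exps k x" for z
   proof -
    have "opush f z : overgraphs G k"
    using xf ographD(2)[of x "Suc k"] by (intro opush_over[OF _ _ Exps_overgraphs[OF that]]) (auto simp: overgraphs_iff)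
    moreover have "opush f (over_rev z) = over_rev (opush f z)" by (cases z) (simp add: over_rev_def)
    ultimately show ?thesis using anti by simp
   qed
   show "v (opush f z) : carrier B" if "z : Exps k (orev x)" for z using cl[OF r that] .
   show "v (opush f z) = v (opush f w)" if "(z, w) : over_rel (fst x) k" for z w using inv[OF xf that] .
  qed (use xf in \<open>auto simp: overgraphs_iff\<close>)
  also have "... = inv\<^bsub>B\<^esub> (finprod B (%c. v (opush f (rep c))) (expansions k x))"
  proof (rule hom_finprod[OF B B, symmetric])
   show "(%a. inv\<^bsub>B\<^esub> a) : hom B B" by (auto simp: hom_def B.inv_mult)
   show "(%c. v (opush f (rep c))) : expansions k x \<rightarrow> carrier B" using cl[OF xf] rep_expansion(1) by blast
  qed
  finally show ?thesis by (simp add: S_def zz over_rev_def)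
 qed
qed

lemma F_dif:
 assumes G: "ribbon_graph G"
 shows "Dif (F_complex G) k : hom (F_grp G (Suc k)) (F_grp G k)"
  and "!!x f. (x, f) : overgraphs G (Suc k) ==> Dif (F_complex G) k (F_gen G (Suc k) (x, f)) =
   finprod (F_grp G k) (%c. F_gen G k (opush f (rep c))) (expansions k x)"
proof -
 let ?S = "%z. finprod (F_grp G k) (%c. F_gen G k (opush (snd z) (rep c))) (expansions k (fst z))"
 have d: "Dif (F_complex G) k = hom_on (F_grp G (Suc k)) (F_grp G k) (overgraphs G (Suc k)) (F_gen G (Suc k)) ?S"
  by (simp add: F_complex_def case_prod_unfold Let_def)
 note h = F_hom_on[where v = ?S and G = G and k = "Suc k", OF F_comm[of G k]
   expansion_sum[where v = "F_gen G k", OF F_comm G F_gen_closed F_gen_cong F_gen_rev]]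
 show "Dif (F_complex G) k : hom (F_grp G (Suc k)) (F_grp G k)"
  unfolding d by (rule h(1))
 show "Dif (F_complex G) k (F_gen G (Suc k) (x, f)) =
   finprod (F_grp G k) (%c. F_gen G k (opush f (rep c))) (expansions k x)" if "(x, f) : overgraphs G (Suc k)" for x f
  unfolding d using h(2)[of "(x, f)"] that by simp
qed

lemma F_dif_top:
 assumes x: "x : ographs (Suc k)"
 shows "Dif (F_complex (fst x)) k (F_gen (fst x) (Suc k) (x, idm (fst x))) =
  finprod (F_grp (fst x) k) (%c. F_gen (fst x) k (rep c)) (expansions k x)"
proof -
 interpret F: comm_group "F_grp (fst x) k" by (rule F_comm)
 have o: "opush (idm (fst x)) z = z" if "z : Exps k x" for z
 proof -
  have "snd z : Mor (fst (fst z)) (fst x)" "ribbon_graph (fst (fst z))"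
   using Exps_overgraphs[OF that] ographD(2) by (auto simp: overgraphs_def)
  hence "idm (fst x) o_m snd z = snd z" using Mor_facts(2) by (intro idm_comp) blast
  thus ?thesis by simp
 qed
 have "(x, idm (fst x)) : overgraphs (fst x) (Suc k)"
  using x by (auto simp: overgraphs_iff dest: ographD(2) intro: iso_in_Mor ribbon_iso_refl)
 thus ?thesis
  unfolding F_dif(2)[OF ographD(2)[OF x] \<open>(x, _) : _\<close>]
  by (intro F.finprod_cong') (auto simp: o[OF rep_expansion(1)] intro: F_gen_closed Exps_overgraphs rep_expansion(1))
qed

lemma orient_sign_values: "orient_sign x = 1 \<or> orient_sign x = - 1" by (simp add: orient_sign_def)

lemma F_aug:
 shows "Aug (F_complex G) : hom (F_grp G 0) integer_group"
  and "!!x f. (x, f) : overgraphs G 0 ==> Aug (F_complex G) (F_gen G 0 (x, f)) = orient_sign x"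
proof -
 have h: "comm_group integer_group" by (simp add: integer_group_eq comm_group_add_group)
 have a: "orient_sign (fst z) = orient_sign (fst w)" if "(z, w) : over_rel G 0" for z w :: "'a overgraph"
 proof -
  obtain x f y g A where z: "z = (x, f)" "w = (y, g)" "x : ographs 0" "y : ographs 0" "oriented_iso x A y"
   using \<open>(z, w) : _\<close> by (auto simp: over_rel_def overgraphs_iff)
  show ?thesis using orient_sign_iso[OF z(3,4,5)] z(1,2) by simp
 qed
 have b: "orient_sign (fst (over_rev z)) = inv\<^bsub>integer_group\<^esub> (orient_sign (fst z))" if "z : overgraphs G 0" for z :: "'a overgraph"
  using that orient_sign_orev[of "fst z"] by (cases z) (auto simp: over_rev_def overgraphs_iff integer_group_eq)
 have c: "orient_sign (fst z) : carrier integer_group" for z :: "'a overgraph" by (simp add: integer_group_eq)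
 note h = F_hom_on[where v = "%z. orient_sign (fst z)" and G = G and k = 0, OF h c a b]
 have d: "Aug (F_complex G) = hom_on (F_grp G 0) integer_group (overgraphs G 0) (F_gen G 0) (%z. orient_sign (fst z))"
  by (simp add: F_complex_def case_prod_unfold)
 show "Aug (F_complex G) : hom (F_grp G 0) integer_group"
  unfolding d by (rule h(1))
 show "Aug (F_complex G) (F_gen G 0 (x, f)) = orient_sign x" if "(x, f) : overgraphs G 0" for x f
  unfolding d using h(2)[of "(x, f)"] that by simp
qed

lemma F_push_spec:
 assumes G: "ribbon_graph G" and f: "f : Mor G G'"
 shows "F_push G G' f k : hom (F_grp G k) (F_grp G' k)"
  and "!!z. z : overgraphs G k ==> F_push G G' f k (F_gen G k z) = F_gen G' k (opush f z)"
proof -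
 have a: "F_gen G' k (opush f z) : carrier (F_grp G' k)" if "z : overgraphs G k" for z
  by (rule F_gen_closed[OF opush_over[OF G f that]])
 have b: "F_gen G' k (opush f z) = F_gen G' k (opush f w)" if "(z, w) : over_rel G k" for z w
  by (rule F_gen_cong[OF opush_rel[OF G f that]])
 have c: "F_gen G' k (opush f (over_rev z)) = inv\<^bsub>F_grp G' k\<^esub> F_gen G' k (opush f z)" if "z : overgraphs G k" for z
  using F_gen_rev[OF opush_over[OF G f that]] by (cases z) (simp add: over_rev_def)
 note h = F_hom_on[where v = "%z. F_gen G' k (opush f z)" and G = G and k = k, OF F_comm a b c]
 have d: "F_push G G' f k = hom_on (F_grp G k) (F_grp G' k) (overgraphs G k) (F_gen G k) (%z. F_gen G' k (opush f z))"
  by (simp add: F_push_def case_prod_unfold)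
 show "F_push G G' f k : hom (F_grp G k) (F_grp G' k)" unfolding d by (rule h(1))
 show "F_push G G' f k (F_gen G k z) = F_gen G' k (opush f z)" if "z : overgraphs G k" for z
  unfolding d by (rule h(2)) (use that in auto)
qed

subsection \<open>Coordinates\<close>

text \<open>
 An expansion is not equivalent to its reversal, so there is a functional that counts it. It takes
 the value 1 on the boundary of the generator that is expanded.
\<close>

lemma expansion_functional:
 assumes x: "x : ographs (Suc k)" and z: "z : Exps k x"
 shows "EX \<delta> :: 'h felem => rat. \<delta> : hom (F_grp (fst x) k) add_group \<and>
  (ALL w:Exps k x. \<delta> (F_gen (fst x) k w) = (if (w, z) : over_rel (fst x) k then 1 else 0)) \<and>
  \<delta> (finprod (F_grp (fst x) k) (%c. F_gen (fst x) k (rep c)) (expansions k x)) = 1"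
proof -
 have sy: "(z, w) : over_rel (fst x) k ==> (w, z) : over_rel (fst x) k" for z w
  using equiv_over_rel[of "fst x" k] by (auto simp: equiv_def elim: symE)
 have nr: "(over_rev w, z) ~: over_rel (fst x) k" if "w : Exps k x" for w
  using Exps_rel[OF sy z] Exps_not_rev[OF ographD(1)[OF x] that] by blast
 obtain \<delta> :: "'h felem => rat" where d: "\<delta> : hom (F_grp (fst x) k) add_group"
  "ALL w:overgraphs (fst x) k. \<delta> (F_gen (fst x) k w) =
   (if (w, z) : over_rel (fst x) k then 1 else if (over_rev w, z) : over_rel (fst x) k then - 1 else 0)"
  using F_delta[OF Exps_overgraphs[OF z] nr[OF z]] by blast
 show ?thesis
 proof (intro exI[of _ \<delta>] conjI ballI)
  show "\<delta> : hom (F_grp (fst x) k) add_group" by (rule d(1))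
  show v: "\<delta> (F_gen (fst x) k w) = (if (w, z) : over_rel (fst x) k then 1 else 0)" if "w : Exps k x" for w
   using bspec[OF d(2), OF Exps_overgraphs[OF that]] nr[OF that] by simp
  have dr: "\<delta> (F_gen (fst x) k (rep c)) = (if (rep c, z) : over_rel (fst x) k then 1 else 0)" if "c : expansions k x" for c
   by (rule v[OF rep_expansion(1)[OF that]])
  obtain c0 where c0: "c0 : expansions k x" "(z, rep c0) : over_rel (fst x) k" using expansion_exists[OF z] .
  have "c = c0" if "c : expansions k x" "(rep c, z) : over_rel (fst x) k" for c
  proof (rule expansion_eqI[OF that(1) c0(1)])
   show "(rep c, rep c0) : over_rel (fst x) k"
    using that(2) c0(2) equiv_over_rel[of "fst x" k] by (auto simp: equiv_def elim: transE)
  qed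
  hence iff: "(rep c, z) : over_rel (fst x) k \<longleftrightarrow> c = c0" if "c : expansions k x" for c
   using that sy[OF c0(2)] by blast
  have "\<delta> (finprod (F_grp (fst x) k) (%c. F_gen (fst x) k (rep c)) (expansions k x)) =
   (SUM c:expansions k x. \<delta> (F_gen (fst x) k (rep c)))"
   unfolding finprod_add_group[symmetric]
   by (rule hom_finprod[OF F_comm comm_group_add_group d(1)]) (auto intro: F_gen_closed Exps_overgraphs rep_expansion(1))
  also have "... = (SUM c:expansions k x. if c = c0 then 1 else 0)"
   by (rule sum.cong) (simp_all add: dr iff)
  also have "... = 1" using c0(1) finite_expansions[OF ographD(1)[OF x]] by simp
  finally show "\<delta> (finprod (F_grp (fst x) k) (%c. F_gen (fst x) k (rep c)) (expansions k x)) = 1" .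
 qed
qed

lemma idm_over: "x : ographs k ==> (x, idm (fst x)) : overgraphs (fst x) k"
 by (auto simp: overgraphs_iff dest: ographD(2) intro: iso_in_Mor ribbon_iso_refl)

text \<open>
 A morphism between graphs of equal codimension collapses no edge, so it is an isomorphism. Hence in the degree of
 its codimension the carrier of a graph is generated by the identity. The generator has infinite order because
 an automorphism over the identity is trivial and cannot reverse the orientation.
\<close>

lemma top_degree:
 assumes x: "x : ographs k"
 shows "EX \<delta> :: 'h felem => rat. \<delta> : hom (F_grp (fst x) k) add_group & \<delta> (F_gen (fst x) k (x, idm (fst x))) = 1 \<and>
  (ALL \<chi>:hom (F_grp (fst x) k) add_group. ALL u:carrier (F_grp (fst x) k). \<chi> u = \<delta> u * \<chi> (F_gen (fst x) k (x, idm (fst x))))"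
proof -
 let ?i = "idm (fst x)" let ?R = "over_rel (fst x) k"
 note o = idm_over[OF x] ographD[OF x]
 have nr: "(over_rev (x, ?i), (x, ?i)) ~: ?R"
 proof
  assume "(over_rev (x, ?i), (x, ?i)) : ?R"
  then obtain A where a: "oriented_iso (orev x) A x" "?i o_m A = ?i" by (auto simp: over_rel_def over_rev_def)
  have "ran A <= halves (fst x)" using ribbon_isoD(2)[OF oriented_isoD[OF a(1)]] by simp
  hence "A = ?i" using idm_comp[of A] a(2) by simp
  hence "oriented_iso (orev x) ?i x" using a by simp
  moreover have "oriented_iso (orev x) ?i (orev x)" using oriented_iso_refl[OF ograph_orev[OF o(2)]] by simp
  ultimately show False using oriented_iso_unique[OF ograph_orev[OF o(2)]] orev_neq[OF o(2)] by fastforce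
 qed
 obtain \<delta> :: "'h felem => rat" where dh: "\<delta> : hom (F_grp (fst x) k) add_group"
  and d: "ALL w:overgraphs (fst x) k. \<delta> (F_gen (fst x) k w) =
   (if (w, (x, ?i)) : ?R then 1 else if (over_rev w, (x, ?i)) : ?R then - 1 else 0)"
  using F_delta[OF o(1) nr] by blast
 have either: "(w, (x, ?i)) : ?R \<or> (over_rev w, (x, ?i)) : ?R" if w: "w : overgraphs (fst x) k" for w
 proof -
  obtain y f where yf: "w = (y, f)" by (cases w)
  have y: "y : ographs k" "f : Mor (fst y) (fst x)" using w yf by (auto simp: overgraphs_iff)
  have iso: "ribbon_iso (fst y) f (fst x)" using Mor_codim[OF ographD(2)[OF y(1)] y(2)] x y(1) by (simp add: ographs_iff)
  have f: "?i o_m f = f" by (rule idm_comp) (simp add: ribbon_isoD(2)[OF iso])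
  have "oriented_iso y f x \<or> oriented_iso (orev y) f x"
   using oriented_iso_dichotomy[OF ographD(1)[OF y(1)] o(2) iso] oriented_iso_orev[OF ographD(1)[OF y(1)], of f "orev x"] o(2) by auto
  moreover have "((y', f), (x, ?i)) : ?R" if "(y', f) : overgraphs (fst x) k" "oriented_iso y' f x" for y'
   by (rule over_relI[OF that(1) o(1) that(2) f])
  ultimately show ?thesis using w over_rev_over[OF w] unfolding yf over_rev_def prod.case by blast
 qed
 show ?thesis
 proof (intro exI[of _ \<delta>] conjI ballI dh)
  let ?g = "F_gen (fst x) k"
  have "((x, ?i), (x, ?i)) : ?R" using equiv_over_rel[of "fst x" k] o(1) by (auto simp: equiv_def dest: refl_onD)
  thus "\<delta> (?g (x, ?i)) = 1" using bspec[OF d o(1)] by simp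
  fix \<chi> :: "'h felem => rat" and u
  assume h: "\<chi> : hom (F_grp (fst x) k) add_group" and u: "u : carrier (F_grp (fst x) k)"
  have h': "(%u. \<delta> u * \<chi> (?g (x, ?i))) : hom (F_grp (fst x) k) add_group"
   using dh by (auto simp: hom_def algebra_simps)
  have gr: "group_hom (F_grp (fst x) k) add_group \<chi>"
   using h F_comm[of "fst x" k, THEN comm_group.axioms(2)] group_add_group by (auto simp: group_hom_def group_hom_axioms_def)
  show "\<chi> u = \<delta> u * \<chi> (?g (x, ?i))"
  proof (rule F_hom_eq[OF _ h h' _ u])
   fix y f assume w: "(y, f) : overgraphs (fst x) k"
   show "\<chi> (?g (y, f)) = \<delta> (?g (y, f)) * \<chi> (?g (x, ?i))"
   proof (cases "((y, f), (x, ?i)) : ?R")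
    case True
    thus ?thesis using bspec[OF d w] F_gen_cong[OF True] by simp
   next
    case False
    hence r: "(over_rev (y, f), (x, ?i)) : ?R" using either[OF w] by blast
    have "\<chi> (?g (x, ?i)) = - \<chi> (?g (y, f))"
    using F_gen_cong[OF r] F_gen_rev[OF w] group_hom.hom_inv[OF gr F_gen_closed[OF w]] by simp
    moreover have "\<delta> (?g (y, f)) = - 1" using bspec[OF d w] False r by simp
    ultimately show ?thesis by simp
   qed
  qed (rule comm_group.axioms(2)[OF comm_group_add_group])
 qed
qed

section \<open>The cycle of a ribbon graph\<close>

text \<open>
 Each oriented ribbon graph of codimension \<open>k\<close> gets a rational \<open>k\<close>-chain on the nerve of its slice:
 cone off the sum of the chains of its expansions.
\<close>

primrec cyc :: "nat => 'h ograph => ('h ssimplex \<Rightarrow>\<^sub>0 rat)" where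
 "cyc 0 x = qs (of_int (orient_sign x)) (top (fst x))"
| "cyc (Suc k) x = ctr k (fst x) (SUM c:expansions k x. qpush (snd (rep c)) (cyc k (fst (rep c))))"

definition fcell :: "nat => 'h overgraph => ('h ssimplex \<Rightarrow>\<^sub>0 rat)" where
 "fcell k z = qpush (snd z) (cyc k (fst z))"

definition zet :: "nat => 'h ograph => ('h ssimplex \<Rightarrow>\<^sub>0 rat)" where
 "zet k x = (SUM c:expansions k x. fcell k (rep c))"

lemma cyc_Suc: "cyc (Suc k) x = ctr k (fst x) (zet k x)" by (simp add: zet_def fcell_def)

lemma fcell_opush: "fcell k (opush f z) = qpush f (fcell k z)" by (simp add: fcell_def qpush_comp)

lemma ctr_uminus: "ctr n G (- x) = - ctr n G x" by (simp add: ctr_def qext_uminus sum_negf qs_uminus)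

lemma qpush_idm: assumes x: "x : CS G n" shows "qpush (idm G) x = x"
proof -
 have "omap (push (idm G)) M = M" if M: "M : NS G n" for M
 proof -
  obtain xs fs where s: "M = (xs, fs)" by (cases M)
  have "push (idm G) z = z" if zs: "z : set xs" for z
  proof -
   obtain i where i: "i \<le> n" "z = xs ! i" using zs M[unfolded s NS_iff] by (auto simp: in_set_conv_nth less_Suc_eq_le)
   hence "ribbon_graph (fst z)" "snd z : Mor (fst z) G" using M[unfolded s NS_iff] by auto
   hence "idm G o_m snd z = snd z" using Mor_facts(2) by (intro idm_comp) auto
   thus ?thesis by (cases z) simp
  qed
  thus ?thesis unfolding s omap_def by (simp add: map_idI)
 qed
 hence "qpush (idm G) x = qext bas x" using x by (intro qext_cong) (auto simp: CS_def)
 thus ?thesis by simp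
qed

lemma cyc_props:
 fixes x x' :: "'h ograph" and z w :: "'h overgraph"
 shows "x : ographs k ==> cyc k x : CS (fst x) k"
 "x : ographs k ==> cyc k (orev x) = - cyc k x"
 "x : ographs k ==> x' : ographs k ==> oriented_iso x A x' ==> qpush A (cyc k x) = cyc k x'"
 and fcell_CS: "z : overgraphs G k ==> fcell k z : CS G k"
 and fcell_cong: "(z, w) : over_rel G k ==> fcell k z = fcell k w"
 and fcell_rev: "z : overgraphs G k ==> fcell k (over_rev z) = - fcell k z"
 and zet_CS: "x : ographs (Suc k) ==> zet k x : CS (fst x) k"
proof -
 define P where "P k \<longleftrightarrow> (ALL x:ographs k. cyc k x : CS (fst x) k & cyc k (orev x) = - cyc k (x :: 'h ograph) \<and>
  (ALL x':ographs k. ALL A. oriented_iso x A x' \<longrightarrow> qpush A (cyc k x) = cyc k x'))" for k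
 have F1: "fcell k z : CS G k" if "P k" "z : overgraphs G k" for k G and z :: "'h overgraph"
 proof -
  have z: "fst z : ographs k" "snd z : Mor (fst (fst z)) G" using that(2) overgraphs_iff[of "fst z" "snd z"] by auto
  have "cyc k (fst z) : CS (fst (fst z)) k" using bspec[OF that(1)[unfolded P_def] z(1)] by blast
  thus ?thesis unfolding fcell_def by (rule CS_push[OF ographD(2)[OF z(1)] z(2)])
 qed
 have F2: "fcell k z = fcell k w" if P: "P k" and zw: "(z, w) : over_rel G k" for k G and z w :: "'h overgraph"
 proof -
  obtain x f y g A where z: "z = (x, f)" "w = (y, g)" "x : ographs k" "y : ographs k" "oriented_iso x A y" "g o_m A = f"
   using zw by (auto simp: over_rel_def overgraphs_iff)
  have "qpush A (cyc k x) = cyc k y" using P z by (auto simp: P_def)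
  hence "qpush g (qpush A (cyc k x)) = qpush g (cyc k y)" by simp
  thus ?thesis using z by (simp add: fcell_def qpush_comp)
 qed
 have F3: "fcell k (over_rev z) = - fcell k z" if P: "P k" and z: "z : overgraphs G k" for k G and z :: "'h overgraph"
 proof -
  obtain x f where xf: "z = (x, f)" by (cases z)
  have x: "x : ographs k" using z xf by (simp add: overgraphs_iff)
  have "cyc k (orev x) = - cyc k x" using P x by (auto simp: P_def)
  thus ?thesis by (simp add: xf fcell_def over_rev_def qext_uminus)
 qed
 have Z: "zet k x : CS (fst x) k" if "P k" "x : ographs (Suc k)" for k and x :: "'h ograph"
  unfolding zet_def by (intro CS_sum F1[OF that(1)] Exps_overgraphs rep_expansion(1))
 have all: "P k" for k
 proof (induction k)
  case 0
  show ?case unfolding P_def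
  proof (intro ballI conjI allI impI)
   fix x x' :: "'h ograph" and A assume x: "x : ographs 0"
   show "cyc 0 x : CS (fst x) 0" using CS_qs[OF top_CS[OF ographD(2)[OF x]]] by simp
   show "cyc 0 (orev x) = - cyc 0 x" using orient_sign_orev[OF x] by (simp add: qs_uminus)
   assume x': "x' : ographs 0" and a: "oriented_iso x A x'"
   show "qpush A (cyc 0 x) = cyc 0 x'"
    using orient_sign_iso[OF x x' a] top_natural[OF ographD(2)[OF x] ographD(2)[OF x'] oriented_isoD[OF a]] by (simp add: qext_qs)
  qed
 next
  case (Suc k)
  have es: "!!z w. (z, w) : over_rel G (Suc k) ==>
    (SUM c:expansions k (fst z). fcell k (opush (snd z) (rep c))) = (SUM c:expansions k (fst w). fcell k (opush (snd w) (rep c)))"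
   "!!z. z : overgraphs G (Suc k) ==>
    (SUM c:expansions k (fst (over_rev z)). fcell k (opush (snd (over_rev z)) (rep c))) = - (SUM c:expansions k (fst z). fcell k (opush (snd z) (rep c)))"
   if "ribbon_graph G" for G :: "'h ribbon"
   using expansion_sum(2,3)[where v = "fcell k", OF comm_group_add_group that, of k] F2[OF Suc] F3[OF Suc]
   by (simp_all add: finprod_add_group)
  have sz: "(SUM c:expansions k x. fcell k (opush f (rep c))) = qpush f (zet k x)" for f and x :: "'h ograph"
   unfolding zet_def qext_sum fcell_opush ..
  show ?case unfolding P_def
  proof (intro ballI conjI allI impI)
   fix x x' :: "'h ograph" and A assume x: "x : ographs (Suc k)"
   note r = ographD(2)[OF x] and i = idm_over[OF x]
   show "cyc (Suc k) x : CS (fst x) (Suc k)" unfolding cyc_Suc by (rule ctr_CS[OF r Z[OF Suc x]])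
   have "qpush (idm (fst x)) (zet k (orev x)) = - qpush (idm (fst x)) (zet k x)"
    using es(2)[OF r i] by (simp add: over_rev_def sz)
   hence "zet k (orev x) = - zet k x"
    using qpush_idm[OF Z[OF Suc x]] qpush_idm[OF Z[OF Suc orev_ographs[OF x]]] by simp
   thus "cyc (Suc k) (orev x) = - cyc (Suc k) x" unfolding cyc_Suc by (simp add: ctr_uminus)
   assume x': "x' : ographs (Suc k)" and a: "oriented_iso x A x'"
   note r' = ographD(2)[OF x'] and i' = idm_over[OF x']
   have m: "A : Mor (fst x) (fst x')" by (rule iso_in_Mor[OF r oriented_isoD[OF a]])
   have "idm (fst x') o_m A = A" by (rule idm_comp) (simp add: ribbon_isoD(2)[OF oriented_isoD[OF a]])
   hence "((x, A), (x', idm (fst x'))) : over_rel (fst x') (Suc k)"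
    using x m by (intro over_relI[OF _ i' a]) (auto simp: overgraphs_iff)
   from es(1)[OF r' this] have "qpush A (zet k x) = qpush (idm (fst x')) (zet k x')" by (simp add: sz)
   hence "qpush A (zet k x) = zet k x'" using qpush_idm[OF Z[OF Suc x']] by simp
   thus "qpush A (cyc (Suc k) x) = cyc (Suc k) x'"
    unfolding cyc_Suc using ctr_natural[OF r r' oriented_isoD[OF a] Z[OF Suc x]] by simp
  qed
 qed
 show "x : ographs k ==> cyc k x : CS (fst x) k"
  "x : ographs k ==> cyc k (orev x) = - cyc k x"
  "x : ographs k ==> x' : ographs k ==> oriented_iso x A x' ==> qpush A (cyc k x) = cyc k x'"
  using all[of k] unfolding P_def by blast+
 show "z : overgraphs G k ==> fcell k z : CS G k" by (rule F1[OF all])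
 show "(z, w) : over_rel G k ==> fcell k z = fcell k w" by (rule F2[OF all])
 show "z : overgraphs G k ==> fcell k (over_rev z) = - fcell k z" by (rule F3[OF all])
 show "x : ographs (Suc k) ==> zet k x : CS (fst x) k" by (rule Z[OF all])
qed

text \<open>The chains of the graphs over \<open>G\<close> define a map from the forest carrier to rational chains.\<close>

definition Psi :: "'h ribbon => nat => 'h felem => ('h ssimplex \<Rightarrow>\<^sub>0 rat)" where
 "Psi G k = hom_on (F_grp G k) add_group (overgraphs G k) (F_gen G k) (fcell k)"

lemma Psi_hom: "Psi G k : hom (F_grp G k) add_group"
 and Psi_gen: "z : overgraphs G k ==> Psi G k (F_gen G k z) = fcell k z"
proof -
 have "fcell k (over_rev z) = inv\<^bsub>add_group\<^esub> fcell k z" if "z : overgraphs G k" for z using fcell_rev[OF that] by simp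
 note h = F_hom_on[where v = "fcell k", OF comm_group_add_group _ fcell_cong this]
 show "Psi G k : hom (F_grp G k) add_group" unfolding Psi_def by (rule h(1)) auto
 show "z : overgraphs G k ==> Psi G k (F_gen G k z) = fcell k z"
  unfolding Psi_def by (rule h(2)) auto
qed

lemma Psi_CS: assumes u: "u : carrier (F_grp G k)" shows "Psi G k u : CS G k"
proof -
 interpret h: group_hom "F_grp G k" add_group "Psi G k"
  using Psi_hom F_comm[of G k, THEN comm_group.axioms(2)] group_add_group by (auto simp: group_hom_def group_hom_axioms_def)
 have g: "F_gen G k ` overgraphs G k <= carrier (F_grp G k)" using F_gen_closed by blast
 have "u : generate (F_grp G k) (F_gen G k ` overgraphs G k)"
  using u over.carrier[of G k] by (simp add: F_grp_def F_gen_def)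
 thus ?thesis
 proof (induction rule: generate.induct)
  case one thus ?case by (simp add: CS_zero)
 next
  case (incl v)
  then obtain z where z: "z : overgraphs G k" "v = F_gen G k z" by blast
  show ?case unfolding z(2) Psi_gen[OF z(1)] by (rule fcell_CS[OF z(1)])
 next
  case (inv v)
  then obtain z where z: "z : overgraphs G k" "v = F_gen G k z" by blast
  have "Psi G k v : CS G k" "v : carrier (F_grp G k)"
   unfolding z(2) Psi_gen[OF z(1)] using fcell_CS[OF z(1)] F_gen_closed[OF z(1)] .
  thus ?case using CS_qs[of "Psi G k v" G k "- 1"] by (simp add: qs_uminus)
 next
  case (eng v w)
  thus ?case using h.G.generate_in_carrier[OF g] CS_add by simp
 qed
qed

lemma Psi_push:
 assumes G: "ribbon_graph G" and f: "f : Mor G G'" and u: "u : carrier (F_grp G k)"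
 shows "Psi G' k (F_push G G' f k u) = qpush f (Psi G k u)"
proof (rule F_hom_eq[OF group_add_group _ _ _ u])
 note F = F_push_spec[where k = k, OF G f]
 show "(%u. Psi G' k (F_push G G' f k u)) : hom (F_grp G k) add_group" by (rule comp_group_hom[OF F(1) Psi_hom])
 show "(%u. qpush f (Psi G k u)) : hom (F_grp G k) add_group" using Psi_hom[of G k] by (auto simp: hom_def qext_add)
 show "Psi G' k (F_push G G' f k (F_gen G k (x, g))) = qpush f (Psi G k (F_gen G k (x, g)))" if "(x, g) : overgraphs G k" for x g
  using F(2)[OF that] Psi_gen[OF that] Psi_gen[OF opush_over[OF G f that]] fcell_opush[where z = "(x, g)" and f = f and k = k] by simp
qed

section \<open>Chain maps carried by the forests\<close>

lemma nerve_chains_simps [simp]: "Grp (nerve_chains C) n = free_Abelian_group (nerve C n)"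
 by (simp add: nerve_chains_def)

lemma emb_dif: "emb (Dif (nerve_chains fat) n c) = qbd (Suc n) (emb c)"
 "emb (Dif (nerve_chains (slice fat G)) n d) = qbd (Suc n) (emb d)"
 by (simp_all add: nerve_chains_def emb_frag_extend emb_sum face_eq bd_def[abs_def] del: sum.atMost_Suc)

lemma slice_push_of: "slice_push fat f (frag_of M) = frag_of (omap (push f) M)"
 by (simp add: slice_push_def omap_def case_prod_unfold)

lemma emb_forget: "emb (slice_forget c) = qomap fst (emb c)"
 by (simp add: slice_forget_def emb_frag_extend omap_def case_prod_unfold)

lemma F_complex_simps [simp]: "Grp (F_complex G) = F_grp G" by (simp add: F_complex_def)

locale carried =
 fixes \<phi> :: "nat => ('h::infinite) fat_chain => 'h gdual" and \<Phi> :: "'h ribbon => nat => 'h fat_slice_chain => 'h felem"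
 assumes phi: "aug_chain_map (nerve_chains fat) GZ_complex \<phi>"
  and Phi: "!!G. ribbon_graph G ==> aug_chain_map (nerve_chains (slice fat G)) (F_complex G) (\<Phi> G)"
  and Phi_push: "!!G G' f n c. ribbon_graph G ==> ribbon_graph G' ==> f : Mor G G' ==> keys c <= NS G n ==>
   \<Phi> G' n (slice_push fat f c) = F_push G G' f n (\<Phi> G n c)"
  and Phi_proj: "!!G n c. ribbon_graph G ==> keys c <= NS G n ==> F_proj G n (\<Phi> G n c) = \<phi> n (slice_forget c)"
begin

lemma Phi_hom: "ribbon_graph G ==> \<Phi> G n : hom (free_Abelian_group (NS G n)) (F_grp G n)"
 using Phi[of G] by (simp add: aug_chain_map_def chain_map_def)

lemma Phi_dif: "ribbon_graph G ==> keys c <= NS G (Suc n) ==>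
 \<Phi> G n (Dif (nerve_chains (slice fat G)) n c) = Dif (F_complex G) n (\<Phi> G (Suc n) c)"
 using Phi[of G] by (simp add: aug_chain_map_def chain_map_def)

lemma Phi_aug: "ribbon_graph G ==> M : NS G 0 ==> Aug (F_complex G) (\<Phi> G 0 (frag_of M)) = 1"
 using Phi[of G] by (simp add: aug_chain_map_def nerve_chains_def)

abbreviation ph :: "'h ribbon => nat => 'h ssimplex => 'h felem" where "ph G n M \<equiv> \<Phi> G n (frag_of M)"

lemma ph_closed: "ribbon_graph G ==> M : NS G n ==> ph G n M : carrier (F_grp G n)"
 using Phi_hom[of G n] by (auto simp: hom_def)

lemma ph_push: "ribbon_graph G ==> ribbon_graph G' ==> f : Mor G G' ==> M : NS G n ==>
 ph G' n (omap (push f) M) = F_push G G' f n (ph G n M)"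
 using Phi_push[of G G' f "frag_of M" n] by (simp add: slice_push_of)

lemma keys_dif: "ribbon_graph G ==> M : NS G (Suc n) ==>
 keys (Dif (nerve_chains (slice fat G)) n (frag_of M)) <= NS G n"
 using CS_qbd[rule_format, OF _ CS_bas, of G M n] keys_emb[of "Dif (nerve_chains (slice fat G)) n (frag_of M)"]
 by (simp add: emb_dif CS_def)

text \<open>Pairing rational chains with functionals on the carrier, through \<open>\<Phi>\<close>.\<close>

lemma pair_dif:
 assumes G: "ribbon_graph G" and h: "\<chi> : hom (F_grp G n) add_group" and c: "c : CS G (Suc n)"
 shows "rext (%M. \<chi> (ph G n M)) (qbd (Suc n) c) = rext (%M. \<chi> (Dif (F_complex G) n (ph G (Suc n) M))) c"
 unfolding rext_comp
proof (rule rext_cong)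
 fix M assume "M : keys c"
 hence M: "M : NS G (Suc n)" using c by (auto simp: CS_def)
 let ?d = "Dif (nerve_chains (slice fat G)) n (frag_of M)"
 have "\<chi> (\<Phi> G n ?d) = rext (%M. \<chi> (ph G n M)) (emb ?d)"
  by (rule rext_integral[OF comp_group_hom[OF Phi_hom[OF G] h] keys_dif[OF G M]])
 also have "emb ?d = bd (Suc n) M" by (simp add: emb_dif)
 finally show "rext (%M. \<chi> (ph G n M)) (bd (Suc n) M) = \<chi> (Dif (F_complex G) n (ph G (Suc n) M))"
  using Phi_dif[OF G, of "frag_of M" n] M by simp
qed

lemma pair_push:
 assumes "ribbon_graph G" "ribbon_graph G'" "f : Mor G G'" and c: "c : CS G n"
 shows "rext (%M. \<chi> (ph G' n M)) (qpush f c) = rext (%M. \<chi> (F_push G G' f n (ph G n M))) c"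
 unfolding rext_comp by (rule rext_cong) (use c ph_push[OF assms(1-3)] in \<open>auto simp: CS_def rext_simps\<close>)

lemma of_int_hom: "h : hom G integer_group ==> (%u. of_int (h u) :: rat) : hom G add_group"
 by (auto simp: hom_def integer_group_eq)

lemma ph_trivalent:
 fixes y :: "'h ograph" and \<chi> :: "'h felem => rat"
 assumes y: "y : ographs 0" and h: "\<chi> : hom (F_grp (fst y) 0) add_group" and M: "M : NS (fst y) 0"
 shows "\<chi> (ph (fst y) 0 M) = of_int (orient_sign y) * \<chi> (F_gen (fst y) 0 (y, idm (fst y)))"
proof -
 obtain \<delta> :: "'h felem => rat" where d: "ALL \<chi>:hom (F_grp (fst y) 0) add_group. ALL u:carrier (F_grp (fst y) 0).
   \<chi> u = \<delta> u * \<chi> (F_gen (fst y) 0 (y, idm (fst y)))"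
  using top_degree[OF y] by blast
 note r = ographD(2)[OF y] and c = ph_closed[rule_format, OF ographD(2)[OF y] M]
 have "(1::rat) = \<delta> (ph (fst y) 0 M) * of_int (orient_sign y)"
  using d[rule_format, OF of_int_hom[OF F_aug(1)] c] Phi_aug[OF r M] F_aug(2)[OF idm_over[OF y]] by simp
 hence "\<delta> (ph (fst y) 0 M) = of_int (orient_sign y)" using orient_sign_values[of y] by auto
 thus ?thesis using d[rule_format, OF h c] by simp
qed

text \<open>
 A graph of codimension 1 has exactly two expansions, with opposite natural orientations. This is
 forced by the existence of the augmented map \<open>\<Phi>\<close>: the difference of any two expansions, taken
 with their signs, is the boundary of the image of an edge, hence a multiple of the sum of all expansions.
\<close>

lemma aug_zet: fixes x :: "'h ograph" assumes x: "x : ographs (Suc 0)" shows "aug (zet 0 x) = 0"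
proof -
 let ?G = "fst x" let ?R = "over_rel (fst x) 0"
 note r = ographD(2)[OF x]
 let ?v = "%z :: 'h overgraph. ([(fst (fst z), snd z)], []) :: 'h ssimplex"
 let ?o = "%z :: 'h overgraph. of_int (orient_sign (fst z)) :: rat"
 have zz: "fst z : ographs 0" "snd z : Mor (fst (fst z)) ?G" if "z : Exps 0 x" for z
  using Exps_overgraphs[OF that] by (auto simp: overgraphs_def)
 have v: "?v z : NS ?G 0" if "z : Exps 0 x" for z
  using zz[OF that] ographD(2)[OF zz(1)[OF that]] by (auto simp: NS_iff)
 \<comment> \<open>The value of \<open>\<Phi>\<close> at a vertex of the slice is determined by naturality, from the identity of a trivalent graph.\<close>
 have phv: "\<chi> (ph ?G 0 (?v z)) = ?o z * \<chi> (F_gen ?G 0 z)" if h: "\<chi> : hom (F_grp ?G 0) add_group" and z: "z : Exps 0 x" for \<chi> z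
 proof -
  obtain y g where yg: "z = (y, g)" by (cases z)
  have y: "y : ographs 0" and g: "g : Mor (fst y) ?G" using zz[OF z] yg by auto
  note ry = ographD(2)[OF y]
  have n: "([(fst y, idm (fst y))], []) : NS (fst y) 0" using ry iso_in_Mor[OF ry ribbon_iso_refl[OF ry]] by (simp add: NS_iff)
  have gi: "g o_m idm (fst y) = g" by (rule comp_idm[OF Mor_facts(1)[OF ry g]])
  note P = F_push_spec[where k = 0, OF ry g]
  have "\<chi> (ph ?G 0 (?v z)) = \<chi> (F_push (fst y) ?G g 0 (ph (fst y) 0 ([(fst y, idm (fst y))], [])))"
   using ph_push[OF ry r g n] by (simp add: yg omap_def gi)
  also have "... = ?o z * \<chi> (F_push (fst y) ?G g 0 (F_gen (fst y) 0 (y, idm (fst y))))"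
   using ph_trivalent[OF y comp_group_hom[OF P(1) h] n] yg by simp
  also have "... = ?o z * \<chi> (F_gen ?G 0 z)" using P(2)[OF idm_over[OF y]] by (simp add: yg gi)
  finally show ?thesis .
 qed
 obtain \<delta>x :: "'h felem => rat" where dx: "ALL \<chi>:hom (F_grp ?G (Suc 0)) add_group. ALL u:carrier (F_grp ?G (Suc 0)).
   \<chi> u = \<delta>x u * \<chi> (F_gen ?G (Suc 0) (x, idm ?G))"
  using top_degree[OF x] by blast
 \<comment> \<open>The edge path from one expansion to the other through the terminal object.\<close>
 have key: "EX m. ALL w:Exps 0 x. ?o z * (if (z, w) : ?R then 1 else 0) - ?o z' * (if (z', w) : ?R then 1 else 0) = m"
  if z: "z : Exps 0 x" "z' : Exps 0 x" for z z'
 proof -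
  let ?J = "%z. J ?G (idm ?G) (?v z)"
  let ?c = "bas (?J z') - bas (?J z)"
  have c: "?c : CS ?G (Suc 0)"
   using J_NS[OF r r ribbon_iso_refl[OF r] v[OF z(1)]] J_NS[OF r r ribbon_iso_refl[OF r] v[OF z(2)]] by (intro CS_diff CS_bas)
  have bc: "qbd (Suc 0) ?c = bas (?v z) - bas (?v z')"
   using bd_J0[OF v[OF z(1)]] bd_J0[OF v[OF z(2)]] by (simp add: qext_diff)
  let ?m = "rext (%M. \<delta>x (ph ?G (Suc 0) M)) ?c"
  have "?o z * (if (z, w) : ?R then 1 else 0) - ?o z' * (if (z', w) : ?R then 1 else 0) = ?m" if w: "w : Exps 0 x" for w
  proof -
   obtain \<chi> :: "'h felem => rat" where h: "\<chi> : hom (F_grp ?G 0) add_group"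
    and cw: "ALL z:Exps 0 x. \<chi> (F_gen ?G 0 z) = (if (z, w) : ?R then 1 else 0)"
    and cd: "\<chi> (finprod (F_grp ?G 0) (%c. F_gen ?G 0 (rep c)) (expansions 0 x)) = 1"
    using expansion_functional[OF x w] by blast
   have "?o z * (if (z, w) : ?R then 1 else 0) - ?o z' * (if (z', w) : ?R then 1 else 0) =
    rext (%M. \<chi> (ph ?G 0 M)) (qbd (Suc 0) ?c)"
    unfolding bc using phv[OF h z(1)] phv[OF h z(2)] cw[rule_format, OF z(1)] cw[rule_format, OF z(2)] by (simp add: rext_simps)
   also have "... = rext (%M. \<chi> (Dif (F_complex ?G) 0 (ph ?G (Suc 0) M))) ?c" by (rule pair_dif[OF r h c])
   also have "... = rext (%M. \<delta>x (ph ?G (Suc 0) M) * 1) ?c"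
   proof (rule rext_cong)
    fix M assume "M : keys ?c"
    hence "M : NS ?G (Suc 0)" using c by (auto simp: CS_def)
    thus "\<chi> (Dif (F_complex ?G) 0 (ph ?G (Suc 0) M)) = \<delta>x (ph ?G (Suc 0) M) * 1"
    using dx[rule_format, OF comp_group_hom[OF F_dif(1)[OF r] h] ph_closed[rule_format, OF r]] F_dif_top[OF x] cd by simp
   qed
   finally show ?thesis by simp
  qed
  thus ?thesis by blast
 qed
 have refl: "(z, z) : ?R" if "z : Exps 0 x" for z
  using equiv_over_rel[of ?G 0] Exps_overgraphs[OF that] by (auto simp: equiv_def dest: refl_onD)
 have sy: "(z, w) : ?R ==> (w, z) : ?R" for z w using equiv_over_rel[of ?G 0] by (auto simp: equiv_def elim: symE)
 have tr: "(z, w) : ?R ==> (w, u) : ?R ==> (z, u) : ?R" for z w u using equiv_over_rel[of ?G 0] by (auto simp: equiv_def elim: transE)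
 have o: "?o z = 1 \<or> ?o z = - 1" for z using orient_sign_values[of "fst z"] by auto
 have opp: "?o z + ?o z' = 0" and third: "w : Exps 0 x ==> (w, z) : ?R \<or> (w, z') : ?R"
  if z: "z : Exps 0 x" "z' : Exps 0 x" and n: "(z, z') ~: ?R" for z z' w
 proof -
  obtain m where m: "!!w. w : Exps 0 x ==> ?o z * (if (z, w) : ?R then 1 else 0) - ?o z' * (if (z', w) : ?R then 1 else 0) = m"
   using key[OF z] by blast
  have n': "(z', z) ~: ?R" using n sy by blast
  have "?o z = m" "- ?o z' = m" using m[OF z(1)] m[OF z(2)] refl[OF z(1)] refl[OF z(2)] n n' by auto
  thus "?o z + ?o z' = 0" by linarith
  show "(w, z) : ?R \<or> (w, z') : ?R" if w: "w : Exps 0 x"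
  proof (rule ccontr)
   assume "\<not> ?thesis"
   hence "m = 0" using m[OF w] sy by (auto split: if_splits)
   thus False using \<open>?o z = m\<close> o[of z] by auto
  qed
 qed
 obtain z z' where z: "z : Exps 0 x" "z' : Exps 0 x" "(z, z') ~: ?R" using two_expansions[OF x] .
 obtain c where c: "c : expansions 0 x" "(z, rep c) : ?R" using expansion_exists[OF z(1)] .
 obtain c' where c': "c' : expansions 0 x" "(z', rep c') : ?R" using expansion_exists[OF z(2)] .
 have n: "(rep c, rep c') ~: ?R" using z(3) c(2) c'(2) sy tr by blast
 hence cc: "c ~= c'" using refl[OF rep_expansion(1)[OF c(1)]] by blast
 have all: "expansions 0 x = {c, c'}"
 proof
  show "expansions 0 x <= {c, c'}"
  proof
   fix d assume d: "d : expansions 0 x"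
   hence "(rep d, rep c) : ?R \<or> (rep d, rep c') : ?R"
    using third[rule_format, OF rep_expansion(1)[OF c(1)] rep_expansion(1)[OF c'(1)] n rep_expansion(1)[OF d]] by blast
   thus "d : {c, c'}" using expansion_eqI[OF d c(1)] expansion_eqI[OF d c'(1)] by blast
  qed
 qed (use c c' in blast)
 have a: "aug (fcell 0 z) = ?o z" if "z : Exps 0 x" for z
  using aug_top[OF ographD(2)[OF zz(1)[OF that]]] by (simp add: fcell_def aug_qomap aug_simps)
 have "aug (zet 0 x) = ?o (rep c) + ?o (rep c')"
  unfolding zet_def all using cc a[OF rep_expansion(1)[OF c(1)]] a[OF rep_expansion(1)[OF c'(1)]] by (simp add: aug_simps)
 thus ?thesis using opp[OF rep_expansion(1)[OF c(1)] rep_expansion(1)[OF c'(1)] n] by simp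
qed

lemma qbd_cyc: fixes x :: "'h ograph" shows "x : ographs (Suc k) ==> qbd (Suc k) (cyc (Suc k) x) = zet k x"
proof (induction k arbitrary: x)
 case 0
 thus ?case unfolding cyc_Suc by (intro ctr_contraction0 ographD(2) zet_CS aug_zet)
next
 case (Suc k)
 note r = ographD(2)[OF Suc.prems]
 have e: "fst (rep c) : ographs (Suc k)" if "c : expansions (Suc k) x" for c
  using Exps_overgraphs[OF rep_expansion(1)[OF that]] by (auto simp: overgraphs_def)
 have "qbd (Suc k) (zet (Suc k) x) = (SUM c:expansions (Suc k) x. qpush (snd (rep c)) (zet k (fst (rep c))))"
  unfolding zet_def[of "Suc k"] qext_sum fcell_def qbd_omap using Suc.IH[OF e] by (intro sum.cong) auto
 also have "... = (SUM c:expansions (Suc k) x. SUM d:expansions k (fst (rep c)). fcell k (fst (rep d), snd (rep c) o_m snd (rep d)))"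
  by (simp add: zet_def qext_sum fcell_opush)
 finally have s: "qbd (Suc k) (zet (Suc k) x) = ..." .
 have "qbd (Suc k) (zet (Suc k) x) = - qbd (Suc k) (zet (Suc k) x)"
  unfolding s by (rule expansions_twice[OF Suc.prems]) (auto intro: fcell_cong fcell_rev)
 hence "qbd (Suc k) (zet (Suc k) x) = 0" by (rule eq_uminus_qs)
 thus ?case unfolding cyc_Suc by (rule cycle_ctr[OF r zet_CS[OF Suc.prems]])
qed

text \<open>On generators this is \<open>qbd_cyc\<close>, pushed forward.\<close>

lemma Psi_dif:
 fixes G :: "'h ribbon"
 assumes G: "ribbon_graph G" and u: "u : carrier (F_grp G (Suc k))"
 shows "Psi G k (Dif (F_complex G) k u) = qbd (Suc k) (Psi G (Suc k) u)"
proof (rule F_hom_eq[OF group_add_group _ _ _ u])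
 show "(%u. Psi G k (Dif (F_complex G) k u)) : hom (F_grp G (Suc k)) add_group"
  by (rule comp_group_hom[OF F_dif(1)[OF G] Psi_hom])
 show "(%u. qbd (Suc k) (Psi G (Suc k) u)) : hom (F_grp G (Suc k)) add_group"
  using Psi_hom[of G "Suc k"] by (auto simp: hom_def qext_add)
 fix x f assume xf: "(x, f) : overgraphs G (Suc k)"
 hence x: "x : ographs (Suc k)" "f : Mor (fst x) G" by (auto simp: overgraphs_iff)
 note r = ographD(2)[OF x(1)]
 have o: "opush f (rep c) : overgraphs G k" if "c : expansions k x" for c
  by (rule opush_over[OF r x(2) Exps_overgraphs[OF rep_expansion(1)[OF that]]])
 have "Psi G k (finprod (F_grp G k) (%c. F_gen G k (opush f (rep c))) (expansions k x)) =
  (SUM c:expansions k x. Psi G k (F_gen G k (opush f (rep c))))"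
  unfolding finprod_add_group[symmetric]
  by (rule hom_finprod[rule_format, OF F_comm comm_group_add_group Psi_hom]) (use o F_gen_closed in blast)
 also have "... = (SUM c:expansions k x. qpush f (fcell k (rep c)))"
  by (intro sum.cong) (auto simp: Psi_gen[OF o] fcell_opush)
 also have "... = qpush f (zet k x)" by (simp add: zet_def qext_sum)
 also have "... = qbd (Suc k) (fcell (Suc k) (x, f))" unfolding fcell_def fst_conv snd_conv qbd_omap qbd_cyc[OF x(1)] ..
 finally show "Psi G k (Dif (F_complex G) k (F_gen G (Suc k) (x, f))) = qbd (Suc k) (Psi G (Suc k) (F_gen G (Suc k) (x, f)))"
  using F_dif(2)[OF G xf] Psi_gen[OF xf] by simp
qed

lemma aug_Psi:
 assumes u: "u : carrier (F_grp G 0)" shows "aug (Psi G 0 u) = of_int (Aug (F_complex G) u)"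
proof (rule F_hom_eq[OF group_add_group _ of_int_hom[OF F_aug(1)] _ u])
 show "(%u. aug (Psi G 0 u)) : hom (F_grp G 0) add_group" using Psi_hom[of G 0] by (auto simp: hom_def aug_simps)
 fix x f assume xf: "(x, f) : overgraphs G 0"
 hence "ribbon_graph (fst x)" using ographD(2)[of x 0] by (auto simp: overgraphs_iff)
 thus "aug (Psi G 0 (F_gen G 0 (x, f))) = of_int (Aug (F_complex G) (F_gen G 0 (x, f)))"
  using F_aug(2)[OF xf] Psi_gen[OF xf] aug_top[OF \<open>ribbon_graph (fst x)\<close>] by (simp add: fcell_def aug_qomap aug_simps)
qed

subsection \<open>The carrier determines the values on the cycles\<close>

text \<open>
 In the degree of its codimension the carrier of \<open>G\<close> is generated by the identity of \<open>G\<close>, so \<open>\<Phi>\<close>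
 sends the cycle of \<open>G\<close> to a multiple of it. Comparing boundaries shows inductively that the factor is 1.
\<close>

lemma pairing_cyc:
 fixes x :: "'h ograph"
 shows "x : ographs k ==> \<chi> : hom (F_grp (fst x) k) add_group ==>
  rext (%M. \<chi> (ph (fst x) k M)) (cyc k x) = \<chi> (F_gen (fst x) k (x, idm (fst x)))"
proof (induction k arbitrary: x \<chi>)
 case 0
 let ?q = "of_int (orient_sign x) :: rat" and ?g = "\<chi> (F_gen (fst x) 0 (x, idm (fst x)))"
 note r = ographD(2)[OF 0(1)]
 have "rext (%M. \<chi> (ph (fst x) 0 M)) (top (fst x)) = rext (%M. 1 * (?q * ?g)) (top (fst x))"
  by (rule rext_cong) (use ph_trivalent[OF 0] top_CS[OF r] in \<open>auto simp: CS_def\<close>)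
 also have "... = aug (top (fst x)) * (?q * ?g)" unfolding rext_scale by (simp add: rext_def aug_def)
 finally have "rext (%M. \<chi> (ph (fst x) 0 M)) (cyc 0 x) = ?q * ?q * ?g" using aug_top[OF r] by (simp add: rext_simps)
 thus ?case using orient_sign_values[of x] by auto
next
 case (Suc k)
 let ?G = "fst x"
 note x = Suc.prems(1) and r = ographD(2)[OF Suc.prems(1)]
 let ?g = "F_gen ?G (Suc k) (x, idm ?G)"
 obtain \<delta> :: "'h felem => rat" where d: "ALL \<chi>:hom (F_grp ?G (Suc k)) add_group. ALL u:carrier (F_grp ?G (Suc k)). \<chi> u = \<delta> u * \<chi> ?g"
  using top_degree[OF x] by blast
 let ?l = "rext (%M. \<delta> (ph ?G (Suc k) M)) (cyc (Suc k) x)"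
 have scale: "rext (%M. \<chi> (ph ?G (Suc k) M)) (cyc (Suc k) x) = ?l * \<chi> ?g" if h: "\<chi> : hom (F_grp ?G (Suc k)) add_group" for \<chi>
 proof -
  have "rext (%M. \<chi> (ph ?G (Suc k) M)) (cyc (Suc k) x) = rext (%M. \<delta> (ph ?G (Suc k) M) * \<chi> ?g) (cyc (Suc k) x)"
   by (rule rext_cong) (use d[rule_format, OF h ph_closed[rule_format, OF r]] cyc_props(1)[OF x] in \<open>auto simp: CS_def\<close>)
  thus ?thesis unfolding rext_scale .
 qed
 obtain z where z: "z : Exps k x" using two_expansions[OF x] by metis
 obtain \<epsilon> :: "'h felem => rat" where e: "\<epsilon> : hom (F_grp ?G k) add_group"
  and e1: "\<epsilon> (finprod (F_grp ?G k) (%c. F_gen ?G k (rep c)) (expansions k x)) = 1"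
  using expansion_functional[OF x z] by blast
 have cell: "rext (%M. \<epsilon> (ph ?G k M)) (fcell k w) = \<epsilon> (F_gen ?G k w)" if w: "w : Exps k x" for w
 proof -
  obtain y f where yf: "w = (y, f)" by (cases w)
  have y: "y : ographs k" "f : Mor (fst y) ?G" using Exps_overgraphs[OF w] yf by (auto simp: overgraphs_iff)
  note ry = ographD(2)[OF y(1)]
  note P = F_push_spec[where k = k, OF ry y(2)]
  have "rext (%M. \<epsilon> (ph ?G k M)) (fcell k w) = rext (%M. \<epsilon> (F_push (fst y) ?G f k (ph (fst y) k M))) (cyc k y)"
   using pair_push[OF ry r y(2) cyc_props(1)[OF y(1)]] by (simp add: fcell_def yf)
  also have "... = \<epsilon> (F_push (fst y) ?G f k (F_gen (fst y) k (y, idm (fst y))))"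
   by (rule Suc.IH[OF y(1) comp_group_hom[OF P(1) e]])
  also have "... = \<epsilon> (F_gen ?G k w)" using P(2)[OF idm_over[OF y(1)]] comp_idm[OF Mor_facts(1)[OF ry y(2)]] by (simp add: yf)
  finally show ?thesis .
 qed
 \<comment> \<open>The factor \<open>?l\<close> can be read off from the boundary, where the induction hypothesis applies.\<close>
 have "?l * 1 = rext (%M. \<epsilon> (Dif (F_complex ?G) k (ph ?G (Suc k) M))) (cyc (Suc k) x)"
  using scale[OF comp_group_hom[OF F_dif(1)[OF r] e]] F_dif_top[OF x] e1 by simp
 also have "... = rext (%M. \<epsilon> (ph ?G k M)) (zet k x)"
  unfolding qbd_cyc[OF x, symmetric] by (rule pair_dif[OF r e cyc_props(1)[OF x], symmetric])
 also have "... = (SUM c:expansions k x. \<epsilon> (F_gen ?G k (rep c)))"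
  unfolding zet_def rext_simps by (intro sum.cong cell rep_expansion(1)) auto
 also have "... = \<epsilon> (finprod (F_grp ?G k) (%c. F_gen ?G k (rep c)) (expansions k x))"
  unfolding finprod_add_group[symmetric]
  by (rule hom_finprod[rule_format, OF F_comm comm_group_add_group e, symmetric]) (auto intro: F_gen_closed Exps_overgraphs rep_expansion(1))
 finally have "?l = 1" using e1 by simp
 thus ?case using scale[OF Suc.prems(2)] by simp
qed

subsection \<open>The homotopy on the slices\<close>

text \<open>
 \<open>rho\<close> is the composite of \<open>\<Phi>\<close> and \<open>Psi\<close>. The homotopy \<open>hmt\<close> is defined on the simplices of the nerve by the usual
 recursion for acyclic models, and \<open>spush\<close> extends it naturally to all simplices of the slices: a simplex is
 the push-forward of the lift of its underlying simplex along the structure map of its last vertex.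
\<close>

definition rho :: "'h ribbon => nat => ('h ssimplex \<Rightarrow>\<^sub>0 rat) => ('h ssimplex \<Rightarrow>\<^sub>0 rat)" where
 "rho G n = qext (%M. Psi G n (ph G n M))"

lemma rho_CS: "ribbon_graph G ==> c : CS G n ==> rho G n c : CS G n"
 unfolding rho_def by (erule CS_qext) (rule Psi_CS[OF ph_closed])

lemma rho_push:
 assumes "ribbon_graph G" "ribbon_graph G'" "f : Mor G G'" and c: "c : CS G n"
 shows "rho G' n (qpush f c) = qpush f (rho G n c)"
 unfolding rho_def qext_comp
 by (rule qext_cong) (use c ph_push[OF assms(1-3)] Psi_push[OF assms(1,3) ph_closed[rule_format, OF assms(1)]] in \<open>auto simp: CS_def\<close>)

lemma rho_qbd:
 assumes G: "ribbon_graph G" and c: "c : CS G (Suc n)"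
 shows "rho G n (qbd (Suc n) c) = qbd (Suc n) (rho G (Suc n) c)"
 unfolding rho_def qext_comp
proof (rule qext_cong)
 fix M assume "M : keys c"
 hence M: "M : NS G (Suc n)" using c by (auto simp: CS_def)
 let ?d = "Dif (nerve_chains (slice fat G)) n (frag_of M)"
 have "Psi G n (\<Phi> G n ?d) = qext (%M. Psi G n (ph G n M)) (emb ?d)"
  by (rule qext_integral[OF comp_group_hom[OF Phi_hom[OF G] Psi_hom] _ keys_dif[OF G M]]) simp
 also have "emb ?d = bd (Suc n) M" by (simp add: emb_dif)
 finally show "qext (%M. Psi G n (ph G n M)) (bd (Suc n) M) = qbd (Suc n) (Psi G (Suc n) (ph G (Suc n) M))"
  using Phi_dif[OF G, of "frag_of M" n] M Psi_dif[OF G ph_closed[rule_format, OF G M]] by simp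
qed

lemma aug_rho: assumes "ribbon_graph G" "M : NS G 0" shows "aug (rho G 0 (bas M)) = 1"
 using aug_Psi[OF ph_closed[rule_format, OF assms]] Phi_aug[OF assms] by (simp add: rho_def)

definition spush :: "(('h ribbon, 'h mor) simplex => ('h ssimplex \<Rightarrow>\<^sub>0 rat)) => ('h ssimplex \<Rightarrow>\<^sub>0 rat) => ('h ssimplex \<Rightarrow>\<^sub>0 rat)" where
 "spush S = qext (%M. qpush (snd (last (fst M))) (S (omap fst M)))"

primrec hmt :: "nat => ('h ribbon, 'h mor) simplex => ('h ssimplex \<Rightarrow>\<^sub>0 rat)" where
 "hmt 0 N = ctr 0 (last (fst N)) (rho (last (fst N)) 0 (bas (hat N)) - bas (hat N))"
| "hmt (Suc n) N = ctr (Suc n) (last (fst N))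
  (rho (last (fst N)) (Suc n) (bas (hat N)) - bas (hat N) - spush (hmt n) (bd (Suc n) (hat N)))"

lemma last_NS: assumes "M : NS G n"
 shows "ribbon_graph (fst (last (fst M)))" "snd (last (fst M)) : Mor (fst (last (fst M))) G" "last (fst (omap fst M)) = fst (last (fst M))"
proof -
 obtain xs fs where s: "M = (xs, fs)" by (cases M)
 have l: "length xs = Suc n" using assms[unfolded s NS_iff] by simp
 hence "xs ~= []" by auto
 hence la: "last xs = xs ! n" using l by (simp add: last_conv_nth)
 show "ribbon_graph (fst (last (fst M)))" "snd (last (fst M)) : Mor (fst (last (fst M))) G"
  using assms[unfolded s NS_iff] by (auto simp: s la)
 show "last (fst (omap fst M)) = fst (last (fst M))" using \<open>xs ~= []\<close> by (simp add: s omap_def last_map)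
qed

lemma hat_CS: assumes "N : nerve fat n" shows "bas (hat N) : CS (last (fst N)) n" "ribbon_graph (last (fst N))"
proof -
 obtain Gs fs where t: "N = (Gs, fs)" by (cases N)
 show "bas (hat N) : CS (last (fst N)) n" using hat_NS[of Gs fs n] assms by (intro CS_bas) (simp add: t hat_def)
 have "length Gs = Suc n" "!!i. i \<le> n ==> ribbon_graph (Gs ! i)" using assms[unfolded t fat_nerve_iff] by auto
 moreover from this have "Gs ~= []" by auto
 ultimately show "ribbon_graph (last (fst N))" by (simp add: t last_conv_nth)
qed

lemma hmt_CS:
 "N : nerve fat n ==> hmt n N : CS (last (fst N)) (Suc n)"
 "c : CS G n ==> spush (hmt n) c : CS G (Suc n)"
proof -
 have S: "spush (hmt n) c : CS G (Suc n)"
  if *: "!!N. N : nerve fat n ==> hmt n N : CS (last (fst N)) (Suc n)" and "c : CS G n" for n G c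
  unfolding spush_def
 proof (rule CS_qext[OF \<open>c : _\<close>])
  fix M assume s: "M : NS G n"
  show "qpush (snd (last (fst M))) (hmt n (omap fst M)) : CS G (Suc n)"
   using CS_push[OF last_NS(1,2)[OF s]] *[OF NS_forget[OF s]] last_NS(3)[OF s] by simp
 qed
 have T: "N : nerve fat n ==> hmt n N : CS (last (fst N)) (Suc n)" for N n
 proof (induction n arbitrary: N)
  case 0
  note h = hat_CS[OF 0]
  show ?case unfolding hmt.simps by (intro ctr_CS CS_diff rho_CS h)
 next
  case (Suc n)
  note h = hat_CS[OF Suc.prems]
  have "bd (Suc n) (hat N) : CS (last (fst N)) n" using CS_qbd[rule_format, OF h(2,1)] by simp
  thus ?case unfolding hmt.simps by (intro ctr_CS CS_diff rho_CS h S Suc.IH)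
 qed
 show "N : nerve fat n ==> hmt n N : CS (last (fst N)) (Suc n)" by (rule T)
 show "c : CS G n ==> spush (hmt n) c : CS G (Suc n)" by (rule S[OF T])
qed

lemma spush_push: assumes "c : CS G n" shows "spush S (qpush f c) = qpush f (spush S c)"
proof -
 have "qext (%M. qext (%M. qpush (snd (last (fst M))) (S (omap fst M))) (bas (omap (push f) M))) c =
  qext (%M. qpush f (qpush (snd (last (fst M))) (S (omap fst M)))) c"
 proof (rule qext_cong)
 fix M assume "M : keys c"
 hence "M : NS G n" using assms by (auto simp: CS_def)
 moreover obtain xs fs where s: "M = (xs, fs)" by (cases M)
 ultimately have "xs ~= []" by (auto simp: NS_iff)
 thus "qext (%M. qpush (snd (last (fst M))) (S (omap fst M))) (bas (omap (push f) M)) =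
  qpush f (qpush (snd (last (fst M))) (S (omap fst M)))"
  unfolding qpush_comp by (simp add: s omap_def last_map case_prod_unfold comp_def)
 qed
 thus ?thesis unfolding spush_def qext_comp[of _ "%M. bas (omap (push f) M)"]
   qext_comp[of "%M. bas (omap (push f) M)" "%M. qpush (snd (last (fst M))) (S (omap fst M))"] .
qed

lemma spush_hat: assumes "N : nerve fat n" shows "spush (hmt n) (bas (hat N)) = hmt n N"
proof -
 obtain Gs fs where t: "N = (Gs, fs)" by (cases N)
 have "Gs ~= []" using assms[unfolded t fat_nerve_iff] by auto
 hence "omap fst (hat N) = N" "snd (last (fst (hat N))) = idm (last (fst N))"
  by (simp_all add: t hat_def omap_def hats_map_fst hats_last)
 thus ?thesis using qpush_idm[OF hmt_CS(1)[OF assms]] by (simp add: spush_def)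
qed

text \<open>It suffices to check homotopy identities on the canonical lifts.\<close>

lemma hmt_bd0: assumes G: "ribbon_graph G" and c: "c : CS G 0"
 shows "qbd (Suc 0) (spush (hmt 0) c) = rho G 0 c - c"
proof -
 have h: "qbd (Suc 0) (hmt 0 N) = rho (last (fst N)) 0 (bas (hat N)) - bas (hat N)" if t: "N : nerve fat 0" for N
 proof -
  note H = hat_CS[OF t]
  have "hat N : NS (last (fst N)) 0" using H(1) by (simp add: CS_def)
  thus ?thesis unfolding hmt.simps
   by (intro ctr_contraction0 CS_diff rho_CS H) (simp add: aug_simps aug_rho[OF H(2)])
 qed
 have "qbd (Suc 0) (spush (hmt 0) (bas M)) = rho G 0 (bas M) - bas M" if M: "M : NS G 0" for M
 proof -
  let ?N = "omap fst M" let ?p = "snd (last (fst M))"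
  note t = NS_forget[OF M] and L = last_NS[OF M]
  note H = hat_CS[OF t]
  have Mh: "bas M = qpush ?p (bas (hat ?N))" using hat_push[OF M] by simp
  have p: "?p : Mor (last (fst ?N)) G" using L by simp
  show ?thesis
   unfolding Mh spush_push[OF H(1)] spush_hat[OF t] qbd_omap h[OF t] rho_push[OF H(2) G p H(1)] qext_diff ..
 qed
 hence "qext (%M. qbd (Suc 0) (spush (hmt 0) (bas M))) c = qext (%M. rho G 0 (bas M) - bas M) c"
  using c by (intro qext_cong) (auto simp: CS_def)
 thus ?thesis by (simp add: qext_fun_diff spush_def rho_def qext_comp[symmetric])
qed

lemma hmt_bd: assumes "ribbon_graph G" "c : CS G (Suc n)"
 shows "qbd (Suc (Suc n)) (spush (hmt (Suc n)) c) + spush (hmt n) (qbd (Suc n) c) = rho G (Suc n) c - c"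
proof -
 have ext: "qbd (Suc (Suc n)) (spush (hmt (Suc n)) c) + spush (hmt n) (qbd (Suc n) c) = rho G (Suc n) c - c"
  if G: "ribbon_graph G" and c: "c : CS G (Suc n)" and
   h: "!!N. N : nerve fat (Suc n) ==> qbd (Suc (Suc n)) (hmt (Suc n) N) =
    rho (last (fst N)) (Suc n) (bas (hat N)) - bas (hat N) - spush (hmt n) (bd (Suc n) (hat N))"
  for G n c
 proof -
  have "qbd (Suc (Suc n)) (spush (hmt (Suc n)) (bas M)) + spush (hmt n) (qbd (Suc n) (bas M)) = rho G (Suc n) (bas M) - bas M"
   if M: "M : NS G (Suc n)" for M
  proof -
   let ?N = "omap fst M" let ?p = "snd (last (fst M))"
   note t = NS_forget[OF M] and L = last_NS[OF M]
   note H = hat_CS[OF t]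
   have Mh: "bas M = qpush ?p (bas (hat ?N))" using hat_push[OF M] by simp
   have p: "?p : Mor (last (fst ?N)) G" using L by simp
   have b: "qbd (Suc n) (bas (hat ?N)) : CS (last (fst ?N)) n" by (rule CS_qbd[rule_format, OF H(2,1)])
   have bb: "bd (Suc n) (hat ?N) = qbd (Suc n) (bas (hat ?N))" by simp
   show ?thesis
    unfolding Mh spush_push[OF H(1)] spush_hat[OF t] qbd_omap spush_push[OF b] h[OF t] rho_push[OF H(2) G p H(1)] qext_diff bb by simp
  qed
  hence "qext (%M. qbd (Suc (Suc n)) (spush (hmt (Suc n)) (bas M)) + spush (hmt n) (qbd (Suc n) (bas M))) c = qext (%M. rho G (Suc n) (bas M) - bas M) c"
   using c by (intro qext_cong) (auto simp: CS_def)
  thus ?thesis by (simp add: qext_fun_diff qext_fun_add spush_def rho_def qext_comp[symmetric])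
 qed
 have "qbd (Suc (Suc n)) (hmt (Suc n) N) = rho (last (fst N)) (Suc n) (bas (hat N)) - bas (hat N) - spush (hmt n) (bd (Suc n) (hat N))"
  if "N : nerve fat (Suc n)" for N n
  using that
 proof (induction n arbitrary: N)
  case 0
  note H = hat_CS[OF 0]
  let ?X = "last (fst N)" let ?b = "bas (hat N)"
  have b: "qbd (Suc 0) ?b : CS ?X 0" by (rule CS_qbd[rule_format, OF H(2,1)])
  have bb: "bd (Suc 0) (hat N) = qbd (Suc 0) ?b" by simp
  have w: "rho ?X (Suc 0) ?b - ?b - spush (hmt 0) (qbd (Suc 0) ?b) : CS ?X (Suc 0)"
   by (intro CS_diff rho_CS H hmt_CS(2) b)
  have "qbd (Suc 0) (rho ?X (Suc 0) ?b - ?b - spush (hmt 0) (qbd (Suc 0) ?b)) = 0"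
   unfolding qext_diff hmt_bd0[OF H(2) b] rho_qbd[rule_format, OF H(2,1)] by simp
  thus ?case unfolding hmt.simps(2)[of 0] bb by (intro cycle_ctr[OF H(2) w])
 next
  case (Suc n)
  note H = hat_CS[OF Suc.prems]
  let ?X = "last (fst N)" let ?b = "bas (hat N)"
  have b: "qbd (Suc (Suc n)) ?b : CS ?X (Suc n)" by (rule CS_qbd[rule_format, OF H(2,1)])
  have bb: "bd (Suc (Suc n)) (hat N) = qbd (Suc (Suc n)) ?b" by simp
  have w: "rho ?X (Suc (Suc n)) ?b - ?b - spush (hmt (Suc n)) (qbd (Suc (Suc n)) ?b) : CS ?X (Suc (Suc n))"
   by (intro CS_diff rho_CS H hmt_CS(2) b)
  have "spush (hmt n) 0 = 0" by (simp add: spush_def)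
  hence "qbd (Suc (Suc n)) (spush (hmt (Suc n)) (qbd (Suc (Suc n)) ?b)) = rho ?X (Suc n) (qbd (Suc (Suc n)) ?b) - qbd (Suc (Suc n)) ?b"
   using ext[OF H(2) b Suc.IH] qbd_qbd[rule_format, OF H(1)] by simp
  hence "qbd (Suc (Suc n)) (rho ?X (Suc (Suc n)) ?b - ?b - spush (hmt (Suc n)) (qbd (Suc (Suc n)) ?b)) = 0"
   unfolding qext_diff rho_qbd[rule_format, OF H(2,1)] by simp
  thus ?case unfolding hmt.simps(2)[of "Suc n"] bb by (intro cycle_ctr[OF H(2) w])
 qed
 thus ?thesis by (rule ext[OF assms])
qed

text \<open>Forgetting the structure maps turns this into a homotopy on the nerve of the whole category.\<close>

definition hty :: "nat => ('h ribbon, 'h mor) simplex => (('h ribbon, 'h mor) simplex \<Rightarrow>\<^sub>0 rat)" where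
 "hty n N = qomap fst (hmt n N)"

lemma forget_spush: "qomap fst (spush (hmt n) c) = qext (hty n) (qomap fst c)"
proof -
 have "qomap fst (spush (hmt n) c) = qext (%M. qomap fst (qpush (snd (last (fst M))) (hmt n (omap fst M)))) c"
  unfolding spush_def by (rule qext_comp)
 also have "... = qext (%M. qext (hty n) (bas (omap fst M))) c" by (simp add: qpush_forget hty_def)
 also have "... = qext (hty n) (qomap fst c)" by (rule qext_comp[symmetric])
 finally show ?thesis .
qed

lemma forget_hat: assumes "N : nerve fat n" shows "qomap fst (bas (hat N)) = bas N"
 by (cases N) (simp add: hat_def omap_def hats_map_fst)

lemma hty_bd:
 assumes "N : nerve fat (Suc n)"
 shows "qbd (Suc (Suc n)) (hty (Suc n) N) + qext (hty n) (bd (Suc n) N) =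
  qomap fst (rho (last (fst N)) (Suc n) (bas (hat N))) - bas N"
proof -
 note H = hat_CS[OF assms]
 have "qbd (Suc (Suc n)) (hty (Suc n) N) + qext (hty n) (qbd (Suc n) (bas N)) =
  qomap fst (qbd (Suc (Suc n)) (spush (hmt (Suc n)) (bas (hat N))) + spush (hmt n) (qbd (Suc n) (bas (hat N))))"
  unfolding qext_add forget_spush qbd_omap[symmetric] forget_hat[OF assms] by simp
 also have "... = qomap fst (rho (last (fst N)) (Suc n) (bas (hat N))) - bas N"
  unfolding hmt_bd[rule_format, OF H(2,1)] qext_diff forget_hat[OF assms] ..
 finally show ?thesis by simp
qed

lemma hty_bd0:
 assumes "N : nerve fat 0"
 shows "qbd (Suc 0) (hty 0 N) = qomap fst (rho (last (fst N)) 0 (bas (hat N))) - bas N"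
proof -
 note H = hat_CS[OF assms]
 have "qbd (Suc 0) (hty 0 N) = qomap fst (qbd (Suc 0) (spush (hmt 0) (bas (hat N))))"
  unfolding forget_spush qbd_omap[symmetric] forget_hat[OF assms] by simp
 also have "... = qomap fst (rho (last (fst N)) 0 (bas (hat N))) - bas N"
  unfolding hmt_bd0[OF H(2,1)] qext_diff forget_hat[OF assms] ..
 finally show ?thesis .
qed

lemma hty_keys: "N : nerve fat n ==> keys (hty n N) <= nerve fat (Suc n)"
 using hmt_CS(1)[of N n] keys_qext[of "%M. bas (omap fst M)" "hmt n N"] NS_forget unfolding hty_def CS_def by fastforce

end

section \<open>Graph homology\<close>

abbreviation UG :: "nat => 'h gelem set" where "UG n \<equiv> carrier (G_up n)"

lemma G_dn_iff: "h : carrier (G_dn n) \<longleftrightarrow>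
  h : hom (G_up n) add_group & h : extensional (UG n) & finite {c : G_gen n ` ographs n. h c ~= 0}"
 by (simp add: G_dn_def integer_group_eq)

lemma G_up_comm: "comm_group (G_up n)" unfolding G_up_def by (rule oiso.comm_group)
lemma G_gen_closed: "x : ographs n ==> G_gen n x : UG n"
 unfolding G_up_def G_gen_def by (rule oiso.gen_closed)
lemma G_gen_cong: "(x, y) : oiso_rel n ==> G_gen n x = G_gen n y"
 unfolding G_gen_def by (rule oiso.gen_cong)

lemma G_dn_eval [simp]: "c : UG n ==> (h \<otimes>\<^bsub>G_dn n\<^esub> k) c = h c + k c" "c : UG n ==> \<one>\<^bsub>G_dn n\<^esub> c = 0"
 by (simp_all add: G_dn_def)

lemma G_dn_comm: "comm_group (G_dn n)"
proof (rule comm_groupI)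
 interpret U: comm_group "G_up n" by (rule G_up_comm)
 fix h k l :: "'a gdual" assume h: "h : carrier (G_dn n)" and k: "k : carrier (G_dn n)" and l: "l : carrier (G_dn n)"
 let ?S = "%h. {c : G_gen n ` ographs n. h c ~= 0}"
 have sub: "G_gen n ` ographs n <= UG n" using G_gen_closed by blast
 show "h \<otimes>\<^bsub>G_dn n\<^esub> k : carrier (G_dn n)"
 proof -
  have "?S (h \<otimes>\<^bsub>G_dn n\<^esub> k) <= ?S h \<union> ?S k" using sub by (auto simp: subset_iff)
  moreover have "finite (?S h \<union> ?S k)" using h k unfolding G_dn_iff by blast
  ultimately have "finite (?S (h \<otimes>\<^bsub>G_dn n\<^esub> k))" by (rule finite_subset)
  moreover have "h \<otimes>\<^bsub>G_dn n\<^esub> k : hom (G_up n) add_group"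
   using h k unfolding G_dn_iff by (auto simp: hom_def)
  moreover have "h \<otimes>\<^bsub>G_dn n\<^esub> k : extensional (UG n)" by (simp add: G_dn_def)
  ultimately show ?thesis unfolding G_dn_iff by blast
 qed
 show "EX k:carrier (G_dn n). k \<otimes>\<^bsub>G_dn n\<^esub> h = \<one>\<^bsub>G_dn n\<^esub>"
 proof
  let ?k = "\<lambda>c\<in>UG n. - h c"
  show "?k \<otimes>\<^bsub>G_dn n\<^esub> h = \<one>\<^bsub>G_dn n\<^esub>" by (auto simp: G_dn_def fun_eq_iff)
  have "?S ?k = ?S h" using sub by (auto simp: subset_iff)
  hence "finite (?S ?k)" using h unfolding G_dn_iff by simp
  moreover have "?k : hom (G_up n) add_group" using h unfolding G_dn_iff by (auto simp: hom_def)
  ultimately show "?k : carrier (G_dn n)" unfolding G_dn_iff by simp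
 qed
 show "h \<otimes>\<^bsub>G_dn n\<^esub> k = k \<otimes>\<^bsub>G_dn n\<^esub> h" by (auto simp: G_dn_def fun_eq_iff)
 show "h \<otimes>\<^bsub>G_dn n\<^esub> k \<otimes>\<^bsub>G_dn n\<^esub> l = h \<otimes>\<^bsub>G_dn n\<^esub> (k \<otimes>\<^bsub>G_dn n\<^esub> l)" by (auto simp: G_dn_def fun_eq_iff)
 show "\<one>\<^bsub>G_dn n\<^esub> \<otimes>\<^bsub>G_dn n\<^esub> h = h" using h by (auto simp: G_dn_def fun_eq_iff extensional_def)
next
 have "\<one>\<^bsub>G_dn n\<^esub> : hom (G_up n) add_group" by (auto simp: hom_def G_dn_def comm_groupE(1)[OF G_up_comm])
 moreover have e: "{c : G_gen n ` ographs n. \<one>\<^bsub>G_dn n\<^esub> c ~= 0} = {}" by (auto simp: G_gen_closed)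
 moreover have "finite {c : G_gen n ` ographs n. \<one>\<^bsub>G_dn n\<^esub> c ~= 0}" unfolding e by simp
 moreover have "\<one>\<^bsub>G_dn n\<^esub> : extensional (UG n)" by (simp add: G_dn_def)
 ultimately show "\<one>\<^bsub>G_dn n\<^esub> : carrier (G_dn n)" unfolding G_dn_iff by blast
qed

interpretation Gd: comm_group "G_dn n" for n by (rule G_dn_comm)

lemma eval_hom: "c : UG n ==> (%h. h c) : hom (G_dn n) add_group"
 by (auto simp: hom_def)

lemma hom_nat_pow_add:
 assumes "group A" "h : hom A add_group" "a : carrier A"
 shows "h (a [^]\<^bsub>A\<^esub> (N::nat)) = of_nat N * (h a :: 'b::comm_ring_1)"
proof -
 interpret A: group A by fact
 interpret h: group_hom A add_group h using assms group_add_group by (simp add: group_hom_def group_hom_axioms_def)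
 show ?thesis by (induction N) (use assms(3) in \<open>auto simp: algebra_simps\<close>)
qed

lemma G_dn_pow: "h : carrier (G_dn n) ==> c : UG n ==> (h [^]\<^bsub>G_dn n\<^esub> (N::nat)) c = int N * h c"
 using hom_nat_pow_add[OF Gd.is_group eval_hom, of c n h N] by simp

lemma G_dn_inv: fixes h :: "'h gdual" assumes h: "h : carrier (G_dn n)" shows "inv\<^bsub>G_dn n\<^esub> h = (\<lambda>c\<in>UG n. - h c)"
proof (rule extensionalityI)
 show "inv\<^bsub>G_dn n\<^esub> h : extensional (UG n)" using Gd.inv_closed[OF h] unfolding G_dn_iff by blast
 fix c :: "'h gelem" assume c: "c : UG n"
 have "(inv\<^bsub>G_dn n\<^esub> h \<otimes>\<^bsub>G_dn n\<^esub> h) c = 0" using Gd.l_inv[OF h] c by simp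
 thus "(inv\<^bsub>G_dn n\<^esub> h) c = (\<lambda>c\<in>UG n. - h c) c" using c by simp
qed simp

lemma G_dn_finprod:
 assumes "f : A \<rightarrow> carrier (G_dn n)" "c : UG n" shows "(finprod (G_dn n) f A) c = (SUM a:A. f a c)"
 using hom_finprod[OF G_dn_comm comm_group_add_group eval_hom[OF assms(2)] assms(1)] by (simp add: finprod_add_group)

lemma G_dn_eqI: "h : carrier (G_dn n) ==> k : carrier (G_dn n) ==> (!!c. c : UG n ==> h c = k c) ==> h = k"
 unfolding G_dn_iff by (meson extensionalityI)

lemma G_dn_eqI_gen:
 fixes h k :: "'h gdual"
 assumes "h : carrier (G_dn n)" "k : carrier (G_dn n)" "!!x. x : ographs n ==> h (G_gen n x) = k (G_gen n x)"
 shows "h = k"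
proof (rule G_dn_eqI[OF assms(1,2)])
 fix c :: "'h gelem" assume c: "c : UG n"
 show "h c = k c"
  by (rule oiso.hom_eq[OF group_add_group, of h n k c]) (use assms c in \<open>auto simp: G_dn_iff G_up_def G_gen_def\<close>)
qed

lemma oiso_rel_rev: "(x, y) : oiso_rel n ==> (orev x, orev y) : oiso_rel n"
 using oriented_iso_orev[OF ographD(1)] orev_ographs unfolding oiso_rel_def by blast

lemma oiso_sym: "(x, y) : oiso_rel n ==> (y, x) : oiso_rel n"
 and oiso_trans: "(x, y) : oiso_rel n ==> (y, z) : oiso_rel n ==> (x, z) : oiso_rel n"
 and oiso_refl: "x : ographs n ==> (x, x) : oiso_rel n"
 using equiv_oiso_rel[of n] by (auto simp: equiv_def elim: symE transE dest: refl_onD)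

lemma oiso_dom: "(x, y) : oiso_rel n ==> x : ographs n & y : ographs n" by (auto simp: oiso_rel_def)

lemma oiso_rev_swap: "x : ographs n ==> y : ographs n ==> (orev x, y) : oiso_rel n \<longleftrightarrow> (x, orev y) : oiso_rel n"
 using oiso_rel_rev[of "orev x" y n] oiso_rel_rev[of x "orev y" n] by (auto dest: ographD(1))

definition dualval :: "nat => 'h ograph => 'h ograph => int" where
 "dualval n x y = (if (x, orev x) : oiso_rel n then 0 else if (x, y) : oiso_rel n then 1
  else if (orev x, y) : oiso_rel n then - 1 else 0)"

lemma G_dual_spec:
 assumes x: "x : ographs n"
 shows "G_dual x : carrier (G_dn n)" "!!y. y : ographs n ==> G_dual x (G_gen n y) = dualval n x y"
proof -
 have cn: "codim (fst x) = n" using x by (simp add: ographs_iff)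
 let ?P = "%h. h : carrier (G_dn n) & (ALL y:ographs n. h (G_gen n y) = dualval n x y)"
 have ex: "EX h. ?P h"
 proof (cases "(x, orev x) : oiso_rel n")
  case True
  hence "?P \<one>\<^bsub>G_dn n\<^esub>" by (simp add: dualval_def G_gen_closed)
  thus ?thesis by blast
 next
  case False
  hence nr: "(orev x, x) ~: oiso_rel n" using oiso_sym by blast
  have "EX h :: 'a gdual. h : hom (G_up n) add_group & (ALL y:ographs n. h (G_gen n y) = dualval n x y)"
  proof (rule oiso.delta_exists[where 'c = int and z = x and n = n])
   show "(orev x, orev y) : oiso_rel n" if "(x, y) : oiso_rel n" for x y :: "'a ograph" by (rule oiso_rel_rev[OF that])
   show "orev (orev x) = x" if "x : ographs n" for x :: "'a ograph" using orev_orev[OF ographD(1)[OF that]] .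
   fix h :: "'a gdual"
   assume h: "h : hom (antisym_group (ographs n) (oiso_rel n) orev) add_group"
    "!!y. y : ographs n ==> h (antisym_gen (ographs n) (oiso_rel n) orev y) =
    (if (y, x) : oiso_rel n then 1 else if (orev y, x) : oiso_rel n then - 1 else 0)"
   have "h (G_gen n y) = dualval n x y" if y: "y : ographs n" for y
   proof -
    have "(y, x) : oiso_rel n \<longleftrightarrow> (x, y) : oiso_rel n" "(orev y, x) : oiso_rel n \<longleftrightarrow> (orev x, y) : oiso_rel n"
    using oiso_sym oiso_rev_swap[OF x y] by blast+
    thus ?thesis using h(2)[OF y] False by (simp add: G_gen_def dualval_def)
   qed
   thus ?thesis using h(1) unfolding G_up_def by blast
  qed (use x nr in auto)
  then obtain h :: "'a gdual" where h: "h : hom (G_up n) add_group" "ALL y:ographs n. h (G_gen n y) = dualval n x y" by blast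
  let ?k = "restrict h (UG n)"
  have k: "?k (G_gen n y) = dualval n x y" if "y : ographs n" for y using h(2) that G_gen_closed[OF that] by simp
  have "{c : G_gen n ` ographs n. ?k c ~= 0} <= {G_gen n x, G_gen n (orev x)}"
  proof
   fix c assume "c : {c : G_gen n ` ographs n. ?k c ~= 0}"
   then obtain y where y: "y : ographs n" "c = G_gen n y" "dualval n x y ~= 0" using k by auto
   hence "(x, y) : oiso_rel n \<or> (orev x, y) : oiso_rel n" by (auto simp: dualval_def split: if_splits)
   thus "c : {G_gen n x, G_gen n (orev x)}" using G_gen_cong y(2) by blast
  qed
  hence "finite {c : G_gen n ` ographs n. ?k c ~= 0}" by (rule finite_subset) simp
  moreover interpret U: comm_group "G_up n" by (rule G_up_comm)
  have "?k : hom (G_up n) add_group" using h(1) by (auto simp: hom_def)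
  ultimately have "?P ?k" using k unfolding G_dn_iff by simp
  thus ?thesis by blast
 qed
 have "G_dual x = (THE h. ?P h)" by (simp add: G_dual_def cn dualval_def[abs_def] Let_def)
 moreover have "?P (THE h. ?P h)"
  using theI'[of ?P] ex G_dn_eqI_gen by (metis (no_types, lifting))
 ultimately show "G_dual x : carrier (G_dn n)" "!!y. y : ographs n ==> G_dual x (G_gen n y) = dualval n x y" by auto
qed

lemma finite_Aut_set: "ribbon_graph G ==> finite (Aut G)" unfolding Aut_def by (rule finite_Aut)

lemma card_Aut_pos: "ribbon_graph G ==> card (Aut G) > 0"
 using finite_Aut_set ribbon_iso_refl by (auto simp: card_gt_0_iff Aut_def)

lemma card_Aut_iso:
 assumes G: "ribbon_graph G" "ribbon_graph G'" and A: "ribbon_iso G A G'"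
 shows "card (Aut G') = card (Aut G)"
proof -
 have le: "card (Aut G) \<le> card (Aut G')" if G: "ribbon_graph G" "ribbon_graph G'" and A: "ribbon_iso G A G'" for G G' :: "'a ribbon" and A
 proof (rule card_inj_on_le[of "%f. A o_m (f o_m minv A)"])
  note inv = ribbon_iso_inv[OF G A]
  show "(%f. A o_m (f o_m minv A)) ` Aut G <= Aut G'"
   using ribbon_iso_comp[OF ribbon_iso_comp[OF inv] A] by (auto simp: Aut_def)
  show "inj_on (%f. A o_m (f o_m minv A)) (Aut G)"
  proof (rule inj_on_inverseI[of _ "%g. minv A o_m (g o_m A)"])
   fix f assume "f : Aut G"
   hence f: "ribbon_iso G f G" by (simp add: Aut_def)
   have a: "minv A o_m A = idm G" using minv_comp[OF ribbon_isoD(3)[OF A]] ribbon_isoD(1)[OF A] by simp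
   have "minv A o_m ((A o_m (f o_m minv A)) o_m A) = (minv A o_m A) o_m (f o_m (minv A o_m A))"
    by (simp add: map_comp_assoc)
   also have "... = f" unfolding a using ribbon_isoD(1,2)[OF f] by (simp add: comp_idm idm_comp)
   finally show "minv A o_m ((A o_m (f o_m minv A)) o_m A) = f" .
  qed
 qed (rule finite_Aut_set[OF G(2)])
 show ?thesis using le[OF assms] le[OF G(2,1) ribbon_iso_inv[OF assms]] by simp
qed

lemma oiso_card: "(x, y) : oiso_rel n ==> card (Aut (fst y)) = card (Aut (fst x))"
 unfolding oiso_rel_def using card_Aut_iso[OF ographD(2) ographD(2) oriented_isoD] by blast

lemma bracket_spec:
 assumes x: "x : ographs n"
 shows "bracket x : carrier (G_dn n)" "y : ographs n ==> bracket x (G_gen n y) = int (card (Aut (fst x))) * dualval n x y"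
proof -
 have b: "bracket x = G_dual x [^]\<^bsub>G_dn n\<^esub> card (Aut (fst x))" using x by (simp add: bracket_def ographs_iff)
 show "bracket x : carrier (G_dn n)" unfolding b by (intro Gd.nat_pow_closed G_dual_spec x)
 show "y : ographs n ==> bracket x (G_gen n y) = int (card (Aut (fst x))) * dualval n x y"
  unfolding b using G_dn_pow[OF G_dual_spec(1)[OF x] G_gen_closed] G_dual_spec(2)[OF x] by simp
qed

lemma bracket_cong:
 assumes "(x, y) : oiso_rel n" shows "bracket x = bracket y"
proof -
 have x: "x : ographs n" "y : ographs n" using oiso_dom[OF assms] by auto
 note s = oiso_sym[OF assms]
 have r: "(orev x, orev y) : oiso_rel n" "(orev y, orev x) : oiso_rel n" using oiso_rel_rev[OF assms] oiso_rel_rev[OF s] .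
 have "dualval n x w = dualval n y w" for w
 proof -
  have "(x, orev x) : oiso_rel n \<longleftrightarrow> (y, orev y) : oiso_rel n" using assms s r oiso_trans by meson
  moreover have "(x, w) : oiso_rel n \<longleftrightarrow> (y, w) : oiso_rel n" using assms s oiso_trans by meson
  moreover have "(orev x, w) : oiso_rel n \<longleftrightarrow> (orev y, w) : oiso_rel n" using r oiso_trans by meson
  ultimately show ?thesis by (simp add: dualval_def)
 qed
 thus ?thesis using oiso_card[OF assms] x by (intro G_dn_eqI_gen[of _ n] bracket_spec) (auto simp: bracket_spec(2))
qed

lemma bracket_orev:
 fixes x :: "'h ograph"
 assumes x: "x : ographs n" shows "bracket (orev x) = inv\<^bsub>G_dn n\<^esub> (bracket x)"
proof (rule G_dn_eqI_gen[of _ n])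
 note r = orev_ographs[OF x] and xx = orev_orev[OF ographD(1)[OF x]]
 show "bracket (orev x) : carrier (G_dn n)" by (rule bracket_spec[OF r])
 show "inv\<^bsub>G_dn n\<^esub> (bracket x) : carrier (G_dn n)" by (intro Gd.inv_closed bracket_spec x)
 fix y :: "'h ograph" assume y: "y : ographs n"
 have s: "(orev x, x) : oiso_rel n \<longleftrightarrow> (x, orev x) : oiso_rel n" using oiso_sym by blast
 have "\<not> ((x, y) : oiso_rel n & (orev x, y) : oiso_rel n)" if "(x, orev x) ~: oiso_rel n"
  using oiso_trans[OF _ oiso_sym] that by blast
 hence "dualval n (orev x) y = - dualval n x y" unfolding dualval_def xx s by auto
 thus "bracket (orev x) (G_gen n y) = (inv\<^bsub>G_dn n\<^esub> (bracket x)) (G_gen n y)"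
  using bracket_spec[OF x] bracket_spec(2)[OF r y] y G_gen_closed[OF y] by (simp add: G_dn_inv)
qed

subsection \<open>The subcomplex of multiples of the orders of automorphism groups\<close>

lemma GZ_sub: "subgroup (carrier (GZ n)) (G_dn n)"
 unfolding GZ_def by (simp, rule Gd.generate_is_subgroup) (auto intro: bracket_spec(1))

lemma GZ_simps [simp]: "\<one>\<^bsub>GZ n\<^esub> = \<one>\<^bsub>G_dn n\<^esub>" "h \<otimes>\<^bsub>GZ n\<^esub> k = h \<otimes>\<^bsub>G_dn n\<^esub> k" by (simp_all add: GZ_def)

lemma GZ_eq: "GZ n = (G_dn n)\<lparr>carrier := carrier (GZ n)\<rparr>" by (simp add: GZ_def)

lemma GZ_comm: "comm_group (GZ n)"
proof -
 interpret Z: group "GZ n" by (subst GZ_eq) (rule subgroup.subgroup_is_group[OF GZ_sub Gd.is_group])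
 show ?thesis
  by (rule Z.group_comm_groupI) (simp add: Gd.m_comm subgroup.mem_carrier[OF GZ_sub])
qed

lemma GZ_G: "h : carrier (GZ n) ==> h : carrier (G_dn n)" using subgroup.mem_carrier[OF GZ_sub] .

lemma GZ_inv: "h : carrier (GZ n) ==> inv\<^bsub>GZ n\<^esub> h = inv\<^bsub>G_dn n\<^esub> h"
 by (subst GZ_eq) (rule Gd.m_inv_consistent[OF GZ_sub])

lemma bracket_GZ: "x : ographs n ==> bracket x : carrier (GZ n)" by (auto simp: GZ_def intro: generate.incl)

lemma GZ_induct [consumes 1, case_names one bracket inv mult]:
 fixes h :: "'h gdual"
 assumes "h : carrier (GZ n)" and "P \<one>\<^bsub>G_dn n\<^esub>" and "!!x. x : ographs n ==> P (bracket x)"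
  and "!!h. h : carrier (GZ n) ==> P h ==> P (inv\<^bsub>G_dn n\<^esub> h)"
  and "!!h k. h : carrier (GZ n) ==> k : carrier (GZ n) ==> P h ==> P k ==> P (h \<otimes>\<^bsub>G_dn n\<^esub> k)"
 shows "P h"
proof -
 have c: "carrier (GZ n) = generate (G_dn n) (bracket ` (ographs n :: 'h ograph set))" by (simp add: GZ_def)
 have "h : generate (G_dn n) (bracket ` ographs n)" using assms(1) c by simp
 thus ?thesis
 proof (induction rule: generate.induct)
  case one show ?case by (rule assms(2))
 next
  case (incl h) thus ?case using assms(3) by blast
 next
  case (inv h) thus ?case using assms(3,4) bracket_GZ by blast
 next
  case (eng h k) thus ?case using assms(5) c by blast
 qed
qed

lemma GZ_pow_simp: "h [^]\<^bsub>GZ n\<^esub> (N::nat) = h [^]\<^bsub>G_dn n\<^esub> N"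
 by (simp add: nat_pow_def GZ_def)

lemma F_proj_spec:
 shows "F_proj G k : hom (F_grp G k) (GZ k)"
  and "!!z. z : overgraphs G k ==> F_proj G k (F_gen G k z) = bracket (fst z)"
proof -
 have z: "fst z : ographs k" if "z : overgraphs G k" for z :: "'a overgraph" using that by (auto simp: overgraphs_def)
 have c: "bracket (fst z) = bracket (fst w)" if "(z, w) : over_rel G k" for z w :: "'a overgraph"
  by (rule bracket_cong[of _ _ k]) (use that in \<open>auto simp: over_rel_def oiso_rel_def overgraphs_iff\<close>)
 have r: "bracket (fst (over_rev z)) = inv\<^bsub>GZ k\<^esub> (bracket (fst z))" if "z : overgraphs G k" for z :: "'a overgraph"
  using bracket_orev[OF z[OF that]] GZ_inv[OF bracket_GZ[OF z[OF that]]] by (simp add: over_rev_def case_prod_unfold)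
 note h = F_hom_on[where v = "%z. bracket (fst z)" and G = G and k = k, OF GZ_comm bracket_GZ[OF z] c r]
 have d: "F_proj G k = hom_on (F_grp G k) (GZ k) (overgraphs G k) (F_gen G k) (%z. bracket (fst z))"
  by (simp add: F_proj_def case_prod_unfold)
 show "F_proj G k : hom (F_grp G k) (GZ k)" unfolding d by (rule h(1))
 show "F_proj G k (F_gen G k z) = bracket (fst z)" if "z : overgraphs G k" for z unfolding d by (rule h(2)) (use that in auto)
qed

text \<open>
 Induction on the support: after multiplication by the order of the automorphism group, a multiple of \<open>\<langle>x\<rangle>\<close> can be
 subtracted so that the value at \<open>x\<close> becomes 0.
\<close>

lemma multiple_in_GZ:
 fixes h :: "'h gdual"
 assumes "h : carrier (G_dn n)" shows "EX M::nat. M > 0 & h [^]\<^bsub>G_dn n\<^esub> M : carrier (GZ n)"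
 using assms
proof (induction "card {c : G_gen n ` ographs n. h c ~= 0}" arbitrary: h rule: less_induct)
 case less
 let ?S = "%h. {c : G_gen n ` ographs n. h c ~= 0}"
 interpret S: subgroup "carrier (GZ n)" "G_dn n" by (rule GZ_sub)
 have fin: "finite (?S h)" using less.prems unfolding G_dn_iff by blast
 show ?case
 proof (cases "?S h = {}")
  case True
  hence "h = \<one>\<^bsub>G_dn n\<^esub>"
   by (intro G_dn_eqI_gen[of _ n] less.prems) (auto simp: G_gen_closed)
  thus ?thesis by (intro exI[of _ 1]) auto
 next
  case False
  then obtain x where x: "x : ographs n" "h (G_gen n x) ~= 0" by auto
  let ?N = "card (Aut (fst x))" and ?m = "h (G_gen n x)"
  let ?k = "h [^]\<^bsub>G_dn n\<^esub> ?N \<otimes>\<^bsub>G_dn n\<^esub> bracket x [^]\<^bsub>G_dn n\<^esub> (- ?m)"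
  have N: "?N > 0" by (rule card_Aut_pos[OF ographD(2)[OF x(1)]])
  note b = bracket_spec[OF x(1)]
  have ip: "(bracket x [^]\<^bsub>G_dn n\<^esub> (z::int)) c = z * bracket x c" if c: "c : UG n" for c z
  proof (cases z)
   case (nonneg i) thus ?thesis using G_dn_pow[OF b(1) c, of i] by (simp add: int_pow_int)
  next
   case (neg i)
   hence "bracket x [^]\<^bsub>G_dn n\<^esub> z = inv\<^bsub>G_dn n\<^esub> (bracket x [^]\<^bsub>G_dn n\<^esub> (Suc i))"
    using Gd.int_pow_neg_int[OF b(1), of "Suc i"] by simp
   hence "(bracket x [^]\<^bsub>G_dn n\<^esub> z) c = - ((bracket x [^]\<^bsub>G_dn n\<^esub> (Suc i)) c)"
    using G_dn_inv[OF Gd.nat_pow_closed[OF b(1), of "Suc i"]] c by (simp del: nat_pow_Suc)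
   thus ?thesis unfolding G_dn_pow[OF b(1) c] neg by (simp add: algebra_simps)
  qed
  have kc: "?k : carrier (G_dn n)" using less.prems b by simp
  have kv: "?k c = int ?N * h c - ?m * bracket x c" if c: "c : UG n" for c
   using ip[OF c, of "- ?m"] G_dn_pow[OF less.prems c, of ?N] c by simp
  have hr: "h (G_gen n (orev y)) = - h (G_gen n y)" if "y : ographs n" for y
  proof -
   interpret hh: group_hom "G_up n" add_group h
    using less.prems unfolding G_dn_iff
    by (simp add: group_hom_def group_hom_axioms_def G_up_comm[THEN comm_group.axioms(2)] group_add_group)
   have "G_gen n (orev y) = inv\<^bsub>G_up n\<^esub> G_gen n y" unfolding G_gen_def G_up_def by (rule oiso.gen_rv[OF that])
   thus ?thesis using G_gen_closed[OF that] by simp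
  qed
  have nr: "(x, orev x) ~: oiso_rel n" using G_gen_cong hr[OF x(1)] x(2) by fastforce
  have "?k (G_gen n x) = 0" using kv[OF G_gen_closed[OF x(1)]] b(2)[OF x(1)] nr oiso_refl[OF x(1)] by (simp add: dualval_def)
  moreover have "?k (G_gen n y) = 0" if y: "y : ographs n" "h (G_gen n y) = 0" for y
  proof -
   have "(x, y) ~: oiso_rel n" "(orev x, y) ~: oiso_rel n" using G_gen_cong[of x y n] G_gen_cong[of "orev x" y n] x y hr[OF x(1)] by auto
   thus ?thesis using kv[OF G_gen_closed[OF y(1)]] b(2)[OF y(1)] y(2) by (simp add: dualval_def)
  qed
  ultimately have "?S ?k \<subset> ?S h" using x by blast
  hence "card (?S ?k) < card (?S h)" by (rule psubset_card_mono[OF fin])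
  from less.hyps[OF this kc] obtain M :: nat where M: "M > 0" "?k [^]\<^bsub>G_dn n\<^esub> M : carrier (GZ n)" by blast
  have "bracket x [^]\<^bsub>G_dn n\<^esub> (int M * ?m) : carrier (GZ n)"
   using Gd.subgroup_int_pow_closed[OF GZ_sub bracket_GZ[OF x(1)]] .
  with M(2) have "?k [^]\<^bsub>G_dn n\<^esub> M \<otimes>\<^bsub>G_dn n\<^esub> bracket x [^]\<^bsub>G_dn n\<^esub> (int M * ?m) : carrier (GZ n)" by (rule S.m_closed)
  also have "?k [^]\<^bsub>G_dn n\<^esub> M \<otimes>\<^bsub>G_dn n\<^esub> bracket x [^]\<^bsub>G_dn n\<^esub> (int M * ?m) = h [^]\<^bsub>G_dn n\<^esub> (M * ?N)"
  proof (rule G_dn_eqI)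
   fix c :: "'h gelem" assume c: "c : UG n"
   have "(?k [^]\<^bsub>G_dn n\<^esub> M) c = int M * (int ?N * h c - ?m * bracket x c)" using G_dn_pow[OF kc c, of M] kv[OF c] by simp
   thus "(?k [^]\<^bsub>G_dn n\<^esub> M \<otimes>\<^bsub>G_dn n\<^esub> bracket x [^]\<^bsub>G_dn n\<^esub> (int M * ?m)) c = (h [^]\<^bsub>G_dn n\<^esub> (M * ?N)) c"
    using ip[OF c, of "int M * ?m"] G_dn_pow[OF less.prems c, of "M * ?N"] c by (simp add: algebra_simps)
  qed (use kc b less.prems in auto)
  finally show ?thesis using M(1) N by (intro exI[of _ "M * ?N"]) auto
 qed
qed

subsection \<open>From graph homology to chains on the nerve\<close>

definition fcyc :: "nat => 'h ograph => (('h ribbon, 'h mor) simplex \<Rightarrow>\<^sub>0 rat)" where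
 "fcyc n x = qomap fst (cyc n x)"

lemma fcyc_cong: assumes "(x, y) : oiso_rel n" shows "fcyc n x = fcyc n y"
proof -
 obtain A where a: "x : ographs n" "y : ographs n" "oriented_iso x A y" using assms by (auto simp: oiso_rel_def)
 have "fcyc n y = qomap fst (qpush A (cyc n x))" unfolding fcyc_def cyc_props(3)[OF a] ..
 thus ?thesis unfolding qpush_forget fcyc_def by simp
qed

lemma fcyc_orev: "x : ographs n ==> fcyc n (orev x) = - fcyc n x"
 by (simp add: fcyc_def cyc_props(2) qext_uminus)

lemma fcyc_keys: assumes "x : ographs n" shows "keys (fcyc n x) <= nerve fat n"
 using cyc_props(1)[OF assms] keys_qext[of "%M. bas (omap fst M)" "cyc n x"] NS_forget unfolding fcyc_def CS_def by fastforce

text \<open>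
 In the sum over generators both a class and its negative occur, with equal contributions; hence the factor
 \<open>1/2\<close>. The division by the order of the automorphism group makes the class \<open>\<langle>x\<rangle>\<close> correspond to the cycle of
 \<open>x\<close> itself.
\<close>

definition chosen :: "nat => 'h gelem => 'h ograph" where
 "chosen n c = (SOME x. x : ographs n & G_gen n x = c)"

lemma chosen: "c : G_gen n ` ographs n ==> chosen n c : ographs n & G_gen n (chosen n c) = c"
 unfolding chosen_def by (rule someI_ex) auto

definition psi :: "nat => 'h gdual => (('h ribbon, 'h mor) simplex \<Rightarrow>\<^sub>0 rat)" where
 "psi n h = qs (1 / 2) (SUM c:{c : G_gen n ` ographs n. h c ~= 0}.
  qs (of_int (h c) / of_nat (card (Aut (fst (chosen n c))))) (fcyc n (chosen n c)))"

lemma psi_superset: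
 assumes "finite A" "{c : G_gen n ` ographs n. h c ~= 0} <= A" "A <= G_gen n ` ographs n"
 shows "psi n h = qs (1 / 2) (SUM c:A. qs (of_int (h c) / of_nat (card (Aut (fst (chosen n c))))) (fcyc n (chosen n c)))"
 unfolding psi_def by (rule arg_cong[of _ _ "qs (1/2)"], rule sum.mono_neutral_left) (use assms in auto)

lemma psi_hom: "psi n : hom (G_dn n) add_group"
proof -
 have "psi n (h \<otimes>\<^bsub>G_dn n\<^esub> k) = psi n h + psi n k" if h: "h : carrier (G_dn n)" "k : carrier (G_dn n)" for h k :: "'a gdual"
 proof -
  let ?S = "%h. {c : G_gen n ` ographs n. h c ~= 0}"
  let ?A = "?S h \<union> ?S k"
  have A: "finite ?A" "?A <= G_gen n ` ographs n" using h unfolding G_dn_iff by blast+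
  have ev: "(h \<otimes>\<^bsub>G_dn n\<^esub> k) c = h c + k c" if "c : G_gen n ` ographs n" for c using that by (auto simp: G_gen_closed)
  have "psi n (h \<otimes>\<^bsub>G_dn n\<^esub> k) = qs (1 / 2) (SUM c:?A. qs (of_int ((h \<otimes>\<^bsub>G_dn n\<^esub> k) c) / of_nat (card (Aut (fst (chosen n c))))) (fcyc n (chosen n c)))"
   by (rule psi_superset[OF A(1) _ A(2)]) (auto simp: ev)
  also have "... = qs (1 / 2) (SUM c:?A. qs (of_int (h c) / of_nat (card (Aut (fst (chosen n c))))) (fcyc n (chosen n c)) +
    qs (of_int (k c) / of_nat (card (Aut (fst (chosen n c))))) (fcyc n (chosen n c)))"
   by (rule arg_cong[of _ _ "qs (1/2)"], rule sum.cong) (auto simp: ev add_divide_distrib qs_add_left)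
  also have "... = psi n h + psi n k"
   unfolding sum.distrib qs_add using psi_superset[OF A(1) _ A(2), of h] psi_superset[OF A(1) _ A(2), of k] by auto
  finally show ?thesis .
 qed
 thus ?thesis by (auto simp: hom_def)
qed

lemma psi_GZ: "psi n : hom (GZ n) add_group" using psi_hom[of n] GZ_G by (auto simp: hom_def)

lemma psi_group_hom: "group_hom (G_dn n) add_group (psi n)"
 by (simp add: group_hom_def group_hom_axioms_def psi_hom Gd.is_group group_add_group)

lemma psi_inv: "h : carrier (G_dn n) ==> psi n (inv\<^bsub>G_dn n\<^esub> h) = - psi n h"
 using group_hom.hom_inv[OF psi_group_hom] by simp

lemma psi_one: "psi n \<one>\<^bsub>G_dn n\<^esub> = 0"
 using group_hom.hom_one[OF psi_group_hom] by simp

text \<open>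
 If \<open>x\<close> has an automorphism that reverses the orientation, then its cycle is its own negative, so both sides
 vanish. Otherwise the two generators \<open>x\<close> and its reversal contribute one half each.
\<close>

lemma psi_bracket: assumes x: "x : ographs n" shows "psi n (bracket x) = fcyc n x"
proof (cases "(x, orev x) : oiso_rel n")
 case True
 have e: "{c : G_gen n ` ographs n. bracket x c ~= 0} = {}" using True by (auto simp: bracket_spec[OF x] dualval_def)
 have "fcyc n x = - fcyc n x" using fcyc_cong[OF True] fcyc_orev[OF x] by simp
 hence "fcyc n x = 0" by (rule eq_uminus_qs)
 thus ?thesis unfolding psi_def e by simp
next
 case False
 let ?N = "card (Aut (fst x))" and ?c = "G_gen n x" and ?d = "G_gen n (orev x)"
 note r = orev_ographs[OF x]
 have N: "?N > 0" by (rule card_Aut_pos[OF ographD(2)[OF x]])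
 have nr: "(x, orev x) ~: oiso_rel n" by (rule False)
 have vc: "bracket x ?c = int ?N" using bracket_spec(2)[OF x x] nr oiso_refl[OF x] by (simp add: dualval_def)
 have vd: "bracket x ?d = - int ?N" using bracket_spec(2)[OF x r] nr oiso_refl[OF r] by (simp add: dualval_def)
 have cd: "?c ~= ?d" using vc vd N by auto
 have S: "{c : G_gen n ` ographs n. bracket x c ~= 0} <= {?c, ?d}"
 proof
  fix c assume "c : {c : G_gen n ` ographs n. bracket x c ~= 0}"
  then obtain y where y: "y : ographs n" "c = G_gen n y" "dualval n x y ~= 0" using bracket_spec(2)[OF x] by auto
  hence "(x, y) : oiso_rel n \<or> (orev x, y) : oiso_rel n" by (auto simp: dualval_def split: if_splits)
  thus "c : {?c, ?d}" using G_gen_cong y(2) by blast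
 qed
 have rel: "(x, y) : oiso_rel n" if "y : ographs n" "bracket x (G_gen n y) = int ?N" for y
 proof -
  have "dualval n x y = 1" using that(2) bracket_spec(2)[OF x that(1)] N by simp
  thus ?thesis by (auto simp: dualval_def split: if_splits)
 qed
 have rel': "(orev x, y) : oiso_rel n" if "y : ographs n" "bracket x (G_gen n y) = - int ?N" for y
 proof -
  have "int ?N * dualval n x y = int ?N * (- 1)" using that(2) bracket_spec(2)[OF x that(1)] by simp
  hence "dualval n x y = - 1" using N by (simp only: mult_cancel_left) simp
  thus ?thesis by (auto simp: dualval_def split: if_splits)
 qed
 have c: "chosen n ?c : ographs n" "G_gen n (chosen n ?c) = ?c" using chosen[of ?c n] x by auto
 have d: "chosen n ?d : ographs n" "G_gen n (chosen n ?d) = ?d" using chosen[of ?d n] r by auto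
 have rc: "(x, chosen n ?c) : oiso_rel n" by (rule rel[OF c(1)]) (simp only: c(2) vc)
 have rd: "(orev x, chosen n ?d) : oiso_rel n" by (rule rel'[OF d(1)]) (simp only: d(2) vd)
 have "psi n (bracket x) = qs (1 / 2) (SUM c:{?c, ?d}. qs (of_int (bracket x c) / of_nat (card (Aut (fst (chosen n c))))) (fcyc n (chosen n c)))"
  by (rule psi_superset[OF _ S]) (use x r in auto)
 also have "... = qs (1 / 2) (qs (of_int (bracket x ?c) / of_nat (card (Aut (fst (chosen n ?c))))) (fcyc n (chosen n ?c)) +
   qs (of_int (bracket x ?d) / of_nat (card (Aut (fst (chosen n ?d))))) (fcyc n (chosen n ?d)))"
  using cd by simp
 also have "... = qs (1 / 2) (fcyc n x + fcyc n x)"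
  unfolding vc vd oiso_card[OF rc] oiso_card[OF rd] fcyc_cong[OF rc, symmetric] fcyc_cong[OF rd, symmetric] fcyc_orev[OF x]
  using N by (simp add: qs_uminus)
 also have "... = fcyc n x" by (intro poly_mapping_eqI) (simp add: lookup_add)
 finally show ?thesis .
qed

lemma psi_keys: "keys (psi n h) <= nerve fat n"
proof -
 have "keys (SUM c:A. qs (f c) (fcyc n (chosen n c))) <= nerve fat n" if "A <= G_gen n ` ographs n" for A f
  using that
 proof (induction A rule: infinite_finite_induct)
  case (insert a A)
  hence "keys (qs (f a) (fcyc n (chosen n a))) <= nerve fat n"
   using keys_qs[of "f a" "fcyc n (chosen n a)"] fcyc_keys[of "chosen n a" n] chosen[of a n] by blast
  thus ?case using insert keys_add[of "qs (f a) (fcyc n (chosen n a))" "SUM c:A. qs (f c) (fcyc n (chosen n c))"] by auto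
 qed auto
 thus ?thesis unfolding psi_def by (rule order_trans[OF keys_qs]) auto
qed

subsection \<open>Comparison with the given chain map\<close>

lemma GZ_complex_simps [simp]: "Grp GZ_complex = GZ" "Dif GZ_complex = Dif G_complex" by (simp_all add: GZ_complex_def)

lemma Dif_G: "Dif G_complex n h = (\<lambda>c\<in>UG n. h (G_bd n c))" by (simp add: G_complex_def)

lemma keys_qbd_fat:
 assumes k: "keys x <= nerve fat (Suc n)" shows "keys (qbd (Suc n) x) <= nerve fat n"
proof -
 have "keys (qbd (Suc n) x) <= (UN s:keys x. keys (bd (Suc n) s))" by (rule keys_qext)
 also have "... <= nerve fat n"
 proof (rule UN_least)
  fix s assume "s : keys x"
  hence s: "s : nerve fat (Suc n)" using k by auto
  have "keys (SUM i:A. qs ((- 1) ^ i) (bas (mf i s))) <= nerve fat n" if "A <= {..Suc n}" for A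
   using that
  proof (induction A rule: infinite_finite_induct)
   case (insert a A)
   hence "keys (qs ((- 1) ^ a) (bas (mf a s))) <= nerve fat n"
    using keys_qs[of "(- 1) ^ a" "bas (mf a s)"] mf_fat[OF s, of a] by auto
   thus ?case using insert keys_add[of "qs ((- 1) ^ a) (bas (mf a s))" "SUM i:A. qs ((- 1) ^ i) (bas (mf i s))"] by auto
  qed auto
  thus "keys (bd (Suc n) s) <= nerve fat n" unfolding bd_def by blast
 qed
 finally show ?thesis .
qed

lemma keys_dif_fat: "keys c <= nerve fat (Suc n) ==> keys (Dif (nerve_chains fat) n c) <= nerve fat n"
 using keys_qbd_fat[of "emb c" n] keys_emb[of "Dif (nerve_chains fat) n c"] by (simp add: emb_dif)

context carried
begin

lemma phi_hom: "\<phi> n : hom (free_Abelian_group (nerve fat n)) (GZ n)"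
 using phi by (simp add: aug_chain_map_def chain_map_def)

lemma phi_dif: "keys c <= nerve fat (Suc n) ==> \<phi> n (Dif (nerve_chains fat) n c) = Dif G_complex n (\<phi> (Suc n) c)"
 using phi by (simp add: aug_chain_map_def chain_map_def)

lemma phi_closed: "keys c <= nerve fat n ==> \<phi> n c : carrier (GZ n)"
 using phi_hom[of n] by (auto simp: hom_def)

lemma phi_eval_hom: "b : UG n ==> (%c. of_int (\<phi> n c b) :: rat) : hom (free_Abelian_group (nerve fat n)) add_group"
 using phi_hom[of n] by (auto simp: hom_def)

abbreviation pe :: "nat => 'h gelem => (('h ribbon, 'h mor) simplex \<Rightarrow>\<^sub>0 rat) => rat" where
 "pe n b \<equiv> rext (%M. of_int (\<phi> n (frag_of M) b))"

lemma pe_emb: "b : UG n ==> keys c <= nerve fat n ==> pe n b (emb c) = of_int (\<phi> n c b)"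
 using rext_integral[OF phi_eval_hom] by simp

lemma slice_forget_of: "slice_forget (frag_of M) = frag_of (omap fst M)"
 by (simp add: slice_forget_def omap_def case_prod_unfold)

text \<open>Apply the projection of the carrier to \<open>pairing_cyc\<close>.\<close>

lemma pe_fcyc:
 fixes x :: "'h ograph"
 assumes x: "x : ographs n" and b: "b : UG n"
 shows "pe n b (fcyc n x) = of_int (bracket x b)"
proof -
 let ?G = "fst x"
 note r = ographD(2)[OF x]
 let ?\<chi> = "%u. of_int (F_proj ?G n u b) :: rat"
 have h: "?\<chi> : hom (F_grp ?G n) add_group" using F_proj_spec(1)[of ?G n] b by (auto simp: hom_def)
 have "pe n b (fcyc n x) = rext (%M. ?\<chi> (ph ?G n M)) (cyc n x)"
  unfolding fcyc_def rext_comp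
 proof (rule rext_cong)
  fix M assume "M : keys (cyc n x)"
  hence "M : NS ?G n" using cyc_props(1)[OF x] by (auto simp: CS_def)
  thus "pe n b (bas (omap fst M)) = ?\<chi> (ph ?G n M)"
   using Phi_proj[OF r, of "frag_of M" n] by (simp add: rext_simps slice_forget_of)
 qed
 also have "... = ?\<chi> (F_gen ?G n (x, idm ?G))" by (rule pairing_cyc[OF x h])
 also have "... = of_int (bracket x b)" using F_proj_spec(2)[OF idm_over[OF x]] by simp
 finally show ?thesis .
qed

lemma pe_psi:
 assumes h: "h : carrier (GZ n)" and b: "b : UG n"
 shows "pe n b (psi n h) = of_int (h b)"
 using h
proof (induction rule: GZ_induct)
 case one thus ?case using b by (simp add: psi_one rext_simps)
next
 case (bracket x) thus ?case using pe_fcyc[OF _ b] by (simp add: psi_bracket)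
next
 case (inv h)
 have "pe n b (- psi n h) = - pe n b (psi n h)" using rext_simps(2)[of _ 0 "psi n h"] by (simp add: rext_simps)
 thus ?case unfolding psi_inv[OF GZ_G[OF inv(1)]] using inv(2) b by (simp add: G_dn_inv[OF GZ_G[OF inv(1)]])
next
 case (mult h k)
 have "psi n (h \<otimes>\<^bsub>G_dn n\<^esub> k) = psi n h + psi n k" using psi_hom[of n] mult(1,2) GZ_G by (auto simp: hom_def)
 thus ?case using mult b by (simp add: rext_simps)
qed

lemma phi_of_psi:
 assumes c: "keys c <= nerve fat n" and h: "h : carrier (GZ n)" and e: "emb c = qs (of_nat N) (psi n h)"
 shows "\<phi> n c = h [^]\<^bsub>G_dn n\<^esub> N"
proof (rule G_dn_eqI)
 show "\<phi> n c : carrier (G_dn n)" by (rule GZ_G[OF phi_closed[OF c]])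
 show "h [^]\<^bsub>G_dn n\<^esub> N : carrier (G_dn n)" using GZ_G[OF h] by simp
 fix b :: "'h gelem" assume b: "b : UG n"
 have "of_int (\<phi> n c b) = (of_int (int N * h b) :: rat)"
  using pe_emb[OF b c] pe_psi[OF h b] by (simp add: e rext_simps)
 hence "\<phi> n c b = int N * h b" by (simp only: of_int_eq_iff)
 thus "\<phi> n c b = (h [^]\<^bsub>G_dn n\<^esub> N) b" using G_dn_pow[OF GZ_G[OF h] b] by simp
qed

text \<open>
 Elements of the dual complex have a default value outside the group. If the boundary of \<open>b\<close> were
 outside, then \<open>\<phi>\<close>, which commutes with boundaries at 0, would force this default value to be 0; so evaluation
 at the boundary of \<open>b\<close> is additive in either case.
\<close>

lemma bd_eval_hom:
 fixes b :: "'h gelem"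
 assumes b: "b : UG n" shows "(%h. h (G_bd n b)) : hom (G_dn (Suc n)) add_group"
proof (cases "G_bd n b : UG (Suc n)")
 case True thus ?thesis by (rule eval_hom)
next
 case False
 have one: "\<phi> m 0 = \<one>\<^bsub>G_dn m\<^esub>" for m
 proof -
  interpret group_hom "free_Abelian_group (nerve fat m)" "GZ m" "\<phi> m"
   using phi_hom[of m] GZ_comm[of m, THEN comm_group.axioms(2)] by (simp add: group_hom_def group_hom_axioms_def)
  show ?thesis using hom_one by simp
 qed
 have "\<phi> n (Dif (nerve_chains fat) n 0) = Dif G_complex n (\<phi> (Suc n) 0)" by (rule phi_dif) simp
 hence "(\<one>\<^bsub>G_dn n\<^esub> :: 'h gdual) = Dif G_complex n \<one>\<^bsub>G_dn (Suc n)\<^esub>" by (simp add: one nerve_chains_def)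
 hence "(\<one>\<^bsub>G_dn n\<^esub>) b = (Dif G_complex n \<one>\<^bsub>G_dn (Suc n)\<^esub>) b" by simp
 hence "(undefined :: int) = 0" using b False by (simp add: Dif_G) (simp add: G_dn_def)
 hence z: "h (G_bd n b) = 0" if "h : carrier (G_dn (Suc n))" for h
  using that False unfolding G_dn_iff extensional_def by simp
 show ?thesis
 proof (rule homI)
  fix h k :: "'h gdual" assume h: "h : carrier (G_dn (Suc n))" and k: "k : carrier (G_dn (Suc n))"
  show "(h \<otimes>\<^bsub>G_dn (Suc n)\<^esub> k) (G_bd n b) = h (G_bd n b) \<otimes>\<^bsub>add_group\<^esub> k (G_bd n b)"
   using z[OF h] z[OF k] z[OF Gd.m_closed[OF h k]] by simp
 qed simp
qed

lemma Dif_mult: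
 fixes h k :: "'h gdual"
 assumes "h : carrier (G_dn (Suc n))" "k : carrier (G_dn (Suc n))"
 shows "Dif G_complex n (h \<otimes>\<^bsub>G_dn (Suc n)\<^esub> k) = Dif G_complex n h \<otimes>\<^bsub>G_dn n\<^esub> Dif G_complex n k"
proof (rule ext)
 fix b :: "'h gelem"
 show "Dif G_complex n (h \<otimes>\<^bsub>G_dn (Suc n)\<^esub> k) b = (Dif G_complex n h \<otimes>\<^bsub>G_dn n\<^esub> Dif G_complex n k) b"
  using bd_eval_hom[of b n] assms by (cases "b : UG n") (auto simp: Dif_G G_dn_def hom_def)
qed

lemma Dif_eval:
 fixes h :: "'h gdual"
 assumes h: "h : carrier (G_dn (Suc n))" and b: "b : UG n"
 shows "Dif G_complex n (h [^]\<^bsub>G_dn (Suc n)\<^esub> (N::nat)) b = int N * Dif G_complex n h b"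
  "Dif G_complex n (inv\<^bsub>G_dn (Suc n)\<^esub> h) b = - Dif G_complex n h b"
  "Dif G_complex n \<one>\<^bsub>G_dn (Suc n)\<^esub> b = 0"
proof -
 interpret e: group_hom "G_dn (Suc n)" add_group "%h. h (G_bd n b)"
  using bd_eval_hom[OF b] group_add_group by (simp add: group_hom_def group_hom_axioms_def Gd.is_group)
 show "Dif G_complex n (h [^]\<^bsub>G_dn (Suc n)\<^esub> N) b = int N * Dif G_complex n h b"
  using hom_nat_pow_add[OF Gd.is_group bd_eval_hom[OF b] h, of N] b by (simp add: Dif_G)
 show "Dif G_complex n (inv\<^bsub>G_dn (Suc n)\<^esub> h) b = - Dif G_complex n h b" "Dif G_complex n \<one>\<^bsub>G_dn (Suc n)\<^esub> b = 0"
  using e.hom_inv[OF h] e.hom_one b by (simp_all add: Dif_G)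
qed

lemma qbd_fcyc:
 fixes x :: "'h ograph"
 assumes x: "x : ographs (Suc n)" shows "qbd (Suc n) (fcyc (Suc n) x) = (SUM c:expansions n x. fcyc n (fst (rep c)))"
 unfolding fcyc_def qbd_omap qbd_cyc[OF x] zet_def qext_sum fcell_def qpush_forget ..

lemma rep_ographs: "c : expansions n x ==> fst (rep c) : ographs n"
 using Exps_overgraphs[OF rep_expansion(1), of c n x] by (cases "rep c") (simp add: overgraphs_iff)

text \<open>Clear denominators in the cycle of \<open>x\<close> and apply \<open>\<phi>\<close> to its boundary.\<close>

lemma Dif_bracket:
 fixes x :: "'h ograph"
 assumes x: "x : ographs (Suc n)"
 shows "Dif G_complex n (bracket x) = finprod (G_dn n) (%c. bracket (fst (rep c))) (expansions n x)"
proof -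
 have br: "(%c. bracket (fst (rep c))) : expansions n x \<rightarrow> carrier (G_dn n)"
  using bracket_spec(1)[OF rep_ographs] by blast
 have "Dif G_complex n (bracket x) b = (SUM c:expansions n x. bracket (fst (rep c)) b)" if b: "b : UG n" for b
 proof -
  obtain N c where N: "N > (0::nat)" and c: "emb c = qs (of_nat N) (psi (Suc n) (bracket x))"
   using clear_denominators by blast
  have k: "keys c <= nerve fat (Suc n)"
   using keys_emb[of c] keys_qs[of "of_nat N" "psi (Suc n) (bracket x)"] psi_keys[of "Suc n" "bracket x"] unfolding c by blast
  note ps = phi_of_psi[OF k bracket_GZ[OF x] c]
  note kd = keys_dif_fat[OF k]
  have "of_int (int N * Dif G_complex n (bracket x) b) = (of_int (\<phi> n (Dif (nerve_chains fat) n c) b) :: rat)"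
   unfolding phi_dif[OF k] ps using Dif_eval(1)[OF bracket_spec(1)[OF x] b, of N] by simp
  also have "... = pe n b (qbd (Suc n) (emb c))" using pe_emb[OF b kd] by (simp add: emb_dif)
  also have "... = of_nat N * (SUM c:expansions n x. of_int (bracket (fst (rep c)) b))"
   unfolding c psi_bracket[OF x] qext_qs qbd_fcyc[OF x] rext_simps
   using pe_fcyc[OF rep_ographs b] by simp
  finally have "of_int (int N * Dif G_complex n (bracket x) b) = (of_int (int N * (SUM c:expansions n x. bracket (fst (rep c)) b)) :: rat)" by simp
  hence "int N * Dif G_complex n (bracket x) b = int N * (SUM c:expansions n x. bracket (fst (rep c)) b)"
   by (simp only: of_int_eq_iff)
  thus ?thesis using N by simp
 qed
 hence ev: "Dif G_complex n (bracket x) b = (finprod (G_dn n) (%c. bracket (fst (rep c))) (expansions n x)) b" if "b : UG n" for b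
  using that G_dn_finprod[OF br that] by simp
 show ?thesis
 proof (rule extensionalityI)
  show "Dif G_complex n (bracket x) : extensional (UG n)" by (simp add: Dif_G)
  show "finprod (G_dn n) (%c. bracket (fst (rep c))) (expansions n x) : extensional (UG n)"
   using Gd.finprod_closed[OF br] unfolding G_dn_iff by blast
 qed (rule ev)
qed

lemma GZ_finprod:
 assumes "f : A \<rightarrow> carrier (GZ n)" shows "finprod (G_dn n) f A : carrier (GZ n)"
proof -
 interpret S: subgroup "carrier (GZ n)" "G_dn n" by (rule GZ_sub)
 show ?thesis using assms
 proof (induction A rule: infinite_finite_induct)
  case (insert a A)
  hence "f a : carrier (GZ n)" "f : A \<rightarrow> carrier (GZ n)" by auto
  moreover from this have "f a : carrier (G_dn n)" "f : A \<rightarrow> carrier (G_dn n)" using GZ_G by blast+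
  ultimately show ?case using insert by simp
 qed auto
qed

lemma Dif_GZ:
 fixes h :: "'h gdual"
 assumes "h : carrier (GZ (Suc n))"
 shows "Dif G_complex n h : carrier (GZ n) & psi n (Dif G_complex n h) = qbd (Suc n) (psi (Suc n) h)"
 using assms
proof (induction rule: GZ_induct)
 case one
 interpret S: subgroup "carrier (GZ n)" "G_dn n" by (rule GZ_sub)
 have "Dif G_complex n \<one>\<^bsub>G_dn (Suc n)\<^esub> = (\<one>\<^bsub>G_dn n\<^esub> :: 'h gdual)"
  by (rule extensionalityI[of _ "UG n"]) (auto simp: Dif_eval(3)[OF Gd.one_closed], auto simp: Dif_G G_dn_def)
 thus ?case by (simp add: psi_one)
next
 case (bracket x)
 have br: "(%c. bracket (fst (rep c))) : expansions n x \<rightarrow> carrier (GZ n)"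
  using bracket_GZ[OF rep_ographs] by blast
 have "psi n (finprod (G_dn n) (%c. bracket (fst (rep c))) (expansions n x)) = (SUM c:expansions n x. psi n (bracket (fst (rep c))))"
  unfolding finprod_add_group[symmetric] by (rule hom_finprod[OF G_dn_comm comm_group_add_group psi_hom]) (use br GZ_G in blast)
 also have "... = qbd (Suc n) (psi (Suc n) (bracket x))"
  unfolding psi_bracket[OF bracket] qbd_fcyc[OF bracket] by (intro sum.cong psi_bracket rep_ographs) auto
 finally show ?case using GZ_finprod[OF br] Dif_bracket[OF bracket] by simp
next
 case (inv h)
 interpret S: subgroup "carrier (GZ n)" "G_dn n" by (rule GZ_sub)
 have "Dif G_complex n (inv\<^bsub>G_dn (Suc n)\<^esub> h) = inv\<^bsub>G_dn n\<^esub> (Dif G_complex n h)"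
  using inv(2) GZ_G by (intro extensionalityI[of _ "UG n"]) (auto simp: Dif_eval(2)[OF GZ_G[OF inv(1)]] G_dn_inv, auto simp: Dif_G)
 thus ?case using inv(2) GZ_G psi_inv[OF GZ_G[OF inv(1)]] psi_inv[OF GZ_G, of "Dif G_complex n h" n] by (simp add: qext_uminus)
next
 case (mult h k)
 interpret S: subgroup "carrier (GZ n)" "G_dn n" by (rule GZ_sub)
 have p: "psi m (h' \<otimes>\<^bsub>G_dn m\<^esub> k') = psi m h' + psi m k'" if "h' : carrier (GZ m)" "k' : carrier (GZ m)" for m and h' k' :: "'h gdual"
  using psi_hom[of m] that GZ_G by (auto simp: hom_def)
 show ?case unfolding Dif_mult[OF GZ_G[OF mult(1)] GZ_G[OF mult(2)]] p[OF mult(1,2)] qext_add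
  using mult(3,4) p[of "Dif G_complex n h" n "Dif G_complex n k"] by simp
qed

lemma Dif_G_dn:
 fixes h :: "'h gdual"
 assumes h: "h : carrier (G_dn (Suc n))" shows "Dif G_complex n h : carrier (G_dn n)"
proof -
 obtain M :: nat where M: "M > 0" "h [^]\<^bsub>G_dn (Suc n)\<^esub> M : carrier (GZ (Suc n))" using multiple_in_GZ[OF h] by blast
 let ?k = "Dif G_complex n (h [^]\<^bsub>G_dn (Suc n)\<^esub> M)" and ?d = "Dif G_complex n h"
 have k: "?k : carrier (G_dn n)" using Dif_GZ[OF M(2)] GZ_G by blast
 have kd: "?k b = int M * ?d b" if "b : UG n" for b by (rule Dif_eval(1)[OF h that])
 interpret U: comm_group "G_up n" by (rule G_up_comm)
 have "?d : hom (G_up n) add_group"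
 proof (rule homI)
  fix a b :: "'h gelem" assume a: "a : UG n" "b : UG n"
  have "?k (a \<otimes>\<^bsub>G_up n\<^esub> b) = ?k a + ?k b" using k a unfolding G_dn_iff by (auto simp: hom_def)
  hence "int M * ?d (a \<otimes>\<^bsub>G_up n\<^esub> b) = int M * (?d a + ?d b)" using a by (simp add: kd algebra_simps)
  thus "?d (a \<otimes>\<^bsub>G_up n\<^esub> b) = ?d a \<otimes>\<^bsub>add_group\<^esub> ?d b" using M(1) by simp
 qed simp
 moreover have "{c : G_gen n ` ographs n. ?d c ~= 0} = {c : G_gen n ` ographs n. ?k c ~= 0}"
  using M(1) by (auto simp: kd G_gen_closed)
 hence "finite {c : G_gen n ` ographs n. ?d c ~= 0}" using k unfolding G_dn_iff by simp
 moreover have "?d : extensional (UG n)" by (simp add: Dif_G)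
 ultimately show ?thesis unfolding G_dn_iff by blast
qed

lemma psi_phi:
 assumes t: "N : nerve fat n"
 shows "psi n (\<phi> n (frag_of N)) = qomap fst (rho (last (fst N)) n (bas (hat N)))"
proof -
 let ?X = "last (fst N)"
 note H = hat_CS[OF t]
 have hN: "hat N : NS ?X n" using H(1) by (simp add: CS_def)
 have "slice_forget (frag_of (hat N)) = frag_of N"
  using emb_forget[of "frag_of (hat N)"] forget_hat[OF t] by (intro emb_inject) simp
 hence "\<phi> n (frag_of N) = F_proj ?X n (ph ?X n (hat N))" using Phi_proj[OF H(2), of "frag_of (hat N)" n] hN by simp
 moreover have "psi n (F_proj ?X n u) = qomap fst (Psi ?X n u)" if u: "u : carrier (F_grp ?X n)" for u
 proof (rule F_hom_eq[OF group_add_group _ _ _ u])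
  show "(%u. psi n (F_proj ?X n u)) : hom (F_grp ?X n) add_group" by (rule comp_group_hom[OF F_proj_spec(1) psi_GZ])
  show "(%u. qomap fst (Psi ?X n u)) : hom (F_grp ?X n) add_group" using Psi_hom[of ?X n] by (auto simp: hom_def qext_add)
  fix x f assume xf: "(x, f) : overgraphs ?X n"
  hence "x : ographs n" by (simp add: overgraphs_iff)
  thus "psi n (F_proj ?X n (F_gen ?X n (x, f))) = qomap fst (Psi ?X n (F_gen ?X n (x, f)))"
   unfolding F_proj_spec(2)[OF xf] Psi_gen[OF xf] fcell_def qpush_forget by (simp add: psi_bracket fcyc_def)
 qed
 ultimately show ?thesis using ph_closed[OF H(2) hN] by (simp add: rho_def)
qed

lemma psi_phi_emb:
 assumes c: "keys c <= nerve fat n"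
 shows "psi n (\<phi> n c) = qext (%N. qomap fst (rho (last (fst N)) n (bas (hat N)))) (emb c)"
 by (rule qext_integral[OF comp_group_hom[OF phi_hom psi_GZ] psi_phi c])

lemma homotopy0:
 assumes c: "keys c <= nerve fat 0"
 shows "psi 0 (\<phi> 0 c) - emb c = qbd (Suc 0) (qext (hty 0) (emb c))"
proof -
 have "qbd (Suc 0) (qext (hty 0) (emb c)) = qext (%N. qomap fst (rho (last (fst N)) 0 (bas (hat N))) - bas N) (emb c)"
  unfolding qext_comp[of "bd (Suc 0)" "hty 0"] by (rule qext_cong) (use c hty_bd0 in auto)
 thus ?thesis unfolding psi_phi_emb[OF c] qext_fun_diff by simp
qed

lemma homotopy:
 assumes c: "keys c <= nerve fat (Suc n)"
 shows "psi (Suc n) (\<phi> (Suc n) c) - emb c = qbd (Suc (Suc n)) (qext (hty (Suc n)) (emb c)) + qext (hty n) (qbd (Suc n) (emb c))"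
proof -
 have "qbd (Suc (Suc n)) (qext (hty (Suc n)) (emb c)) + qext (hty n) (qbd (Suc n) (emb c)) =
  qext (%N. qbd (Suc (Suc n)) (hty (Suc n) N) + qext (hty n) (bd (Suc n) N)) (emb c)"
  unfolding qext_fun_add qext_comp[of "bd (Suc (Suc n))" "hty (Suc n)"] qext_comp[of "hty n" "bd (Suc n)"] ..
 also have "... = qext (%N. qomap fst (rho (last (fst N)) (Suc n) (bas (hat N))) - bas N) (emb c)"
  by (rule qext_cong, rule hty_bd) (use c in auto)
 finally show ?thesis unfolding psi_phi_emb[OF c] qext_fun_diff by simp
qed

end

section \<open>Rational chain complexes\<close>

interpretation Fr: comm_group "free_Abelian_group S" for S by (rule abelian_free_Abelian_group)

abbreviation NF :: "nat => (('h ribbon, 'h mor) simplex \<Rightarrow>\<^sub>0 int) monoid" where "NF n \<equiv> free_Abelian_group (nerve fat n)"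

text \<open>The rational chain \<open>x\<close> as an element of the tensor product of the integral chains with \<open>\<rat>\<close>.\<close>

definition rch :: "nat => (('h ribbon, 'h mor) simplex \<Rightarrow>\<^sub>0 rat) => (('h fat_chain \<times> rat) \<Rightarrow>\<^sub>0 int) set" where
 "rch n x = finprod (rt (NF n)) (%M. pt (NF n) (frag_of M) (lookup x M)) (keys x)"

lemma comm_group_NF: "comm_group (NF n)" by (rule abelian_free_Abelian_group)

interpretation RT: comm_group "rt (NF n)" for n by (rule comm_group_rt[OF comm_group_NF])

context
 fixes n :: nat and A :: "(('h ribbon, 'h mor) simplex \<Rightarrow>\<^sub>0 int) monoid"
 defines "A \<equiv> NF n"
begin

lemma rch_superset:
 assumes "finite S" "keys x <= S" "S <= nerve fat n"
 shows "rch n x = finprod (rt A) (%M. pt A (frag_of M) (lookup x M)) S"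
 unfolding rch_def A_def
proof (rule RT.finprod_mono_neutral_cong_left[OF assms(1,2)])
 fix M assume "M : S - keys x"
 thus "pt (NF n) (frag_of M) (lookup x M) = \<one>\<^bsub>rt (NF n)\<^esub>"
  using assms(3) by (auto simp: in_keys_iff intro!: pt_zero[OF comm_group_NF])
next
 show "(%M. pt (NF n) (frag_of M) (lookup x M)) : S \<rightarrow> carrier (rt (NF n))"
  using assms(3) by (auto intro!: pt_closed[OF comm_group_NF])
qed simp

lemma rch_closed: "keys x <= nerve fat n ==> rch n x : carrier (rt A)"
 unfolding rch_def A_def by (rule RT.finprod_closed) (auto intro!: pt_closed[OF comm_group_NF])

lemma rch_add:
 assumes "keys x <= nerve fat n" "keys y <= nerve fat n"
 shows "rch n (x + y) = rch n x \<otimes>\<^bsub>rt A\<^esub> rch n y"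
proof -
 let ?S = "keys x \<union> keys y"
 have S: "finite ?S" "?S <= nerve fat n" using assms by auto
 have c: "(%M. pt (NF n) (frag_of M) (f M)) : ?S \<rightarrow> carrier (rt (NF n))" for f
  using S(2) by (auto intro!: pt_closed[OF comm_group_NF])
 have "rch n (x + y) = finprod (rt A) (%M. pt A (frag_of M) (lookup x M) \<otimes>\<^bsub>rt A\<^esub> pt A (frag_of M) (lookup y M)) ?S"
  unfolding rch_superset[OF S(1) keys_add S(2)] lookup_add unfolding A_def
  by (rule RT.finprod_cong') (use S(2) c in \<open>auto simp: pt_add_right[OF comm_group_NF] intro!: RT.m_closed pt_closed[OF comm_group_NF]\<close>)
 also have "... = rch n x \<otimes>\<^bsub>rt A\<^esub> rch n y"
  unfolding rch_superset[OF S(1) Un_upper1 S(2)] rch_superset[OF S(1) Un_upper2 S(2)] unfolding A_def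
  by (rule RT.finprod_multf[OF c c])
 finally show ?thesis .
qed

lemma rch_zero: "rch n 0 = \<one>\<^bsub>rt A\<^esub>" by (simp add: rch_def A_def)

lemma rch_diff:
 assumes x: "keys x <= nerve fat n" and y: "keys y <= nerve fat n"
 shows "rch n (x - y) = rch n x \<otimes>\<^bsub>rt A\<^esub> inv\<^bsub>rt A\<^esub> rch n y"
proof -
 have d: "keys (x - y) <= nerve fat n" using keys_diff[of x y] x y by auto
 have "rch n x = rch n (x - y) \<otimes>\<^bsub>rt A\<^esub> rch n y" using rch_add[OF d y] by simp
 thus ?thesis using rch_closed[OF x] rch_closed[OF d] rch_closed[OF y] unfolding A_def by (simp add: RT.inv_solve_right)
qed

lemma rch_bas: "M : nerve fat n ==> rch n (qs q (bas M)) = pt A (frag_of M) q"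
proof -
 assume s: "M : nerve fat n"
 have "rch n (qs q (bas M)) = finprod (rt A) (%N. pt A (frag_of N) (lookup (qs q (bas M)) N)) {M}"
  by (rule rch_superset) (use s keys_qs[of q "bas M"] in auto)
 thus ?thesis using s pt_closed[OF comm_group_NF, of "frag_of M" n q] by (simp add: A_def Pi_def)
qed

lemma rch_emb: assumes "keys c <= nerve fat n" shows "rch n (qs q (emb c)) = pt A c q"
 using assms
proof (rule free_Abelian_group_induct)
 have "pt A \<one>\<^bsub>A\<^esub> q = \<one>\<^bsub>rt A\<^esub>" unfolding A_def by (rule pt_one_left[OF comm_group_NF])
 thus "rch n (qs q (emb 0)) = pt A 0 q" by (simp add: rch_zero A_def)
 fix c d :: "'h fat_chain"
 assume c: "keys c <= nerve fat n" "keys d <= nerve fat n"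
  and e: "rch n (qs q (emb c)) = pt A c q" "rch n (qs q (emb d)) = pt A d q"
 have k: "keys (qs q (emb c)) <= nerve fat n" "keys (qs q (emb d)) <= nerve fat n"
  using keys_qs[of q "emb c"] keys_qs[of q "emb d"] c by auto
 have "rch n (qs q (emb (c - d))) = rch n (qs q (emb c)) \<otimes>\<^bsub>rt A\<^esub> inv\<^bsub>rt A\<^esub> rch n (qs q (emb d))"
  using rch_diff[OF k] by (simp add: qs_minus)
 also have "... = pt A c q \<otimes>\<^bsub>rt A\<^esub> pt A (- d) q"
  using pt_inv[OF comm_group_NF, of d n q] c unfolding e by (simp add: A_def)
 also have "... = pt A (c - d) q"
  using pt_add_left[OF comm_group_NF, of c n "- d" q] c by (simp add: A_def)
 finally show "rch n (qs q (emb (c - d))) = pt A (c - d) q" .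
next
 show "rch n (qs q (emb (frag_of M))) = pt A (frag_of M) q" if "M : nerve fat n" for M using rch_bas[OF that] by simp
qed

lemma rch_hom_exists:
 assumes G: "comm_group G" and B: "B : hom G (add_group :: (('h ribbon, 'h mor) simplex \<Rightarrow>\<^sub>0 rat) monoid)"
  and k: "!!g. g : carrier G ==> keys (B g) <= nerve fat n"
 shows "EX h. h : hom (rt G) (rt A) & (ALL g:carrier G. ALL q. h (pt G g q) = rch n (qs q (B g)))"
proof -
 have kq: "keys (qs q (B g)) <= nerve fat n" if "g : carrier G" for g q using k[OF that] keys_qs[of q "B g"] by blast
 have B2: "B (g \<otimes>\<^bsub>G\<^esub> g') = B g + B g'" if "g : carrier G" "g' : carrier G" for g g' using B that by (auto simp: hom_def)
 show ?thesis
 proof (rule rt_hom_exists[OF G, of "rt A" "%g q. rch n (qs q (B g))"])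
  show "comm_group (rt A)" unfolding A_def by (rule comm_group_rt[OF comm_group_NF])
  show "rch n (qs q (B g)) : carrier (rt A)" if "g : carrier G" for g q by (rule rch_closed[OF kq[OF that]])
  show "rch n (qs q (B (g \<otimes>\<^bsub>G\<^esub> g'))) = rch n (qs q (B g)) \<otimes>\<^bsub>rt A\<^esub> rch n (qs q (B g'))" if "g : carrier G" "g' : carrier G" for g g' q
   unfolding B2[OF that] qs_add by (rule rch_add[OF kq[OF that(1)] kq[OF that(2)]])
  show "rch n (qs (q + q') (B g)) = rch n (qs q (B g)) \<otimes>\<^bsub>rt A\<^esub> rch n (qs q' (B g))" if "g : carrier G" for g q q'
   unfolding qs_add_left by (rule rch_add[OF kq[OF that] kq[OF that]])
 qed blast
qed

end

text \<open>With a common denominator, \<open>rch\<close> becomes a pure tensor, on which maps of the form \<open>f \<otimes> \<rat>\<close> are easy to evaluate.\<close>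

lemma rch_integral:
 assumes "keys x <= nerve fat n"
 shows "EX N c. N > (0::nat) & emb c = qs (of_nat N) x & keys c <= nerve fat n \<and>
  (ALL q. rch n (qs q x) = pt (NF n) c (q / of_nat N))"
proof -
 obtain N c where N: "N > (0::nat)" and c: "emb c = qs (of_nat N) x" using clear_denominators by blast
 have k: "keys c <= nerve fat n" using keys_emb[of c] keys_qs[of "of_nat N" x] assms unfolding c by blast
 have "rch n (qs q x) = pt (NF n) c (q / of_nat N)" for q using rch_emb[OF k, of "q / of_nat N"] N by (simp add: c)
 thus ?thesis using N c k by blast
qed

lemma G_complex_simps [simp]: "Grp (G_complex :: 'h gdual chain_complex) = G_dn" by (simp add: G_complex_def)

lemma rat_complex_simps [simp]: "Grp (rat_complex C) n = rt (Grp C n)" "Dif (rat_complex C) n = rat_map (Grp C (Suc n)) (Grp C n) (Dif C n)"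
 by (simp_all add: rat_complex_def)

context carried
begin

lemma Dif_NF_hom: "Dif (nerve_chains fat) n : hom (NF (Suc n)) (NF n :: 'h fat_chain monoid)"
proof -
 have kd: "keys (Dif (nerve_chains fat) n c) <= nerve fat n" if k: "keys c <= nerve fat (Suc n)" for c :: "'h fat_chain"
  by (rule keys_dif_fat[OF k])
 have "Dif (nerve_chains fat) n (c + d) = Dif (nerve_chains fat) n c + Dif (nerve_chains fat) n d" for c d :: "'h fat_chain"
  by (rule emb_inject) (simp add: emb_dif qext_add)
 thus ?thesis using kd by (auto simp: hom_def)
qed

abbreviation "QD n \<equiv> rat_map (NF (Suc n)) (NF n :: 'h fat_chain monoid) (Dif (nerve_chains fat) n)"
abbreviation "QZ n \<equiv> rat_map (GZ (Suc n)) (GZ n :: 'h gdual monoid) (Dif G_complex n)"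
abbreviation "Qf n \<equiv> rat_map (NF n) (GZ n) (\<phi> n)"

lemma Dif_GZ_hom: "Dif G_complex n : hom (GZ (Suc n)) (GZ n :: 'h gdual monoid)"
proof (rule homI)
 fix h k :: "'h gdual" assume h: "h : carrier (GZ (Suc n))" and k: "k : carrier (GZ (Suc n))"
 show "Dif G_complex n h : carrier (GZ n)" using Dif_GZ[OF h] by simp
 show "Dif G_complex n (h \<otimes>\<^bsub>GZ (Suc n)\<^esub> k) = Dif G_complex n h \<otimes>\<^bsub>GZ n\<^esub> Dif G_complex n k"
  using Dif_mult[OF GZ_G[OF h] GZ_G[OF k]] by simp
qed

lemma Dif_G_hom: "Dif G_complex n : hom (G_dn (Suc n)) (G_dn n :: 'h gdual monoid)"
 by (rule homI) (rule Dif_G_dn Dif_mult, assumption+)+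

lemmas QD = rat_map_spec[OF comm_group_NF comm_group_NF Dif_NF_hom]
lemmas QZ = rat_map_spec[OF GZ_comm GZ_comm Dif_GZ_hom]
lemmas Qf = rat_map_spec[OF comm_group_NF GZ_comm phi_hom]

lemma QD_rch:
 fixes x :: "('h ribbon, 'h mor) simplex \<Rightarrow>\<^sub>0 rat"
 assumes "keys x <= nerve fat (Suc n)"
 shows "QD n (rch (Suc n) (qs q x)) = rch n (qs q (qbd (Suc n) x))"
proof -
 obtain N c where N: "N > (0::nat)" "emb c = qs (of_nat N) x" "keys c <= nerve fat (Suc n)"
  "ALL q. rch (Suc n) (qs q x) = pt (NF (Suc n)) c (q / of_nat N)" using rch_integral[OF assms] by blast
 have kd: "keys (Dif (nerve_chains fat) n c) <= nerve fat n" by (rule keys_dif_fat[OF N(3)])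
 have "QD n (rch (Suc n) (qs q x)) = pt (NF n) (Dif (nerve_chains fat) n c) (q / of_nat N)"
  unfolding spec[OF N(4)] by (rule QD(2)) (use N(3) in simp)
 also have "... = rch n (qs (q / of_nat N) (qbd (Suc n) (emb c)))" using rch_emb[OF kd, of "q / of_nat N"] by (simp add: emb_dif)
 also have "... = rch n (qs q (qbd (Suc n) x))" using N(1) by (simp add: N(2) qext_qs)
 finally show ?thesis .
qed

lemma Qf_rch:
 assumes h: "h : carrier (GZ n)" and m: "m > (0::nat)"
 shows "Qf n (rch n (qs (1 / of_nat m) (psi n h))) = pt (GZ n) h (1 / of_nat m)"
proof -
 obtain N c where N: "N > (0::nat)" "emb c = qs (of_nat N) (psi n h)" "keys c <= nerve fat n"
  "ALL q. rch n (qs q (psi n h)) = pt (NF n) c (q / of_nat N)" using rch_integral[OF psi_keys[of n h]] by blast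
 have "Qf n (rch n (qs (1 / of_nat m) (psi n h))) = pt (GZ n) (\<phi> n c) (1 / of_nat m / of_nat N)"
  unfolding spec[OF N(4)] by (rule Qf(2)) (use N(3) in simp)
 also have "\<phi> n c = h [^]\<^bsub>GZ n\<^esub> N" using phi_of_psi[OF N(3) h N(2)] by (simp add: GZ_pow_simp)
 also have "pt (GZ n) (h [^]\<^bsub>GZ n\<^esub> N) (1 / of_nat m / of_nat N) = pt (GZ n) h (1 / of_nat m)"
  using pt_nat_pow[OF GZ_comm h, of N "1 / of_nat m / of_nat N"] N(1) by simp
 finally show ?thesis .
qed

text \<open>
 Homomorphisms from a tensor product with \<open>\<rat>\<close> are determined by their values on pure tensors, where the
 identities reduce to \<open>homotopy\<close> and to \<open>phi_of_psi\<close>. In the order \<open>\<phi>\<close> after \<open>psi\<close> the homotopy is zero.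
\<close>

lemma homotopy_equivalence:
 "chain_homotopy_equivalence (rat_complex (nerve_chains fat)) (rat_complex GZ_complex) (rat_chain_map (nerve_chains fat) GZ_complex \<phi>)"
proof -
 have Qfd: "Qf n (QD n t) = QZ n (Qf (Suc n) t)" if t: "t : carrier (rt (NF (Suc n)))" for n t
 proof (rule rt_hom_eqI[OF comm_group_NF _ comp_group_hom[OF QD(1) Qf(1)] comp_group_hom[OF Qf(1) QZ(1)] t])
  show "Group.group (rt (GZ n))" by (rule comm_group.axioms(2)[OF comm_group_rt[OF GZ_comm]])
  fix c :: "'h fat_chain" and m :: nat assume c: "c : carrier (NF (Suc n))"
  hence k: "Dif (nerve_chains fat) n c : carrier (NF n)" "\<phi> (Suc n) c : carrier (GZ (Suc n))"
   using keys_dif_fat phi_closed by auto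
  show "Qf n (QD n (pt (NF (Suc n)) c (1 / of_nat m))) = QZ n (Qf (Suc n) (pt (NF (Suc n)) c (1 / of_nat m)))"
   unfolding QD(2)[OF c] Qf(2)[OF c] Qf(2)[OF k(1)] QZ(2)[OF k(2)] using phi_dif c by simp
 qed
 have "EX g. g : hom (rt (GZ n)) (rt (NF n :: 'h fat_chain monoid)) & (ALL h:carrier (GZ n). ALL q. g (pt (GZ n) h q) = rch n (qs q (psi n h)))" for n
  by (rule rch_hom_exists[OF GZ_comm psi_GZ psi_keys])
 then obtain g where g1: "!!n. g n : hom (rt (GZ n)) (rt (NF n :: 'h fat_chain monoid))"
  and g2: "!!n h q. h : carrier (GZ n) ==> g n (pt (GZ n) h q) = rch n (qs q (psi n h))"
  by metis
 have sh: "(%c. qext (hty n) (emb c)) : hom (NF n) add_group" for n by (auto simp: hom_def qext_add)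
 have sk: "keys (qext (hty n) (emb c)) <= nerve fat (Suc n)" if "c : carrier (NF n)" for n c
  using keys_qext[of "hty n" "emb c"] hty_keys that by fastforce
 have "EX s. s : hom (rt (NF n)) (rt (NF (Suc n) :: 'h fat_chain monoid)) & (ALL c:carrier (NF n). ALL q. s (pt (NF n) c q) = rch (Suc n) (qs q (qext (hty n) (emb c))))" for n
  by (rule rch_hom_exists[OF comm_group_NF sh sk])
 then obtain s where s1: "!!n. s n : hom (rt (NF n)) (rt (NF (Suc n) :: 'h fat_chain monoid))"
  and s2: "!!n c q. c : carrier (NF n) ==> s n (pt (NF n) c q) = rch (Suc n) (qs q (qext (hty n) (emb c)))"
  by metis
 have gd: "g n (QZ n t) = QD n (g (Suc n) t)" if t: "t : carrier (rt (GZ (Suc n)))" for n t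
 proof (rule rt_hom_eqI[OF GZ_comm _ comp_group_hom[OF QZ(1) g1] comp_group_hom[OF g1 QD(1)] t])
  show "Group.group (rt (NF n))" by (rule RT.is_group)
  fix h :: "'h gdual" and m :: nat assume h: "h : carrier (GZ (Suc n))"
  note D = Dif_GZ[OF h]
  show "g n (QZ n (pt (GZ (Suc n)) h (1 / of_nat m))) = QD n (g (Suc n) (pt (GZ (Suc n)) h (1 / of_nat m)))"
   unfolding QZ(2)[OF h] g2[OF h] g2[OF conjunct1[OF D]] QD_rch[OF psi_keys] using D by simp
 qed
 have fg: "Qf n (g n t) = t" if t: "t : carrier (rt (GZ n))" for n t
 proof -
  obtain h m where hm: "h : carrier (GZ n)" "m > (0::nat)" "t = pt (GZ n) h (1 / of_nat m)" using rt_pure[OF GZ_comm t] by blast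
  show ?thesis unfolding hm(3) g2[OF hm(1)] by (rule Qf_rch[OF hm(1,2)])
 qed
 have pc: "\<phi> n c : carrier (GZ n)" if "c : carrier (NF n)" for n c using phi_closed that by simp
 have gf0: "g 0 (Qf 0 t) \<otimes>\<^bsub>rt (NF 0)\<^esub> inv\<^bsub>rt (NF 0)\<^esub> t = QD 0 (s 0 t)" if t: "t : carrier (rt (NF 0))" for t
 proof -
  obtain c m where c: "c : carrier (NF 0)" "m > (0::nat)" "t = pt (NF 0) c (1 / of_nat m)" using rt_pure[OF comm_group_NF t] by blast
  let ?q = "1 / of_nat m :: rat"
  have k: "keys c <= nerve fat 0" using c(1) by simp
  have ke: "keys (qs ?q (emb c)) <= nerve fat 0" using keys_qs[of ?q "emb c"] k by auto
  have kp: "keys (qs ?q (psi 0 (\<phi> 0 c))) <= nerve fat 0" using keys_qs psi_keys by (rule order_trans)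
  have e1: "g 0 (Qf 0 t) = rch 0 (qs ?q (psi 0 (\<phi> 0 c)))" unfolding c(3) Qf(2)[OF c(1)] g2[OF pc[OF c(1)]] ..
  have e2: "rch 0 (qs ?q (emb c)) = t" unfolding c(3) by (rule rch_emb[OF k])
  have "g 0 (Qf 0 t) \<otimes>\<^bsub>rt (NF 0)\<^esub> inv\<^bsub>rt (NF 0)\<^esub> t = rch 0 (qs ?q (psi 0 (\<phi> 0 c)) - qs ?q (emb c))"
   unfolding e1 rch_diff[OF kp ke] e2 ..
  also have "... = rch 0 (qs ?q (qbd (Suc 0) (qext (hty 0) (emb c))))" unfolding homotopy0[OF k, symmetric] qs_minus ..
  also have "... = QD 0 (s 0 t)" unfolding c(3) s2[OF c(1)] QD_rch[OF sk[OF c(1)]] ..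
  finally show ?thesis .
 qed
 have gf: "g (Suc n) (Qf (Suc n) t) \<otimes>\<^bsub>rt (NF (Suc n))\<^esub> inv\<^bsub>rt (NF (Suc n))\<^esub> t = QD (Suc n) (s (Suc n) t) \<otimes>\<^bsub>rt (NF (Suc n))\<^esub> s n (QD n t)"
  if t: "t : carrier (rt (NF (Suc n)))" for n t
 proof -
  obtain c m where c: "c : carrier (NF (Suc n))" "m > (0::nat)" "t = pt (NF (Suc n)) c (1 / of_nat m)" using rt_pure[OF comm_group_NF t] by blast
  let ?q = "1 / of_nat m :: rat"
  have k: "keys c <= nerve fat (Suc n)" using c(1) by simp
  have d: "Dif (nerve_chains fat) n c : carrier (NF n)" using keys_dif_fat[OF k] by simp
  let ?a = "qext (hty n) (qbd (Suc n) (emb c))" and ?b = "qbd (Suc (Suc n)) (qext (hty (Suc n)) (emb c))"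
  have ke: "keys (qs ?q (emb c)) <= nerve fat (Suc n)" using keys_qs[of ?q "emb c"] k by auto
  have kp: "keys (qs ?q (psi (Suc n) (\<phi> (Suc n) c))) <= nerve fat (Suc n)" using keys_qs psi_keys by (rule order_trans)
  have ka: "keys (qs ?q ?a) <= nerve fat (Suc n)"
   using sk[OF d] keys_qs[of ?q ?a] by (simp add: emb_dif)
  have kb: "keys (qs ?q ?b) <= nerve fat (Suc n)"
   using keys_qs[of ?q ?b] keys_qbd_fat[OF sk[OF c(1)]] by blast
  have e1: "g (Suc n) (Qf (Suc n) t) = rch (Suc n) (qs ?q (psi (Suc n) (\<phi> (Suc n) c)))"
   unfolding c(3) Qf(2)[OF c(1)] g2[OF pc[OF c(1)]] ..
  have e2: "rch (Suc n) (qs ?q (emb c)) = t" unfolding c(3) by (rule rch_emb[OF k])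
  have "g (Suc n) (Qf (Suc n) t) \<otimes>\<^bsub>rt (NF (Suc n))\<^esub> inv\<^bsub>rt (NF (Suc n))\<^esub> t = rch (Suc n) (qs ?q (psi (Suc n) (\<phi> (Suc n) c)) - qs ?q (emb c))"
   unfolding e1 rch_diff[OF kp ke] e2 ..
  also have "... = rch (Suc n) (qs ?q ?b + qs ?q ?a)" unfolding qs_minus[symmetric] homotopy[OF k] qs_add ..
  also have "... = rch (Suc n) (qs ?q ?b) \<otimes>\<^bsub>rt (NF (Suc n))\<^esub> rch (Suc n) (qs ?q ?a)" by (rule rch_add[OF kb ka])
  also have "rch (Suc n) (qs ?q ?b) = QD (Suc n) (s (Suc n) t)" unfolding c(3) s2[OF c(1)] QD_rch[OF sk[OF c(1)]] ..
  also have "rch (Suc n) (qs ?q ?a) = s n (QD n t)" unfolding c(3) QD(2)[OF c(1)] s2[OF d] emb_dif ..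
  finally show ?thesis .
 qed
 have one: "(%t. \<one>\<^bsub>rt (GZ (Suc n))\<^esub>) : hom (rt (GZ n :: 'h gdual monoid)) (rt (GZ (Suc n) :: 'h gdual monoid))" for n
 proof -
  interpret R: comm_group "rt (GZ (Suc n))" by (rule comm_group_rt[OF GZ_comm])
  show ?thesis by (auto simp: hom_def)
 qed
 have Q1: "QZ n \<one>\<^bsub>rt (GZ (Suc n))\<^esub> = \<one>\<^bsub>rt (GZ n)\<^esub>" for n
  by (rule hom_one[OF QZ(1)]; rule comm_group.axioms(2)[OF comm_group_rt[OF GZ_comm]])
 have fg1: "Qf n (g n t) \<otimes>\<^bsub>rt (GZ n)\<^esub> inv\<^bsub>rt (GZ n)\<^esub> t = \<one>\<^bsub>rt (GZ n)\<^esub>" if "t : carrier (rt (GZ n))" for n t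
  unfolding fg[OF that] by (rule group.r_inv[OF comm_group.axioms(2)[OF comm_group_rt[OF GZ_comm]] that])
 have oo: "\<one>\<^bsub>rt (GZ n)\<^esub> = \<one>\<^bsub>rt (GZ n)\<^esub> \<otimes>\<^bsub>rt (GZ n)\<^esub> \<one>\<^bsub>rt (GZ n :: 'h gdual monoid)\<^esub>" for n
 proof -
  interpret R: comm_group "rt (GZ n)" by (rule comm_group_rt[OF GZ_comm])
  show ?thesis by simp
 qed
 have m1: "chain_map (rat_complex (nerve_chains fat)) (rat_complex GZ_complex) (rat_chain_map (nerve_chains fat) GZ_complex \<phi>)"
  using Qf(1) Qfd by (simp add: chain_map_def rat_chain_map_def)
 have m2: "chain_map (rat_complex GZ_complex) (rat_complex (nerve_chains fat)) g"
  using g1 gd by (simp add: chain_map_def)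
 have h1: "chain_homotopic (rat_complex (nerve_chains fat)) (rat_complex (nerve_chains fat))
   (%n. g n \<circ> rat_chain_map (nerve_chains fat) GZ_complex \<phi> n) (%n. id)"
  unfolding chain_homotopic_def using s1 gf0 gf by (intro exI[of _ s]) (simp add: rat_chain_map_def)
 have h2: "chain_homotopic (rat_complex GZ_complex) (rat_complex GZ_complex)
   (%n. rat_chain_map (nerve_chains fat) GZ_complex \<phi> n \<circ> g n) (%n. id)"
  unfolding chain_homotopic_def
 proof (intro exI[of _ "%n t. \<one>\<^bsub>rt (GZ (Suc n) :: 'h gdual monoid)\<^esub>"] conjI allI ballI, goal_cases)
  case (1 n)
  show ?case unfolding rat_complex_simps GZ_complex_simps by (rule one)
 next
  case (2 t)
  thus ?case by (simp add: rat_chain_map_def fg1 Q1)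
 next
  case (3 n t)
  thus ?case using oo[of "Suc n"] by (simp add: rat_chain_map_def fg1 Q1)
 qed
 show ?thesis unfolding chain_homotopy_equivalence_def using m1 m2 h1 h2 by blast
qed

text \<open>The rationals are flat, so injectivity survives; surjectivity comes from \<open>multiple_in_GZ\<close>.\<close>

lemma rational_iso:
 "chain_iso (rat_complex GZ_complex) (rat_complex (G_complex :: 'h gdual chain_complex)) (rat_chain_map GZ_complex G_complex (%n. id))"
proof -
 have ih: "id : hom (GZ n) (G_dn n :: 'h gdual monoid)" for n using GZ_G by (auto simp: hom_def)
 note I = rat_map_spec[OF GZ_comm G_dn_comm ih]
 note QG = rat_map_spec[OF G_dn_comm G_dn_comm Dif_G_hom]
 let ?I = "%n. rat_map (GZ n) (G_dn n :: 'h gdual monoid) id"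
 let ?G = "%n. rat_map (G_dn (Suc n)) (G_dn n :: 'h gdual monoid) (Dif G_complex n)"
 have cm: "?I n (QZ n t) = ?G n (?I (Suc n) t)" if t: "t : carrier (rt (GZ (Suc n)))" for n t
 proof (rule rt_hom_eqI[OF GZ_comm _ comp_group_hom[OF QZ(1) I(1)] comp_group_hom[OF I(1) QG(1)] t])
  show "Group.group (rt (G_dn n))" by (rule comm_group.axioms(2)[OF comm_group_rt[OF G_dn_comm]])
  fix h :: "'h gdual" and m :: nat assume h: "h : carrier (GZ (Suc n))"
  note D = conjunct1[OF Dif_GZ[OF h]] and hG = GZ_G[OF h]
  show "?I n (QZ n (pt (GZ (Suc n)) h (1 / of_nat m))) = ?G n (?I (Suc n) (pt (GZ (Suc n)) h (1 / of_nat m)))"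
   unfolding QZ(2)[OF h] I(2)[OF D] I(2)[OF h] by (simp add: QG(2)[OF hG])
 qed
 have iso: "?I n : iso (rt (GZ n)) (rt (G_dn n))" for n
 proof -
  interpret A: comm_group "rt (GZ n)" by (rule comm_group_rt[OF GZ_comm])
  interpret B: comm_group "rt (G_dn n)" by (rule comm_group_rt[OF G_dn_comm])
  interpret h: group_hom "rt (GZ n)" "rt (G_dn n)" "?I n" using I(1) by (simp add: group_hom_def group_hom_axioms_def A.is_group B.is_group)
  have inj: "t = \<one>\<^bsub>rt (GZ n)\<^esub>" if t: "t : carrier (rt (GZ n))" "?I n t = \<one>\<^bsub>rt (G_dn n)\<^esub>" for t
  proof -
   obtain k m where k: "k : carrier (GZ n)" "m > (0::nat)" "t = pt (GZ n) k (1 / of_nat m)" using rt_pure[OF GZ_comm t(1)] by blast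
   have "k b = 0" if b: "b : UG n" for b
   proof -
    have "EX e. e : hom (rt (G_dn n)) add_group & (ALL h:carrier (G_dn n). ALL q. e (pt (G_dn n) h q) = q * of_int (h b))"
    by (rule rt_hom_exists[OF G_dn_comm comm_group_add_group, where b = "%h q. q * of_int (h b) :: rat"])
    (use b in \<open>auto simp: algebra_simps\<close>)
    then obtain e :: "_ => rat" where e: "e : hom (rt (G_dn n)) add_group" "!!h q. h : carrier (G_dn n) ==> e (pt (G_dn n) h q) = q * of_int (h b)"
    by blast
    have "e \<one>\<^bsub>rt (G_dn n)\<^esub> = 0" using hom_one[OF e(1) B.is_group group_add_group] by simp
    moreover have "pt (G_dn n) k (1 / of_nat m) = \<one>\<^bsub>rt (G_dn n)\<^esub>" using t(2) I(2)[OF k(1), of "1 / of_nat m"] k(3) by simp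
    ultimately have "1 / of_nat m * of_int (k b) = (0 :: rat)" using e(2)[OF GZ_G[OF k(1)], of "1 / of_nat m"] by metis
    thus ?thesis using k(2) by simp
   qed
   hence "k = \<one>\<^bsub>G_dn n\<^esub>" by (intro G_dn_eqI[OF GZ_G[OF k(1)]]) auto
   thus ?thesis using k(3) pt_one_left[OF GZ_comm, of n] by simp
  qed
  have surj: "EX s:carrier (rt (GZ n)). ?I n s = t" if t: "t : carrier (rt (G_dn n))" for t
  proof -
   obtain k m where k: "k : carrier (G_dn n)" "m > (0::nat)" "t = pt (G_dn n) k (1 / of_nat m)" using rt_pure[OF G_dn_comm t] by blast
   obtain M :: nat where M: "M > 0" "k [^]\<^bsub>G_dn n\<^esub> M : carrier (GZ n)" using multiple_in_GZ[OF k(1)] by blast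
   let ?s = "pt (GZ n) (k [^]\<^bsub>G_dn n\<^esub> M) (1 / of_nat m / of_nat M)"
   have "?I n ?s = t" unfolding I(2)[OF M(2)] k(3) using pt_nat_pow[OF G_dn_comm k(1), of M "1 / of_nat m / of_nat M"] M(1) by simp
   thus ?thesis using pt_closed[OF GZ_comm M(2)] by blast
  qed
  have "inj_on (?I n) (carrier (rt (GZ n)))" unfolding h.inj_on_one_iff using inj by blast
  moreover have "?I n ` carrier (rt (GZ n)) = carrier (rt (G_dn n))" using surj h.hom_closed by blast
  ultimately show ?thesis using I(1) by (simp add: iso_def bij_betw_def)
 qed
 show ?thesis unfolding chain_iso_def chain_map_def using I(1) cm iso by (simp add: rat_chain_map_def)
qed

end

theorem theorem1p22:
  fixes \<phi> :: "nat \<Rightarrow> ('h::infinite) fat_chain \<Rightarrow> 'h gdual"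
  assumes "aug_chain_map (nerve_chains fat) GZ_complex \<phi>"
    and "carried_by_forests \<phi>"
  shows "chain_homotopy_equivalence (rat_complex (nerve_chains fat)) (rat_complex GZ_complex)
           (rat_chain_map (nerve_chains fat) GZ_complex \<phi>)
       \<and> chain_iso (rat_complex GZ_complex)
           (rat_complex (G_complex :: 'h gdual chain_complex))
           (rat_chain_map GZ_complex G_complex (\<lambda>n. id))"
proof -
 obtain \<Phi> :: "'h ribbon => nat => 'h fat_slice_chain => 'h felem" where P:
  "ALL G:Obj fat. aug_chain_map (nerve_chains (slice fat G)) (F_complex G) (\<Phi> G)"
  "ALL G:Obj fat. ALL G':Obj fat. ALL h:Arr fat G G'. ALL n. ALL c:carrier (Grp (nerve_chains (slice fat G)) n).
    \<Phi> G' n (slice_push fat h c) = F_push G G' h n (\<Phi> G n c)"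
  "ALL G:Obj fat. ALL n. ALL c:carrier (Grp (nerve_chains (slice fat G)) n). F_proj G n (\<Phi> G n c) = \<phi> n (slice_forget c)"
  using assms(2) unfolding carried_by_forests_def by blast
 interpret carried \<phi> \<Phi>
  by (unfold_locales, rule assms(1)) (use P in auto)
 show ?thesis using homotopy_equivalence rational_iso by blast
qed

end
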